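(* Let $\kappa>0$, let $\mathcal X,\mathcal Y$ be nonempty finite sets, let $\nu\in\mathcal P(\mathcal X)$ and $\xi\in\mathcal P(\mathcal Y\times\mathcal Y)$, and let $L_n^{\mathsf{CM}}, L_n^{\mathsf{FE}}, L_n^{\mathsf{ER}}$ be the neighborhood empirical measures of the marked $\mathsf{CM}(\alpha_n,\kappa)$, $\mathsf{FE}(\kappa)$ and $\mathsf{ER}(\kappa)$ random graph sequences. Then the sequence $\{L_n^{\mathsf{CM}}\}$ (respectively, $\{L_n^{\mathsf{FE}}\}$ and $\{L_n^{\mathsf{ER}}\}$) satisfies the large deviation principle (at speed $n$) on $\mathcal P(\mathcal T_{*,1}[\mathcal X;\mathcal Y])$ with rate function $\mathfrak I^{\mathsf{CM}}$ (respectively, $\mathfrak I^{\mathsf{FE}}$ and $\mathfrak I^{\mathsf{ER}}$), where $$\mathfrak I^{\mathsf{CM}}(\mu)=\begin{cases}\mathfrak I_{\kappa,\eta_1^{\alpha}}(\mu)&\text{if }\mu_{o,\deg}=\alpha,\\ \infty&\text{otherwise,}\end{cases}\qquad \mathfrak I^{\mathsf{FE}}(\mu)=\mathfrak I_{\kappa,\eta_1^{\mathrm{Poi}(\kappa)}}(\mu),$$ $$\mathfrak I^{\mathsf{ER}}(\mu)=\begin{cases}\ell_\kappa(\beta')+\mathfrak I_{\beta',\eta_1^{\mathrm{Poi}(\beta')}}(\mu)&\text{if }\beta':=\mathbb E_\mu[\deg_{\mathbf T}(o)]<\infty,\\ \infty&\text{otherwise.}\end{cases}$$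
   Context: Marked graphs. A marked graph carries a mark $x_v\in\mathcal X$ at each vertex $v$ and, on each edge $\{u,v\}$, a pair of marks $(y_{(u,v)},y_{(v,u)})\in\mathcal Y\times\mathcal Y$, where $y_{(u,v)}$ is associated with the endpoint $u$. $\mathcal T_{*,1}[\mathcal X;\mathcal Y]$ is the (countable, discrete) set of isomorphism classes of rooted marked trees of depth at most 1 (stars rooted at their center $o$; isomorphisms preserve root and marks). $N_o(\tau)$ is the set of neighbors of the root and $\deg_\tau(o)=|N_o(\tau)|$. $\mathcal P(\cdot)$ denotes probability measures with the weak topology. For $\mu\in\mathcal P(\mathcal T_{*,1}[\mathcal X;\mathcal Y])$, $\mu_o$ is the law of the root mark and $\mu_{o,\deg}$ the law of the root degree; $\mathbf T$ denotes a random tree with the indicated law. $H(\cdot\|\cdot)$ is relative entropy. Random graphs. All graphs are simple with vertex set $\{1,\dots,n\}$; graphs for different $n$ are independent. - $\mathsf{CM}(\alpha_n,\kappa)$: $M\in\mathbb N$, $\alpha$ is a probability measure on $\{0,\dots,M\}$ with mean $\kappa$; $\alpha_n$ are probability measures on $\{0,\dots,M\}$ with $\alpha_n(\{i\})\in\{0,1/n,\dots,1\}$, $n\sum_i i\,\alpha_n(\{i\})$ even, and $\alpha_n\to\alpha$; $G_n$ is uniform over the graphs on $n$ vertices with empirical degree distribution $\alpha_n$. - $\mathsf{FE}(\kappa)$: $m_n/n\to\kappa/2$; $G_n$ is uniform over graphs on $n$ vertices with $m_n$ edges. - $\mathsf{ER}(\kappa)$: $G_n$ is the Erdős–Rényi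 graph with connection probability $\kappa/n$. Marks. Given $G_n$, vertex marks are i.i.d. with law $\nu$ and, independently, the edge mark pairs $(Y_{(u,v)},Y_{(v,u)})$ are i.i.d. over edges with law $\bar\xi(y,y'):=\frac12[\xi(y,y')+\xi(y',y)]$. The neighborhood empirical measure is $L_n=\frac1n\sum_{v\in G_n}\delta_{\mathrm{cl}_v}$, where $\mathrm{cl}_v\in\mathcal T_{*,1}[\mathcal X;\mathcal Y]$ is the marked star formed by $v$ (the root), its neighbors and the edges joining $v$ to them. True laws. For a degree law $q$ on $\mathbb N_0$, let $\eta_1$ be the law on $\mathcal T_{*,1}[\mathcal X;\mathcal Y]$ of the star with root degree law $q$, i.i.d. vertex marks of law $\nu$ and i.i.d. edge mark pairs of law $\bar\xi$, all independent. It is denoted $\eta_1^{\alpha}$ if $q=\alpha$ and $\eta_1^{\mathrm{Poi}(\beta)}$ if $q$ is Poisson with mean $\beta\ge0$. Size-biasing. For $\mu$ with $0<\mathbb E_\mu[\deg_{\mathbf T}(o)]<\infty$ let $\frac{d\bar\mu}{d\mu}(\tau)=\deg_\tau(o)/\mathbb E_\mu[\deg_{\mathbf T}(o)]$. Under $\bar\mu$, let $1$ be a uniformly random child of the root; let $(\mathbf X_v,\mathbf Y)$ denote marks. Then $\bar\mu^{1,o}$ is the joint law of $((\mathbf X_1,\mathbf Y_{(1,o)}),(\mathbf X_o,\mathbf Y_{(o,1)}))$ on $(\mathcal X\times\mathcal Y)^2$, $\bar\mu^1$ is the law of $(\mathbf X_1,\mathbf Y_{(1,o)})$, and $\bar\mu^{1|o}$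 is the conditional law of $(\mathbf X_1,\mathbf Y_{(1,o)})$ given $(\mathbf X_o,\mathbf Y_{(o,1)})$. Define $\bar\eta_1^{1,o},\bar\eta_1^1,\bar\eta_1^{1|o}$ in the same way from $\eta_1$. For $\mu\ll\eta_1$ define probability measures $\check\mu,\hat\mu$ by $$\frac{d\check\mu}{d\eta_1}(\tau)=\prod_{v\in N_o(\tau)}\frac{d\bar\mu^1}{d\bar\eta_1^1}(X_v,Y_{(v,o)}),\qquad \frac{d\hat\mu}{d\eta_1}(\tau)=\prod_{v\in N_o(\tau)}\frac{d\bar\mu^{1|o}}{d\bar\eta_1^{1|o}}(X_v,Y_{(v,o)}\mid X_o,Y_{(o,v)}).$$ (Where the conditioning value has zero $\bar\mu$-probability, any version of the conditional law absolutely continuous with respect to $\bar\eta_1^{1|o}$ is fixed; the choice is inconsequential.) Rate functionals. For $\beta\ge0$, $$\mathfrak I_{\beta,\eta_1}(\mu)=\begin{cases}H(\mu_o\|\nu)&\text{if }\beta=0\text{ and }\mathbb E_\mu[\deg_{\mathbf T}(o)]=0,\\ \frac12[H(\mu\|\check\mu)+H(\mu\|\hat\mu)]&\text{if }\beta>0,\ \mathbb E_\mu[\deg_{\mathbf T}(o)]=\beta,\ \bar\mu^{1,o}\text{ symmetric, }\mu\ll\eta_1,\\ \infty&\text{otherwise,}\end{cases}$$ where symmetric means invariant under exchange of the two $(\mathcal X\times\mathcal Y)$-coordinates, and $\ell_\kappa(\beta)=\frac\kappa2\left(\frac\beta\kappa\log\frac\beta\kappa-\frac\beta\kappa+1\right)$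 with $0\log0=0$. *)

theory Defs
  imports "HOL-Probability.Probability"
begin

section \<open>Weak topology, relative entropy and large deviations\<close>

text \<open>Probability measures on a countable discrete space are represented by the type of probability
  mass functions. All real functions on a discrete space are continuous, so the weak topology is the
  initial topology of the integrals of all bounded real functions.\<close>

definition weak_topology :: "'a pmf topology" where
  "weak_topology = topology_generated_by
     {{\<mu>. measure_pmf.expectation \<mu> f \<in> U} | f U. bounded (range (f :: 'a \<Rightarrow> real)) \<and> open U}"

lemma topspace_weak_topology [simp]: "topspace weak_topology = UNIV"
proof -
  have "UNIV \<in> {{\<mu>. measure_pmf.expectation \<mu> f \<in> U} | f U.
          bounded (range (f :: 'a \<Rightarrow> real)) \<and> open U}"
    by (intro CollectI exI[of _ "\<lambda>_. 0"] exI[of _ UNIV]) auto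
  then show ?thesis
    unfolding weak_topology_def topology_generated_by_topspace by blast
qed

text \<open>Relative entropy of the probability measure N with respect to M. Note the argument
  order of the library's constants. The negative part of the integrand is always integrable,
  so a non-integrable log-density means that the entropy is infinite (the library's
  Bochner integral would return 0).\<close>

definition rel_entropy :: "'a measure \<Rightarrow> 'a measure \<Rightarrow> ereal" where
  "rel_entropy N M =
     (if absolutely_continuous M N \<and> integrable N (entropy_density (exp 1) M N)
      then ereal (KL_divergence (exp 1) M N) else \<infinity>)"

definition log_prob :: "real \<Rightarrow> ereal" where
  "log_prob p = (if p = 0 then - \<infinity> else ereal (ln p))"

text \<open>Rate functions have compact sublevel sets; in a Hausdorff space this includes lower
  semicontinuity.\<close>

definition rate_function :: "'a topology \<Rightarrow> ('a \<Rightarrow> ereal) \<Rightarrow> bool" where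
  "rate_function T I \<longleftrightarrow>
     (\<forall>x \<in> topspace T. 0 \<le> I x) \<and>
     (\<forall>c::real. compactin T {x \<in> topspace T. I x \<le> ereal c})"

text \<open>The sequence of random variables enters only through its sequence of laws.\<close>

definition satisfies_LDP ::
  "'a topology \<Rightarrow> (nat \<Rightarrow> real) \<Rightarrow> (nat \<Rightarrow> 'a pmf) \<Rightarrow> ('a \<Rightarrow> ereal) \<Rightarrow> bool" where
  "satisfies_LDP T speed law I \<longleftrightarrow>
     rate_function T I \<and>
     (\<forall>U. openin T U \<longrightarrow>
        - (INF x\<in>U. I x)
          \<le> liminf (\<lambda>n. ereal (1 / speed n) * log_prob (measure_pmf.prob (law n) U))) \<and>
     (\<forall>C. closedin T C \<longrightarrow>
        limsup (\<lambda>n. ereal (1 / speed n) * log_prob (measure_pmf.prob (law n) C))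
          \<le> - (INF x\<in>C. I x))"

section \<open>Marked graphs and marked stars\<close>

text \<open>Edges are two-element sets of vertices; the mark emark G u v is the one of the edge
  {u,v} that is associated with the endpoint u. Marks are meaningless off the vertices and edges.\<close>

record ('v, 'x, 'y) mgraph =
  verts :: "'v set"
  edges :: "'v set set"
  vmark :: "'v \<Rightarrow> 'x"
  emark :: "'v \<Rightarrow> 'v \<Rightarrow> 'y"

definition nbrs :: "'v set set \<Rightarrow> 'v \<Rightarrow> 'v set" where
  "nbrs E v = {u. u \<noteq> v \<and> {u, v} \<in> E}"

text \<open>The isomorphism class of a marked star with root o is encoded by the root mark together with
  the multiset of the triples $(x_v, (y_{(v,o)}, y_{(o,v)}))$ over the children v of the root.
  Lemmas star_class_eq_iff and star_class_surj below show that this is a bijective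
  encoding of the isomorphism classes.\<close>

type_synonym ('x, 'y) star = "'x \<times> ('x \<times> 'y \<times> 'y) multiset"

definition star_deg :: "('x, 'y) star \<Rightarrow> nat" where
  "star_deg \<tau> = size (snd \<tau>)"

definition star_class :: "('v, 'x, 'y) mgraph \<Rightarrow> 'v \<Rightarrow> ('x, 'y) star" where
  "star_class G v =
     (vmark G v,
      image_mset (\<lambda>u. (vmark G u, emark G u v, emark G v u)) (mset_set (nbrs (edges G) v)))"

definition is_star :: "('v, 'x, 'y) mgraph \<Rightarrow> 'v \<Rightarrow> bool" where
  "is_star G r \<longleftrightarrow> finite (verts G) \<and> r \<in> verts G \<and> edges G = (\<lambda>v. {v, r}) ` (verts G - {r})"

definition rooted_iso ::
  "('v \<Rightarrow> 'w) \<Rightarrow> ('v, 'x, 'y) mgraph \<Rightarrow> 'v \<Rightarrow> ('w, 'x, 'y) mgraph \<Rightarrow> 'w \<Rightarrow> bool" where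
  "rooted_iso f G r H s \<longleftrightarrow>
     bij_betw f (verts G) (verts H) \<and> f r = s \<and>
     (\<forall>u\<in>verts G. \<forall>v\<in>verts G. {u, v} \<in> edges G \<longleftrightarrow> {f u, f v} \<in> edges H) \<and>
     (\<forall>v\<in>verts G. vmark H (f v) = vmark G v) \<and>
     (\<forall>u\<in>verts G. \<forall>v\<in>verts G. {u, v} \<in> edges G \<longrightarrow> emark H (f u) (f v) = emark G u v)"

text \<open>The star formed by a vertex v of a graph, its neighbours and the edges joining v to them.\<close>

definition star_subgraph :: "('v, 'x, 'y) mgraph \<Rightarrow> 'v \<Rightarrow> ('v, 'x, 'y) mgraph" where
  "star_subgraph G v =
     G \<lparr> verts := insert v (nbrs (edges G) v), edges := (\<lambda>u. {u, v}) ` nbrs (edges G) v \<rparr>"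

lemma nbrs_star_subgraph: "nbrs (edges (star_subgraph G v)) v = nbrs (edges G) v"
  by (auto simp: nbrs_def star_subgraph_def doubleton_eq_iff)

lemma is_star_star_subgraph: "finite (nbrs (edges G) v) \<Longrightarrow> is_star (star_subgraph G v) v"
  by (auto simp: is_star_def star_subgraph_def nbrs_def)

lemma star_class_star_subgraph: "star_class (star_subgraph G v) v = star_class G v"
  by (simp add: star_class_def nbrs_star_subgraph) (simp add: star_subgraph_def)

lemma nbrs_star: "is_star G r \<Longrightarrow> nbrs (edges G) r = verts G - {r}"
  by (auto simp: is_star_def nbrs_def doubleton_eq_iff)

lemma image_mset_eq_imp_bij:
  assumes "finite A" "finite B" "image_mset g (mset_set A) = image_mset h (mset_set B)"
  shows "\<exists>f. bij_betw f A B \<and> (\<forall>a\<in>A. h (f a) = g a)"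
  using assms
proof (induction A arbitrary: B rule: finite_induct)
  case empty
  then show ?case by (auto simp: mset_set_empty_iff bij_betw_def)
next
  case (insert a A)
  have "g a \<in># image_mset h (mset_set B)"
    using insert.prems(2)[symmetric] insert.hyps by simp
  then obtain b where b: "b \<in> B" "h b = g a"
    using insert.prems(1) by auto
  have "mset_set B = add_mset b (mset_set (B - {b}))"
    using b insert.prems(1) by (metis mset_set.remove)
  then have "image_mset g (mset_set A) = image_mset h (mset_set (B - {b}))"
    using insert.prems insert.hyps b by simp
  then obtain f where f: "bij_betw f A (B - {b})" "\<forall>a\<in>A. h (f a) = g a"
    using insert.IH[of "B - {b}"] insert.prems(1) by auto
  have bij: "bij_betw (f(a := b)) A (B - {b})"
    using f(1) insert.hyps by (subst bij_betw_cong[of A _ f]) auto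
  have "bij_betw (f(a := b)) (A \<union> {a}) ((B - {b}) \<union> {b})"
    using bij by (rule bij_betw_combine) (auto simp: bij_betw_def)
  moreover have "(B - {b}) \<union> {b} = B" using b by auto
  ultimately have "bij_betw (f(a := b)) (insert a A) B" by simp
  moreover have "\<forall>a'\<in>insert a A. h ((f(a := b)) a') = g a'"
    using f(2) b insert.hyps by auto
  ultimately show ?case by blast
qed

lemma star_class_eq_iff:
  assumes G: "is_star G r" and H: "is_star H s"
  shows "star_class G r = star_class H s \<longleftrightarrow> (\<exists>f. rooted_iso f G r H s)"
proof (rule iffI)
  let ?g = "\<lambda>u. (vmark G u, emark G u r, emark G r u)"
  let ?h = "\<lambda>u. (vmark H u, emark H u s, emark H s u)"
  have fin: "finite (verts G - {r})" "finite (verts H - {s})"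
    and rs: "r \<in> verts G" "s \<in> verts H"
    and eG: "edges G = (\<lambda>v. {v, r}) ` (verts G - {r})"
    and eH: "edges H = (\<lambda>v. {v, s}) ` (verts H - {s})"
    using G H by (auto simp: is_star_def)
  show "\<exists>f. rooted_iso f G r H s" if eq: "star_class G r = star_class H s"
  proof -
    have root: "vmark G r = vmark H s"
      and m: "image_mset ?g (mset_set (verts G - {r})) = image_mset ?h (mset_set (verts H - {s}))"
      using eq nbrs_star[OF G] nbrs_star[OF H] by (auto simp: star_class_def)
    obtain f where f: "bij_betw f (verts G - {r}) (verts H - {s})"
      and fm: "\<forall>a\<in>verts G - {r}. ?h (f a) = ?g a"
      using image_mset_eq_imp_bij[OF fin m] by blast
    define F where "F = f(r := s)"
    have Fr: "F r = s" and Fo: "\<And>v. v \<noteq> r \<Longrightarrow> F v = f v" by (auto simp: F_def)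
    have "bij_betw F (verts G - {r}) (verts H - {s})"
      using f by (subst bij_betw_cong[of _ _ f]) (auto simp: Fo)
    then have "bij_betw F ((verts G - {r}) \<union> {r}) ((verts H - {s}) \<union> {s})"
      by (rule bij_betw_combine) (auto simp: Fr bij_betw_def)
    then have bij: "bij_betw F (verts G) (verts H)"
      using rs by (simp add: insert_absorb)
    have inj: "\<And>u. u \<in> verts G \<Longrightarrow> F u = s \<longleftrightarrow> u = r"
      using bij rs Fr by (metis bij_betw_def inj_onD)
    have mem: "\<And>u. u \<in> verts G \<Longrightarrow> F u \<in> verts H"
      using bij by (auto simp: bij_betw_def)
    have eG': "{u, v} \<in> edges G \<longleftrightarrow> (u = r \<and> v \<noteq> r) \<or> (v = r \<and> u \<noteq> r)"
      if "u \<in> verts G" "v \<in> verts G" for u v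
      using that by (auto simp: eG doubleton_eq_iff)
    have eH': "{u, v} \<in> edges H \<longleftrightarrow> (u = s \<and> v \<noteq> s) \<or> (v = s \<and> u \<noteq> s)"
      if "u \<in> verts H" "v \<in> verts H" for u v
      using that by (auto simp: eH doubleton_eq_iff)
    have "rooted_iso F G r H s"
      unfolding rooted_iso_def
    proof (intro conjI ballI impI)
      fix u v assume uv: "u \<in> verts G" "v \<in> verts G"
      show "{u, v} \<in> edges G \<longleftrightarrow> {F u, F v} \<in> edges H"
        using eG'[OF uv] eH'[OF mem mem, OF uv] inj uv by auto
      assume "{u, v} \<in> edges G"
      then show "emark H (F u) (F v) = emark G u v"
        using eG'[OF uv] fm uv by (auto simp: Fr Fo)
    next
      fix v assume "v \<in> verts G"
      then show "vmark H (F v) = vmark G v"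
        using fm root by (cases "v = r") (auto simp: Fr Fo)
    qed (use bij Fr in auto)
    then show ?thesis by blast
  qed
  show "star_class G r = star_class H s" if iso: "\<exists>f. rooted_iso f G r H s"
  proof -
    from iso obtain f where bij: "bij_betw f (verts G) (verts H)" and fr: "f r = s"
      and vm: "\<And>v. v \<in> verts G \<Longrightarrow> vmark H (f v) = vmark G v"
      and em: "\<And>u v. u \<in> verts G \<Longrightarrow> v \<in> verts G \<Longrightarrow> {u, v} \<in> edges G \<Longrightarrow>
                 emark H (f u) (f v) = emark G u v"
      by (auto simp: rooted_iso_def)
    have "bij_betw f (verts G - {r}) (verts H - {s})"
      using bij fr rs by (auto simp: bij_betw_def inj_on_def)
    then have "mset_set (verts H - {s}) = image_mset f (mset_set (verts G - {r}))"
      by (simp add: bij_betw_def image_mset_mset_set)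
    then have "image_mset ?h (mset_set (verts H - {s}))
        = image_mset (\<lambda>u. ?h (f u)) (mset_set (verts G - {r}))"
      by (simp add: image_mset.compositionality comp_def)
    also have "\<dots> = image_mset ?g (mset_set (verts G - {r}))"
    proof (rule image_mset_cong)
      fix u assume "u \<in># mset_set (verts G - {r})"
      then have u: "u \<in> verts G" "u \<noteq> r" using fin by auto
      then have "{u, r} \<in> edges G" "{r, u} \<in> edges G" by (auto simp: eG insert_commute)
      then show "?h (f u) = ?g u"
        using em[of u r] em[of r u] vm[of u] u rs fr by auto
    qed
    finally show ?thesis
      using nbrs_star[OF G] nbrs_star[OF H] vm[OF rs(1)] fr by (simp add: star_class_def)
  qed
qed

lemma star_class_surj:
  fixes \<tau> :: "('x, 'y) star"
  shows "\<exists>G :: (nat, 'x, 'y) mgraph. is_star G 0 \<and> star_class G 0 = \<tau>"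
proof -
  obtain x A where \<tau>: "\<tau> = (x, A)" by (cases \<tau>)
  obtain cs where cs: "mset cs = A" using ex_mset by blast
  define G :: "(nat, 'x, 'y) mgraph" where
    "G = \<lparr> verts = {..length cs}, edges = (\<lambda>v. {v, 0}) ` ({..length cs} - {0}),
           vmark = (\<lambda>v. if v = 0 then x else fst (cs ! (v - 1))),
           emark = (\<lambda>u v. if v = 0 then fst (snd (cs ! (u - 1))) else snd (snd (cs ! (v - 1)))) \<rparr>"
  have star: "is_star G 0" by (auto simp: is_star_def G_def)
  have eq: "{..length cs} - {0} = Suc ` {..<length cs}"
    by (auto simp: image_Suc_lessThan)
  have "image_mset (\<lambda>u. (vmark G u, emark G u 0, emark G 0 u)) (mset_set (Suc ` {..<length cs}))
      = image_mset ((!) cs) (mset_set {..<length cs})"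
    by (simp add: image_mset_mset_set[symmetric] image_mset.compositionality comp_def G_def)
  also have "\<dots> = A"
  proof -
    have "mset (map ((!) cs) [0..<length cs]) = A" using cs by (simp only: map_nth)
    then show ?thesis by (simp only: mset_map mset_upt lessThan_atLeast0)
  qed
  finally have "star_class G 0 = \<tau>"
    using nbrs_star[OF star] eq by (simp add: star_class_def \<tau>) (simp add: G_def)
  with star show ?thesis by blast
qed

section \<open>Random marked graphs\<close>

definition vertex_pairs :: "nat \<Rightarrow> nat set set" where
  "vertex_pairs n = {e. e \<subseteq> {1..n} \<and> card e = 2}"

definition empirical_measure :: "nat \<Rightarrow> (nat \<Rightarrow> 'a) \<Rightarrow> 'a pmf" where
  "empirical_measure n f = map_pmf f (pmf_of_set {1..n})"

text \<open>Standing assumptions on the degree sequences of the configuration model.\<close>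

definition CM_degrees :: "nat \<Rightarrow> real \<Rightarrow> nat pmf \<Rightarrow> (nat \<Rightarrow> nat pmf) \<Rightarrow> bool" where
  "CM_degrees M \<kappa> \<alpha> \<alpha>n \<longleftrightarrow>
     set_pmf \<alpha> \<subseteq> {0..M} \<and> measure_pmf.expectation \<alpha> real = \<kappa> \<and>
     (\<forall>n\<ge>1. set_pmf (\<alpha>n n) \<subseteq> {0..M} \<and>
        (\<forall>i\<in>{0..M}. \<exists>k\<in>{0..n}. pmf (\<alpha>n n) i = real k / real n) \<and>
        (\<exists>k::nat. real n * (\<Sum>i=0..M. real i * pmf (\<alpha>n n) i) = real (2 * k))) \<and>
     limitin weak_topology \<alpha>n \<alpha> sequentially"

text \<open>Laws of the (unmarked) edge sets on the vertices 1, ..., n. In the first two models there may be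
  no admissible graph for finitely many n, where the value of the uniform law is irrelevant;
  similarly the library's Bernoulli distribution truncates its parameter to the unit interval.\<close>

definition CM_graph :: "nat pmf \<Rightarrow> nat \<Rightarrow> nat set set pmf" where
  "CM_graph a n =
     pmf_of_set {E. E \<subseteq> vertex_pairs n \<and> empirical_measure n (\<lambda>v. card (nbrs E v)) = a}"

definition FE_graph :: "nat \<Rightarrow> nat \<Rightarrow> nat set set pmf" where
  "FE_graph m n = pmf_of_set {E. E \<subseteq> vertex_pairs n \<and> card E = m}"

definition ER_graph :: "real \<Rightarrow> nat \<Rightarrow> nat set set pmf" where
  "ER_graph \<kappa> n =
     map_pmf (\<lambda>present. {e \<in> vertex_pairs n. present e})
       (Pi_pmf (vertex_pairs n) False (\<lambda>_. bernoulli_pmf (\<kappa> / real n)))"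

definition sym_law :: "('y \<times> 'y) pmf \<Rightarrow> ('y \<times> 'y) pmf" where
  "sym_law \<xi> = embed_pmf (\<lambda>(y, y'). (pmf \<xi> (y, y') + pmf \<xi> (y', y)) / 2)"

lemma pmf_sym_law: "pmf (sym_law \<xi>) (y, y') = (pmf \<xi> (y, y') + pmf \<xi> (y', y)) / 2"
proof -
  have swap: "pmf (map_pmf prod.swap \<xi>) z = pmf \<xi> (prod.swap z)" for z
    by (metis inj_swap pmf_map_inj' swap_swap)
  have half: "ennreal ((a + b) / 2) = (ennreal a + ennreal b) * ennreal (1 / 2)"
    if "a \<ge> 0" "b \<ge> 0" for a b :: real
  proof -
    have "ennreal ((a + b) * (1 / 2)) = ennreal (a + b) * ennreal (1 / 2)"
      using that by (intro ennreal_mult) auto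
    then show ?thesis using that by (simp add: ennreal_plus)
  qed
  have "(\<integral>\<^sup>+z. ennreal ((\<lambda>(y, y'). (pmf \<xi> (y, y') + pmf \<xi> (y', y)) / 2) z) \<partial>count_space UNIV)
      = (\<integral>\<^sup>+z. (ennreal (pmf \<xi> z) + ennreal (pmf (map_pmf prod.swap \<xi>) z)) * ennreal (1 / 2)
          \<partial>count_space UNIV)"
    by (intro nn_integral_cong) (auto simp: swap half)
  also have "\<dots> = (1 + 1) * ennreal (1 / 2)"
    by (simp add: nn_integral_multc nn_integral_add nn_integral_pmf_eq_1)
  also have "\<dots> = 1"
    by (metis ennreal_1 ennreal_plus half one_add_one zero_le_one div_self zero_neq_numeral)
  finally show ?thesis
    unfolding sym_law_def by (subst pmf_embed_pmf) auto
qed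

text \<open>The edge mark pair drawn for {u,v} with u < v is read as $(y_{(u,v)}, y_{(v,u)})$; as its law is
  symmetric, the orientation is immaterial.\<close>

definition marked_graph :: "nat \<Rightarrow> nat set set \<Rightarrow> 'x pmf \<Rightarrow> ('y \<times> 'y) pmf \<Rightarrow>
    (nat, 'x, 'y) mgraph pmf" where
  "marked_graph n E \<nu> \<xi> =
     do {
       x \<leftarrow> Pi_pmf {1..n} undefined (\<lambda>_. \<nu>);
       y \<leftarrow> Pi_pmf E undefined (\<lambda>_. sym_law \<xi>);
       return_pmf \<lparr> verts = {1..n}, edges = E, vmark = x,
         emark = (\<lambda>u v. if u < v then fst (y {u, v}) else snd (y {u, v})) \<rparr>
     }"

text \<open>The law of the neighborhood empirical measure, given the law of the edge set.\<close>

definition nbhd_law :: "nat \<Rightarrow> nat set set pmf \<Rightarrow> 'x pmf \<Rightarrow> ('y \<times> 'y) pmf \<Rightarrow>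
    ('x, 'y) star pmf pmf" where
  "nbhd_law n graph \<nu> \<xi> =
     do {
       E \<leftarrow> graph;
       G \<leftarrow> marked_graph n E \<nu> \<xi>;
       return_pmf (empirical_measure n (star_class G))
     }"

section \<open>True laws and size-biasing\<close>

definition true_law :: "nat pmf \<Rightarrow> 'x pmf \<Rightarrow> ('y \<times> 'y) pmf \<Rightarrow> ('x, 'y) star pmf" where
  "true_law q \<nu> \<xi> =
     do {
       d \<leftarrow> q;
       x \<leftarrow> \<nu>;
       cs \<leftarrow> replicate_pmf d (pair_pmf \<nu> (sym_law \<xi>));
       return_pmf (x, mset cs)
     }"

text \<open>The library's Poisson distribution is only specified for positive rates.\<close>

definition Poi :: "real \<Rightarrow> nat pmf" where
  "Poi \<beta> = (if \<beta> = 0 then return_pmf 0 else poisson_pmf \<beta>)"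

definition mean_deg :: "('x, 'y) star pmf \<Rightarrow> ennreal" where
  "mean_deg \<mu> = (\<integral>\<^sup>+\<tau>. of_nat (star_deg \<tau>) \<partial>measure_pmf \<mu>)"

definition size_biased :: "('x, 'y) star pmf \<Rightarrow> ('x, 'y) star pmf" where
  "size_biased \<mu> = embed_pmf (\<lambda>\<tau>. pmf \<mu> \<tau> * (real (star_deg \<tau>) / enn2real (mean_deg \<mu>)))"

lemma pmf_size_biased:
  assumes "0 < mean_deg \<mu>" "mean_deg \<mu> < \<infinity>"
  shows "pmf (size_biased \<mu>) \<tau> = pmf \<mu> \<tau> * (real (star_deg \<tau>) / enn2real (mean_deg \<mu>))"
proof -
  define c where "c = enn2real (mean_deg \<mu>)"
  have c: "ennreal c = mean_deg \<mu>" "c > 0"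
    using assms by (auto simp: c_def less_top enn2real_positive_iff)
  have "(\<integral>\<^sup>+\<tau>. ennreal (pmf \<mu> \<tau> * (real (star_deg \<tau>) / c)) \<partial>count_space UNIV)
      = (\<integral>\<^sup>+\<tau>. (ennreal (pmf \<mu> \<tau>) * of_nat (star_deg \<tau>)) * ennreal (1 / c) \<partial>count_space UNIV)"
    using c by (intro nn_integral_cong)
      (simp add: ennreal_mult[symmetric] ennreal_of_nat_eq_real_of_nat)
  also have "\<dots> = mean_deg \<mu> * ennreal (1 / c)"
    by (simp add: nn_integral_multc mean_deg_def nn_integral_measure_pmf)
  also have "\<dots> = 1"
    using c by (simp add: c(1)[symmetric] ennreal_mult[symmetric])
  finally show ?thesis
    unfolding size_biased_def c_def by (subst pmf_embed_pmf) (auto simp: c_def)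
qed

text \<open>Joint law of $((X_1, Y_{(1,o)}), (X_o, Y_{(o,1)}))$ under the size-biased law, where 1 is a
  uniformly random child of the root.\<close>

definition child_root_law :: "('x, 'y) star pmf \<Rightarrow> (('x \<times> 'y) \<times> ('x \<times> 'y)) pmf" where
  "child_root_law \<mu> =
     do {
       \<tau> \<leftarrow> size_biased \<mu>;
       (x, y, y') \<leftarrow> pmf_of_multiset (snd \<tau>);
       return_pmf ((x, y), (fst \<tau>, y'))
     }"

definition child_law :: "('x, 'y) star pmf \<Rightarrow> ('x \<times> 'y) pmf" where
  "child_law \<mu> = map_pmf fst (child_root_law \<mu>)"

definition child_cond_law :: "('x, 'y) star pmf \<Rightarrow> 'x \<times> 'y \<Rightarrow> ('x \<times> 'y) pmf" where
  "child_cond_law \<mu> b = map_pmf fst (cond_pmf (child_root_law \<mu>) {z. snd z = b})"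

text \<open>A version of the conditional law under mu that is absolutely continuous with respect to the
  one under eta: where the conditioning value is mu-null, the conditional law under eta is used.
  Conditioning values that are eta-null as well occur only on an eta-null set of stars.\<close>

definition child_cond_version ::
  "('x, 'y) star pmf \<Rightarrow> ('x, 'y) star pmf \<Rightarrow> 'x \<times> 'y \<Rightarrow> ('x \<times> 'y) pmf" where
  "child_cond_version \<eta> \<mu> b =
     (if b \<in> snd ` set_pmf (child_root_law \<mu>) then child_cond_law \<mu> b else child_cond_law \<eta> b)"

definition check_law :: "('x, 'y) star pmf \<Rightarrow> ('x, 'y) star pmf \<Rightarrow> ('x, 'y) star measure" where
  "check_law \<eta> \<mu> = density (measure_pmf \<eta>) (\<lambda>\<tau>.
     ennreal (\<Prod>(x, y, y')\<in>#snd \<tau>. pmf (child_law \<mu>) (x, y) / pmf (child_law \<eta>) (x, y)))"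

definition hat_law :: "('x, 'y) star pmf \<Rightarrow> ('x, 'y) star pmf \<Rightarrow> ('x, 'y) star measure" where
  "hat_law \<eta> \<mu> = density (measure_pmf \<eta>) (\<lambda>\<tau>.
     ennreal (\<Prod>(x, y, y')\<in>#snd \<tau>.
       pmf (child_cond_version \<eta> \<mu> (fst \<tau>, y')) (x, y) / pmf (child_cond_law \<eta> (fst \<tau>, y')) (x, y)))"

section \<open>Rate functionals\<close>

definition rate_functional ::
  "'x pmf \<Rightarrow> real \<Rightarrow> ('x, 'y) star pmf \<Rightarrow> ('x, 'y) star pmf \<Rightarrow> ereal" where
  "rate_functional \<nu> \<beta> \<eta> \<mu> =
     (if \<beta> = 0 \<and> mean_deg \<mu> = 0 then
        rel_entropy (measure_pmf (map_pmf fst \<mu>)) (measure_pmf \<nu>)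
      else if \<beta> > 0 \<and> mean_deg \<mu> = ennreal \<beta> \<and>
           map_pmf prod.swap (child_root_law \<mu>) = child_root_law \<mu> \<and>
           absolutely_continuous (measure_pmf \<eta>) (measure_pmf \<mu>) then
        (rel_entropy (measure_pmf \<mu>) (check_law \<eta> \<mu>) +
         rel_entropy (measure_pmf \<mu>) (hat_law \<eta> \<mu>)) / 2
      else \<infinity>)"

text \<open>The convention 0 log 0 = 0 holds for the library's logarithm.\<close>

definition edge_cost :: "real \<Rightarrow> real \<Rightarrow> real" where
  "edge_cost \<kappa> \<beta> = \<kappa> / 2 * (\<beta> / \<kappa> * ln (\<beta> / \<kappa>) - \<beta> / \<kappa> + 1)"

definition rate_CM :: "real \<Rightarrow> nat pmf \<Rightarrow> 'x pmf \<Rightarrow> ('y \<times> 'y) pmf \<Rightarrow> ('x, 'y) star pmf \<Rightarrow> ereal" where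
  "rate_CM \<kappa> \<alpha> \<nu> \<xi> \<mu> =
     (if map_pmf star_deg \<mu> = \<alpha> then rate_functional \<nu> \<kappa> (true_law \<alpha> \<nu> \<xi>) \<mu> else \<infinity>)"

definition rate_FE :: "real \<Rightarrow> 'x pmf \<Rightarrow> ('y \<times> 'y) pmf \<Rightarrow> ('x, 'y) star pmf \<Rightarrow> ereal" where
  "rate_FE \<kappa> \<nu> \<xi> \<mu> = rate_functional \<nu> \<kappa> (true_law (Poi \<kappa>) \<nu> \<xi>) \<mu>"

definition rate_ER :: "real \<Rightarrow> 'x pmf \<Rightarrow> ('y \<times> 'y) pmf \<Rightarrow> ('x, 'y) star pmf \<Rightarrow> ereal" where
  "rate_ER \<kappa> \<nu> \<xi> \<mu> =
     (if mean_deg \<mu> < \<infinity> then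
        let \<beta>' = enn2real (mean_deg \<mu>)
        in ereal (edge_cost \<kappa> \<beta>') + rate_functional \<nu> \<beta>' (true_law (Poi \<beta>') \<nu> \<xi>) \<mu>
      else \<infinity>)"

end

theory Submission
  imports Defs "HOL-Combinatorics.Multiset_Permutations"
begin

text \<open>All three models are reduced to the Erdos-Renyi graph. Call (root mark, child mark, edge marks) the
  colour of a half-edge. For a sequence t of stars whose colour counts are symmetric, the probability that the
  marked Erdos-Renyi graph has the stars t is the probability of t under i.i.d. stars of the Poisson law, times
  the probability that a uniform matching of the half-edges of opposite colours gives a simple graph, times a
  factor that depends on the colour counts only. Removing edges one by one bounds the matching
  probability by 1. It equals 1 up to negligible factors if the stars at hand cannot produce loops
  or multiple edges, and this is enforced by splitting every vertex mark into many classes and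
  admitting only stars whose root and children lie in distinct classes. With Stirling's formula this gives the local
  rate $H(\mu\|\eta) - \frac12 D$, where $\eta$ is the Poisson star law and $D$ the divergence of the colour
  means of $\mu$ from those of $\eta$. The other two models are the Erdos-Renyi graph conditioned on
  its number of edges or on its degrees. In the sum $H(\mu\|\check\mu) + H(\mu\|\hat\mu)$ the
  marginals cancel by symmetry, which identifies the rate with the functional of the theorem.\<close>

abbreviation prob :: "'a pmf => 'a set => real" where "prob p A == measure_pmf.prob p A"
abbreviation expect :: "'a pmf => ('a => real) => real" where "expect p f == measure_pmf.expectation p f"
abbreviation ev_seq (binder "Ev " 10) where "ev_seq Q == eventually Q sequentially"
abbreviation "decay r n == exp (- (r * real n))"
abbreviation "weak == weak_topology"
abbreviation "emp == empirical_measure"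
abbreviation "deg == star_deg"
notation LIMSEQ ("((_)/ ----> (_))" [60, 60] 60) and iff (infixr "<->" 25)

section \<open>The weak topology on a discrete space\<close>

lemma pmf_finite_approx: assumes "ep > 0"
 obtains F where "finite F" "prob mu F > 1 - ep"
proof -
 let ?A = "%n. from_nat_into (set_pmf mu) ` {..n}"
 have "(%n. prob mu (?A n)) ----> prob mu (\<Union>n. ?A n)" by (intro measure_pmf.finite_Lim_measure_incseq) (auto simp: incseq_def)
 moreover have "(\<Union>n. ?A n) = set_pmf mu" using range_from_nat_into[OF set_pmf_not_empty countable_set_pmf, of mu] by blast
 moreover have "prob mu (set_pmf mu) = 1" by (subst measure_pmf.prob_eq_1) (auto simp: AE_measure_pmf)
 ultimately have "Ev n. prob mu (?A n) > 1 - ep" using assms by (intro order_tendstoD, auto)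
 then obtain n where "prob mu (?A n) > 1 - ep" by (auto simp: eventually_sequentially)
 thus ?thesis using that[of "?A n"] by auto
qed

lemma expectation_split_finite:
 fixes f :: "'a => real" assumes F: "finite F" and f: "!!a. \<bar>f a\<bar> <= B"
 shows "\<bar>expect mu f - (SUM a:F. f a * pmf mu a)\<bar> <= B * prob mu (- F)"
proof -
 have B: "B >= 0" using f[of undefined] by linarith
 have int: "integrable (measure_pmf mu) (%x. f x * indicator A x)" for A by (intro measure_pmf.integrable_const_bound[where B = B])
   (use f B in \<open>auto simp: indicator_def abs_mult\<close>)
 have "expect mu f = expect mu (%x. f x * indicator F x + f x * indicator (- F) x)"
  by (intro Bochner_Integration.integral_cong) (auto simp: indicator_def)
 also have "... = expect mu (%x. f x * indicator F x) + expect mu (%x. f x * indicator (- F) x)" by (intro Bochner_Integration.integral_add int)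
 finally have "\<bar>expect mu f - (SUM a:F. f a * pmf mu a)\<bar> = \<bar>expect mu (%x. f x * indicator (- F) x)\<bar>" by (simp, subst integral_measure_pmf_real[OF F], auto simp: indicator_def intro!: sum.cong)
 also have "... <= expect mu (%x. \<bar>f x * indicator (- F) x\<bar>)" by simp
 also have "... <= expect mu (%x. B * indicator (- F) x)" by (intro integral_mono integrable_abs int integrable_mult_right
     measure_pmf.integrable_const_bound[where B = 1]) (use f in \<open>auto simp: indicator_def\<close>)
 finally show ?thesis by simp
qed

lemma prob_finite_sum: "finite F ==> prob mu F = (SUM a:F. pmf mu a)" by (simp add: measure_measure_pmf_finite)

lemma prob_compl_pmf: "prob mu (- F) = 1 - prob mu F" using measure_pmf.prob_compl[of F mu] by (simp add: Compl_eq_Diff_UNIV)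

text \<open>A finite set \<open>F\<close> carries almost all the mass of \<open>mu\<close>.
  Closeness of the atoms in \<open>F\<close> forces a nearby law to put almost all its mass on
  \<open>F\<close> too, so integrals of bounded functions are close. Hence finitely many atoms
  control every weak neighbourhood.\<close>

lemma weak_nbhd:
 fixes mu :: "'a pmf" assumes "openin weak U" "mu : U"
 obtains F ep where "finite F" "ep > 0" "!!mu'. (!!a. a : F ==> \<bar>pmf mu' a - pmf mu a\<bar> < ep) ==> mu' : U"
proof -
 define P where "P U <-> (ALL mu:U. EX F ep. finite F & ep > (0::real) &
  (ALL mu'. (ALL a:F. \<bar>pmf mu' a - pmf mu a\<bar> < ep) --> mu' : U))" for U :: "'a pmf set"
 have "generate_topology_on {{mu. expect mu f : U} | f U.
     bounded (range (f :: 'a => real)) & open U} U" using assms(1) unfolding weak_topology_def openin_topology_generated_by_iff .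
 hence "P U"
 proof (induction rule: generate_topology_on.induct)
  case Empty
  thus ?case by (simp add: P_def)
 next
  case (Int a b)
  show ?case unfolding P_def
  proof
   fix mu assume mu: "mu : a \<inter> b"
   obtain F ep where F: "finite F" "ep > 0" "ALL mu'. (ALL a:F. \<bar>pmf mu' a - pmf mu a\<bar> < ep) --> mu' : a"
    using bspec[OF Int.IH(1)[unfolded P_def] IntD1[OF mu]] by (elim exE conjE)
   obtain G de where G: "finite G" "de > 0" "ALL mu'. (ALL a:G. \<bar>pmf mu' a - pmf mu a\<bar> < de) --> mu' : b"
    using bspec[OF Int.IH(2)[unfolded P_def] IntD2[OF mu]] by (elim exE conjE)
   from F G show "EX F ep. finite F & ep > (0::real) & (ALL mu'. (ALL a:F. \<bar>pmf mu' a - pmf mu a\<bar> < ep) --> mu' : a \<inter> b)"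
    by (intro exI[of _ "F \<union> G"] exI[of _ "min ep de"]) auto
  qed
 next
  case (UN K)
  show ?case unfolding P_def
  proof
   fix mu assume "mu : \<Union>K"
   then obtain k where k: "k : K" "mu : k" by blast
   obtain F ep where F: "finite F" "ep > 0" "ALL mu'. (ALL a:F. \<bar>pmf mu' a - pmf mu a\<bar> < ep) --> mu' : k"
    using bspec[OF UN.IH[OF k(1), unfolded P_def] k(2)] by (elim exE conjE)
   thus "EX F ep. finite F & ep > (0::real) & (ALL mu'. (ALL a:F. \<bar>pmf mu' a - pmf mu a\<bar> < ep) --> mu' : \<Union>K)" using k by blast
  qed
 next
  case (Basis s)
  then obtain f V where s: "s = {mu. expect mu f : V}" and bf: "bounded (range (f :: 'a => real))" and V: "open V" by blast
  from bf obtain B where B: "B > 0" "!!a. \<bar>f a\<bar> <= B" unfolding bounded_pos by auto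
  show ?case unfolding P_def
  proof
   fix mu assume "mu : s"
   then obtain e where e: "e > 0" "!!y. dist y (expect mu f) < e ==> y : V" using V s unfolding open_dist by auto
   \<comment> \<open>The tolerance \<open>e\<close> is shared out: the tails of \<open>mu\<close>
     and \<open>mu'\<close> outside \<open>F\<close> cost at most e / 8 and e / 4, the sum over
     \<open>F\<close> at most e / 8.\<close>
   obtain F where F: "finite F" "prob mu F > 1 - e / (8 * B)" using pmf_finite_approx[of "e / (8 * B)"] e(1) B(1) by auto
   define ep where "ep = e / (8 * B * (real (card F) + 1))"
   have e1: "ep > 0" unfolding ep_def using e(1) B(1) by simp
   have "(real (card F) + 1) * ep = e / (8 * B)" unfolding ep_def by simp
   hence e3: "real (card F) * ep <= e / (8 * B)" using e1 by (simp add: distrib_right)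
   have e2: "real (card F) * (B * ep) <= e / 8" using mult_left_mono[OF e3, of B] B(1) B(1) by (simp add: mult.left_commute)
   note e4 = e2 e1 e3
   show "EX F ep. finite F & ep > (0::real) & (ALL mu'. (ALL a:F. \<bar>pmf mu' a - pmf mu a\<bar> < ep) --> mu' : s)"
   proof (intro exI conjI allI impI)
    fix mu' assume close: "ALL a:F. \<bar>pmf mu' a - pmf mu a\<bar> < ep"
    have "\<bar>prob mu' F - prob mu F\<bar> <= (SUM a:F. \<bar>pmf mu' a - pmf mu a\<bar>)" by (simp add: prob_finite_sum F sum_subtractf[symmetric])
    also have "... <= real (card F) * ep" using close by (intro sum_bounded_above) (auto intro: less_imp_le)
    finally have p1: "prob mu' (- F) <= e / (4 * B)" using F(2) e4(3) unfolding prob_compl_pmf by linarith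
    have p2: "prob mu (- F) <= e / (8 * B)" using F(2) unfolding prob_compl_pmf by simp
    have "\<bar>(SUM a:F. f a * pmf mu' a) - (SUM a:F. f a * pmf mu a)\<bar> <= (SUM a:F. \<bar>f a * (pmf mu' a - pmf mu a)\<bar>)" unfolding sum_subtractf[symmetric] right_diff_distrib[symmetric] by simp
    also have "... <= real (card F) * (B * ep)"
    proof (rule sum_bounded_above)
     fix a assume "a : F"
     thus "\<bar>f a * (pmf mu' a - pmf mu a)\<bar> <= B * ep" unfolding abs_mult using close B by (intro mult_mono) (auto intro: less_imp_le)
    qed
    finally have p3: "\<bar>(SUM a:F. f a * pmf mu' a) - (SUM a:F. f a * pmf mu a)\<bar> <= e / 8" using e4 by linarith
    have p4: "\<bar>expect mu f - (SUM a:F. f a * pmf mu a)\<bar> <= B * (e / (8 * B))"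
     using expectation_split_finite[of F f B mu, OF F(1) B(2)] mult_left_mono[OF p2, of B] B(1) by linarith
    have "dist (expect mu' f) (expect mu f) < e"
    proof -
     have "B * (e / (8 * B)) = e / 8" "B * (e / (4 * B)) = e / 4" using B(1) by auto
     thus ?thesis using expectation_split_finite[of F f B mu', OF F(1) B(2)] mult_left_mono[OF p1, of B] B(1) p3 p4  e(1) unfolding dist_real_def by linarith
    qed
    thus "mu' : s" using e(2) by (simp add: s)
   qed (use F e4 in auto)
  qed
 qed
 then obtain F ep where F: "finite F" "ep > 0" "ALL mu'. (ALL a:F. \<bar>pmf mu' a - pmf mu a\<bar> < ep) --> mu' : U"
  using bspec[OF \<open>P U\<close>[unfolded P_def] assms(2)] by (elim exE conjE)
 show ?thesis by (rule that[OF F(1,2)]) (use F(3) in auto)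
qed

lemma openin_weak_expectation: assumes "bounded (range (f :: 'a => real))" "open U" shows "openin weak {mu. expect mu f : U}"
 unfolding weak_topology_def by (rule topology_generated_by_Basis) (use assms in blast)

lemma expectation_finite_support:
 fixes f :: "'a => real" assumes "finite F" "!!a. a ~: F ==> f a = 0" shows "expect mu f = (SUM a:F. f a * pmf mu a)"
 by (rule integral_measure_pmf_real[OF assms(1)]) (use assms(2) in auto)

lemma openin_weak_finite_sum: assumes "finite F" "open U" shows "openin weak {mu. (SUM a:F. f a * pmf mu a) : (U :: real set)}"
proof -
 define g where "g a = (if a : F then f a else 0)" for a
 have "range g <= insert 0 (f ` F)" by (auto simp: g_def)
 hence "openin weak {mu. expect mu g : U}" using assms(1) finite_subset by (intro openin_weak_expectation assms finite_imp_bounded, blast)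
 also have "{mu. expect mu g : U} = {mu. (SUM a:F. f a * pmf mu a) : U}" by (subst expectation_finite_support[of F]) (auto simp: g_def assms)
 finally show ?thesis .
qed

lemma openin_weak_ball: assumes "finite F" shows "openin weak {mu'. ALL a:F. \<bar>pmf mu' a - pmf mu a\<bar> < ep}"
proof -
 have 1: "openin weak {mu'. \<bar>pmf mu' a - pmf mu a\<bar> < ep}" for a using openin_weak_finite_sum[of "{a}" "ball (pmf mu a) ep" "%_. 1"]
  by (simp add: dist_real_def abs_minus_commute)
 have "openin weak (topspace weak \<inter> (\<Inter>a\<in>F. {mu'. \<bar>pmf mu' a - pmf mu a\<bar> < ep}))" using assms 1
  using openin_topspace[of "weak :: 'a pmf topology"] by (cases "F = {}") (auto intro!: openin_Inter simp del: INT_simps)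
 moreover have "topspace weak \<inter> (\<Inter>a\<in>F. {mu'. \<bar>pmf mu' a - pmf mu a\<bar> < ep})
  = {mu'. ALL a:F. \<bar>pmf mu' a - pmf mu a\<bar> < ep}" by auto
 ultimately show ?thesis by simp
qed

lemma limitin_weak_pmf: assumes "limitin weak X mu F" shows "((%n. pmf (X n) a) \<longlongrightarrow> pmf mu a) F"
proof (rule tendstoI)
 fix e :: real assume e: "e > 0"
 have "openin weak {mu'. ALL b:{a}. \<bar>pmf mu' b - pmf mu b\<bar> < e}" by (rule openin_weak_ball) simp
 moreover have "mu : {mu'. ALL b:{a}. \<bar>pmf mu' b - pmf mu b\<bar> < e}" using e by simp
 ultimately have "\<forall>\<^sub>F n in F. X n : {mu'. ALL b:{a}. \<bar>pmf mu' b - pmf mu b\<bar> < e}" using assms unfolding limitin_def by blast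
 thus "\<forall>\<^sub>F n in F. dist (pmf (X n) a) (pmf mu a) < e" by eventually_elim (simp add: dist_real_def)
qed

lemma nn_integral_exhaust: assumes A: "!!j::nat. finite (A j)" "incseq A" "(\<Union>j. A j) = UNIV" and M: "sets M = UNIV"
 shows "(\<integral>\<^sup>+a. f a \<partial>M) = (SUP j. SUM a:A j. f a * emeasure M {a})"
proof -
 have "(\<integral>\<^sup>+a. f a \<partial>M) = (\<integral>\<^sup>+a. (SUP j. f a * indicator (A j) a) \<partial>M)"
 proof (rule nn_integral_cong)
  fix a
  obtain j where "a : A j" using A(3) by blast
  thus "f a = (SUP j. f a * indicator (A j) a)" by (intro antisym SUP_upper2[of j] SUP_least) (auto simp: indicator_def)
 qed
 also have "... = (SUP j. \<integral>\<^sup>+a. f a * indicator (A j) a \<partial>M)"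
 proof (rule nn_integral_monotone_convergence_SUP)
  show "incseq (%j a. f a * indicator (A j) a)" using A(2) by (force simp: incseq_def le_fun_def indicator_def)
  show "(%a. f a * indicator (A j) a) : borel_measurable M" for j using sets_eq_imp_space_eq[of M "count_space UNIV"] M M by (auto simp: measurable_def)
 qed
 also have "... = (SUP j. SUM a:A j. f a * emeasure M {a})" by (intro SUP_cong refl nn_integral_indicator_finite) (use A M in auto)
 finally show ?thesis .
qed

section \<open>Compactness of the sets of laws with a bounded moment\<close>

lemma nn_integral_moment_SUP:
 fixes h :: "'a => nat" assumes fin: "!!k. finite {a. h a <= k}" shows "(\<integral>\<^sup>+a. of_nat (h a) \<partial>measure_pmf mu)
   = (SUP j. ennreal (SUM a:{a. h a <= j}. real (h a) * pmf mu a))"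
proof -
 have "(\<integral>\<^sup>+a. of_nat (h a) \<partial>mu) = (SUP j. SUM a:{a. h a <= j}. of_nat (h a) * emeasure mu {a})"
  by (rule nn_integral_exhaust) (use fin in \<open>auto simp: incseq_def\<close>)
 also have "... = (SUP j. ennreal (SUM a:{a. h a <= j}. real (h a) * pmf mu a))" by (intro SUP_cong refl)
   (simp add: emeasure_pmf_single ennreal_mult' ennreal_of_nat_eq_real_of_nat flip: sum_ennreal)
 finally show ?thesis .
qed

text \<open>Laws are points of a product of unit intervals, compact by Tychonoff. Markov's
  inequality turns the moment bound into a uniform lower bound on the mass of each finite level set.
  Such bounds survive pointwise limits, so no mass escapes and the limits are again laws.\<close>

lemma compactin_weak_moment:
 fixes h :: "'a => nat" assumes fin: "!!k. finite {a. h a <= k}" and B: "B >= 0"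
 shows "compactin weak {mu. (\<integral>\<^sup>+a. of_nat (h a) \<partial>measure_pmf mu) <= ennreal B}"
proof -
 \<comment> \<open>The last condition is Markov's inequality for the levels above j, where
   \<open>h\<close> is at least j + 1. Together with the first one it makes every point of
   \<open>S\<close> sum to 1.\<close>
 define S :: "('a => real) set" where "S = (UNIV \<rightarrow>\<^sub>E {0..1}) \<inter> (\<Inter>j. {f. (SUM a:{a. h a <= j}. f a) <= 1} \<inter>
   {f. (SUM a:{a. h a <= j}. real (h a) * f a) <= B} \<inter>
   {f. (SUM a:{a. h a <= j}. f a) >= 1 - B / real (Suc j)})"
 have "compact (UNIV \<rightarrow>\<^sub>E {0..1::real} :: ('a => real) set)" using compactin_PiE[of "%_::'a. euclideanreal" UNIV "%_. {0..1}"]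
  by (simp add: euclidean_product_topology)
 moreover have "closed (\<Inter>j. {f :: 'a => real. (SUM a:{a. h a <= j}. f a) <= 1} \<inter>
   {f. (SUM a:{a. h a <= j}. real (h a) * f a) <= B} \<inter>
   {f. (SUM a:{a. h a <= j}. f a) >= 1 - B / real (Suc j)})" by (intro closed_Int closed_INT ballI closed_Collect_le continuous_intros) auto
 ultimately have compS: "compact S" unfolding S_def by auto
 have S_D: "0 <= f a" "f a <= 1" "(SUM a:{a. h a <= j}. f a) <= 1" "(SUM a:{a. h a <= j}. real (h a) * f a) <= B"
  "(SUM a:{a. h a <= j}. f a) >= 1 - B / real (Suc j)" if "f : S" for f a j using that unfolding S_def by auto
 have nn1: "(\<integral>\<^sup>+a. ennreal (f a) \<partial>count_space UNIV) = 1" if f: "f : S" for f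
 proof (rule antisym)
  have SUP: "(\<integral>\<^sup>+a. ennreal (f a) \<partial>count_space UNIV) = (SUP j. (SUM a:{a. h a <= j}. ennreal (f a)))"
   by (subst nn_integral_exhaust[where A = "%j. {a. h a <= j}"]) (use fin in \<open>auto simp: incseq_def\<close>)
  show "(\<integral>\<^sup>+a. ennreal (f a) \<partial>count_space UNIV) <= 1"
   unfolding SUP by (rule SUP_least) (use S_D[OF f] in \<open>auto simp: sum_ennreal\<close>)
  have ge: "ennreal (1 - B / real (Suc j)) <= (\<integral>\<^sup>+a. ennreal (f a) \<partial>count_space UNIV)" for j
  proof -
   have "ennreal (1 - B / real (Suc j)) <= (SUM a:{a. h a <= j}. ennreal (f a))" using S_D[OF f] by (simp add: sum_ennreal, intro ennreal_leI, auto)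
   also have "... <= (\<integral>\<^sup>+a. ennreal (f a) \<partial>count_space UNIV)" unfolding SUP by (rule SUP_upper) simp
   finally show ?thesis .
  qed
  have "(%j. ennreal (1 - B / real (Suc j))) ----> ennreal (1 - 0)"
   by (intro tendsto_ennrealI tendsto_diff tendsto_const LIMSEQ_Suc[OF lim_const_over_n])
  thus "1 <= (\<integral>\<^sup>+a. ennreal (f a) \<partial>count_space UNIV)"
   using ge by (intro LIMSEQ_le_const2[where X = "%j. ennreal (1 - B / real (Suc j))"]) auto
 qed
 have pmfS: "pmf (embed_pmf f) a = f a" if "f : S" for f a by (rule pmf_embed_pmf) (use S_D[OF that] nn1[OF that] in auto)
 note mom = nn_integral_moment_SUP[OF fin]
 have "embed_pmf ` S = {mu. (\<integral>\<^sup>+a. of_nat (h a) \<partial>measure_pmf mu) <= ennreal B}" (is "_ = ?R")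
 proof
  show "embed_pmf ` S <= ?R" using S_D by (auto simp: mom pmfS intro!: SUP_least ennreal_leI)
  show "?R <= embed_pmf ` S"
  proof
   fix mu assume R: "mu : ?R"
   have 1: "(SUM a:{a. h a <= j}. real (h a) * pmf mu a) <= B" for j
   proof -
    have "ennreal (SUM a:{a. h a <= j}. real (h a) * pmf mu a) <= (SUP j. ennreal (SUM a:{a. h a <= j}. real (h a) * pmf mu a))"
     by (intro SUP_upper) auto
    also have "... <= ennreal B" using R by (simp add: mom)
    finally show ?thesis using B by simp
   qed
   have 2: "sum (pmf mu) {a. h a <= j} >= 1 - B / real (Suc j)" for j
   proof -
    have "prob mu {a. Suc j <= h a} <= B / real (Suc j)"
    proof -
     have "ennreal (real (Suc j)) * emeasure mu {a. Suc j <= h a}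
       = (\<integral>\<^sup>+a. ennreal (real (Suc j)) * indicator {a. Suc j <= h a} a \<partial>mu)" by (subst nn_integral_cmult_indicator) auto
     also have "... <= (\<integral>\<^sup>+a. of_nat (h a) \<partial>mu)"
      by (intro nn_integral_mono) (auto simp: indicator_def ennreal_of_nat_eq_real_of_nat simp del: of_nat_Suc intro!: ennreal_leI)
     also have "... <= ennreal B" using R by simp
     finally have "ennreal (real (Suc j) * prob mu {a. Suc j <= h a}) <= ennreal B"
      by (simp only: measure_pmf.emeasure_eq_measure ennreal_mult' of_nat_0_le_iff)
     thus ?thesis using B by (simp add: field_simps del: of_nat_Suc)
    qed
    moreover have "- {a. h a <= j} = {a. Suc j <= h a}" by auto
    ultimately have "1 - prob mu {a. h a <= j} <= B / real (Suc j)" using prob_compl_pmf[of mu "{a. h a <= j}"] by simp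
    thus ?thesis using fin by (simp add: prob_finite_sum)
   qed
   have 3: "sum (pmf mu) {a. h a <= j} <= 1" for j using measure_pmf.prob_le_1[of mu "{a. h a <= j}"] fin by (simp add: prob_finite_sum)
   have "pmf mu : S" unfolding S_def using 1 2 3 by (auto simp: pmf_le_1)
   moreover have "embed_pmf (pmf mu) = mu" by (rule pmf_eqI) (simp add: pmfS \<open>pmf mu \<in> S\<close>)
   ultimately show "mu : embed_pmf ` S" by force
  qed
 qed
 moreover have "compactin weak (embed_pmf ` S)"
 proof (rule image_compactin)
  show "compactin (top_of_set S) S" using compS by simp
  show "continuous_map (top_of_set S) weak embed_pmf" unfolding continuous_map_def
  proof (intro conjI allI impI)
   fix U :: "'a pmf set" assume U: "openin weak U"
   have "EX T. open T & f : T & (ALL g:T \<inter> S. embed_pmf g : U)" if f: "f : S" "embed_pmf f : U" for f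
   proof -
    obtain F ep where F: "finite F" "ep > 0" "!!mu'. (!!a. a : F ==> \<bar>pmf mu' a - pmf (embed_pmf f) a\<bar> < ep) ==> mu' : U"
     using weak_nbhd[OF U f(2)] by blast
    have "open (\<Inter>a\<in>F. {g. \<bar>g a - f a\<bar> < ep})" using F(1) by (intro open_INT ballI open_Collect_less continuous_intros) auto
    moreover have "f : (\<Inter>a\<in>F. {g. \<bar>g a - f a\<bar> < ep})" using F by simp
    moreover have "ALL g:(\<Inter>a\<in>F. {g. \<bar>g a - f a\<bar> < ep}) \<inter> S. embed_pmf g : U" using F(3) f by (auto simp: pmfS)
    ultimately show ?thesis by blast
   qed
   then obtain T where T: "!!f. f : S ==> embed_pmf f : U ==> open (T f) & f : T f & (ALL g:T f \<inter> S. embed_pmf g : U)" by metis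
   let ?W = "\<Union>f\<in>{f:S. embed_pmf f : U}. T f"
   have "openin (top_of_set S) (S \<inter> ?W)" using T by auto
   moreover have "{f : topspace (top_of_set S). embed_pmf f : U} = S \<inter> ?W" using T by auto
   ultimately show "openin (top_of_set S) {f : topspace (top_of_set S). embed_pmf f : U}" by simp
  qed auto
 qed
 ultimately show ?thesis by simp
qed

text \<open>The complement is a union of conditions on partial sums over finite level sets, each of
  which is open.\<close>

lemma closedin_weak_moment:
 fixes h :: "'a => nat" assumes fin: "!!k. finite {a. h a <= k}"
 shows "closedin weak {mu. (\<integral>\<^sup>+a. of_nat (h a) \<partial>measure_pmf mu) <= ennreal B}"
proof -
 note mom = nn_integral_moment_SUP[OF fin]
 have "openin weak (\<Union>j. {mu. (SUM a:{a. h a <= j}. real (h a) * pmf mu a) : {x. ennreal B < ennreal x}})"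
 proof (intro openin_Union ballI)
  fix T assume "T : range (%j. {mu. (SUM a:{a. h a <= j}. real (h a) * pmf mu a) : {x. ennreal B < ennreal x}})"
  then obtain j where T: "T = {mu. (SUM a:{a. h a <= j}. real (h a) * pmf mu a) : {x. ennreal B < ennreal x}}" by auto
  show "openin weak T" unfolding T by (rule openin_weak_finite_sum[OF fin], intro open_Collect_less continuous_on_ennreal continuous_intros)
 qed
 moreover have "(\<Union>j. {mu. (SUM a:{a. h a <= j}. real (h a) * pmf mu a) : {x. ennreal B < ennreal x}})
  = - {mu. (\<integral>\<^sup>+a. of_nat (h a) \<partial>measure_pmf mu) <= ennreal B}" by (simp add: set_eq_iff mom SUP_le_iff not_le)
 ultimately show ?thesis by (simp add: closedin_def Compl_eq_Diff_UNIV)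
qed

section \<open>A local criterion for large deviation principles\<close>

lemma log_prob_le_iff: assumes "n > 0" "p >= 0" shows "ereal (1 / n) * log_prob p <= ereal (- r) <-> p <= exp (- (r * n))"
proof (cases "p = 0")
 case False
 with assms have p: "p > 0" by simp
 have "ereal (1 / n) * log_prob p <= ereal (- r) <-> ln p <= - (r * n)" using assms p by (simp add: log_prob_def field_simps)
 thus ?thesis using p by (metis exp_le_cancel_iff exp_ln)
qed (use assms in \<open>simp add: log_prob_def\<close>)

lemma log_prob_ge_iff: assumes "n > 0" "p >= 0" shows "ereal (- r) <= ereal (1 / n) * log_prob p <-> exp (- (r * n)) <= p"
proof (cases "p = 0")
 case False
 with assms have p: "p > 0" by simp
 have "ereal (- r) <= ereal (1 / n) * log_prob p <-> - (r * n) <= ln p" using assms p by (simp add: log_prob_def field_simps)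
 thus ?thesis using p by (metis exp_le_cancel_iff exp_ln)
qed (use assms in \<open>simp add: log_prob_def\<close>)

lemma limsup_log_prob_le: assumes "Ev n. p n <= decay r n" "!!n. p n >= 0" shows "limsup (%n. ereal (1 / real n) * log_prob (p n)) <= ereal (- r)"
proof (rule Limsup_bounded)
 show "Ev n. ereal (1 / real n) * log_prob (p n) <= ereal (- r)" using assms(1) eventually_gt_at_top[of 0]
  by eventually_elim (simp add: log_prob_le_iff assms(2))
qed

lemma liminf_log_prob_ge: assumes "Ev n. p n >= decay r n" "!!n. p n >= 0" shows "ereal (- r) <= liminf (%n. ereal (1 / real n) * log_prob (p n))"
proof (rule Liminf_bounded)
 show "Ev n. ereal (- r) <= ereal (1 / real n) * log_prob (p n)" using assms(1) eventually_gt_at_top[of 0]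
  by eventually_elim (simp add: log_prob_ge_iff assms(2))
qed

lemma ereal_neg_le_if:
 fixes x L :: ereal assumes "!!r. x < ereal r ==> ereal (- r) <= L" shows "- x <= L"
proof (rule ccontr)
 assume "~ - x <= L"
 hence "L < - x" by simp
 then obtain r where "L < ereal r" "ereal r < - x" using ereal_dense2 by blast
 hence "x < ereal (- r)" by (cases x) auto
 from assms[OF this] \<open>L < ereal r\<close> show False by simp
qed

lemma le_ereal_neg_if:
 fixes x L :: ereal assumes "!!r. ereal r < x ==> L <= ereal (- r)" shows "L <= - x"
proof (rule ccontr)
 assume "~ L <= - x"
 hence "- x < L" by simp
 then obtain r where "- x < ereal r" "ereal r < L" using ereal_dense2 by blast
 hence "ereal (- r) < x" by (cases x) auto
 from assms[OF this] \<open>ereal r < L\<close> show False by simp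
qed

text \<open>The gap between \<open>r\<close> and \<open>r'\<close> absorbs the number of terms:
  finite unions are free on the exponential scale.\<close>

lemma eventually_exp_sum_le: assumes fin: "finite A" and r: "r < r'" and p: "!!a. a : A ==> Ev n. p a n <= decay r' n"
 shows "Ev n. (SUM a:A. p a n) <= decay r n"
proof -
 have ev: "Ev n. ALL a:A. p a n <= decay r' n" using fin p by (simp add: eventually_ball_finite)
 obtain N :: nat where N: "real N >= real (card A) / (r' - r)" using real_arch_simple by blast
 show ?thesis using ev eventually_ge_at_top[of N]
 proof eventually_elim
  case (elim n)
  have "(SUM a:A. p a n) <= real (card A) * decay r' n" using elim(1) by (intro sum_bounded_above) auto
  also have "real (card A) <= exp ((r' - r) * real n)"
  proof -
   have "real (card A) <= (r' - r) * real N" using N r by (simp add: field_simps)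
   also have "... <= (r' - r) * real n" using elim(2) r by simp
   finally show ?thesis using exp_ge_add_one_self[of "(r' - r) * real n"] by linarith
  qed
  also have "exp ((r' - r) * real n) * decay r' n = decay r n" by (simp add: exp_add[symmetric] algebra_simps)
  finally show ?case by simp
 qed
qed

text \<open>Compactness of \<open>K\<close> turns upper bounds near single laws into one for closed
  sets. Nonnegativity and lower semicontinuity of \<open>I\<close> come from comparing the two local
  bounds on the same open set.\<close>

lemma satisfies_LDP_local:
 fixes law :: "nat => 'a pmf pmf" assumes lower: "!!mu U r. [|openin weak U; mu : U; I mu < ereal r|] ==> Ev n. decay r n <= prob (law n) U"
  and upper: "!!mu r. ereal r < I mu ==> EX U. openin weak U & mu : U & (Ev n. prob (law n) U <= decay r n)"
  and tight: "!!r. EX K. compactin weak K & closedin weak K & (Ev n. prob (law n) (- K) <= decay r n)" shows "satisfies_LDP weak real law I"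
proof -
 have low: "- I mu <= liminf (%n. ereal (1 / real n) * log_prob (prob (law n) U))" if "openin weak U" "mu : U" for mu U
  by (rule ereal_neg_le_if) (intro liminf_log_prob_ge lower[OF that], auto)
 \<comment> \<open>An upper bound for the probabilities of an open set around \<open>mu\<close>
   bounds \<open>I mu\<close> from below, because the lower bound holds on that set as well.\<close>
 have lowup: "ereal r <= I mu" if "openin weak U" "mu : U" "Ev n. prob (law n) U <= decay r n" for mu U r
 proof -
  have "- I mu <= limsup (%n. ereal (1 / real n) * log_prob (prob (law n) U))"
   using low[OF that(1,2)] Liminf_le_Limsup[OF sequentially_bot] order_trans by blast
  also have "... <= ereal (- r)" by (rule limsup_log_prob_le[OF that(3)]) simp
  finally show ?thesis by (metis ereal_minus_le_minus uminus_ereal.simps(1))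
 qed
 have nonneg: "0 <= I mu" for mu
 proof -
  show ?thesis by (simp add: zero_ereal_def, rule lowup[of UNIV], (use openin_topspace[of "weak :: 'a pmf topology"] in auto))
 qed
 have lsc: "closedin weak {mu. I mu <= ereal c}" for c
 proof -
  have "EX T. openin weak T & mu : T & T <= - {mu. I mu <= ereal c}" if "~ I mu <= ereal c" for mu
  proof -
   have "ereal c < I mu" using that by simp
   then obtain r where r: "ereal c < ereal r" "ereal r < I mu" using ereal_dense2 by blast
   from upper[OF r(2)] obtain U where U: "openin weak U" "mu : U" "Ev n. prob (law n) U <= decay r n" by blast
   have "I mu' > ereal c" if "mu' : U" for mu' using lowup[OF U(1) that U(3)] r(1) by (rule order.strict_trans2[rotated])
   thus ?thesis using U by (metis (mono_tags, lifting) ComplI leD mem_Collect_eq subsetI)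
  qed
  thus ?thesis by (simp add: closedin_def Compl_eq_Diff_UNIV, subst openin_subopen, auto simp del: not_le)
 qed
 have compact: "compactin weak {mu. I mu <= ereal c}" for c
 proof -
  obtain K where K: "compactin weak K" "closedin weak K" "Ev n. prob (law n) (- K) <= decay (c + 1) n" using tight by blast
  have "ereal (c + 1) <= I mu" if "mu ~: K" for mu using K(2) lowup[OF _ _ K(3)] that by (simp add: closedin_def Compl_eq_Diff_UNIV)
  hence "{mu. I mu <= ereal c} <= K"
   by (metis (mono_tags, lifting) add_le_same_cancel1 ereal_less_eq(3) mem_Collect_eq not_one_le_zero order_trans subsetI)
  thus ?thesis using closed_compactin[OF K(1) _ lsc] by blast
 qed
 have up: "limsup (%n. ereal (1 / real n) * log_prob (prob (law n) C)) <= - (INF mu\<in>C. I mu)" if C: "closedin weak C" for C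
 proof (rule le_ereal_neg_if)
  fix r assume "ereal r < (INF mu\<in>C. I mu)"
  then obtain r' where r': "ereal r < ereal r'" "ereal r' < (INF mu\<in>C. I mu)" using ereal_dense2 by blast
  have "ALL mu:C. EX U. openin weak U & mu : U & (Ev n. prob (law n) U <= decay r' n)"
   using r'(2) by (intro ballI upper) (meson INF_lower order.strict_trans2)
  from bchoice[OF this] obtain U where "ALL mu:C. openin weak (U mu) & mu : U mu & (Ev n. prob (law n) (U mu) <= decay r' n)" ..
  hence U: "!!mu. mu : C ==> openin weak (U mu)" "!!mu. mu : C ==> mu : U mu" "!!mu. mu : C ==> Ev n. prob (law n) (U mu) <= decay r' n" by auto
  obtain K where K: "compactin weak K" "Ev n. prob (law n) (- K) <= decay r' n" using tight by blast
  have cCK: "compactin weak (C \<inter> K)" using closed_Int_compactin[OF C K(1)] .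
  obtain \<F> where F: "finite \<F>" "\<F> <= U ` C" "C \<inter> K <= \<Union>\<F>" using compactinD[OF cCK, of "U ` C"] U(1,2) by blast
  let ?A = "insert (- K) \<F>"
  have "Ev n. (SUM V:?A. prob (law n) V) <= decay r n" using F(1,2) U(3) K(2) r'(1) by (intro eventually_exp_sum_le[of _ _ r']) auto
  hence "Ev n. prob (law n) C <= decay r n"
  proof eventually_elim
   case (elim n)
   have "prob (law n) C <= prob (law n) (\<Union>V\<in>?A. V)" using F(3) by (intro measure_pmf.finite_measure_mono) auto
   also have "... <= (SUM V:?A. prob (law n) V)" using F(1) by (intro measure_pmf.finite_measure_subadditive_finite) auto
   finally show ?case using elim by simp
  qed
  thus "limsup (%n. ereal (1 / real n) * log_prob (prob (law n) C)) <= ereal (- r)" by (rule limsup_log_prob_le) simp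
 qed
 have "- (INF mu\<in>U. I mu) <= liminf (%n. ereal (1 / real n) * log_prob (prob (law n) U))" if U: "openin weak U" for U
 proof -
  have "- liminf (%n. ereal (1 / real n) * log_prob (prob (law n) U)) <= (INF mu\<in>U. I mu)"
   by (rule INF_greatest) (use low[OF U] ereal_uminus_le_reorder in blast)
  thus ?thesis using ereal_uminus_le_reorder by blast
 qed
 with up compact nonneg show ?thesis by (simp add: satisfies_LDP_def rate_function_def)
qed

section \<open>Counting marked graphs with given stars\<close>

text \<open>The denominator of a multinomial coefficient: a multiset of size n has n! /
  \<open>mfact m\<close> orderings. For the colours of a graph, its square root stands for the
  number of matchings of the half-edges.\<close>

definition mfact :: "'a multiset => real" where "mfact m = (PROD c:set_mset m. fact (count m c))"

lemma mfact_superset: assumes "finite A" "set_mset m <= A" shows "mfact m = (PROD c:A. fact (count m c))"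
 unfolding mfact_def by (rule prod.mono_neutral_left) (use assms in \<open>auto simp: not_in_iff\<close>)

lemma mfact_empty [simp]: "mfact {#} = 1" by (simp add: mfact_def)

lemma mfact_pos [simp]: "mfact m > 0" unfolding mfact_def by (rule prod_pos) auto

lemma mfact_nonzero [simp]: "mfact m ~= 0" by (rule less_imp_neq[OF mfact_pos, symmetric])

lemma mfact_nonneg [simp]: "mfact m >= 0" using mfact_pos[of m] by linarith

lemma mfact_add_mset: "mfact (add_mset c m) = real (Suc (count m c)) * mfact m"
proof -
 let ?A = "insert c (set_mset m)"
 have "mfact (add_mset c m) = (PROD a:?A. fact (count (add_mset c m) a))" by (rule mfact_superset) auto
 also have "... = fact (Suc (count m c)) * (PROD a:?A - {c}. fact (count (add_mset c m) a))" by (subst prod.remove[of _ c]) auto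
 also have "(PROD a:?A - {c}. fact (count (add_mset c m) a)) = (PROD a:?A - {c}. fact (count m a) :: real)" by (intro prod.cong) auto
 also have "fact (Suc (count m c)) * ... = real (Suc (count m c)) * (fact (count m c) * (PROD a:?A - {c}. fact (count m a)))" by simp
 also have "fact (count m c) * (PROD a:?A - {c}. fact (count m a)) = (PROD a:?A. fact (count m a) :: real)" by (subst (2) prod.remove[of _ c]) auto
 also have "... = mfact m" by (rule mfact_superset[symmetric]) auto
 finally show ?thesis .
qed

lemma mfact_remove: "c :# m ==> mfact m = real (count m c) * mfact (m - {#c#})" using mfact_add_mset[of c "m - {#c#}"] by simp

lemma mfact_1: assumes "!!c. count m c <= 1" shows "mfact m = 1" unfolding mfact_def
proof (intro prod.neutral ballI)
 fix c
 have "count m c = 0 | count m c = 1" using assms[of c] by linarith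
 thus "fact (count m c) = (1 :: real)" by auto
qed

text \<open>Colours of the half-edges at the root, in the order root mark, child mark, edge mark at
  the child, edge mark at the root.\<close>

definition cols :: "('x, 'y) star => ('x * 'x * 'y * 'y) multiset" where "cols ta = image_mset (Pair (fst ta)) (snd ta)"

fun rev_col :: "'x * 'x * 'y * 'y => 'x * 'x * 'y * 'y" where "rev_col (x, x', y, y') = (x', x, y', y)"

abbreviation "rev_cols == image_mset rev_col"

lemma rev_col_rev_col [simp]: "rev_col (rev_col k) = k" by (cases k) auto

lemma size_cols [simp]: "size (cols ta) = deg ta" by (simp add: cols_def star_deg_def)

section \<open>Labellings of the pairs of vertices and their half-edges\<close>

definition all_pairs :: "nat set => nat set set" where "all_pairs V = {e. e <= V & card e = 2}"

text \<open>A marked graph on \<open>V\<close> as one function on the pairs: \<open>None\<close> for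
  a missing edge, otherwise its mark pair. In this form the edges and edge marks of the marked
  Erdos-Renyi graph have a product law.\<close>

definition labellings :: "nat set => (nat set => ('y * 'y) option) set" where "labellings V = {l. ALL e. e ~: all_pairs V --> l e = None}"

definition lmark :: "(nat set => ('y * 'y) option) => nat => nat => 'y" where
 "lmark l u v = (if u < v then fst (the (l {u, v})) else snd (the (l {u, v})))"

definition lnbrs :: "nat set => (nat set => ('y * 'y) option) => nat => nat set" where "lnbrs V l v = {u : V. u ~= v & l {u, v} ~= None}"

definition half :: "(nat => 'x) => (nat set => ('y * 'y) option) => nat => nat => 'x * 'y * 'y" where "half x l v u = (x u, lmark l u v, lmark l v u)"

definition halves :: "nat set => (nat => 'x) => (nat set => ('y * 'y) option) => nat => ('x * 'y * 'y) multiset" where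
 "halves V x l v = image_mset (half x l v) (mset_set (lnbrs V l v))"

definition realizations :: "nat set => (nat => 'x) => (nat => ('x * 'y * 'y) multiset) => (nat set => ('y * 'y) option) set" where
 "realizations V x d = {l : labellings V. ALL v:V. halves V x l v = d v}"

definition total_cols :: "nat set => (nat => 'x) => (nat => ('x * 'y * 'y) multiset) => ('x * 'x * 'y * 'y) multiset" where
 "total_cols V x d = (SUM v:V. image_mset (Pair (x v)) (d v))"

text \<open>Oriented as in \<open>lmark\<close>, so that \<open>y\<close> belongs to the endpoint
  \<open>w\<close> and \<open>y'\<close> to \<open>v\<close>; the half-edge seen from
  \<open>v\<close> is then \<open>(x w, y, y')\<close>.\<close>

definition pair_label :: "nat => nat => 'y => 'y => 'y * 'y" where "pair_label v w y y' = (if w < v then (y, y') else (y', y))"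

lemma finite_all_pairs [simp]: "finite V ==> finite (all_pairs V)" unfolding all_pairs_def by (rule finite_subset[of _ "Pow V"]) auto

lemma in_all_pairs [simp]: "{u, v} : all_pairs V <-> u : V & v : V & u ~= v" by (auto simp: all_pairs_def card_insert_if)

lemma all_pairsE: assumes "e : all_pairs V"
 obtains u v where "e = {u, v}" "u : V" "v : V" "u ~= v" using assms by (auto simp: all_pairs_def card_2_iff)

lemma finite_labellings [simp]: assumes "finite V" shows "finite (labellings V :: (nat set => ('y::finite * 'y) option) set)"
proof (rule finite_subset)
 show "labellings V <= {f. (ALL e. (e : all_pairs V --> f e : UNIV) & (e ~: all_pairs V --> f e = None))}" by (auto simp: labellings_def)
 show "finite {f :: nat set => ('y * 'y) option. (ALL e. (e : all_pairs V --> f e : UNIV) & (e ~: all_pairs V --> f e = None))}"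
  by (rule finite_set_of_finite_funs) (use assms in auto)
qed

lemma finite_realizations [simp]: "finite V ==> finite (realizations V x (d :: nat => ('x * 'y::finite * 'y) multiset))"
 by (rule finite_subset[OF _ finite_labellings[of V]]) (auto simp: realizations_def)

lemma finite_lnbrs [simp]: "finite V ==> finite (lnbrs V l v)" by (auto simp: lnbrs_def)

lemma
 fixes y y' :: 'y and l :: "nat set => ('y * 'y) option" assumes V: "finite V" "v : V" "w : V" "v ~= w" and l: "l {v, w} = None"
 defines "l' \<equiv> l({v, w} := Some (pair_label v w y y'))" shows halves_upd1: "halves V x l' v = add_mset (x w, y, y') (halves V x l v)"
  and halves_upd2: "halves V x l' w = add_mset (x v, y', y) (halves V x l w)"
  and halves_upd3: "u ~= v ==> u ~= w ==> halves V x l' u = halves V x l u"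
proof -
 have l': "l' {u, u'} = l {u, u'}" if "{u, u'} ~= {v, w}" for u u' using that by (simp add: l'_def)
 have l'vw: "l' {v, w} = Some (pair_label v w y y')" "l' {w, v} = Some (pair_label v w y y')" by (simp_all add: l'_def insert_commute)
 have lwv: "l {w, v} = None" using l by (simp add: insert_commute)
 have n1: "lnbrs V l' v = insert w (lnbrs V l v)" "w ~: lnbrs V l v" using V l'vw l' l lwv by (auto simp: lnbrs_def l'_def doubleton_eq_iff)
 have n2: "lnbrs V l' w = insert v (lnbrs V l w)" "v ~: lnbrs V l w" using V l'vw l' l lwv by (auto simp: lnbrs_def l'_def doubleton_eq_iff)
 have h1: "half x l' v w = (x w, y, y')" "half x l' w v = (x v, y', y)" using V(4) by (auto simp: half_def lmark_def l'vw pair_label_def)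
 have h2: "half x l' u u' = half x l u u'" if "{u, u'} ~= {v, w}" for u u'
 proof -
  have "l' {u, u'} = l {u, u'}" "l' {u', u} = l {u', u}" using that by (simp_all add: l' insert_commute)
  thus ?thesis by (simp only: half_def lmark_def)
 qed
 have h3: "image_mset (half x l' u) (mset_set (lnbrs V l u)) = image_mset (half x l u) (mset_set (lnbrs V l u))" for u
 proof (rule image_mset_cong)
  fix u' assume "u' :# mset_set (lnbrs V l u)"
  hence "{u, u'} ~= {v, w}" using V l lwv V(4) by (auto simp: lnbrs_def doubleton_eq_iff insert_commute)
  thus "half x l' u u' = half x l u u'" by (rule h2)
 qed
 show "halves V x l' v = add_mset (x w, y, y') (halves V x l v)" using n1 V by (simp add: halves_def h1 h3)
 show "halves V x l' w = add_mset (x v, y', y) (halves V x l w)" using n2 V by (simp add: halves_def h1 h3)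
 show "halves V x l' u = halves V x l u" if "u ~= v" "u ~= w"
 proof -
  have "lnbrs V l' u = lnbrs V l u" using that by (auto simp: lnbrs_def l'_def doubleton_eq_iff)
  thus ?thesis by (simp add: halves_def h3)
 qed
qed

lemma pair_label_cases: assumes "v ~= w" "l {v, w} = Some z" shows "z = pair_label v w (lmark l w v) (lmark l v w)"
 using assms by (auto simp: pair_label_def lmark_def insert_commute)

lemma lmark_upd: assumes "v ~= w" shows "lmark (l({v, w} := Some (pair_label v w y y'))) w v = y"
  and "lmark (l({v, w} := Some (pair_label v w y y'))) v w = y'" using assms by (auto simp: lmark_def pair_label_def insert_commute)

lemma labelling_induct [consumes 2, case_names empty insert]: assumes "finite V" "l : labellings V" and "P (%_. None)"
  and "!!l v w y y'. [|l : labellings V; v : V; w : V; v ~= w; l {v, w} = None; P l|] ==> P (l({v, w} := Some (pair_label v w y y')))" shows "P l"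
 using assms(2)
proof (induction "card {e. l e ~= None}" arbitrary: l)
 case 0
 have "finite {e. l e ~= None}" by (rule finite_subset[OF _ finite_all_pairs[OF assms(1)]]) (use 0 in \<open>auto simp: labellings_def\<close>)
 with 0 have "{e. l e ~= None} = {}" by simp
 hence "l = (%_. None)" by blast
 thus ?case using assms(3) by simp
next
 case (Suc n)
 obtain e where e: "l e ~= None" using Suc(2) by (metis (mono_tags, lifting) card.empty empty_Collect_eq nat.distinct(1))
 hence "e : all_pairs V" using Suc.prems by (auto simp: labellings_def)
 then obtain v w where vw: "e = {v, w}" "v : V" "w : V" "v ~= w" by (rule all_pairsE)
 let ?l = "l(e := None)"
 have "{e'. ?l e' ~= None} = {e. l e ~= None} - {e}" by auto
 hence "n = card {e. ?l e ~= None}" using Suc(2)  e by simp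
 moreover have lab: "?l : labellings V" using Suc.prems by (auto simp: labellings_def)
 ultimately have "P ?l" by (rule Suc.hyps)
 from e obtain z where z: "l {v, w} = Some z" using vw by auto
 have "P (?l({v, w} := Some (pair_label v w (lmark l w v) (lmark l v w))))" by (rule assms(4)[OF lab]) (use vw \<open>P ?l\<close> in auto)
 also have "?l({v, w} := Some (pair_label v w (lmark l w v) (lmark l v w))) = l" using pair_label_cases[of v w l z] z vw by auto
 finally show ?case .
qed

lemma total_cols_split2: assumes "finite V" "v : V" "w : V" "v ~= w"
 shows "total_cols V x d = image_mset (Pair (x v)) (d v) + image_mset (Pair (x w)) (d w) + total_cols (V - {v, w}) x d"
proof -
 have "V - {v, w} = V - {v} - {w}" by auto
 thus ?thesis using assms unfolding total_cols_def by (simp add: sum.remove[of V v] sum.remove[of "V - {v}" w] ac_simps)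
qed

lemma total_cols_cong: "(!!u. u : V ==> d u = d' u) ==> total_cols V x d = total_cols V x d'" unfolding total_cols_def by (rule sum.cong) auto

lemma total_cols_halves_upd: assumes V: "finite V" "v : V" "w : V" "v ~= w" and l: "l {v, w} = None"
 shows "total_cols V x (halves V x (l({v, w} := Some (pair_label v w y y'))))
  = total_cols V x (halves V x l) + {#(x v, x w, y, y'), (x w, x v, y', y)#}"
 unfolding total_cols_split2[OF V] halves_upd1[of V v w l, OF V l] halves_upd2[of V v w l, OF V l]
 by (subst total_cols_cong[of "V - {v, w}" _ "halves V x l"]) (use halves_upd3[of V v w l, OF V l] in auto)

lemma halves_None [simp]: "halves V x (%_. None) v = {#}" by (simp add: halves_def lnbrs_def)

lemma total_cols_empty: "(!!v. v : V ==> d v = {#}) ==> total_cols V x d = {#}" unfolding total_cols_def by (rule sum.neutral) auto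

text \<open>Each edge contributes a colour together with its reversal, so symmetry persists while
  edges are added one by one.\<close>

lemma total_cols_balanced: assumes "finite V" "l : labellings V" shows "rev_cols (total_cols V x (halves V x l)) = total_cols V x (halves V x l)"
 using assms
proof (induction rule: labelling_induct)
 case empty
 thus ?case by (simp add: total_cols_empty)
next
 case (insert l v w y y')
 thus ?case unfolding total_cols_halves_upd[of V v w l, OF assms(1) insert(2-5)] by simp
qed

lemma realizations_total: "finite V ==> l : realizations V x d ==> total_cols V x (halves V x l) = total_cols V x d"
 by (rule total_cols_cong) (auto simp: realizations_def)

lemma realizations_balanced: assumes "finite V" "realizations V x d ~= {}" shows "rev_cols (total_cols V x d) = total_cols V x d"
proof -
 obtain l where l: "l : realizations V x d" using assms(2) by blast
 hence "l : labellings V" by (simp add: realizations_def)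
 from total_cols_balanced[OF assms(1) this, of x] show ?thesis by (simp only: realizations_total[OF assms(1) l])
qed

text \<open>The half-edges still to be matched once the half-edge \<open>c\<close> of
  \<open>v\<close> has been joined to its opposite at \<open>w\<close>.\<close>

definition rem_edge where "rem_edge x d v w c = d(v := d v - {#c#}, w := d w - {#(x v, snd (snd c), fst (snd c))#})"

section \<open>The recurrence for the number of realizations\<close>

lemma add_mset_eq_iff_diff: "a :# M ==> add_mset a A = M <-> A = M - {#a#}" by auto

lemma realizations_upd: assumes V: "finite V" "v : V" "w : V" "v ~= w" and l: "l {v, w} = None" and c: "(x w, y, y') :# d v" "(x v, y', y) :# d w"
 shows "l({v, w} := Some (pair_label v w y y')) : realizations V x d <-> l : realizations V x (rem_edge x d v w (x w, y, y'))"
proof -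
 have 1: "l({v, w} := Some (pair_label v w y y')) : labellings V <-> l : labellings V" using V l by (auto simp: labellings_def) (metis l)
 have split: "(ALL u:V. Q u) <-> Q v & Q w & (ALL u:V - {v, w}. Q u)" for Q using V by blast
 show ?thesis unfolding realizations_def mem_Collect_eq 1 split[of "%u. halves V x _ u = _ u"] using c halves_upd3[of V v w l _ x y y', OF V l]
  by (auto simp: halves_upd1[of V v w l, OF V l] halves_upd2[of V v w l, OF V l] rem_edge_def V(4) add_mset_eq_iff_diff)
qed

lemma count_halves: assumes "finite V" shows "count (halves V x l v) c = card {u : V. u : lnbrs V l v & half x l v u = c}"
proof -
 have "count (halves V x l v) c = card (half x l v -` {c} \<inter> lnbrs V l v)" using assms by (simp add: halves_def count_image_mset)
 also have "half x l v -` {c} \<inter> lnbrs V l v = {u : V. u : lnbrs V l v & half x l v u = c}" by (auto simp: lnbrs_def)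
 finally show ?thesis .
qed

lemma sum_card_swap: assumes "finite A" "finite B" shows "(SUM a:A. card {b : B. P a b}) = (SUM b:B. card {a : A. P a b})"
proof -
 have 1: "card {b : B. Q b} = (SUM b:B. if Q b then 1 else 0)" if "finite B" for Q and B :: "'c set" using that by (simp add: sum.If_cases Int_def)
 show ?thesis by (simp add: 1[OF assms(1)] 1[OF assms(2)]) (rule sum.swap)
qed

text \<open>Double counting of the pairs of a realization and a neighbour \<open>w\<close> of
  \<open>v\<close> joined through the half-edge \<open>(x', y, y')\<close>. Deleting that edge is a
  bijection onto the realizations of the reduced data in which {v, w} is still free; this side
  condition is what keeps the graph simple.\<close>

lemma realizations_recurrence:
 fixes x :: "nat => 'x" and d :: "nat => ('x * 'y::finite * 'y) multiset" assumes V: "finite V" "v : V" and c: "(x', y, y') :# d v"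
 defines "W \<equiv> {w : V. w ~= v & x w = x' & (x v, y', y) :# d w}" shows "card (realizations V x d) * count (d v) (x', y, y')
  = (SUM w:W. card {l : realizations V x (rem_edge x d v w (x', y, y')). l {v, w} = None})"
proof -
 let ?R = "realizations V x d" and ?c = "(x', y, y')"
 let ?A = "%w. {l : ?R. w : lnbrs V l v & half x l v w = ?c}"
 have "card ?R * count (d v) ?c = (SUM l:?R. card {u : V. u : lnbrs V l v & half x l v u = ?c})"
 proof -
  have "(SUM l:?R. card {u : V. u : lnbrs V l v & half x l v u = ?c}) = (SUM l:?R. count (d v) ?c)"
   using V by (intro sum.cong refl) (auto simp: realizations_def count_halves[symmetric])
  thus ?thesis by simp
 qed
 also have "... = (SUM w:V. card (?A w))" using V by (intro sum_card_swap) auto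
 also have "... = (SUM w:W. card (?A w))"
 proof (rule sum.mono_neutral_right)
  show "ALL w:V - W. card (?A w) = 0"
  proof
   fix w assume w: "w : V - W"
   have "?A w = {}"
   proof (rule ccontr)
    assume "?A w ~= {}"
    then obtain l where l: "l : ?R" "w : lnbrs V l v" "half x l v w = ?c" by blast
    hence wv: "w ~= v" "x w = x'" by (auto simp: lnbrs_def half_def)
    have "v : lnbrs V l w" using l(2) V by (auto simp: lnbrs_def insert_commute)
    moreover have "half x l w v = (x v, y', y)" using l(3) by (simp add: half_def)
    ultimately have "(x v, y', y) :# halves V x l w" using V by (auto simp: halves_def intro!: image_eqI[of _ _ v])
    thus False using l(1) w w wv by (simp add: realizations_def W_def)
   qed
   thus "card (?A w) = 0" by (simp only: card.empty)
  qed
 qed (use V in \<open>auto simp: W_def\<close>)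
 also have "... = (SUM w:W. card {l : realizations V x (rem_edge x d v w ?c). l {v, w} = None})"
 proof (rule sum.cong[OF refl])
  fix w assume w: "w : W"
  hence W: "w : V" "v ~= w" "x w = x'" "(x v, y', y) :# d w" by (auto simp: W_def)
  let ?B = "{l : realizations V x (rem_edge x d v w ?c). l {v, w} = None}"
  let ?f = "%l. l({v, w} := Some (pair_label v w y y'))"
  let ?g = "%l. l({v, w} := None)"
  have upd: "?f l : ?R <-> l : realizations V x (rem_edge x d v w ?c)" if "l {v, w} = None" for l
   using realizations_upd[of V v w l x y y' d, OF V W(1,2) that] W c by simp
  have "bij_betw ?f ?B (?A w)"
  proof (rule bij_betwI[where g = ?g])
   show "?f : ?B \<rightarrow> ?A w"
   proof
    fix l assume l: "l : ?B"
    have fl: "?f l {v, w} = Some (pair_label v w y y')" "?f l {w, v} = Some (pair_label v w y y')" by auto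
    have "half x (?f l) v w = ?c" using W(2,3) by (simp add: half_def lmark_upd del: fun_upd_apply)
    moreover have "w : lnbrs V (?f l) v" using W fl unfolding lnbrs_def by simp
    ultimately show "?f l : ?A w" using upd l by blast
   qed
   have gA: "?f (?g l) = l" if l: "l : ?A w" for l
   proof -
    from l obtain z where z: "l {v, w} = Some z" by (auto simp: lnbrs_def insert_commute)
    show ?thesis using pair_label_cases[of v w l z, OF W(2) z] l z by (simp add: half_def fun_eq_iff)
   qed
   show "?g : ?A w \<rightarrow> ?B"
   proof
    fix l assume l: "l : ?A w"
    thus "?g l : ?B" using gA[OF l] upd[of "?g l"] by simp
   qed
   show "?f (?g l) = l" if "l : ?A w" for l using gA[OF that] .
   show "?g (?f l) = l" if "l : ?B" for l using that by auto
  qed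
  thus "card (?A w) = card ?B" by (simp add: bij_betw_same_card)
 qed
 finally show ?thesis .
qed

lemma total_cols_rem_edge: assumes V: "finite V" "v : V" "w : V" "v ~= w" and c: "(x w, y, y') :# d v" "(x v, y', y) :# d w" shows "total_cols V x d
  = total_cols V x (rem_edge x d v w (x w, y, y')) + {#(x v, x w, y, y'), (x w, x v, y', y)#}"
proof -
 have "total_cols (V - {v, w}) x (rem_edge x d v w (x w, y, y')) = total_cols (V - {v, w}) x d" by (rule total_cols_cong) (auto simp: rem_edge_def)
 moreover have "image_mset (Pair (x v)) (d v) = image_mset (Pair (x v)) (d v - {#(x w, y, y')#}) + {#(x v, x w, y, y')#}"
  using c(1) by (metis add_mset_add_single image_mset_add_mset insert_DiffM)
 moreover have "image_mset (Pair (x w)) (d w) = image_mset (Pair (x w)) (d w - {#(x v, y', y)#}) + {#(x w, x v, y', y)#}"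
  using c(2) by (metis add_mset_add_single image_mset_add_mset insert_DiffM)
 ultimately show ?thesis using V(4) by (simp add: total_cols_split2[OF V] rem_edge_def)
qed

lemma prod_mfact_rem_edge: assumes V: "finite V" "v : V" "w : V" "v ~= w" and c: "(x w, y, y') :# d v" "(x v, y', y) :# d w"
 shows "(PROD u:V. mfact (d u)) = real (count (d v) (x w, y, y')) * real (count (d w) (x v, y', y))
  * (PROD u:V. mfact (rem_edge x d v w (x w, y, y') u))"
proof -
 have split: "(PROD u:V. f u) = f v * f w * (PROD u:V - {v, w}. f u)" for f :: "_ => real"
 proof -
  have "V - {v, w} = V - {v} - {w}" by auto
  thus ?thesis using V by (simp add: prod.remove[of V v] prod.remove[of "V - {v}" w])
 qed
 show ?thesis using V(4) c by (simp add: split mfact_remove[of _ "d v"] mfact_remove[of _ "d w"] rem_edge_def)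
qed

text \<open>The factors \<open>mfact (d u)\<close> make equal half-edges at a vertex
  distinguishable. The recurrence becomes the one for perfect matchings: a fixed half-edge at
  \<open>v\<close> chooses its partner among the opposite half-edges at other vertices.\<close>

lemma realizations_step:
 fixes x :: "nat => 'x" and d :: "nat => ('x * 'y::finite * 'y) multiset" assumes V: "finite V" "v : V" and c: "(x', y, y') :# d v"
 defines "W \<equiv> {w : V. w ~= v & x w = x' & (x v, y', y) :# d w}" shows "real (card (realizations V x d)) * (PROD u:V. mfact (d u))
  = (SUM w:W. real (count (d w) (x v, y', y)) * (real (card {l : realizations V x (rem_edge x d v w (x', y, y')). l {v, w} = None})
    * (PROD u:V. mfact (rem_edge x d v w (x', y, y') u))))"
proof -
 let ?c = "(x', y, y')"
 let ?B = "%w. real (card {l : realizations V x (rem_edge x d v w ?c). l {v, w} = None})"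
 have pos: "real (count (d v) ?c) > 0" using c by simp
 have "real (card (realizations V x d)) = (SUM w:W. ?B w) / real (count (d v) ?c)" using arg_cong[OF realizations_recurrence[of V v x' y y' d x, OF V c, folded W_def], of real] pos by (simp add: field_simps)
 hence "real (card (realizations V x d)) * (PROD u:V. mfact (d u)) = (SUM w:W. ?B w * ((PROD u:V. mfact (d u)) / real (count (d v) ?c)))"
  by (simp add: sum_distrib_right sum_divide_distrib)
 also have "... = (SUM w:W. real (count (d w) (x v, y', y)) * (?B w * (PROD u:V. mfact (rem_edge x d v w ?c u))))"
 proof (rule sum.cong[OF refl])
  fix w assume "w : W"
  hence w: "w : V" "v ~= w" "x w = x'" "(x v, y', y) :# d w" by (auto simp: W_def)
  have "(PROD u:V. mfact (d u)) / real (count (d v) ?c) = real (count (d w) (x v, y', y)) * (PROD u:V. mfact (rem_edge x d v w ?c u))"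
  proof -
   have ne: "real (count (d v) ?c) ~= 0" using pos by linarith
   have "(PROD u:V. mfact (d u)) = real (count (d v) ?c) * real (count (d w) (x v, y', y)) * (PROD u:V. mfact (rem_edge x d v w ?c u))"
    using prod_mfact_rem_edge[OF V w(1,2), of x y y' d] w c by simp
   moreover have "P = a * b * q ==> a ~= 0 ==> P / a = b * q" for P a b q :: real by simp
   ultimately show ?thesis using ne by blast
  qed
  thus "?B w * ((PROD u:V. mfact (d u)) / real (count (d v) ?c)) =
   real (count (d w) (x v, y', y)) * (?B w * (PROD u:V. mfact (rem_edge x d v w ?c u)))" by simp
 qed
 finally show ?thesis .
qed

lemma count_image_mset_inj: "inj f ==> count (image_mset f m) (f a) = count m a" by (induction m) (auto simp: inj_eq)

lemma count_total_cols: "finite V ==> count (total_cols V x d) (a, c) = (SUM u:{u:V. x u = a}. count (d u) c)"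
proof -
 assume V: "finite V"
 have "count (image_mset (Pair (x u)) (d u)) (a, c) = (if x u = a then count (d u) c else 0)" for u
 proof (cases "x u = a")
  case True
  thus ?thesis using count_image_mset_inj[of "Pair (x u)" "d u" c] by (simp add: inj_on_def)
 qed (auto simp: not_in_iff[symmetric])
 thus ?thesis using V by (simp add: total_cols_def count_sum sum.inter_filter)
qed

text \<open>Removing one edge divides \<open>mfact T\<close> by the square of the number of opposite
  half-edges, or by n (n - 1) if the colour is its own reversal and occurs n times. Hence
  \<open>sqrt (mfact T)\<close> satisfies the matching recurrence with equality in the first case
  and as an upper bound in the second.\<close>

lemma mfact_balanced_remove: assumes T: "T = T' + {#k, rev_col k#}" and bal: "rev_cols T = T"
 shows "rev_col k ~= k ==> mfact T = (real (count T (rev_col k)))\<^sup>2 * mfact T'"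
  and "rev_col k = k ==> mfact T = real (count T k) * (real (count T k) - 1) * mfact T'"
proof -
 have inj: "inj rev_col" by (metis injI rev_col_rev_col)
 have "count T (rev_col k) = count (rev_cols T) (rev_col k)" by (simp add: bal)
 also have "... = count T k" by (rule count_image_mset_inj[OF inj])
 finally have eq: "count T (rev_col k) = count T k" .
 show "mfact T = (real (count T (rev_col k)))\<^sup>2 * mfact T'" if "rev_col k ~= k" using eq that by (simp add: T mfact_add_mset power2_eq_square)
 show "mfact T = real (count T k) * (real (count T k) - 1) * mfact T'" if "rev_col k = k" using that by (simp add: T mfact_add_mset)
qed

lemma size_total_cols: "size (total_cols V x d) = (SUM v:V. size (d v))" by (induction V rule: infinite_finite_induct) (auto simp: total_cols_def)

lemma realizations_empty: assumes V: "finite V" and d: "!!v. v : V ==> d v = {#}" shows "realizations V x d = {%_. None}"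
proof -
 have "l = (%_. None)" if l: "l : realizations V x d" for l
 proof
  fix e
  show "l e = None"
  proof (cases "e : all_pairs V")
   case True
   then obtain u v where e: "e = {u, v}" "u : V" "v : V" "u ~= v" by (rule all_pairsE)
   have "lnbrs V l v = {}" using l e d V by (simp add: realizations_def halves_def mset_set_empty_iff)
   thus ?thesis using e by (auto simp: lnbrs_def simp del: not_None_eq)
  qed (use l in \<open>auto simp: realizations_def labellings_def\<close>)
 qed
 thus ?thesis using d by (auto simp: realizations_def labellings_def)
qed

text \<open>Induction on the number of half-edges. Dropping the requirement that {v, w} be free only
  enlarges the count; the \<open>s\<close> possible partners contribute a factor \<open>s\<close>,
  and \<open>sqrt (mfact T)\<close> loses at least as much.\<close>

lemma card_realizations_upper:
 fixes d :: "nat => ('x * 'y::finite * 'y) multiset" assumes V: "finite V"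
 shows "real (card (realizations V x d)) * (PROD u:V. mfact (d u)) <= sqrt (mfact (total_cols V x d))"
proof (induction "size (total_cols V x d)" arbitrary: d rule: less_induct)
 case less
 show ?case
 proof (cases "realizations V x d = {} | (ALL v:V. d v = {#})")
  case True
  thus ?thesis
  proof
   assume "ALL v:V. d v = {#}"
   thus ?thesis using V by (simp add: realizations_empty total_cols_empty)
  qed simp
 next
  case False
  then obtain v where v: "v : V" "d v ~= {#}" by blast
  then obtain x' y y' where c: "(x', y, y') :# d v" by (metis multiset_nonemptyE prod_cases3)
  let ?c = "(x', y, y')" and ?c' = "(x v, y', y)"
  define W where "W = {w : V. w ~= v & x w = x' & ?c' :# d w}"
  define T where "T = total_cols V x d"
  define T' where "T' = T - {#(x v, ?c), (x', ?c')#}"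
  have bal: "rev_cols T = T" unfolding T_def using realizations_balanced V False by blast
  have TW: "total_cols V x (rem_edge x d v w ?c) = T'" "T = T' + {#(x v, ?c), (x', ?c')#}" if "w : W" for w
   using total_cols_rem_edge[of V v w x y y' d] V v c that by (auto simp: W_def T_def T'_def)
  define s where "s = (SUM w:W. count (d w) ?c')"
  have "real (card (realizations V x d)) * (PROD u:V. mfact (d u)) = (SUM w:W. real (count (d w) (x v, y', y)) *
    (real (card {l : realizations V x (rem_edge x d v w ?c). l {v, w} = None}) * (PROD u:V. mfact (rem_edge x d v w ?c u))))"
   unfolding W_def by (rule realizations_step) (use V v c in auto)
  also have "... <= (SUM w:W. real (count (d w) (x v, y', y)) * sqrt (mfact T'))"
  proof (rule sum_mono, rule mult_left_mono)
   fix w assume w: "w : W"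
   have "real (card {l : realizations V x (rem_edge x d v w ?c). l {v, w} = None}) * (PROD u:V. mfact (rem_edge x d v w ?c u))
    <= real (card (realizations V x (rem_edge x d v w ?c))) * (PROD u:V. mfact (rem_edge x d v w ?c u))"
    using V by (intro mult_right_mono prod_nonneg) (auto intro!: card_mono)
   also have "... <= sqrt (mfact (total_cols V x (rem_edge x d v w ?c)))" by (rule less) (use TW[OF w] T_def in simp)
   finally show "real (card {l : realizations V x (rem_edge x d v w ?c). l {v, w} = None})
    * (PROD u:V. mfact (rem_edge x d v w ?c u)) <= sqrt (mfact T')" using TW[OF w] by simp
  qed simp
  also have "... = real s * sqrt (mfact T')" by (simp add: s_def sum_distrib_right)
  also have "... <= sqrt (mfact T)"
  proof (cases "W = {}")
   case False
   then obtain w where "w : W" by blast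
   from TW(2)[OF this] have T: "T = T' + {#(x v, ?c), rev_col (x v, ?c)#}" by simp
   have cT: "count T (x', ?c') = (SUM u:{u:V. x u = x'}. count (d u) ?c')" unfolding T_def by (rule count_total_cols[OF V])
   have sW: "s = (SUM u:{u:V. x u = x'} - {v}. count (d u) ?c')"
    unfolding s_def by (rule sum.mono_neutral_left) (use V in \<open>auto simp: W_def not_in_iff\<close>)
   have "(real s)\<^sup>2 * mfact T' <= mfact T"
   proof (cases "rev_col (x v, ?c) = (x v, ?c)")
    case True
    \<comment> \<open>For a self-reverse colour the half-edges of \<open>v\<close> itself are no
      partners, so \<open>s\<close> is at most n - 1 and its square at most n (n - 1), where n is
      the count of the colour.\<close>
    hence eq: "x' = x v" "y = y'" unfolding rev_col.simps prod.inject by blast+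
    have "count T (x', ?c') = count (d v) ?c' + s" unfolding cT sW by (rule sum.remove) (use V v eq in auto)
    hence "Suc s <= count T (x v, ?c)" using c eq by simp
    hence "real s <= real (count T (x v, ?c)) - 1" by linarith
    thus ?thesis unfolding power2_eq_square mfact_balanced_remove(2)[OF T bal True] by (intro mult_right_mono, auto, intro mult_mono, auto)
   next
    case False
    have "s <= count T (x', ?c')" unfolding cT sW by (rule sum_mono2) (use V in auto)
    thus ?thesis unfolding mfact_balanced_remove(1)[OF T bal False] rev_col.simps by simp
   qed
   hence "sqrt ((real s)\<^sup>2 * mfact T') <= sqrt (mfact T)" by simp
   thus ?thesis by (simp add: real_sqrt_mult)
  qed (simp add: s_def)
  finally show ?thesis by (simp add: T_def)
 qed
qed

section \<open>Stars whose root and children lie in distinct classes\<close>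

definition good_star :: "('x => 'c) => ('x, 'y) star => bool" where
 "good_star cl ta <-> (ALL k. count (add_mset (cl (fst ta)) (image_mset (%c. cl (fst c)) (snd ta))) k <= 1)"

lemma good_star_mono: assumes "good_star cl (a, m)" "m' <=# m" shows "good_star cl (a, m')" unfolding good_star_def
proof
 fix k
 let ?m = "%m. add_mset (cl a) (image_mset (%c. cl (fst c)) m)"
 have "?m m' <=# ?m m" using assms(2) by (simp add: image_mset_subseteq_mono)
 hence "count (?m m') k <= count (?m m) k" by (rule mset_subset_eq_count)
 also have "... <= 1" using assms(1) by (simp add: good_star_def)
 finally show "count (add_mset (cl (fst (a, m'))) (image_mset (%c. cl (fst c)) (snd (a, m')))) k <= 1" by simp
qed

lemma good_starD: assumes "good_star cl (a, m)" shows "c :# m ==> cl (fst c) ~= cl a" and "{#c, c'#} <=# m ==> cl (fst c) ~= cl (fst c')"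
  and "count m c <= 1"
proof -
 let ?m = "%m. add_mset (cl a) (image_mset (%c. cl (fst c)) m)"
 have g: "count (?m m') k <= 1" if "m' <=# m" for k m' using good_star_mono[OF assms that] by (simp add: good_star_def)
 show "cl (fst c) ~= cl a" if "c :# m"
 proof
  assume "cl (fst c) = cl a"
  thus False using g[of "{#c#}" "cl a"] that by simp
 qed
 show 2: "cl (fst c) ~= cl (fst c')" if "{#c, c'#} <=# m" for c c'
 proof
  assume "cl (fst c) = cl (fst c')"
  thus False using g[OF that, of "cl (fst c)"] by (simp split: if_splits)
 qed
 show "count m c <= 1"
 proof (rule ccontr)
  assume "~ count m c <= 1"
  hence "c :# m" "c :# m - {#c#}" by (auto simp: in_diff_count simp flip: count_greater_zero_iff)
  hence "{#c, c#} <=# m" by (simp add: insert_subset_eq_iff)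
  from 2[OF this] show False by simp
 qed
qed

text \<open>For good stars the recurrence loses nothing. No colour is its own reversal, so every
  opposite half-edge is available as a partner. A realization of the reduced data cannot contain {v,
  w}, because that would give \<open>v\<close> two children of the same class.\<close>

lemma card_realizations_lower:
 fixes d :: "nat => ('x * 'y::finite * 'y) multiset" assumes V: "finite V" and good: "!!v. v : V ==> good_star cl (x v, d v)"
  and bal: "rev_cols (total_cols V x d) = total_cols V x d"
 shows "sqrt (mfact (total_cols V x d)) <= real (card (realizations V x d)) * (PROD u:V. mfact (d u))" using good bal
proof (induction "size (total_cols V x d)" arbitrary: d rule: less_induct)
 case less
 show ?case
 proof (cases "ALL v:V. d v = {#}")
  case True
  thus ?thesis using V by (simp add: realizations_empty total_cols_empty)
 next
  case False
  then obtain v where v: "v : V" "d v ~= {#}" by blast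
  then obtain x' y y' where c: "(x', y, y') :# d v" by (metis multiset_nonemptyE prod_cases3)
  let ?c = "(x', y, y')" and ?c' = "(x v, y', y)"
  define W where "W = {w : V. w ~= v & x w = x' & ?c' :# d w}"
  define T where "T = total_cols V x d"
  define T' where "T' = T - {#(x v, ?c), (x', ?c')#}"
  have bal: "rev_cols T = T" unfolding T_def by (rule less.prems)
  have TW: "total_cols V x (rem_edge x d v w ?c) = T'" "T = T' + {#(x v, ?c), (x', ?c')#}" if "w : W" for w
   using total_cols_rem_edge[of V v w x y y' d] V v c that by (auto simp: W_def T_def T'_def)
  have clx: "x' ~= x v" using good_starD(1)[OF less.prems(1)[OF v(1)] c] by auto
  define s where "s = (SUM w:W. count (d w) ?c')"
  have "s = (SUM u:{u:V. x u = x'}. count (d u) ?c')"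
   unfolding s_def by (rule sum.mono_neutral_left) (use V clx in \<open>auto simp: W_def not_in_iff\<close>)
  also have "... = count T (x', ?c')" unfolding T_def by (rule count_total_cols[OF V, symmetric])
  finally have s: "s = count T (x', ?c')" .
  also have "... = count (rev_cols T) (rev_col (x v, ?c))" by (simp add: bal)
  also have "... = count T (x v, ?c)" by (rule count_image_mset_inj) (metis injI rev_col_rev_col)
  also have "... = (SUM u:{u:V. x u = x v}. count (d u) ?c)" unfolding T_def by (rule count_total_cols[OF V])
  finally have "count (d v) ?c <= s" using V v by (simp only:) (rule member_le_sum, auto)
  moreover have "0 < count (d v) ?c" using c by simp
  ultimately have "W ~= {}" by (force simp: s_def)
  then obtain w0 where "w0 : W" by blast
  note T = TW(2)[OF this]
  have "sqrt (mfact T) = real s * sqrt (mfact T')" using mfact_balanced_remove(1)[of T T' "(x v, ?c)"] T bal clx s by (simp add: real_sqrt_mult)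
  also have "... = (SUM w:W. real (count (d w) (x v, y', y)) * sqrt (mfact T'))" by (simp add: s_def sum_distrib_right)
  also have "... <= (SUM w:W. real (count (d w) (x v, y', y)) * (real (card {l : realizations V x (rem_edge x d v w ?c). l {v, w} = None})
    * (PROD u:V. mfact (rem_edge x d v w ?c u))))"
  proof (rule sum_mono, rule mult_left_mono)
   fix w assume w: "w : W"
   hence w': "w : V" "w ~= v" "x w = x'" "?c' :# d w" by (auto simp: W_def)
   let ?d = "rem_edge x d v w ?c"
   \<comment> \<open>An edge to \<open>w\<close> would be a further half-edge at \<open>v\<close>
     with the child mark of \<open>?c\<close>, hence with the same class.\<close>
   have "l {v, w} = None" if l: "l : realizations V x ?d" for l
   proof (rule ccontr)
    assume "l {v, w} ~= None"
    hence "half x l v w :# halves V x l v" using w' V by (simp add: lnbrs_def insert_commute halves_def)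
    hence "half x l v w :# d v - {#?c#}" using l v w' by (auto simp: realizations_def rem_edge_def)
    hence "{#half x l v w, ?c#} <=# d v" using c by (metis add_mset_commute insert_DiffM insert_subset_eq_iff mset_subset_eq_single)
    from good_starD(2)[OF less.prems(1)[OF v(1)] this] show False using w' by (simp add: half_def)
   qed
   hence eq: "{l : realizations V x ?d. l {v, w} = None} = realizations V x ?d" by blast
   have "sqrt (mfact (total_cols V x ?d)) <= real (card (realizations V x ?d)) * (PROD u:V. mfact (?d u))"
   proof (rule less.hyps)
    show "size (total_cols V x ?d) < size (total_cols V x d)" using TW[OF w] T_def by simp
    show "good_star cl (x u, ?d u)" if "u : V" for u by (rule good_star_mono[OF less.prems(1)[OF that]]) (simp add: rem_edge_def)
    show "rev_cols (total_cols V x ?d) = total_cols V x ?d" using bal T TW(1)[OF w] by simp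
   qed
   thus "sqrt (mfact T') <= real (card {l : realizations V x ?d. l {v, w} = None}) * (PROD u:V. mfact (?d u))" using TW(1)[OF w] by (simp only: eq)
  qed simp
  also have "... = real (card (realizations V x d)) * (PROD u:V. mfact (d u))"
   unfolding W_def by (rule realizations_step[symmetric]) (use V v c in auto)
  finally show ?thesis by (simp add: T_def)
 qed
qed

abbreviation "poi_law kp nu xi == true_law (Poi kp) nu xi"
section \<open>Point probabilities\<close>

definition child_wt :: "'x pmf => ('y * 'y) pmf => 'x * 'y * 'y => real" where "child_wt nu xi c = pmf nu (fst c) * pmf (sym_law xi) (snd c)"

text \<open>The probability of a colour when all marks are independent;
  \<open>kp * edge_wt nu xi k\<close> is the mean number of half-edges of colour \<open>k\<close>
  under the Poisson star law, by \<open>colmean_true_law\<close>.\<close>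

definition edge_wt :: "'x pmf => ('y * 'y) pmf => 'x * 'x * 'y * 'y => real" where "edge_wt nu xi k = pmf nu (fst k) * child_wt nu xi (snd k)"

lemma child_wt_nonneg [simp]: "child_wt nu xi c >= 0" by (simp add: child_wt_def)

lemma edge_wt_nonneg [simp]: "edge_wt nu xi k >= 0" by (simp add: edge_wt_def)

lemma sym_law_swap: "pmf (sym_law xi) (y, y') = pmf (sym_law xi) (y', y)" by (simp add: pmf_sym_law add.commute)

lemma edge_wt_rev [simp]: "edge_wt nu xi (rev_col k) = edge_wt nu xi k" by (cases k) (simp add: edge_wt_def child_wt_def sym_law_swap)

lemma pmf_replicate: "pmf (replicate_pmf n p) xs = (if length xs = n then \<Prod>x\<leftarrow>xs. pmf p x else 0)"
proof (induction n arbitrary: xs)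
 case 0
 thus ?case by simp
next
 case (Suc n)
 have eq: "replicate_pmf (Suc n) p = map_pmf (%(x, xs). x # xs) (pair_pmf p (replicate_pmf n p))"
  by (simp add: pair_pmf_def map_bind_pmf bind_assoc_pmf bind_return_pmf map_return_pmf)
 show ?case
 proof (cases xs)
  case Nil
  thus ?thesis by (auto simp: pmf_eq_0_set_pmf simp del: replicate_pmf.simps) (auto simp: set_replicate_pmf)
 next
  case (Cons a as)
  show ?thesis unfolding eq using pmf_map_inj'[of "%(x, xs). x # xs" _ "(a, as)"] Suc Cons by (simp add: inj_def pmf_pair)
 qed
qed

lemma card_permutations_mfact: "real (card (permutations_of_multiset m)) = fact (size m) / mfact m"
proof -
 have "real (card (permutations_of_multiset m)) * mfact m = real (fact (size m))"
  unfolding mfact_def card_permutations_of_multiset_aux[symmetric, of m] by simp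
 thus ?thesis by (simp add: nonzero_eq_divide_eq)
qed

lemma pmf_mset_replicate: "pmf (map_pmf mset (replicate_pmf n p)) m = (if size m = n then fact n / mfact m * (PROD c:#m. pmf p c) else 0)"
proof -
 have "pmf (map_pmf mset (replicate_pmf n p)) m = prob (replicate_pmf n p) (permutations_of_multiset m)"
  unfolding pmf_map by (rule arg_cong[where f = "prob _"]) (auto simp: permutations_of_multiset_def)
 also have "... = (SUM xs:permutations_of_multiset m. pmf (replicate_pmf n p) xs)" by (simp add: prob_finite_sum)
 also have "... = (SUM xs:permutations_of_multiset m. if size m = n then (PROD c:#m. pmf p c) else 0)"
 proof (rule sum.cong[OF refl])
  fix xs assume "xs : permutations_of_multiset m"
  hence m: "mset xs = m" by (rule permutations_of_multisetD)
  thus "pmf (replicate_pmf n p) xs = (if size m = n then (PROD c:#m. pmf p c) else 0)"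
   by (simp add: pmf_replicate flip: m mset_map prod_mset_prod_list)
 qed
 also have "... = (if size m = n then fact n / mfact m * (PROD c:#m. pmf p c) else 0)" by (simp add: card_permutations_mfact)
 finally show ?thesis .
qed

lemma pmf_pair_child: "pmf (pair_pmf nu (sym_law xi)) c = child_wt nu xi c" by (cases c) (simp add: pmf_pair child_wt_def)

lemma pmf_pair_child_fun: "pmf (pair_pmf nu (sym_law xi)) = child_wt nu xi" by (rule ext) (rule pmf_pair_child)

lemma true_law_alt: "true_law q nu xi =
 bind_pmf q (%d. pair_pmf nu (map_pmf mset (replicate_pmf d (pair_pmf nu (sym_law xi)))))" unfolding true_law_def pair_pmf_def map_pmf_def
 by (simp add: bind_assoc_pmf bind_return_pmf)

lemma pmf_true_law: "pmf (true_law q nu xi) ta = pmf q (deg ta) * fact (deg ta) * pmf nu (fst ta)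
  * (PROD c:#snd ta. child_wt nu xi c) / mfact (snd ta)"
proof -
 obtain x m where ta: "ta = (x, m)" by (cases ta)
 have "pmf (true_law q nu xi) ta = (\<integral>d. pmf nu x * (if size m = d then fact d / mfact m * (PROD c:#m. child_wt nu xi c) else 0) \<partial>q)"
  by (simp add: true_law_alt pmf_bind ta pmf_pair pmf_mset_replicate pmf_pair_child_fun cong: if_cong)
 also have "... = (SUM d:{size m}. pmf nu x * (if size m = d then fact d / mfact m * (PROD c:#m. child_wt nu xi c) else 0) * pmf q d)"
  by (rule integral_measure_pmf_real) (auto split: if_splits)
 finally show ?thesis by (simp add: ta star_deg_def)
qed

lemma pmf_Poi: "be >= 0 ==> pmf (Poi be) d = be ^ d / fact d * exp (- be)" by (cases "be = 0"; cases d) (auto simp: Poi_def pmf_poisson)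

lemma pmf_true_law_Poi: assumes "be >= 0" shows "pmf (true_law (Poi be) nu xi) ta
  = exp (- be) * pmf nu (fst ta) * (PROD c:#snd ta. be * child_wt nu xi c) / mfact (snd ta)"
proof -
 show ?thesis by (simp add: prod_mset.distrib star_deg_def pmf_true_law pmf_Poi[OF assms])
qed

text \<open>The law of the whole sequence of stars. Probabilities are estimated point by point on
  this space and pass to the empirical measures only at the end. The value \<open>undefined\<close>
  off the vertices agrees with the default chosen in the product laws.\<close>

definition star_seq_law :: "nat => nat set set pmf => 'x pmf => ('y * 'y) pmf => (nat => ('x, 'y) star) pmf" where "star_seq_law n graph nu xi =
  do {
   E \<leftarrow> graph;
   G \<leftarrow> marked_graph n E nu xi;
   return_pmf (%v. if v : {1..n} then star_class G v else undefined)
  }"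

lemma empirical_measure_cong: assumes "n >= 1" "!!v. v : {1..n} ==> f v = g v" shows "emp n f = emp n g" unfolding empirical_measure_def
 by (rule map_pmf_cong) (use assms in \<open>auto simp: set_pmf_of_set\<close>)

abbreviation "ER_law kp nu xi n == star_seq_law n (ER_graph kp n) nu xi"

lemma nbhd_law_eq_star_seq: assumes "n >= 1" shows "nbhd_law n graph nu xi = map_pmf (emp n) (star_seq_law n graph nu xi)"
 unfolding nbhd_law_def star_seq_law_def map_bind_pmf map_return_pmf
 by (intro bind_pmf_cong refl arg_cong[where f = return_pmf] empirical_measure_cong[OF assms]) auto

lemma vertex_pairs_eq: "vertex_pairs n = all_pairs {1..n}" by (simp add: vertex_pairs_def all_pairs_def)

text \<open>One draw decides both the presence of an edge and its mark pair; \<open>None\<close>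
  means absence.\<close>

definition edge_label_law :: "real => ('y * 'y) pmf => ('y * 'y) option pmf" where
 "edge_label_law p xi = do {b \<leftarrow> bernoulli_pmf p; if b then map_pmf Some (sym_law xi) else return_pmf None}"

definition label_stars :: "nat => (nat => 'x) => (nat set => ('y * 'y) option) => nat => ('x, 'y) star" where
 "label_stars n x l = (%v. if v : {1..n} then (x v, halves {1..n} x l v) else undefined)"

lemma star_class_label: assumes E: "E <= all_pairs V" and v: "v : V" shows "star_class \<lparr> verts = V, edges = E, vmark = x,
     emark = (%u v. if u < v then fst (y {u, v}) else snd (y {u, v})) \<rparr> v = (x v, halves V x (%e. if e : E then Some (y e) else None) v)"
proof -
 have "nbrs E v = lnbrs V (%e. if e : E then Some (y e) else None) v" using E v by (auto simp: nbrs_def lnbrs_def)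
 moreover have "image_mset (%u. (x u, if u < v then fst (y {u, v}) else snd (y {u, v}),
    if v < u then fst (y {v, u}) else snd (y {v, u}))) (mset_set (nbrs E v))
  = image_mset (half x (%e. if e : E then Some (y e) else None) v) (mset_set (nbrs E v))"
 proof (rule image_mset_cong)
  fix u assume "u :# mset_set (nbrs E v)"
  hence "u : nbrs E v" by (cases "finite (nbrs E v)") auto
  hence "{u, v} : E" "{v, u} : E" "u ~= v" by (auto simp: nbrs_def insert_commute)
  thus "(x u, if u < v then fst (y {u, v}) else snd (y {u, v}), if v < u then fst (y {v, u}) else snd (y {v, u}))
   = half x (%e. if e : E then Some (y e) else None) v u" by (simp add: half_def lmark_def)
 qed
 ultimately show ?thesis by (simp add: star_class_def halves_def)
qed

text \<open>Choosing the edges first and marking the chosen ones afterwards amounts to independent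
  labels; the two descriptions differ only in the default values off the chosen edges, which the
  proof aligns.\<close>

lemma edge_label_law_Pi: "Pi_pmf (all_pairs {1..n}) None (%_. edge_label_law p xi) = do {
    E \<leftarrow> map_pmf (%present. {e : all_pairs {1..n}. present e}) (Pi_pmf (all_pairs {1..n}) False (%_. bernoulli_pmf p));
    y \<leftarrow> Pi_pmf E undefined (%_. sym_law xi);
    return_pmf (%e. if e : E then Some (y e) else None)
   }"
proof -
 let ?A = "all_pairs {1..n}"
 have fin: "finite ?A" by simp
 have inner: "Pi_pmf ?A None (%e. if b e then map_pmf Some (sym_law xi) else return_pmf None)
   = bind_pmf (Pi_pmf {e : ?A. b e} undefined (%_. sym_law xi)) (%y. return_pmf (%e. if e : {e : ?A. b e} then Some (y e) else None))" for b
 proof -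
  let ?E = "{e : ?A. b e}"
  have finE: "finite ?E" by simp
  have "Pi_pmf ?A None (%e. if b e then map_pmf Some (sym_law xi) else return_pmf None) = Pi_pmf ?E None (%_. map_pmf Some (sym_law xi))"
   by (rule Pi_pmf_if_set[OF fin])
  also have "... = map_pmf (%f e. if e : ?E then f e else None) (Pi_pmf ?E (Some undefined) (%_. map_pmf Some (sym_law xi)))"
   by (rule Pi_pmf_default_swap[OF finE, symmetric])
  also have "Pi_pmf ?E (Some undefined) (%_. map_pmf Some (sym_law xi)) = map_pmf (%h. Some \<circ> h) (Pi_pmf ?E undefined (%_. sym_law xi))"
   by (rule Pi_pmf_map[OF finE]) simp
  finally show ?thesis by (simp add: map_pmf_comp comp_def map_pmf_def[symmetric])
 qed
 show ?thesis unfolding edge_label_law_def by (subst Pi_pmf_bind[OF fin, where d' = False]) (simp only: bind_map_pmf inner)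
qed

lemma star_seq_law_ER: "ER_law kp nu xi n = bind_pmf (Pi_pmf {1..n} undefined (%_. nu))
    (%x. map_pmf (label_stars n x) (Pi_pmf (all_pairs {1..n}) None (%_. edge_label_law (kp / real n) xi)))"
proof -
 let ?A = "all_pairs {1..n}"
 have sub: "E <= ?A" if "E : set_pmf (ER_graph kp n)" for E using that by (auto simp: ER_graph_def vertex_pairs_eq)
 have key: "(%v. if v : {1..n} then star_class \<lparr> verts = {1..n}, edges = E, vmark = x,
     emark = (%u v. if u < v then fst (y {u, v}) else snd (y {u, v})) \<rparr> v else undefined)
   = label_stars n x (%e. if e : E then Some (y e) else None)" if "E <= ?A" for E x y
  unfolding label_stars_def by (intro ext if_cong refl star_class_label[OF that])
 have "ER_law kp nu xi n
  = do { E \<leftarrow> ER_graph kp n; x \<leftarrow> Pi_pmf {1..n} undefined (%_. nu); y \<leftarrow> Pi_pmf E undefined (%_. sym_law xi);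
    return_pmf (label_stars n x (%e. if e : E then Some (y e) else None)) }"
  unfolding star_seq_law_def marked_graph_def bind_assoc_pmf bind_return_pmf by (intro bind_pmf_cong refl arg_cong[where f = return_pmf] key sub)
 also have "... = do { x \<leftarrow> Pi_pmf {1..n} undefined (%_. nu); E \<leftarrow> ER_graph kp n; y \<leftarrow> Pi_pmf E undefined (%_. sym_law xi);
    return_pmf (label_stars n x (%e. if e : E then Some (y e) else None)) }" by (rule bind_commute_pmf)
 also have "... = bind_pmf (Pi_pmf {1..n} undefined (%_. nu)) (%x. map_pmf (label_stars n x) (Pi_pmf ?A None (%_. edge_label_law (kp / real n) xi)))"
  unfolding edge_label_law_Pi map_bind_pmf map_return_pmf ER_graph_def vertex_pairs_eq ..
 finally show ?thesis .
qed

section \<open>The probability of a sequence of stars\<close>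

definition seq_cols :: "nat => (nat => ('x, 'y) star) => ('x * 'x * 'y * 'y) multiset" where "seq_cols n t = (SUM v:{1..n}. cols (t v))"

abbreviation "freq n t k == real (count (seq_cols n t) k) / real n"

lemma seq_cols_total: "seq_cols n t = total_cols {1..n} (%v. fst (t v)) (%v. snd (t v))" by (simp add: seq_cols_def total_cols_def cols_def)

lemma total_cols_cong_fst: "(!!v. v : V ==> x v = x' v) ==> (!!v. v : V ==> d v = d' v) ==> total_cols V x d = total_cols V x' d'"
 unfolding total_cols_def by (rule sum.cong) auto

lemma halves_cong: assumes "!!v. v : V ==> x v = x' v" shows "halves V x l v = halves V x' l v" unfolding halves_def
proof (rule image_mset_cong)
 fix u assume "u :# mset_set (lnbrs V l v)"
 hence "u : lnbrs V l v" by (cases "finite (lnbrs V l v)") auto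
 thus "half x l v u = half x' l v u" using assms by (simp add: lnbrs_def half_def)
qed

lemma pmf_star_seq_ER: assumes t: "!!v. v ~: {1..n} ==> t v = undefined" shows "pmf (ER_law kp nu xi n) t = (PROD v:{1..n}. pmf nu (fst (t v)))
  * prob (Pi_pmf (all_pairs {1..n}) None (%_. edge_label_law (kp / real n) xi)) (realizations {1..n} (%v. fst (t v)) (%v. snd (t v)))"
proof -
 let ?V = "{1..n}" and ?L = "Pi_pmf (all_pairs {1..n}) None (%_. edge_label_law (kp / real n) xi)"
 define x0 where "x0 = (%v. if v : ?V then fst (t v) else undefined)"
 let ?R = "realizations ?V (%v. fst (t v)) (%v. snd (t v))"
 have lab: "l : labellings ?V" if "l : set_pmf ?L" for l using that set_Pi_pmf_subset[of "all_pairs ?V" None] by (auto simp: labellings_def)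
 have "pmf (ER_law kp nu xi n) t = (\<integral>x. pmf (map_pmf (label_stars n x) ?L) t \<partial>(Pi_pmf ?V undefined (%_. nu)))"
  by (simp add: star_seq_law_ER pmf_bind)
 also have "... = (SUM x:{x0}. pmf (map_pmf (label_stars n x) ?L) t * pmf (Pi_pmf ?V undefined (%_. nu)) x)"
 proof (rule integral_measure_pmf_real)
  fix x assume x: "x : set_pmf (Pi_pmf ?V undefined (%_. nu))" "pmf (map_pmf (label_stars n x) ?L) t ~= 0"
  from x(2) obtain l where "t = label_stars n x l" by (auto simp: pmf_eq_0_set_pmf)
  moreover have "x v = undefined" if "v ~: ?V" for v using x(1) set_Pi_pmf_subset[of ?V undefined] that by auto
  ultimately show "x : {x0}" by (auto simp: x0_def label_stars_def fun_eq_iff)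
 qed simp
 also have "... = pmf (map_pmf (label_stars n x0) ?L) t * pmf (Pi_pmf ?V undefined (%_. nu)) x0" by simp
 also have "pmf (map_pmf (label_stars n x0) ?L) t = prob ?L ?R"
 proof -
  have "l : label_stars n x0 -` {t} <-> l : ?R" if "l : set_pmf ?L" for l
  proof -
   have "halves ?V x0 l v = halves ?V (%v. fst (t v)) l v" for v by (rule halves_cong) (simp add: x0_def)
   thus ?thesis using t lab[OF that] by (auto simp: label_stars_def fun_eq_iff x0_def realizations_def prod_eq_iff)
  qed
  thus ?thesis unfolding pmf_map by (intro measure_pmf.finite_measure_eq_AE) (auto simp: AE_measure_pmf_iff)
 qed
 also have "pmf (Pi_pmf ?V undefined (%_. nu)) x0 = (PROD v:?V. pmf nu (fst (t v)))" by (subst pmf_Pi) (auto simp: x0_def)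
 finally show ?thesis by simp
qed

lemma pmf_edge_label: assumes "0 <= p" "p <= 1" shows "pmf (edge_label_law p xi) None = 1 - p"
  and "pmf (edge_label_law p xi) (Some z) = p * pmf (sym_law xi) z"
proof -
 have 1: "pmf (map_pmf Some (sym_law xi)) None = 0" by (simp add: pmf_eq_0_set_pmf)
 have 2: "pmf (map_pmf Some (sym_law xi)) (Some z) = pmf (sym_law xi) z" by simp
 show "pmf (edge_label_law p xi) None = 1 - p" unfolding edge_label_law_def pmf_bind by (subst integral_bernoulli_pmf) (use assms 1 in auto)
 show "pmf (edge_label_law p xi) (Some z) = p * pmf (sym_law xi) z" unfolding edge_label_law_def pmf_bind
  by (subst integral_bernoulli_pmf) (use assms 2 in auto)
qed

text \<open>Every edge enters \<open>total_cols\<close> with two colours of the same weight, whence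
  the square root.\<close>

lemma prod_edge_label: assumes V: "finite V" and l: "l : labellings V" and p: "0 <= p" "p < 1"
 shows "(PROD e:all_pairs V. pmf (edge_label_law p xi) (l e)) = (1 - p) ^ card (all_pairs V)
  * sqrt (PROD k:#total_cols V x (halves V x l). p / (1 - p) * pmf (sym_law xi) (snd (snd k)))" using V l
proof (induction rule: labelling_induct)
 case empty
 thus ?case using p by (simp add: total_cols_empty pmf_edge_label)
next
 case (insert l v w y y')
 let ?l = "l({v, w} := Some (pair_label v w y y'))" and ?e = "{v, w}"
 let ?f = "%l e. pmf (edge_label_law p xi) (l e)"
 let ?r = "p / (1 - p) * pmf (sym_law xi) (y, y')"
 have e: "?e : all_pairs V" using insert by simp
 have "(PROD e:all_pairs V. ?f ?l e) = ?f ?l ?e * (PROD e:all_pairs V - {?e}. ?f ?l e)" using V e by (intro prod.remove) auto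
 also have "?f ?l ?e = p * pmf (sym_law xi) (y, y')" using p by (simp add: pair_label_def sym_law_swap pmf_edge_label)
 also have "(PROD e:all_pairs V - {?e}. ?f ?l e) = (PROD e:all_pairs V - {?e}. ?f l e)" by simp
 also have "p * pmf (sym_law xi) (y, y') * ... = ?r * (?f l ?e * (PROD e:all_pairs V - {?e}. ?f l e))" using p insert by (simp add: pmf_edge_label)
 also have "?f l ?e * (PROD e:all_pairs V - {?e}. ?f l e) = (PROD e:all_pairs V. ?f l e)" using V e by (intro prod.remove[symmetric]) auto
 finally have 1: "(PROD e:all_pairs V. ?f ?l e) = ?r * (PROD e:all_pairs V. ?f l e)" .
 define r where "r = ?r"
 have 2: "(PROD k:#total_cols V x (halves V x ?l). p / (1 - p) * pmf (sym_law xi) (snd (snd k)))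
  = (?r * ?r) * (PROD k:#total_cols V x (halves V x l). p / (1 - p) * pmf (sym_law xi) (snd (snd k)))" using sym_law_swap[of xi y' y]
  by (simp add: total_cols_halves_upd[of V v w l, OF V insert(2-5)] del: fun_upd_apply)
 show ?case unfolding 1 2 insert.IH r_def[symmetric] real_sqrt_mult[of "r * r"] using p by (simp, simp add: r_def)
qed

text \<open>What remains of the probability of a star sequence when the i.i.d. Poisson star
  probabilities and the normalized number of realizations are split off. The exponential undoes the
  Poisson normalizations, the power treats every pair as missing, and the root compares the
  matchings of the colours with their weights. The term \<open>kp * (n - kp)\<close> comes from the
  odds p / (1 - p) = kp^2 / (kp (n - kp)) for p = kp / n.\<close>

definition col_factor :: "real => 'x pmf => ('y * 'y) pmf => nat => ('x * 'x * 'y * 'y) multiset => real" where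
 "col_factor kp nu xi n T = exp (kp * real n) * (1 - kp / real n) ^ card (all_pairs {1..n})
  * sqrt (mfact T / (PROD k:#T. kp * (real n - kp) * edge_wt nu xi k))"

lemma prod_mset_total_cols:
 fixes f :: "_ => real" shows "(PROD k:#total_cols V x d. f k) = (PROD v:V. PROD c:#d v. f (x v, c))"
 by (induction V rule: infinite_finite_induct) (auto simp: total_cols_def image_mset.compositionality comp_def)

lemma prod_mset_pos:
 fixes f :: "'a => real" shows "(!!k. k :# T ==> f k > 0) ==> (PROD k:#T. f k) > 0" by (induction T) auto

lemma prod_mset_nz:
 fixes f :: "'a => real" shows "(PROD k:#T. f k) ~= 0 ==> k :# T ==> f k ~= 0" by (auto simp: prod_mset_zero_iff)

lemma prod_mset_nonneg':
 fixes f :: "'a => real" shows "(!!k. k :# T ==> f k >= 0) ==> (PROD k:#T. f k) >= 0" by (induction T) auto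

text \<open>All realizations are equally likely, because the probability of a labelling depends on
  its colours only.\<close>

lemma prob_realizations:
 fixes xi :: "('y::finite * 'y) pmf" assumes V: "finite V" and p: "0 <= p" "p < 1"
 shows "prob (Pi_pmf (all_pairs V) None (%_. edge_label_law p xi)) (realizations V x d)
  = real (card (realizations V x d)) * ((1 - p) ^ card (all_pairs V) * sqrt (PROD k:#total_cols V x d. p / (1 - p) * pmf (sym_law xi) (snd (snd k))))"
proof -
 have "pmf (Pi_pmf (all_pairs V) None (%_. edge_label_law p xi)) l = (1 - p) ^ card (all_pairs V)
  * sqrt (PROD k:#total_cols V x d. p / (1 - p) * pmf (sym_law xi) (snd (snd k)))" if l: "l : realizations V x d" for l
 proof -
  have l': "l : labellings V" using l by (simp add: realizations_def)
  hence "pmf (Pi_pmf (all_pairs V) None (%_. edge_label_law p xi)) l = (PROD e:all_pairs V. pmf (edge_label_law p xi) (l e))"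
   using V by (subst pmf_Pi) (auto simp: labellings_def)
  thus ?thesis by (simp only: prod_edge_label[OF V l' p, of xi x] realizations_total[OF V l])
 qed
 thus ?thesis using V by (simp add: prob_finite_sum)
qed

text \<open>The last factor is the normalized number of realizations divided by the number
  \<open>sqrt (mfact T)\<close> of matchings, the ratio controlled by
  \<open>card_realizations_upper\<close> and \<open>card_realizations_lower\<close>; all else is
  exact.\<close>

lemma star_seq_identity:
 fixes xi :: "('y::finite * 'y) pmf" and t :: "nat => ('x, 'y) star" assumes t: "!!v. v ~: {1..n} ==> t v = undefined" and kp: "0 < kp" "kp < real n"
  and bal: "rev_cols (seq_cols n t) = seq_cols n t" and pos: "!!v. v : {1..n} ==> pmf nu (fst (t v)) > 0"
   "!!k. k :# seq_cols n t ==> pmf (sym_law xi) (snd (snd k)) > 0"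
 defines "R \<equiv> realizations {1..n} (%v. fst (t v)) (%v. snd (t v))" shows "pmf (ER_law kp nu xi n) t =
  (PROD v:{1..n}. pmf (poi_law kp nu xi) (t v)) * col_factor kp nu xi n (seq_cols n t)
   * (real (card R) * (PROD v:{1..n}. mfact (snd (t v))) / sqrt (mfact (seq_cols n t)))"
  and "(PROD v:{1..n}. pmf (poi_law kp nu xi) (t v)) * col_factor kp nu xi n (seq_cols n t) > 0"
proof -
 let ?V = "{1..n}"
 define T where "T = seq_cols n t"
 define p where "p = kp / real n"
 have p: "0 < p" "p < 1" using kp by (auto simp: p_def field_simps)
 define N where "N = card (all_pairs ?V)"
 define s where "s = (%k :: 'x * 'x * 'y * 'y. pmf (sym_law xi) (snd (snd k)))"
 have fstT: "pmf nu (fst k) > 0" if k: "k :# T" for k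
 proof -
  obtain v where "v : ?V" "k :# cols (t v)" using k unfolding T_def seq_cols_def by (metis (no_types, lifting) finite_atLeastAtMost set_mset_sum UN_E)
  thus ?thesis using pos(1)[of v] by (auto simp: cols_def)
 qed
 have revT: "rev_col k :# T" if "k :# T" for k using that bal unfolding T_def by (metis imageI set_image_mset)
 have sndT: "pmf nu (fst (snd k)) > 0" if k: "k :# T" for k using fstT[OF revT[OF k]] by (cases k) auto
 have sT: "s k > 0" if "k :# T" for k using pos(2) that by (simp add: s_def T_def)
 define P1 where "P1 = (PROD k:#T. pmf nu (fst k))"
 define S where "S = (PROD k:#T. s k)"
 have P1: "P1 > 0" unfolding P1_def by (rule prod_mset_pos) (rule fstT)
 have S: "S > 0" unfolding S_def by (rule prod_mset_pos) (rule sT)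
 \<comment> \<open>By symmetry of the colours, the child marks of all half-edges have the same
   product of weights as the root marks.\<close>
 have "(PROD k:#T. pmf nu (fst (snd k))) = (PROD k:#rev_cols T. pmf nu (fst k))" by (simp add: image_mset.compositionality comp_def, intro arg_cong[where f = prod_mset] image_mset_cong, auto)
 also have "... = P1" using bal by (simp add: P1_def T_def)
 finally have P2: "(PROD k:#T. pmf nu (fst (snd k))) = P1" .
 define z where "z = size T"
 have CW: "(PROD k:#T. kp * child_wt nu xi (snd k)) = kp ^ z * (P1 * S)"
  unfolding child_wt_def by (simp add: prod_mset.distrib z_def P2 S_def s_def mult.assoc)
 have EW: "(PROD k:#T. kp * (real n - kp) * edge_wt nu xi k) = (kp * (real n - kp)) ^ z * (P1 * (P1 * S))"
  unfolding child_wt_def edge_wt_def by (simp add: prod_mset.distrib z_def P2 S_def s_def P1_def[symmetric] mult.assoc power_mult_distrib)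
 have RW: "(PROD k:#T. p / (1 - p) * pmf (sym_law xi) (snd (snd k))) = (p / (1 - p)) ^ z * S"
 proof -
  have "(PROD k:#T. p / (1 - p) * pmf (sym_law xi) (snd (snd k))) = (PROD k:#T. p / (1 - p)) * S" unfolding S_def s_def by (rule prod_mset.distrib)
  thus ?thesis by (simp add: z_def)
 qed
 have EW0: "(kp * (real n - kp)) ^ z * (P1 * (P1 * S)) > 0" using kp P1 S by simp
 define NU where "NU = (PROD v:?V. pmf nu (fst (t v)))"
 have NU: "NU > 0" unfolding NU_def using pos(1) by (intro prod_pos) auto
 define MF where "MF = (PROD v:?V. mfact (snd (t v)))"
 have MF: "MF > 0" unfolding MF_def by (intro prod_pos) auto
 have ETA: "(PROD v:?V. pmf (poi_law kp nu xi) (t v)) = exp (- kp * real n) * NU * (kp ^ z * (P1 * S)) / MF"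
 proof -
  have "(PROD v:?V. PROD c:#snd (t v). kp * child_wt nu xi c) = (PROD k:#T. kp * child_wt nu xi (snd k))"
   unfolding T_def seq_cols_total prod_mset_total_cols by simp
  moreover have "(PROD v:?V. exp (- kp)) = exp (- kp * real n)" by (simp add: exp_of_nat_mult[symmetric])
  ultimately show ?thesis using kp by (simp add: pmf_true_law_Poi prod_dividef prod.distrib CW NU_def MF_def del: prod_constant)
 qed
 have pq: "p / (1 - p) * (kp * (real n - kp)) = kp\<^sup>2" using kp by (simp add: p_def field_simps power2_eq_square)
 have LHS: "pmf (ER_law kp nu xi n) t = NU * (real (card R) * ((1 - p) ^ N * sqrt ((p / (1 - p)) ^ z * S)))"
 proof -
  have "pmf (ER_law kp nu xi n) t = (PROD v:{1..n}. pmf nu (fst (t v)))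
  * prob (Pi_pmf (all_pairs {1..n}) None (%_. edge_label_law (kp / real n) xi)) R" unfolding R_def by (rule pmf_star_seq_ER) (rule t)
  thus ?thesis by (simp only: p_def[symmetric] R_def NU_def N_def seq_cols_total[symmetric]
    prob_realizations[OF finite_atLeastAtMost order_less_imp_le[OF p(1)] p(2)] RW T_def[symmetric])
 qed
 have sq: "sqrt ((p / (1 - p)) ^ z * S) = kp ^ z * (P1 * S) / sqrt ((kp * (real n - kp)) ^ z * (P1 * (P1 * S)))"
 proof -
  have "sqrt ((p / (1 - p)) ^ z * S) * sqrt ((kp * (real n - kp)) ^ z * (P1 * (P1 * S)))
    = sqrt ((p / (1 - p) * (kp * (real n - kp))) ^ z * ((P1 * S) * (P1 * S)))" unfolding real_sqrt_mult[symmetric] power_mult_distrib by simp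
  also have "... = sqrt ((kp ^ z * (P1 * S))\<^sup>2)" unfolding pq by (simp add: power2_eq_square power_mult_distrib ac_simps)
  also have "... = kp ^ z * (P1 * S)" using kp P1 S by simp
  finally show ?thesis using EW0 by (subst nonzero_eq_divide_eq) (simp_all only: real_sqrt_eq_0_iff less_imp_neq[symmetric] not_False_eq_True)
 qed
 have CF: "col_factor kp nu xi n T = exp (kp * real n) * (1 - p) ^ N * (sqrt (mfact T) / sqrt ((kp * (real n - kp)) ^ z * (P1 * (P1 * S))))"
  by (simp add: col_factor_def EW p_def N_def real_sqrt_divide)
 have e: "exp (- kp * real n) * exp (kp * real n) = 1" by (simp add: exp_add[symmetric])
 show "pmf (ER_law kp nu xi n) t = (PROD v:?V. pmf (poi_law kp nu xi) (t v)) * col_factor kp nu xi n (seq_cols n t)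
   * (real (card R) * (PROD v:?V. mfact (snd (t v))) / sqrt (mfact (seq_cols n t)))"
 proof -
  define E1 where "E1 = exp (- kp * real n)"
  define E2 where "E2 = exp (kp * real n)"
  define sM where "sM = sqrt (mfact T)"
  define sE where "sE = sqrt ((kp * (real n - kp)) ^ z * (P1 * (P1 * S)))"
  define W where "W = kp ^ z * (P1 * S)"
  have nz: "MF ~= 0" "sM ~= 0" "sE ~= 0" using MF less_imp_neq[OF EW0] by (simp_all only: sM_def sE_def real_sqrt_eq_0_iff mfact_nonzero less_imp_neq[symmetric] not_False_eq_True)
  have e': "E1 * E2 = 1" using e by (simp add: E1_def E2_def)
  have gen: "nu * (r * (q * (w / se))) = (e1 * nu * w / mf) * (e2 * q * (sm / se)) * (r * mf / sm)"
   if "e1 * e2 = 1" "mf ~= 0" "sm ~= 0" "se ~= 0" for nu r q w se e1 e2 mf sm :: real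
  proof -
   have "(e1 * nu * w / mf) * (e2 * q * (sm / se)) * (r * mf / sm) = (e1 * e2) * (nu * (r * (q * (w / se))))" using that by simp
   thus ?thesis using that by simp
  qed
  show ?thesis unfolding LHS sq ETA T_def[symmetric] CF MF_def[symmetric]
    E1_def[symmetric] E2_def[symmetric] sM_def[symmetric] sE_def[symmetric] W_def[symmetric] by (rule gen[OF e' nz])
 qed
 show "(PROD v:?V. pmf (poi_law kp nu xi) (t v)) * col_factor kp nu xi n (seq_cols n t) > 0" unfolding ETA T_def[symmetric] CF using NU MF P1 S kp p EW0 mfact_pos[of T] by simp
qed

text \<open>A point of the support has a realization, hence symmetric colours and positive weights;
  the bound is the identity with last factor at most 1.\<close>

lemma star_seq_upper:
 fixes xi :: "('y::finite * 'y) pmf" and t :: "nat => ('x, 'y) star" assumes kp: "0 < kp" "kp < real n" and supp: "t : set_pmf (ER_law kp nu xi n)"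
 shows "pmf (ER_law kp nu xi n) t <= (PROD v:{1..n}. pmf (poi_law kp nu xi) (t v)) * col_factor kp nu xi n (seq_cols n t)"
  and "rev_cols (seq_cols n t) = seq_cols n t" and "!!v. v : {1..n} ==> pmf (poi_law kp nu xi) (t v) > 0"
  and "!!k. k :# seq_cols n t ==> edge_wt nu xi k > 0" and "!!v. v ~: {1..n} ==> t v = undefined"
proof -
 show t: "!!v. v ~: {1..n} ==> t v = undefined" using supp by (auto simp: star_seq_law_def)
 let ?P = "pmf (ER_law kp nu xi n) t"
 let ?R = "realizations {1..n} (%v. fst (t v)) (%v. snd (t v))"
 have P: "?P > 0" using supp by (simp add: pmf_positive)
 have p: "0 <= kp / real n" "kp / real n < 1" using kp by auto
 have Peq: "?P = (PROD v:{1..n}. pmf nu (fst (t v))) * (real (card ?R) * ((1 - kp / real n) ^ card (all_pairs {1..n})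
  * sqrt (PROD k:#seq_cols n t. (kp / real n) / (1 - kp / real n) * pmf (sym_law xi) (snd (snd k)))))"
 proof -
  have "?P = (PROD v:{1..n}. pmf nu (fst (t v))) * prob (Pi_pmf (all_pairs {1..n}) None (%_. edge_label_law (kp / real n) xi)) ?R"
   by (rule pmf_star_seq_ER) (rule t)
  thus ?thesis by (simp only: prob_realizations[OF finite_atLeastAtMost p] seq_cols_total)
 qed
 from P have R: "?R ~= {}" unfolding Peq by auto
 show bal: "rev_cols (seq_cols n t) = seq_cols n t" unfolding seq_cols_total by (rule realizations_balanced[OF _ R]) simp
 have "(PROD v:{1..n}. pmf nu (fst (t v))) ~= 0" using P unfolding Peq by (intro notI) (simp only: mult_zero_left less_irrefl)
 hence pos1: "pmf nu (fst (t v)) > 0" if "v : {1..n}" for v using that by simp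
 have "(PROD k:#seq_cols n t. (kp / real n) / (1 - kp / real n) * pmf (sym_law xi) (snd (snd k))) ~= 0"
  using P unfolding Peq by (intro notI) (simp only: mult_zero_right real_sqrt_zero less_irrefl)
 hence pos2: "pmf (sym_law xi) (snd (snd k)) > 0" if "k :# seq_cols n t" for k
  using prod_mset_nz[OF _ that] unfolding less_le by (metis mult_zero_right pmf_nonneg)
 have id: "pmf (ER_law kp nu xi n) t = (PROD v:{1..n}. pmf (poi_law kp nu xi) (t v)) * col_factor kp nu xi n (seq_cols n t)
   * (real (card ?R) * (PROD v:{1..n}. mfact (snd (t v))) / sqrt (mfact (seq_cols n t)))"
  "(PROD v:{1..n}. pmf (poi_law kp nu xi) (t v)) * col_factor kp nu xi n (seq_cols n t) > 0"
  by (rule star_seq_identity[OF _ kp bal], fact t, fact pos1, fact pos2)+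
 have le1: "real (card ?R) * (PROD v:{1..n}. mfact (snd (t v))) / sqrt (mfact (seq_cols n t)) <= 1" using card_realizations_upper[of "{1..n}" "%v. fst (t v)" "%v. snd (t v)"] mfact_pos[of "seq_cols n t"] by (simp add: seq_cols_total)
 show "?P <= (PROD v:{1..n}. pmf (poi_law kp nu xi) (t v)) * col_factor kp nu xi n (seq_cols n t)"
  unfolding id(1) using mult_left_mono[OF le1 order_less_imp_le[OF id(2)]] by simp
 show "pmf (poi_law kp nu xi) (t v) > 0" if "v : {1..n}" for v using id(2) that by (auto simp: less_le)
 have "(PROD k:#seq_cols n t. kp * (real n - kp) * edge_wt nu xi k) ~= 0" using id(2) by (intro notI) (simp add: col_factor_def)
 thus "edge_wt nu xi k > 0" if "k :# seq_cols n t" for k using prod_mset_nz[OF _ that] unfolding less_le by (metis mult_zero_right edge_wt_nonneg)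
qed

lemma star_seq_lower:
 fixes xi :: "('y::finite * 'y) pmf" and t :: "nat => ('x, 'y) star" assumes kp: "0 < kp" "kp < real n" and t: "!!v. v ~: {1..n} ==> t v = undefined"
  and bal: "rev_cols (seq_cols n t) = seq_cols n t" and good: "!!v. v : {1..n} ==> good_star cl (t v)"
  and pos: "!!v. v : {1..n} ==> pmf (poi_law kp nu xi) (t v) > 0"
 shows "(PROD v:{1..n}. pmf (poi_law kp nu xi) (t v)) * col_factor kp nu xi n (seq_cols n t) <= pmf (ER_law kp nu xi n) t"
  and "(PROD v:{1..n}. pmf (poi_law kp nu xi) (t v)) * col_factor kp nu xi n (seq_cols n t) > 0" and "!!k. k :# seq_cols n t ==> edge_wt nu xi k > 0"
proof -
 have pos1: "pmf nu (fst (t v)) > 0" "!!c. c :# snd (t v) ==> child_wt nu xi c > 0" if v: "v : {1..n}" for v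
 proof -
  have *: "exp (- kp) * pmf nu (fst (t v)) * (PROD c:#snd (t v). kp * child_wt nu xi c) / mfact (snd (t v)) > 0"
   using pos[OF v] kp by (simp add: pmf_true_law_Poi)
  thus "pmf nu (fst (t v)) > 0" by (auto simp: less_le)
  from * have "(PROD c:#snd (t v). kp * child_wt nu xi c) ~= 0" by (intro notI) simp
  thus "child_wt nu xi c > 0" if "c :# snd (t v)" for c using prod_mset_nz[OF _ that] unfolding less_le by (metis mult_zero_right child_wt_nonneg)
 qed
 have mem: "EX v:{1..n}. k :# cols (t v)" if "k :# seq_cols n t" for k
  using that unfolding seq_cols_def by (metis (no_types, lifting) finite_atLeastAtMost set_mset_sum UN_E)
 show ew: "edge_wt nu xi k > 0" if "k :# seq_cols n t" for k using mem[OF that] pos1 by (auto simp: cols_def edge_wt_def)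
 have pos2: "pmf (sym_law xi) (snd (snd k)) > 0" if "k :# seq_cols n t" for k
  using ew[OF that] by (auto simp: edge_wt_def child_wt_def zero_less_mult_iff)
 let ?R = "realizations {1..n} (%v. fst (t v)) (%v. snd (t v))"
 have id: "pmf (ER_law kp nu xi n) t = (PROD v:{1..n}. pmf (poi_law kp nu xi) (t v)) * col_factor kp nu xi n (seq_cols n t)
   * (real (card ?R) * (PROD v:{1..n}. mfact (snd (t v))) / sqrt (mfact (seq_cols n t)))"
  "(PROD v:{1..n}. pmf (poi_law kp nu xi) (t v)) * col_factor kp nu xi n (seq_cols n t) > 0"
  by (rule star_seq_identity[OF _ kp bal], fact t, fact pos1(1), fact pos2)+
 have "sqrt (mfact (seq_cols n t)) <= real (card (realizations {1..n} (%v. fst (t v)) (%v. snd (t v)))) * (PROD v:{1..n}. mfact (snd (t v)))"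
  unfolding seq_cols_total by (rule card_realizations_lower[where cl = cl]) (use good bal seq_cols_total[of n t] in auto)
 hence le1: "1 <= real (card (realizations {1..n} (%v. fst (t v)) (%v. snd (t v)))) * (PROD v:{1..n}. mfact (snd (t v))) / sqrt (mfact (seq_cols n t))" by simp
 show "(PROD v:{1..n}. pmf (poi_law kp nu xi) (t v)) * col_factor kp nu xi n (seq_cols n t) <= pmf (ER_law kp nu xi n) t"
  unfolding id(1) using mult_left_mono[OF le1 order_less_imp_le[OF id(2)]] by simp
 show "(PROD v:{1..n}. pmf (poi_law kp nu xi) (t v)) * col_factor kp nu xi n (seq_cols n t) > 0" by (rule id(2))
qed

section \<open>Asymptotics of factorials\<close>

lemma ln_fact_upper: "ln (fact k) <= (real k + 1) * ln (real k + 1) - real k"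
proof (induction k)
 case (Suc k)
 have "ln (fact (Suc k) :: real) = ln (real k + 1) + ln (fact k)" by (simp add: ln_mult)
 also have "... <= (real k + 2) * ln (real k + 1) - real k" using Suc by (simp add: algebra_simps)
 also have "... <= (real k + 2) * ln (real k + 2) - (real k + 1)"
 proof -
  have "ln ((real k + 1) / (real k + 2)) <= (real k + 1) / (real k + 2) - 1" by (rule ln_le_minus_one) simp
  hence "(real k + 2) * (ln (real k + 1) - ln (real k + 2)) <= (real k + 2) * ((real k + 1) / (real k + 2) - 1)"
   by (intro mult_left_mono) (auto simp: ln_div)
  thus ?thesis by (simp add: field_simps)
 qed
 finally show ?case by (simp add: algebra_simps)
qed simp

lemma ln_fact_lower: "real k * ln (real k) - real k <= ln (fact k)"
proof (induction k)
 case (Suc k)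
 show ?case
 proof (cases "k = 0")
  case False
  have "real k * (ln (real k + 1) - ln (real k)) <= 1"
  proof -
   have "ln ((real k + 1) / real k) <= (real k + 1) / real k - 1" using False by (intro ln_le_minus_one) auto
   hence "real k * ln ((real k + 1) / real k) <= 1" using False by (simp add: field_simps)
   thus ?thesis using False by (simp add: ln_div)
  qed
  moreover have "ln (fact (Suc k) :: real) = ln (real k + 1) + ln (fact k)" by (simp add: ln_mult)
  ultimately show ?thesis using Suc by (simp add: algebra_simps)
 qed simp
qed simp

lemma xlnx_abs_le: assumes "0 <= u" "u <= 1" shows "\<bar>u * ln u\<bar> <= 2 * sqrt u"
proof (cases "u = 0")
 case False
 with assms have u: "u > 0" by simp
 have "ln (1 / sqrt u) <= 1 / sqrt u - 1" using u by (intro ln_le_minus_one) auto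
 hence "u * (- ln u) <= u * (2 / sqrt u)" using u by (intro mult_left_mono, auto, simp add: ln_div ln_sqrt)
 also have "... = 2 * sqrt u" using u by (simp add: field_simps)
 finally show ?thesis using assms u ln_le_zero_iff[of u] by (simp add: abs_mult)
qed simp

lemma tendsto_xlnx:
 fixes f :: "'b => real" assumes f: "(f \<longlongrightarrow> t) F" and nn: "\<forall>\<^sub>F j in F. f j >= 0"
 shows "((%j. f j * ln (f j)) \<longlongrightarrow> t * ln t) F"
proof (cases "t = 0")
 case False
 thus ?thesis by (intro tendsto_intros f) auto
next
 case True
 have "\<forall>\<^sub>F j in F. f j < 1" using f True by (intro order_tendstoD(2)[OF f]) auto
 hence "\<forall>\<^sub>F j in F. norm (f j * ln (f j)) <= 2 * sqrt (f j)" using nn by eventually_elim (use xlnx_abs_le in auto)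
 moreover have "((%j. 2 * sqrt (f j)) \<longlongrightarrow> 2 * sqrt 0) F" using f True by (intro tendsto_intros) auto
 ultimately show ?thesis using True by (simp add: Lim_null_comparison)
qed

lemma filterlim_real_divide: assumes "filterlim N at_top F" shows "((%j. c / real (N j)) \<longlongrightarrow> 0) F"
 by (intro real_tendsto_divide_at_top[OF tendsto_const] filterlim_compose[OF filterlim_real_sequentially assms])

text \<open>Stirling's formula to first order, including colours that die out, for which t ln t is
  0. Filter and sizes \<open>N\<close> are arbitrary because \<open>col_factor_uniform_upper\<close>
  takes the limit along sizes produced by a contradiction.\<close>

lemma tendsto_ln_fact:
 fixes N a :: "'b => nat" assumes N: "filterlim N at_top F" and a: "((%j. real (a j) / real (N j)) \<longlongrightarrow> t) F"
 shows "((%j. (ln (fact (a j)) - real (a j) * ln (real (N j))) / real (N j)) \<longlongrightarrow> t * ln t - t) F"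
proof -
 have Npos: "\<forall>\<^sub>F j in F. N j > 0" by (rule eventually_compose_filterlim[OF eventually_gt_at_top N])
 let ?u = "%j. real (a j) / real (N j)" and ?v = "%j. (real (a j) + 1) / real (N j)"
 have v: "(?v \<longlongrightarrow> t) F" using tendsto_add[OF a filterlim_real_divide[OF N, of 1]] by (simp add: add_divide_distrib)
 have lnN: "((%j. ln (real (N j)) / real (N j)) \<longlongrightarrow> 0) F" using filterlim_compose[OF lim_ln_over_n N] .
 have low: "((%j. ?u j * ln (?u j) - ?u j) \<longlongrightarrow> t * ln t - t) F" by (intro tendsto_diff tendsto_xlnx a) auto
 have "((%j. ?v j * ln (?v j) - ?u j + ln (real (N j)) / real (N j)) \<longlongrightarrow> t * ln t - t + 0) F"
  by (intro tendsto_add tendsto_diff tendsto_xlnx a v lnN) auto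
 hence up: "((%j. ?v j * ln (?v j) - ?u j + ln (real (N j)) / real (N j)) \<longlongrightarrow> t * ln t - t) F" by simp
 show ?thesis
 proof (rule tendsto_sandwich[OF _ _ low up])
  show "\<forall>\<^sub>F j in F. ?u j * ln (?u j) - ?u j <= (ln (fact (a j)) - real (a j) * ln (real (N j))) / real (N j)" using Npos
  proof eventually_elim
   case (elim j)
   have "?u j * ln (?u j) - ?u j = (real (a j) * ln (real (a j)) - real (a j) - real (a j) * ln (real (N j))) / real (N j)"
    using elim by (cases "a j = 0") (auto simp: ln_div field_simps)
   also have "... <= (ln (fact (a j)) - real (a j) * ln (real (N j))) / real (N j)"
    using ln_fact_lower[of "a j"] elim by (intro divide_right_mono) auto
   finally show ?case .
  qed
  show "\<forall>\<^sub>F j in F. (ln (fact (a j)) - real (a j) * ln (real (N j))) / real (N j)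
    <= ?v j * ln (?v j) - ?u j + ln (real (N j)) / real (N j)" using Npos
  proof eventually_elim
   case (elim j)
   have "(ln (fact (a j)) - real (a j) * ln (real (N j))) / real (N j)
     <= ((real (a j) + 1) * ln (real (a j) + 1) - real (a j) - real (a j) * ln (real (N j))) / real (N j)"
    using ln_fact_upper[of "a j"] elim by (intro divide_right_mono) auto
   also have "... = ?v j * ln (?v j) - ?u j + ln (real (N j)) / real (N j)" using elim by (simp add: ln_div field_simps)
   finally show ?case .
  qed
 qed
qed

lemma card_all_pairs: "real (card (all_pairs {1..n})) = real n * (real n - 1) / 2"
proof -
 have "card (all_pairs {1..n}) = n choose 2" unfolding all_pairs_def using n_subsets[of "{1..n}" 2] by simp
 moreover have "real (n choose 2) = real n * (real n - 1) / 2"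
 proof -
  have "2 * (n choose 2) = n * (n - 1)" by (simp add: choose_two, cases n, auto)
  hence "2 * real (n choose 2) = real (n * (n - 1))" by (metis of_nat_mult of_nat_numeral)
  thus ?thesis by (cases n, auto simp: algebra_simps)
 qed
 ultimately show ?thesis by simp
qed

lemma tendsto_nonedge_factor: assumes N: "filterlim N at_top F" and kp: "kp > 0"
 shows "((%j. real (card (all_pairs {1..N j})) * ln (1 - kp / real (N j)) / real (N j)) \<longlongrightarrow> - kp / 2) F"
proof -
 have ev: "\<forall>\<^sub>F j in F. real (N j) > 2 * kp"
  by (rule eventually_compose_filterlim[OF eventually_gt_at_top filterlim_compose[OF filterlim_real_sequentially N]])
 have q: "((%j. kp / real (N j)) \<longlongrightarrow> 0) F" by (rule filterlim_real_divide[OF N])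
 have low: "((%j. - (kp / (1 - kp / real (N j)))) \<longlongrightarrow> - (kp / (1 - 0))) F" by (intro tendsto_intros q) auto
 have 1: "((%j. real (N j) * ln (1 - kp / real (N j))) \<longlongrightarrow> - kp) F"
 proof (rule tendsto_sandwich[of "%j. - (kp / (1 - kp / real (N j)))" _ _ "%_. - kp"])
  show "\<forall>\<^sub>F j in F. - (kp / (1 - kp / real (N j))) <= real (N j) * ln (1 - kp / real (N j))" using ev
  proof eventually_elim
   case (elim j)
   define w where "w = 1 - kp / real (N j)"
   have n: "real (N j) > 0" using elim kp by linarith
   have w: "w > 0" using elim kp n by (simp add: w_def)
   have "ln (1 / w) <= 1 / w - 1" using w by (intro ln_le_minus_one) auto
   hence "- ln w <= 1 / w - 1" using w by (simp add: ln_div)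
   also have "1 / w - 1 = (1 - w) / w" using w by (simp add: diff_divide_distrib)
   finally have "real (N j) * (- ln w) <= real (N j) * ((kp / real (N j)) / w)" using n by (intro mult_left_mono, auto, simp add: w_def)
   thus ?case using n by (simp add: w_def)
  qed
  show "\<forall>\<^sub>F j in F. real (N j) * ln (1 - kp / real (N j)) <= - kp" using ev
  proof eventually_elim
   case (elim j)
   have n: "real (N j) > 0" using elim kp by linarith
   have "ln (1 - kp / real (N j)) <= (1 - kp / real (N j)) - 1" using elim kp n by (intro ln_le_minus_one) (simp add: field_simps)
   hence "real (N j) * ln (1 - kp / real (N j)) <= real (N j) * (- (kp / real (N j)))" using n by (intro mult_left_mono) auto
   thus ?case using n by simp
  qed
 qed (use low in simp_all)
 have A: "((%j. real (N j) * ln (1 - kp / real (N j)) * ((1 - 1 / real (N j)) / 2)) \<longlongrightarrow> - kp * ((1 - 0) / 2)) F"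
  by (intro tendsto_intros 1 filterlim_real_divide[OF N]) auto
 have B: "\<forall>\<^sub>F j in F. real (N j) * ln (1 - kp / real (N j)) * ((1 - 1 / real (N j)) / 2)
   = real (card (all_pairs {1..N j})) * ln (1 - kp / real (N j)) / real (N j)" using ev
 proof eventually_elim
  case (elim j)
  have n: "real (N j) > 0" using elim kp by linarith
  thus ?case unfolding card_all_pairs by (simp add: field_simps)
 qed
 from Lim_transform_eventually[OF A B] show ?thesis by simp
qed

section \<open>The exponential rate of the colour factor\<close>

definition pcols :: "'x pmf => ('y * 'y) pmf => ('x * 'x * 'y * 'y) set" where "pcols nu xi = {k. edge_wt nu xi k > 0}"

text \<open>The divergence of finite measures, the sum of p ln (p / q) - p + q, of the colour means
  p from q = \<open>kp * edge_wt\<close>; the terms q add up to \<open>kp\<close> since the edge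
  weights have total mass 1.\<close>

definition col_div :: "real => 'x pmf => ('y * 'y) pmf => ('x * 'x * 'y * 'y => real) => real" where
 "col_div kp nu xi pc = (SUM k:pcols nu xi. pc k * ln (pc k / (kp * edge_wt nu xi k)) - pc k) + kp"

text \<open>Finiteness rests on the support of \<open>nu\<close> and not on the mark type, since
  marks that carry a class form an infinite type.\<close>

lemma finite_pcols:
 fixes xi :: "('y::finite * 'y) pmf" assumes "finite (set_pmf nu)" shows "finite (pcols nu xi)"
proof (rule finite_subset)
 show "pcols nu xi <= set_pmf nu \<times> set_pmf nu \<times> UNIV" by (auto simp: pcols_def edge_wt_def child_wt_def zero_less_mult_iff set_pmf_iff)
qed (use assms in simp)

lemma prod_mset_count:
 fixes f :: "'a => real" assumes "finite A" "set_mset T <= A" shows "(PROD k:#T. f k) = (PROD k:A. f k ^ count T k)" using assms(2)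
proof (induction T)
 case (add k T)
 have k: "k : A" and T: "set_mset T <= A" using add.prems by auto
 have "(PROD a:A. f a ^ count (add_mset k T) a) = f k ^ Suc (count T k) * (PROD a:A - {k}. f a ^ count (add_mset k T) a)"
  using k assms(1) by (subst prod.remove[of _ k]) auto
 also have "(PROD a:A - {k}. f a ^ count (add_mset k T) a) = (PROD a:A - {k}. f a ^ count T a)" by (intro prod.cong) auto
 also have "f k ^ Suc (count T k) * ... = f k * (f k ^ count T k * (PROD a:A - {k}. f a ^ count T a))" by simp
 also have "f k ^ count T k * (PROD a:A - {k}. f a ^ count T a) = (PROD a:A. f a ^ count T a)"
  using k assms(1) by (subst (2) prod.remove[of _ k]) auto
 finally show ?case using add.IH[OF T] by simp
qed simp

lemma ln_col_factor:
 fixes xi :: "('y::finite * 'y) pmf" assumes fin: "finite (set_pmf nu)" and kp: "0 < kp" "kp < real n" and T: "set_mset T <= pcols nu xi"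
 shows "col_factor kp nu xi n T > 0" and "ln (col_factor kp nu xi n T) = kp * real n + real (card (all_pairs {1..n})) * ln (1 - kp / real n)
   + (SUM k:pcols nu xi. ln (fact (count T k)) - real (count T k) * ln (kp * (real n - kp) * edge_wt nu xi k)) / 2"
proof -
 note C = finite_pcols[OF fin, of xi]
 have w: "kp * (real n - kp) * edge_wt nu xi k > 0" if "k : pcols nu xi" for k using that kp by (simp add: pcols_def)
 have M: "mfact T = (PROD k:pcols nu xi. fact (count T k))" by (rule mfact_superset[OF C T])
 have W: "(PROD k:#T. kp * (real n - kp) * edge_wt nu xi k) = (PROD k:pcols nu xi. (kp * (real n - kp) * edge_wt nu xi k) ^ count T k)"
  by (rule prod_mset_count[OF C T])
 have Wpos: "(PROD k:#T. kp * (real n - kp) * edge_wt nu xi k) > 0" unfolding W by (intro prod_pos) (use w in auto)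
 have q: "1 - kp / real n > 0" using kp by simp
 have S: "sqrt (mfact T / (PROD k:#T. kp * (real n - kp) * edge_wt nu xi k)) > 0" using Wpos by simp
 show "col_factor kp nu xi n T > 0" unfolding col_factor_def using q S by simp
 have lnM: "ln (mfact T) = (SUM k:pcols nu xi. ln (fact (count T k)))" unfolding M by (rule ln_prod) (use C in auto)
 have lnW: "ln (PROD k:#T. kp * (real n - kp) * edge_wt nu xi k) = (SUM k:pcols nu xi. real (count T k) * ln (kp * (real n - kp) * edge_wt nu xi k))"
 proof -
  have "ln (PROD k:pcols nu xi. (kp * (real n - kp) * edge_wt nu xi k) ^ count T k)
    = (SUM k:pcols nu xi. ln ((kp * (real n - kp) * edge_wt nu xi k) ^ count T k))" by (rule ln_prod[OF C]) (use w less_irrefl in fastforce)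
  also have "... = (SUM k:pcols nu xi. real (count T k) * ln (kp * (real n - kp) * edge_wt nu xi k))" by (intro sum.cong refl ln_realpow w)
  finally show ?thesis unfolding W .
 qed
 show "ln (col_factor kp nu xi n T) = kp * real n + real (card (all_pairs {1..n})) * ln (1 - kp / real n)
   + (SUM k:pcols nu xi. ln (fact (count T k)) - real (count T k) * ln (kp * (real n - kp) * edge_wt nu xi k)) / 2" unfolding col_factor_def using q S Wpos by (simp add: ln_mult_pos ln_realpow ln_sqrt ln_divide_pos lnM lnW sum_subtractf)
qed

text \<open>Stirling's formula for every colour count. Of the exponent \<open>kp\<close> the missing
  edges take back kp / 2 and the square root halves the colour terms, so half the divergence is
  left.\<close>

lemma tendsto_col_factor:
 fixes xi :: "('y::finite * 'y) pmf" and N :: "'b => nat" assumes fin: "finite (set_pmf nu)" and kp: "0 < kp" and N: "filterlim N at_top F"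
  and T: "\<forall>\<^sub>F j in F. set_mset (T j) <= pcols nu xi"
  and pc: "!!k. k : pcols nu xi ==> ((%j. real (count (T j) k) / real (N j)) \<longlongrightarrow> pc k) F"
 shows "((%j. ln (col_factor kp nu xi (N j) (T j)) / real (N j)) \<longlongrightarrow> col_div kp nu xi pc / 2) F"
proof -
 let ?C = "pcols nu xi"
 have ev: "\<forall>\<^sub>F j in F. real (N j) > kp"
  by (rule eventually_compose_filterlim[OF eventually_gt_at_top filterlim_compose[OF filterlim_real_sequentially N]])
 have tm: "((%j. (ln (fact (count (T j) k)) - real (count (T j) k) * ln (real (N j))) / real (N j)
    - real (count (T j) k) / real (N j) * (ln (1 - kp / real (N j)) + ln (kp * edge_wt nu xi k)))
   \<longlongrightarrow> (pc k * ln (pc k) - pc k) - pc k * (ln (1 - 0) + ln (kp * edge_wt nu xi k))) F" if k: "k : ?C" for k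
  by (intro tendsto_intros tendsto_ln_fact N pc[OF k] filterlim_real_divide) auto
 have A: "((%j. kp + real (card (all_pairs {1..N j})) * ln (1 - kp / real (N j)) / real (N j)
   + (SUM k:?C. (ln (fact (count (T j) k)) - real (count (T j) k) * ln (real (N j))) / real (N j)
    - real (count (T j) k) / real (N j) * (ln (1 - kp / real (N j)) + ln (kp * edge_wt nu xi k))) / 2)
  \<longlongrightarrow> kp + - kp / 2 + (SUM k:?C. (pc k * ln (pc k) - pc k) - pc k * (ln (1 - 0) + ln (kp * edge_wt nu xi k))) / 2) F"
  by (intro tendsto_intros tendsto_nonedge_factor N kp tm tendsto_sum) auto
 have C: "kp + - kp / 2 + (SUM k:?C. (pc k * ln (pc k) - pc k) - pc k * (ln (1 - 0) + ln (kp * edge_wt nu xi k))) / 2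
   = col_div kp nu xi pc / 2" if "F ~= bot"
 proof -
  have "(SUM k:?C. (pc k * ln (pc k) - pc k) - pc k * (ln (1 - 0) + ln (kp * edge_wt nu xi k)))
   = (SUM k:?C. pc k * ln (pc k / (kp * edge_wt nu xi k)) - pc k)"
  proof (rule sum.cong[OF refl])
   fix k assume k: "k : ?C"
   have p: "pc k >= 0" by (rule tendsto_lowerbound[OF pc[OF k] _ that]) auto
   show "(pc k * ln (pc k) - pc k) - pc k * (ln (1 - 0) + ln (kp * edge_wt nu xi k)) = pc k * ln (pc k / (kp * edge_wt nu xi k)) - pc k"
    using k p kp by (cases "pc k = 0") (auto simp: ln_divide_pos pcols_def algebra_simps)
  qed
  thus ?thesis by (simp add: col_div_def)
 qed
 have B: "\<forall>\<^sub>F j in F. kp + real (card (all_pairs {1..N j})) * ln (1 - kp / real (N j)) / real (N j)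
   + (SUM k:?C. (ln (fact (count (T j) k)) - real (count (T j) k) * ln (real (N j))) / real (N j)
    - real (count (T j) k) / real (N j) * (ln (1 - kp / real (N j)) + ln (kp * edge_wt nu xi k))) / 2
   = ln (col_factor kp nu xi (N j) (T j)) / real (N j)" using ev T
 proof eventually_elim
  case (elim j)
  have n: "real (N j) > 0" using elim kp by linarith
  have "(SUM k:?C. (ln (fact (count (T j) k)) - real (count (T j) k) * ln (real (N j))) / real (N j)
    - real (count (T j) k) / real (N j) * (ln (1 - kp / real (N j)) + ln (kp * edge_wt nu xi k)))
   = (SUM k:?C. ln (fact (count (T j) k)) - real (count (T j) k) * ln (kp * (real (N j) - kp) * edge_wt nu xi k)) / real (N j)"
   unfolding sum_divide_distrib
  proof (rule sum.cong[OF refl])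
   fix k assume k: "k : ?C"
   have q: "1 - kp / real (N j) > 0" using elim n by simp
   have "ln (kp * (real (N j) - kp) * edge_wt nu xi k) = ln (real (N j) * ((1 - kp / real (N j)) * (kp * edge_wt nu xi k)))"
   proof -
    show ?thesis using n by (simp add: right_diff_distrib ac_simps)
   qed
   also have "... = ln (real (N j)) + (ln (1 - kp / real (N j)) + ln (kp * edge_wt nu xi k))"
   proof -
    have pos: "kp * edge_wt nu xi k > 0" using k kp by (simp add: pcols_def)
    show ?thesis by (subst ln_mult_pos[OF n mult_pos_pos[OF q pos]], subst ln_mult_pos[OF q pos]) simp
   qed
   finally show "(ln (fact (count (T j) k)) - real (count (T j) k) * ln (real (N j))) / real (N j)
    - real (count (T j) k) / real (N j) * (ln (1 - kp / real (N j)) + ln (kp * edge_wt nu xi k))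
    = (ln (fact (count (T j) k)) - real (count (T j) k) * ln (kp * (real (N j) - kp) * edge_wt nu xi k)) / real (N j)"
    by (simp add: diff_divide_distrib algebra_simps add_divide_distrib)
  qed
  thus ?case unfolding ln_col_factor(2)[OF fin kp elim(1,2)] using n by (simp add: add_divide_distrib)
 qed
 show ?thesis
 proof (cases "F = bot")
  case False
  from Lim_transform_eventually[OF A B] show ?thesis unfolding C[OF False] .
 qed simp
qed

text \<open>Uniformity by contradiction: failures for the tolerances 1 / (j + 1) would provide sizes
  and multisets along which \<open>tendsto_col_factor\<close> is violated.\<close>

lemma col_factor_uniform_upper:
 fixes xi :: "('y::finite * 'y) pmf" assumes fin: "finite (set_pmf nu)" and kp: "0 < kp" and ep: "ep > 0"
 shows "EX de>0. EX n0. ALL n>=n0. ALL T. set_mset T <= pcols nu xi --> (ALL k:pcols nu xi. \<bar>real (count T k) / real n - pc k\<bar> <= de) -->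
  col_factor kp nu xi n T <= exp (real n * (col_div kp nu xi pc / 2 + ep))"
proof (rule ccontr)
 assume neg: "~ ?thesis"
 have "EX n T. n >= j & set_mset T <= pcols nu xi & (ALL k:pcols nu xi. \<bar>real (count T k) / real n - pc k\<bar> <= 1 / real (Suc j)) &
  ~ col_factor kp nu xi n T <= exp (real n * (col_div kp nu xi pc / 2 + ep))" for j
  using neg[simplified, rule_format, of "1 / real (Suc j)" j] by force
 then obtain N T where NT: "!!j. N j >= j" "!!j. set_mset (T j) <= pcols nu xi"
  "!!j k. k : pcols nu xi ==> \<bar>real (count (T j) k) / real (N j) - pc k\<bar> <= 1 / real (Suc j)"
  "!!j. ~ col_factor kp nu xi (N j) (T j) <= exp (real (N j) * (col_div kp nu xi pc / 2 + ep))" by metis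
 have N: "filterlim N at_top sequentially" by (rule filterlim_at_top_mono[OF filterlim_ident]) (use NT(1) in auto)
 have lim: "(%j. real (count (T j) k) / real (N j)) ----> pc k" if k: "k : pcols nu xi" for k
 proof -
  have "(%j. real (count (T j) k) / real (N j) - pc k) ----> 0"
  proof (rule Lim_null_comparison)
   show "\<forall>\<^sub>F j in sequentially. norm (real (count (T j) k) / real (N j) - pc k) <= 1 / real (Suc j)" using NT(3)[OF k] by auto
   show "(%j. 1 / real (Suc j)) ----> 0" by (rule LIMSEQ_Suc[OF lim_const_over_n])
  qed
  thus ?thesis by (simp add: LIM_zero_iff)
 qed
 have "(%j. ln (col_factor kp nu xi (N j) (T j)) / real (N j)) ----> col_div kp nu xi pc / 2"
  by (rule tendsto_col_factor[OF fin kp N]) (use NT(2) lim in auto)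
 hence "\<forall>\<^sub>F j in sequentially. ln (col_factor kp nu xi (N j) (T j)) / real (N j) < col_div kp nu xi pc / 2 + ep"
  by (rule order_tendstoD(2)) (use ep in simp)
 moreover have "\<forall>\<^sub>F j in sequentially. real (N j) > kp"
  by (rule eventually_compose_filterlim[OF eventually_gt_at_top filterlim_compose[OF filterlim_real_sequentially N]])
 ultimately have "\<forall>\<^sub>F j in sequentially. False"
 proof eventually_elim
  case (elim j)
  have pos: "col_factor kp nu xi (N j) (T j) > 0" by (rule ln_col_factor(1)[OF fin kp elim(2) NT(2)])
  have "ln (col_factor kp nu xi (N j) (T j)) < real (N j) * (col_div kp nu xi pc / 2 + ep)" using elim kp elim(1) by (simp add: field_simps)
  hence "col_factor kp nu xi (N j) (T j) < exp (real (N j) * (col_div kp nu xi pc / 2 + ep))" using pos by (metis exp_less_cancel_iff exp_ln)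
  thus False using NT(4)[of j] by simp
 qed
 thus False by simp
qed

section \<open>Relative entropy of probability mass functions\<close>

lemma absolutely_continuous_pmf_density: assumes f: "!!a. a : set_pmf mu ==> f a > (0 :: real)" and sub: "set_pmf mu <= set_pmf et"
 shows "absolutely_continuous (density (measure_pmf et) (%a. ennreal (f a))) (measure_pmf mu)" unfolding absolutely_continuous_def
proof
 fix A assume "A : null_sets (density et (%a. ennreal (f a)))"
 hence "AE a in et. a : A --> ennreal (f a) = 0" by (subst (asm) null_sets_density_iff) auto
 hence "ALL a:set_pmf et. a : A --> f a <= 0" by (simp add: AE_measure_pmf_iff ennreal_eq_0_iff)
 thus "A : null_sets mu" using f sub by (force simp: null_sets_def measure_pmf.emeasure_eq_measure measure_pmf_zero_iff)
qed

lemma absolutely_continuous_pmf_iff: "absolutely_continuous (measure_pmf et) (measure_pmf mu) <-> set_pmf mu <= set_pmf et"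
proof
 assume ac: "absolutely_continuous et mu"
 have "set_pmf mu \<inter> - set_pmf et = {}" using ac by (auto simp: absolutely_continuous_def null_sets_def measure_pmf.emeasure_eq_measure measure_pmf_zero_iff)
 thus "set_pmf mu <= set_pmf et" by blast
next
 assume "set_pmf mu <= set_pmf et"
 thus "absolutely_continuous et mu" using absolutely_continuous_pmf_density[of mu "%_. 1" et] by (simp add: density_1)
qed

text \<open>The Radon-Nikodym derivative is computed atom by atom. The reference measure is a
  density because \<open>check_law\<close> and \<open>hat_law\<close> have this form.\<close>

lemma rel_entropy_density:
 fixes f :: "'a => real" assumes f: "!!a. a : set_pmf mu ==> f a > 0" and sub: "set_pmf mu <= set_pmf et"
 shows "rel_entropy (measure_pmf mu) (density (measure_pmf et) (%a. ennreal (f a)))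
  = (if integrable (measure_pmf mu) (%a. ln (pmf mu a / (pmf et a * f a)))
   then ereal (expect mu (%a. ln (pmf mu a / (pmf et a * f a)))) else \<infinity>)"
proof -
 let ?M = "density et (%a. ennreal (f a))"
 interpret M: sigma_finite_measure ?M by (subst sigma_finite_measure.sigma_finite_iff_density_finite)
   (auto intro: prob_space_imp_sigma_finite measure_pmf.prob_space_axioms)
 have ac: "absolutely_continuous ?M mu" by (rule absolutely_continuous_pmf_density[OF f sub])
 have RN: "enn2real (RN_deriv ?M (measure_pmf mu) a) = pmf mu a / (pmf et a * f a)" if a: "a : set_pmf mu" for a
 proof -
  have "density ?M (RN_deriv ?M mu) = measure_pmf mu" by (rule M.density_RN_deriv[OF ac]) simp
  hence "emeasure mu {a} = emeasure (density ?M (RN_deriv ?M mu)) {a}" by simp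
  also have "... = (\<integral>\<^sup>+x. RN_deriv ?M mu x * indicator {a} x \<partial>?M)" by (rule emeasure_density) auto
  also have "... = RN_deriv ?M mu a * emeasure ?M {a}" by simp
  also have "emeasure ?M {a} = ennreal (pmf et a * f a)"
  proof -
   have "emeasure ?M {a} = (\<integral>\<^sup>+x. ennreal (f x) * indicator {a} x \<partial>et)" by (rule emeasure_density) auto
   also have "... = ennreal (pmf et a * f a)" using f[OF a] by (simp add: emeasure_pmf_single ennreal_mult' mult.commute)
   finally show ?thesis .
  qed
  finally have eq: "ennreal (pmf mu a) = RN_deriv ?M mu a * ennreal (pmf et a * f a)" by (simp add: emeasure_pmf_single)
  have pos: "pmf et a * f a > 0" using a sub f by (auto simp: set_pmf_iff less_le)
  have "enn2real (ennreal (pmf mu a)) = enn2real (RN_deriv ?M mu a) * (pmf et a * f a)" unfolding eq enn2real_mult using pos by simp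
  thus ?thesis by (subst nonzero_eq_divide_eq[OF less_imp_neq[OF pos, symmetric]]) simp
 qed
 have AE: "AE a in mu. entropy_density (exp 1) ?M mu a = ln (pmf mu a / (pmf et a * f a))"
  by (simp add: AE_measure_pmf_iff entropy_density_def RN log_def)
 have "integrable mu (entropy_density (exp 1) ?M mu) <-> integrable mu (%a. ln (pmf mu a / (pmf et a * f a)))"
  by (rule integrable_cong_AE) (use AE in auto)
 moreover have "KL_divergence (exp 1) ?M mu = expect mu (%a. ln (pmf mu a / (pmf et a * f a)))"
  unfolding KL_divergence_def by (rule integral_cong_AE) (use AE in auto)
 ultimately show ?thesis using ac by (simp add: rel_entropy_def)
qed

definition kl_real :: "'a pmf => 'a pmf => real" where "kl_real mu et = expect mu (%a. ln (pmf mu a / pmf et a))"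

definition kl_finite :: "'a pmf => 'a pmf => bool" where
 "kl_finite mu et <-> set_pmf mu <= set_pmf et & integrable (measure_pmf mu) (%a. ln (pmf mu a / pmf et a))"

lemma rel_entropy_pmf: "rel_entropy (measure_pmf mu) (measure_pmf et) = (if kl_finite mu et then ereal (kl_real mu et) else \<infinity>)"
proof (cases "set_pmf mu <= set_pmf et")
 case True
 thus ?thesis using rel_entropy_density[of mu "%_. 1" et] by (simp add: density_1 kl_finite_def kl_real_def)
next
 case False
 thus ?thesis by (simp add: rel_entropy_def absolutely_continuous_pmf_iff kl_finite_def)
qed

text \<open>The two linear terms cancel in the sum over the whole space and make every summand
  nonnegative, so that relative entropy is the supremum of sums over finite sets.\<close>

definition kl_term :: "'a pmf => 'a pmf => 'a => real" where "kl_term mu et a = pmf mu a * ln (pmf mu a / pmf et a) - pmf mu a + pmf et a"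

lemma kl_term_nonneg: assumes "set_pmf mu <= set_pmf et" shows "kl_term mu et a >= 0"
proof (cases "pmf mu a = 0")
 case False
 hence p: "pmf mu a > 0" "pmf et a > 0" using assms by (auto simp: set_pmf_iff less_le)
 have "pmf mu a * ln (pmf et a / pmf mu a) <= pmf mu a * (pmf et a / pmf mu a - 1)" using p by (intro mult_left_mono, auto, intro ln_le_minus_one, auto)
 thus ?thesis using p by (simp add: kl_term_def ln_div right_diff_distrib)
qed (simp add: kl_term_def)

text \<open>Monotone convergence for the nonnegative terms under \<open>et\<close>, followed by a
  change of measure with the density \<open>r\<close> of \<open>mu\<close>. Bounded partial sums
  thus give integrability of the log-density, and with it finite entropy.\<close>

lemma kl_finite_exhaust:
 fixes h :: "'a => nat" assumes fin: "!!k. finite {a. h a <= k}" and sub: "set_pmf mu <= set_pmf et"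
  and B: "!!k. (SUM a:{a. h a <= k}. kl_term mu et a) <= B" shows "kl_finite mu et" and "kl_real mu et <= B"
proof -
 define ph where "ph a = kl_term mu et a / pmf et a" for a
 have ph0: "ph a >= 0" for a using kl_term_nonneg[OF sub] by (simp add: ph_def)
 have phet: "ph a * pmf et a = kl_term mu et a" for a
 proof (cases "pmf et a = 0")
  case True
  thus ?thesis using sub True by (auto simp: set_pmf_iff ph_def kl_term_def)
 qed (simp add: ph_def)
 have "(\<integral>\<^sup>+a. ennreal (ph a) \<partial>et) = (SUP k. SUM a:{a. h a <= k}. ennreal (ph a) * emeasure et {a})"
  by (rule nn_integral_exhaust) (use fin in \<open>auto simp: incseq_def\<close>)
 also have "... = (SUP k. ennreal (SUM a:{a. h a <= k}. kl_term mu et a))"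
 proof (rule SUP_cong[OF refl])
  fix k
  have "(SUM a:{a. h a <= k}. ennreal (ph a) * emeasure et {a}) = (SUM a:{a. h a <= k}. ennreal (kl_term mu et a))"
   by (intro sum.cong refl) (simp add: emeasure_pmf_single ph0 phet flip: ennreal_mult)
  thus "(SUM a:{a. h a <= k}. ennreal (ph a) * emeasure et {a}) = ennreal (SUM a:{a. h a <= k}. kl_term mu et a)" using kl_term_nonneg[OF sub] by simp
 qed
 also have "... <= ennreal B" by (intro SUP_least ennreal_leI B)
 finally have nn: "(\<integral>\<^sup>+a. ennreal (ph a) \<partial>et) <= ennreal B" .
 have intph: "integrable et ph" by (rule integrableI_nonneg) (use ph0 nn in \<open>auto intro: order.strict_trans1\<close>)
 define r where "r a = pmf mu a / pmf et a" for a
 have dens: "density et (%a. ennreal (r a)) = measure_pmf mu"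
 proof -
  have "density et (%a. ennreal (r a)) = density (count_space UNIV) (%a. ennreal (pmf et a) * ennreal (r a))"
   unfolding measure_pmf_eq_density[of et] by (rule density_density_eq) auto
  also have "(%a. ennreal (pmf et a) * ennreal (r a)) = (%a. ennreal (pmf mu a))"
  proof
   fix a
   show "ennreal (pmf et a) * ennreal (r a) = ennreal (pmf mu a)" using sub by (simp add: ennreal_mult'[symmetric], cases "pmf et a = 0", auto simp: r_def set_pmf_iff)
  qed
  finally show ?thesis by (simp add: measure_pmf_eq_density)
 qed
 have r0: "r a >= 0" for a by (simp add: r_def)
 have intr: "integrable et r" and Er: "expect et r = 1"
 proof -
  have "integrable mu (%_. 1 :: real)" by simp
  thus "integrable et r" unfolding dens[symmetric] by (subst (asm) integrable_density, (use r0 in auto))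
  have "(\<integral>a. (1::real) \<partial>mu) = (\<integral>a. r a *\<^sub>R (1::real) \<partial>et)"
   unfolding dens[symmetric] by (rule integral_density) (use r0 in auto)
  thus "expect et r = 1" by simp
 qed
 have rl: "AE a in et. r a *\<^sub>R ln (r a) = ph a + r a - 1" by (auto simp: AE_measure_pmf_iff ph_def r_def kl_term_def set_pmf_iff field_simps)
 have "integrable et (%a. r a *\<^sub>R ln (r a))"
  by (subst integrable_cong_AE[OF _ _ rl]) (auto intro!: intph intr Bochner_Integration.integrable_diff Bochner_Integration.integrable_add)
 hence "integrable mu (%a. ln (r a))" unfolding dens[symmetric] by (subst integrable_density) (use r0 in auto)
 thus "kl_finite mu et" using sub by (simp add: kl_finite_def r_def)
 have "kl_real mu et = (\<integral>a. ln (r a) \<partial>mu)" by (simp add: kl_real_def r_def)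
 also have "... = (\<integral>a. r a *\<^sub>R ln (r a) \<partial>et)" unfolding dens[symmetric] by (rule integral_density) (use r0 in auto)
 also have "... = (\<integral>a. ph a + r a - 1 \<partial>et)" by (rule integral_cong_AE) (use rl in auto)
 also have "... = expect et ph" using intph intr Er by simp
 also have "... <= B"
 proof -
  show ?thesis using B[of 0] kl_term_nonneg[OF sub] nn ph0 by (subst integral_eq_nn_integral, auto intro!: enn2real_leI, meson order_trans sum_nonneg)
 qed
 finally show "kl_real mu et <= B" .
qed

text \<open>Finitely many atoms suffice to see an entropy above \<open>r\<close>, also when the
  entropy is infinite; the Chernoff bound of \<open>iid_local_upper\<close> works with such finite
  sums.\<close>

lemma rel_entropy_greater:
 fixes h :: "'a => nat" assumes fin: "!!k. finite {a. h a <= k}" and sub: "set_pmf mu <= set_pmf et"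
  and r: "ereal r < rel_entropy (measure_pmf mu) (measure_pmf et)" shows "EX k. r < (SUM a:{a. h a <= k}. kl_term mu et a)"
proof (rule ccontr)
 assume "~ ?thesis"
 hence B: "(SUM a:{a. h a <= k}. kl_term mu et a) <= r" for k by (auto simp: not_less)
 show False using kl_finite_exhaust[OF fin sub B] r by (simp add: rel_entropy_pmf)
qed

section \<open>The upper bound for the Erdos-Renyi graph\<close>

lemma finite_stars: "finite {ta :: ('x::finite, 'y::finite) star. deg ta <= K}"
proof (rule finite_subset)
 show "{ta :: ('x, 'y) star. deg ta <= K} <= UNIV \<times> mset ` {xs. set xs <= UNIV & length xs <= K}"
 proof
  fix ta :: "('x, 'y) star" assume "ta : {ta. deg ta <= K}"
  moreover obtain xs where xs: "mset xs = snd ta" using ex_mset by blast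
  moreover have "length xs = size (snd ta)" using xs by (metis size_mset)
  ultimately have "snd ta : mset ` {xs. set xs <= UNIV & length xs <= K}" by (auto simp: star_deg_def image_iff intro!: exI[of _ xs])
  thus "ta : UNIV \<times> mset ` {xs. set xs <= UNIV & length xs <= K}" by (cases ta) auto
 qed
 show "finite ((UNIV :: 'x set) \<times> mset ` {xs :: ('x * 'y * 'y) list. set xs <= UNIV & length xs <= K})"
  by (intro finite_cartesian_product finite_imageI finite_lists_length_le) auto
qed

lemma expectation_empirical:
 fixes g :: "'a => real" assumes "n >= 1" shows "expect (emp n t) g = (SUM v:{1..n}. g (t v)) / real n"
 using assms unfolding empirical_measure_def by (simp add: integral_pmf_of_set)

lemma sum_pmf_empirical:
 fixes g :: "'a => real" assumes "n >= 1" "finite F"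
 shows "(SUM a:F. g a * pmf (emp n t) a) = (SUM v:{1..n}. if t v : F then g (t v) else 0) / real n"
proof -
 have "(SUM a:F. g a * pmf (emp n t) a) = (SUM a:F. (if a : F then g a else 0) * pmf (emp n t) a)" by simp
 also have "... = expect (emp n t) (%a. if a : F then g a else 0)" by (rule expectation_finite_support[symmetric]) (use assms in auto)
 finally show ?thesis by (simp only: expectation_empirical[OF assms(1)])
qed

lemma prob_dominated: assumes C: "C >= 0" and dom: "!!t. t : S ==> pmf P t <= C * pmf Q t" shows "prob P S <= C * prob Q S"
proof -
 have em: "emeasure (measure_pmf P) S = (\<integral>\<^sup>+t. ennreal (pmf P t) * indicator S t \<partial>count_space UNIV)" for P :: "'a pmf"
  by (simp add: nn_integral_measure_pmf[symmetric])
 have "emeasure P S <= (\<integral>\<^sup>+t. ennreal C * (ennreal (pmf Q t) * indicator S t) \<partial>count_space UNIV)"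
  unfolding em using dom C by (intro nn_integral_mono) (auto simp: indicator_def ennreal_mult[symmetric] intro!: ennreal_leI)
 also have "... = ennreal C * emeasure Q S" unfolding em by (rule nn_integral_cmult) simp
 finally show ?thesis using C by (simp add: measure_pmf.emeasure_eq_measure ennreal_mult'[symmetric])
qed

lemma chernoff_Pi_pmf:
 fixes f :: "'a => real" assumes A: "finite A" and int: "integrable (measure_pmf et) (%a. exp (f a))"
 shows "prob (Pi_pmf A d (%_. et)) {t. b <= (SUM v:A. f (t v))} <= exp (- b) * (expect et (%a. exp (f a))) ^ card A"
proof -
 let ?Q = "Pi_pmf A d (%_. et)"
 have intP: "integrable (measure_pmf ?Q) (%t. PROD v:A. exp (f (t v)))" by (rule integrable_prod_Pi_pmf) (use int A in auto)
 have "prob ?Q {t. b <= (SUM v:A. f (t v))} = prob ?Q {t : space ?Q. exp b <= (PROD v:A. exp (f (t v)))}" using A by (simp add: exp_sum[symmetric])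
 also have "... <= expect ?Q (%t. PROD v:A. exp (f (t v))) / exp b"
  by (rule integral_Markov_inequality_measure[where A = "{}"]) (use intP in \<open>auto intro!: prod_nonneg\<close>)
 also have "expect ?Q (%t. PROD v:A. exp (f (t v))) = (PROD v:A. expect et (%a. exp (f a)))" by (rule expectation_prod_Pi_pmf) (use int A in auto)
 finally show ?thesis by (simp add: exp_minus field_simps)
qed

lemma map_star_deg_true_law: "map_pmf deg (true_law q nu xi) = q"
proof -
 have "map_pmf deg (true_law q nu xi) = bind_pmf q (%d. bind_pmf nu (%x. bind_pmf (replicate_pmf d (pair_pmf nu (sym_law xi))) (%cs. return_pmf d)))"
  unfolding true_law_def map_bind_pmf map_return_pmf by (intro bind_pmf_cong refl) (auto simp: star_deg_def set_replicate_pmf)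
 thus ?thesis by (simp add: bind_return_pmf')
qed

lemma prob_bind_pmf_le: assumes c: "c >= 0" and le: "!!x. prob (f x) S <= c" shows "prob (bind_pmf X f) S <= c"
proof -
 have "emeasure (bind_pmf X f) S = (\<integral>\<^sup>+x. emeasure (f x) S \<partial>X)" by simp
 also have "... <= (\<integral>\<^sup>+x. ennreal c \<partial>X)"
  using le by (intro nn_integral_mono) (simp add: measure_pmf.emeasure_eq_measure ennreal_leI)
 also have "... = ennreal c" by simp
 finally show ?thesis using c by (simp add: measure_pmf.emeasure_eq_measure)
qed

section \<open>Exponential tails of the number of edges and of large degrees\<close>

lemma size_total_cols_labelling: assumes V: "finite V" and l: "l : labellings V"
 shows "size (total_cols V x (halves V x l)) = 2 * card {e : all_pairs V. l e ~= None}" using V l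
proof (induction rule: labelling_induct)
 case empty
 thus ?case by (simp add: total_cols_empty)
next
 case (insert l v w y y')
 let ?l = "l({v, w} := Some (pair_label v w y y'))"
 have "{e : all_pairs V. ?l e ~= None} = insert {v, w} {e : all_pairs V. l e ~= None}" using insert by auto
 moreover have "{v, w} ~: {e : all_pairs V. l e ~= None}" using insert by auto
 ultimately show ?case using V insert.IH by (simp add: total_cols_halves_upd[of V v w l, OF V insert(2-5)] del: fun_upd_apply)
qed

lemma seq_cols_label_stars: "seq_cols n (label_stars n x l) = total_cols {1..n} x (halves {1..n} x l)"
 unfolding seq_cols_total by (rule total_cols_cong_fst) (auto simp: label_stars_def)

lemma expectation_edge_label:
 fixes xi :: "('b * 'b) pmf" assumes p: "0 <= p" "p <= 1"
 shows "expect (edge_label_law p xi) (%l. exp (if l = None then 0 else 1)) = 1 + p * (exp 1 - 1)"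
proof -
 have "map_pmf (%l :: ('b * 'b) option. l ~= None) (edge_label_law p xi) = bernoulli_pmf p"
 proof -
  have "map_pmf (%l. l ~= None) (edge_label_law p xi) = bind_pmf (bernoulli_pmf p) return_pmf" unfolding edge_label_law_def map_bind_pmf
   by (intro bind_pmf_cong refl) (auto simp: map_pmf_comp map_return_pmf)
  thus ?thesis by (simp add: bind_return_pmf')
 qed
 hence "expect (bernoulli_pmf p) (%b. exp (if b then 1 else 0 :: real)) = expect (edge_label_law p xi) (%l. exp (if l ~= None then 1 else 0))"
  by (metis (no_types, lifting) integral_map_pmf Bochner_Integration.integral_cong)
 moreover have "(%l :: ('b * 'b) option. exp (if l ~= None then 1 else 0 :: real)) = (%l. exp (if l = None then 0 else 1))" by auto
 ultimately show ?thesis using p by (simp add: algebra_simps)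
qed

lemma total_degree_tail:
 fixes nu :: "'x pmf" and xi :: "('y * 'y) pmf" assumes kp: "kp > 0" shows "EX B>=1. Ev n.
  prob (ER_law kp nu xi n) {t. B * real n < real (size (seq_cols n t))} <= decay r n"
proof (intro exI conjI)
 \<comment> \<open>\<open>size (seq_cols n t)\<close> is twice the number of edges, whose
   exponential moment of slope 1 is at most exp (kp n) because e - 1 <= 2. So B / 2 has to reach r +
   kp.\<close>
 define B where "B = max 1 (2 * (r + kp))"
 show "B >= 1" by (simp add: B_def)
 have B: "r + kp <= B / 2" by (auto simp: B_def)
 obtain n0 :: nat where n0: "real n0 > kp" using reals_Archimedean2 by blast
 show "Ev n. prob (ER_law kp nu xi n)
   {t. B * real n < real (size (seq_cols n t))} <= decay r n" using eventually_ge_at_top[of n0]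
 proof eventually_elim
  case (elim n)
  have n: "real n > kp" "real n > 0" using elim n0 kp by linarith+
  define p where "p = kp / real n"
  have p: "0 <= p" "p <= 1" using n kp by (auto simp: p_def field_simps)
  let ?A = "all_pairs {1..n}" and ?lab = "edge_label_law p xi"
  let ?f = "%l. if l = None then 0 else (1 :: real)"
  have "prob (map_pmf (label_stars n x) (Pi_pmf ?A None (%_. ?lab))) {t. B * real n < real (size (seq_cols n t))} <= decay r n" for x
  proof -
   let ?Q = "Pi_pmf ?A None (%_. ?lab)"
   have "prob (map_pmf (label_stars n x) ?Q) {t. B * real n < real (size (seq_cols n t))}
    = prob ?Q {l. B * real n < real (size (seq_cols n (label_stars n x l)))}" by simp
   also have "... <= prob ?Q {l. B * real n / 2 <= (SUM e:?A. ?f (l e))}"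
   proof (rule measure_pmf.finite_measure_mono_AE)
    have "B * real n / 2 <= (SUM e:?A. ?f (l e))" if "l : set_pmf ?Q" "B * real n < real (size (seq_cols n (label_stars n x l)))" for l
    proof -
     have "l : labellings {1..n}" using that(1) set_Pi_pmf_subset[of ?A None] by (auto simp: labellings_def)
     hence "size (seq_cols n (label_stars n x l)) = 2 * card {e : ?A. l e ~= None}"
      unfolding seq_cols_label_stars by (rule size_total_cols_labelling[rotated]) simp
     moreover have "(SUM e:?A. ?f (l e)) = real (card {e : ?A. l e ~= None})" by (simp add: sum.If_cases Int_def)
     ultimately show ?thesis using that(2) by simp
    qed
    thus "AE l in ?Q. l : {l. B * real n < real (size (seq_cols n (label_stars n x l)))} -->
      l : {l. B * real n / 2 <= (SUM e:?A. ?f (l e))}" by (simp add: AE_measure_pmf_iff)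
   qed simp
   also have "... <= exp (- (B * real n / 2)) * (expect ?lab (%l. exp (?f l))) ^ card ?A"
    by (rule chernoff_Pi_pmf) (auto intro!: measure_pmf.integrable_const_bound[where B = "exp 1"])
   also have "... = exp (- (B * real n / 2)) * (1 + p * (exp 1 - 1)) ^ card ?A" by (simp only: expectation_edge_label[OF p])
   also have "(1 + p * (exp 1 - 1)) ^ card ?A <= exp (real (card ?A) * (p * (exp 1 - 1)))" using p by (simp add: exp_of_nat_mult, intro power_mono exp_ge_add_one_self, auto)
   also have "... <= exp (kp * real n)"
   proof -
    have "real (card ?A) * (p * (exp 1 - 1)) <= real (card ?A) * (p * 2)" using exp_le p by (intro mult_left_mono, auto)
    also have "... <= kp * real n" unfolding card_all_pairs p_def using n kp by simp
    finally show ?thesis by simp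
   qed
   also have "exp (- (B * real n / 2)) * exp (kp * real n) = exp (- ((B / 2 - kp) * real n))" by (simp add: exp_add[symmetric] algebra_simps)
   also have "... <= decay r n"
   proof -
    show ?thesis using B by (simp, intro mult_right_mono, auto)
   qed
   finally show ?thesis by simp
  qed
  thus ?case unfolding star_seq_law_ER p_def by (intro prob_bind_pmf_le) auto
 qed
qed

text \<open>With at most B n half-edges, a count c satisfies c! <= (B n)^c, and n - kp >= n / 2. The
  powers of n in factorials and weights cancel, and an exponential bound remains.\<close>

lemma col_factor_crude:
 fixes xi :: "('y::finite * 'y) pmf" assumes fin: "finite (set_pmf nu)" and kp: "kp > 0" and B: "B >= 1"
 shows "EX C. ALL n T. 2 * kp <= real n --> set_mset T <= pcols nu xi --> real (size T) <= B * real n -->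
  col_factor kp nu xi n T <= exp (C * real n)"
proof (intro exI allI impI)
 let ?P = "pcols nu xi"
 define C where "C = kp + (SUM k:?P. B * (ln (2 * B) + \<bar>ln (kp * edge_wt nu xi k)\<bar>)) / 2"
 fix n and T :: "('a * 'a * 'y * 'y) multiset"
 assume n: "2 * kp <= real n" and T: "set_mset T <= ?P" and size: "real (size T) <= B * real n"
 have n': "kp < real n" using n kp by linarith
 have tm: "ln (fact (count T k)) - real (count T k) * ln (kp * (real n - kp) * edge_wt nu xi k)
   <= B * (ln (2 * B) + \<bar>ln (kp * edge_wt nu xi k)\<bar>) * real n" if k: "k : ?P" for k
 proof -
  define D where "D = real (count T k)"
  have w: "kp * edge_wt nu xi k > 0" using k kp by (simp add: pcols_def)
  have nk: "real n - kp > 0" using n' by simp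
  have D: "0 <= D" "D <= B * real n" using size count_le_size[of T k] by (auto simp: D_def)
  have "ln (fact (count T k)) <= D * ln (B * real n)"
  proof (cases "count T k = 0")
   case False
   have "ln (fact (count T k) :: real) <= ln (real (count T k) ^ count T k)"
    using fact_le_power[of "count T k", where 'a = real] by (subst ln_le_cancel_iff) (use False in auto)
   also have "... = D * ln D" by (simp add: ln_realpow D_def)
   also have "... <= D * ln (B * real n)"
   proof -
    have "0 < D" using False by (simp add: D_def)
    thus ?thesis using D by simp
   qed
   finally show ?thesis .
  qed (simp add: D_def)
  moreover have "ln (kp * (real n - kp) * edge_wt nu xi k) = ln (real n - kp) + ln (kp * edge_wt nu xi k)"
   using ln_mult_pos[OF nk w] by (simp add: ac_simps)
  moreover have "ln (B * real n) <= ln (2 * B) + ln (real n - kp)"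
  proof -
   have "ln (B * real n) <= ln ((2 * B) * (real n - kp))" using n B n n' kp B by simp
   also have "... = ln (2 * B) + ln (real n - kp)" using nk B by (intro ln_mult_pos) auto
   finally show ?thesis .
  qed
  ultimately have "ln (fact (count T k)) - D * ln (kp * (real n - kp) * edge_wt nu xi k)
    <= D * (ln (2 * B) + ln (real n - kp)) - D * (ln (real n - kp) + ln (kp * edge_wt nu xi k))" using D by (smt (verit) mult_left_mono)
  also have "... = D * (ln (2 * B) - ln (kp * edge_wt nu xi k))" by (simp add: algebra_simps)
  also have "... <= D * (ln (2 * B) + \<bar>ln (kp * edge_wt nu xi k)\<bar>)" using D by (intro mult_left_mono) auto
  also have "... <= (B * real n) * (ln (2 * B) + \<bar>ln (kp * edge_wt nu xi k)\<bar>)" using D B by (intro mult_right_mono) auto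
  finally show ?thesis by (simp add: D_def ac_simps)
 qed
 have "ln (col_factor kp nu xi n T) <= kp * real n + 0 + (SUM k:?P. B * (ln (2 * B) + \<bar>ln (kp * edge_wt nu xi k)\<bar>) * real n) / 2" unfolding ln_col_factor(2)[OF fin kp n' T] using n' kp tm by (intro add_mono divide_right_mono sum_mono mult_nonneg_nonpos, auto)
 also have "... = C * real n" by (simp add: C_def sum_distrib_right[symmetric] distrib_right)
 finally show "col_factor kp nu xi n T <= exp (C * real n)" using ln_col_factor(1)[OF fin kp n' T] by (metis exp_le_cancel_iff exp_ln)
qed

lemma exp_deg_integrable:
 fixes nu :: "'x pmf" and xi :: "('y * 'y) pmf" assumes kp: "kp > 0"
 shows "integrable (measure_pmf (poi_law kp nu xi)) (%ta. exp (c * real (deg ta)))"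
proof -
 have "integrable (Poi kp) (%d. exp (c * real d))"
 proof -
  have eq: "(%d. pmf (Poi kp) d *\<^sub>R exp (c * real d)) = (%d. exp (- kp) * ((kp * exp c) ^ d /\<^sub>R fact d))"
   using kp by (auto simp: pmf_Poi power_mult_distrib exp_of_nat_mult[symmetric] fun_eq_iff field_simps)
  have "summable (%d. exp (- kp) * ((kp * exp c) ^ d /\<^sub>R fact d))" by (intro summable_mult summable_exp_generic)
  hence "integrable (count_space UNIV) (%d. pmf (Poi kp) d *\<^sub>R exp (c * real d))" unfolding eq[symmetric] by (subst integrable_count_space_nat_iff, simp)
  thus ?thesis unfolding measure_pmf_eq_density by (subst integrable_density) auto
 qed
 hence "integrable (map_pmf deg (poi_law kp nu xi)) (%d. exp (c * real d))" by (simp only: map_star_deg_true_law)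
 thus ?thesis by simp
qed

definition big_deg :: "nat => ('x, 'y) star => real" where "big_deg K ta = (if deg ta > K then real (deg ta) else 0)"

lemma big_deg_le: "0 <= big_deg K ta" "big_deg K ta <= real (deg ta)" by (auto simp: big_deg_def)

text \<open>For every slope \<open>c\<close> the exponential moment tends to 1 as \<open>K\<close>
  grows, by dominated convergence. An arbitrarily large slope is therefore affordable at the price
  of a factor e per vertex.\<close>

lemma exp_big_deg:
 fixes nu :: "'x pmf" and xi :: "('y * 'y) pmf" assumes kp: "kp > 0" and c: "c >= 0"
 shows "integrable (measure_pmf (poi_law kp nu xi)) (%ta. exp (c * big_deg K ta))"
  and "EX K0. ALL K>=K0. expect (poi_law kp nu xi) (%ta. exp (c * big_deg K ta)) <= exp 1"
proof -
 let ?et = "poi_law kp nu xi"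
 have le: "norm (exp (c * big_deg K ta)) <= norm (exp (c * real (deg ta)))" for K and ta :: "('x, 'y) star"
  using c by (simp add: mult_left_mono big_deg_le)
 show "integrable (measure_pmf ?et) (%ta. exp (c * big_deg K ta))" for K
  by (rule Bochner_Integration.integrable_bound[OF exp_deg_integrable[OF kp, of nu xi c]]) (use le in auto)
 have "(%K. expect ?et (%ta. exp (c * big_deg K ta))) ----> expect ?et (%ta. 1)"
 proof (rule integral_dominated_convergence[where w = "%ta. exp (c * real (deg ta))"])
  show "integrable (measure_pmf ?et) (%ta. exp (c * real (deg ta)))" by (rule exp_deg_integrable[OF kp])
  show "AE ta in measure_pmf ?et. (%K. exp (c * big_deg K ta)) ----> 1"
  proof (rule AE_I2)
   fix ta :: "('x, 'y) star"
   show "(%K. exp (c * big_deg K ta)) ----> 1"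
    by (rule tendsto_eventually, rule eventually_mono[OF eventually_ge_at_top[of "deg ta"]]) (auto simp: big_deg_def)
  qed
  show "AE ta in measure_pmf ?et. norm (exp (c * big_deg K ta)) <= exp (c * real (deg ta))" for K using le by simp
 qed auto
 hence "\<forall>\<^sub>F K in sequentially. expect ?et (%ta. exp (c * big_deg K ta)) < exp 1" by (rule order_tendstoD(2)) simp
 thus "EX K0. ALL K>=K0. expect ?et (%ta. exp (c * big_deg K ta)) <= exp 1" by (auto simp: eventually_sequentially intro: less_imp_le)
qed

text \<open>The change of measure behind the upper bounds: where the colour factor is at most
  \<open>C\<close>, the Erdos-Renyi law is at most \<open>C\<close> times the i.i.d. star
  law.\<close>

lemma star_seq_ER_dominated:
 fixes nu :: "'x pmf" and xi :: "('y::finite * 'y) pmf" assumes kp: "0 < kp" "kp < real n" and C: "C >= 0"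
  and bound: "!!t. t : S ==> set_mset (seq_cols n t) <= pcols nu xi ==> col_factor kp nu xi n (seq_cols n t) <= C" shows "prob (ER_law kp nu xi n) S
  <= C * prob (Pi_pmf {1..n} undefined (%_. poi_law kp nu xi)) S"
proof (rule prob_dominated[OF C])
 fix t assume t: "t : S"
 show "pmf (ER_law kp nu xi n) t <= C * pmf (Pi_pmf {1..n} undefined (%_. poi_law kp nu xi)) t"
 proof (cases "t : set_pmf (ER_law kp nu xi n)")
  case True
  note u = star_seq_upper[OF kp True]
  have "pmf (ER_law kp nu xi n) t <= (PROD v:{1..n}. pmf (poi_law kp nu xi) (t v)) * col_factor kp nu xi n (seq_cols n t)" by (rule u(1))
  also have "... <= (PROD v:{1..n}. pmf (poi_law kp nu xi) (t v)) * C" using u(4) t by (intro mult_left_mono bound prod_nonneg) (auto simp: pcols_def)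
  finally show ?thesis using u(5) by (simp add: mult.commute, subst pmf_Pi', auto)
 qed (use C in \<open>simp add: set_pmf_iff\<close>)
qed

lemma eventually_exp_union: assumes "r < r'" and "Ev n. prob (P n) (A n) <= decay r' n" and "Ev n. prob (P n) (B n) <= decay r' n"
  and S: "!!n. S n <= A n \<union> B n" shows "Ev n. prob (P n) (S n) <= decay r n"
proof -
 have "Ev n. (SUM b:{True, False}. prob (P n) (if b then A n else B n)) <= decay r n"
 proof (rule eventually_exp_sum_le[OF _ assms(1)])
  show "Ev n. prob (P n) (if b then A n else B n) <= decay r' n" for b using assms(2,3) by (cases b) simp_all
 qed simp
 thus ?thesis
 proof eventually_elim
  case (elim n)
  have "prob (P n) (S n) <= prob (P n) (A n \<union> B n)" using S by (intro measure_pmf.finite_measure_mono) auto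
  also have "... <= prob (P n) (A n) + prob (P n) (B n)" by (rule measure_Un_le) auto
  finally show ?case using elim by simp
 qed
qed

text \<open>The slope is chosen first, to beat the crude exponent of the colour factor, and the
  level \<open>K\<close> afterwards. So the half-edges at vertices of degree above \<open>K\<close>
  exceed a proportion \<open>de\<close> only with probability below any prescribed exponential
  rate.\<close>

lemma big_deg_tail:
 fixes nu :: "'x pmf" and xi :: "('y::finite * 'y) pmf" assumes fin: "finite (set_pmf nu)" and kp: "kp > 0" and de: "de > 0"
 shows "EX K0. ALL K>=K0. Ev n. prob (ER_law kp nu xi n)
  {t. de * real n <= (SUM v:{1..n}. big_deg K (t v))} <= decay r n"
proof -
 let ?P = "%n. ER_law kp nu xi n" and ?et = "poi_law kp nu xi"
 obtain B where B: "B >= 1" and evB: "Ev n.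
  prob (?P n) {t. B * real n < real (size (seq_cols n t))} <= decay (r + 1) n" using total_degree_tail[OF kp, of nu xi "r + 1"] by blast
 obtain C where C: "!!n T. 2 * kp <= real n ==> set_mset T <= pcols nu xi ==> real (size T) <= B * real n ==>
  col_factor kp nu xi n T <= exp (C * real n)" using col_factor_crude[OF fin kp B] by blast
 \<comment> \<open>The exponents from the colour factor, the moment and Markov's inequality add up
   to C + 1 - c de, which has to be at most - (r + 1).\<close>
 define c where "c = max 0 ((C + r + 2) / de)"
 have c: "c >= 0" "C + r + 2 <= c * de" using de by (auto simp: c_def field_simps max_def)
 obtain K0 where K0: "!!K. K >= K0 ==> expect ?et (%ta. exp (c * big_deg K ta)) <= exp 1" using exp_big_deg(2)[OF kp c(1), of nu xi] by blast
 obtain n0 :: nat where n0: "real n0 >= 2 * kp" using real_arch_simple by blast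
 show ?thesis
 proof (intro exI allI impI)
  fix K assume K: "K >= K0"
  let ?S = "%n. {t :: nat => ('x, 'y) star. de * real n <= (SUM v:{1..n}. big_deg K (t v))}"
  let ?G = "%n. {t :: nat => ('x, 'y) star. real (size (seq_cols n t)) <= B * real n}"
  have ev1: "Ev n. prob (?P n) (?S n \<inter> ?G n) <= decay (r + 1) n" using eventually_ge_at_top[of n0]
  proof eventually_elim
   case (elim n)
   have n: "2 * kp <= real n" "kp < real n" using elim n0 kp by linarith+
   have "prob (?P n) (?S n \<inter> ?G n) <= exp (C * real n) * prob (Pi_pmf {1..n} undefined (%_. ?et)) (?S n \<inter> ?G n)"
    by (rule star_seq_ER_dominated[OF kp n(2)]) (use C[OF n(1)] in auto)
   also have "... <= exp (C * real n) * prob (Pi_pmf {1..n} undefined (%_. ?et)) {t. c * (de * real n) <= (SUM v:{1..n}. c * big_deg K (t v))}"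
    using c(1) by (intro mult_left_mono measure_pmf.finite_measure_mono) (auto simp: sum_distrib_left[symmetric] intro!: mult_left_mono)
   also have "... <= exp (C * real n) * (exp (- (c * (de * real n))) * (expect ?et (%ta. exp (c * big_deg K ta))) ^ card {1..n})"
    by (intro mult_left_mono chernoff_Pi_pmf exp_big_deg(1)[OF kp c(1)]) auto
   also have "... <= exp (C * real n) * (exp (- (c * (de * real n))) * exp 1 ^ card {1..n})"
    using K0[OF K] by (intro mult_left_mono power_mono Bochner_Integration.integral_nonneg) auto
   also have "... = exp (- ((c * de - C - 1) * real n))" by (simp add: exp_of_nat_mult[symmetric] exp_add[symmetric] algebra_simps)
   also have "... <= decay (r + 1) n"
   proof -
    show ?thesis using c(2) by (simp, intro mult_right_mono, auto)
   qed
   finally show ?case .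
  qed
  show "Ev n. prob (?P n) (?S n) <= decay r n" by (rule eventually_exp_union[OF _ ev1 evB]) auto
 qed
qed

section \<open>Weak neighbourhoods of the empirical measure and the colour means\<close>

definition seq_ball :: "nat => 'a set => real => 'a pmf => (nat => 'a) set" where
 "seq_ball n F ep mu = {t. ALL a:F. \<bar>pmf (emp n t) a - pmf mu a\<bar> < ep}"

definition colmean :: "('x, 'y) star pmf => 'x * 'x * 'y * 'y => real" where "colmean mu k = expect mu (%ta. real (count (cols ta) k))"

lemma count_cols_le: "count (cols ta) k <= deg ta" using count_le_size[of "cols ta" k] by simp

lemma integrable_star_deg: assumes "mean_deg mu < \<infinity>" shows "integrable (measure_pmf mu) (%ta. real (deg ta))"
 by (rule integrableI_nonneg) (use assms in \<open>auto simp: mean_deg_def ennreal_of_nat_eq_real_of_nat\<close>)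

lemma mean_deg_expectation: assumes "mean_deg mu < \<infinity>" shows "mean_deg mu = ennreal (expect mu (%ta. real (deg ta)))"
 unfolding mean_deg_def ennreal_of_nat_eq_real_of_nat by (rule nn_integral_eq_integral) (use integrable_star_deg[OF assms] in auto)

lemma integrable_le_star_deg: assumes "integrable (measure_pmf mu) (%ta. real (deg ta))" "!!ta. \<bar>g ta\<bar> <= real (deg ta)"
 shows "integrable (measure_pmf mu) g" by (rule Bochner_Integration.integrable_bound[OF assms(1)]) (use assms(2) in auto)

lemma expectation_big_deg: assumes int: "integrable (measure_pmf mu) (%ta. real (deg ta))" and de: "de > 0"
 shows "EX K0. ALL K>=K0. expect mu (big_deg K) < de"
proof -
 have "(%K. expect mu (big_deg K)) ----> expect mu (%_. 0)"
 proof (rule integral_dominated_convergence[where w = "%ta. real (deg ta)"])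
  show "AE ta in mu. (%K. big_deg K ta) ----> 0"
  proof (rule AE_I2)
   fix ta
   show "(%K. big_deg K ta) ----> 0" by (rule tendsto_eventually, rule eventually_mono[OF eventually_ge_at_top[of "deg ta"]]) (auto simp: big_deg_def)
  qed
 qed (use int in \<open>auto simp: big_deg_def\<close>)
 hence "\<forall>\<^sub>F K in sequentially. expect mu (big_deg K) < de" by (intro order_tendstoD(2)) (use de in auto)
 thus ?thesis by (simp add: eventually_sequentially)
qed

lemma expectation_truncate:
 fixes mu :: "('x::finite, 'y::finite) star pmf" assumes int: "integrable (measure_pmf mu) (%ta. real (deg ta))"
  and g: "!!ta. 0 <= g ta" "!!ta. g ta <= real (deg ta)"
 shows "\<bar>expect mu g - (SUM ta:{ta. deg ta <= K}. g ta * pmf mu ta)\<bar> <= expect mu (big_deg K)"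
proof -
 let ?F = "{ta :: ('x, 'y) star. deg ta <= K}"
 have ig: "integrable (measure_pmf mu) (%ta. if ta : A then g ta else 0)" for A by (rule integrable_le_star_deg[OF int]) (use g in auto)
 have ib: "integrable mu (big_deg K)" by (rule integrable_le_star_deg[OF int]) (auto simp: big_deg_def)
 have "expect mu g = expect mu (%ta. (if ta : ?F then g ta else 0) + (if ta : - ?F then g ta else 0))"
  by (intro Bochner_Integration.integral_cong) auto
 also have "... = expect mu (%ta. if ta : ?F then g ta else 0) + expect mu (%ta. if ta : - ?F then g ta else 0)"
  by (rule Bochner_Integration.integral_add[OF ig ig])
 also have "expect mu (%ta. if ta : ?F then g ta else 0) = (SUM ta:?F. (if ta : ?F then g ta else 0) * pmf mu ta)"
  by (rule expectation_finite_support[OF finite_stars]) auto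
 finally have "expect mu g - (SUM ta:?F. g ta * pmf mu ta) = expect mu (%ta. if ta : - ?F then g ta else 0)" by simp
 moreover have "0 <= expect mu (%ta. if ta : - ?F then g ta else 0)" by (rule Bochner_Integration.integral_nonneg) (use g in auto)
 moreover have "expect mu (%ta. if ta : - ?F then g ta else 0) <= expect mu (big_deg K)"
  by (rule integral_mono[OF ig ib]) (use g in \<open>auto simp: big_deg_def\<close>)
 ultimately show ?thesis by simp
qed

lemma count_seq_cols: "real (count (seq_cols n t) k) = (SUM v:{1..n}. real (count (cols (t v)) k))" by (simp add: seq_cols_def count_sum)

lemma colmean_empirical: "n >= 1 ==> colmean (emp n t) k = freq n t k" unfolding colmean_def by (simp add: expectation_empirical count_seq_cols)

lemma integrable_empirical:
 fixes g :: "'a => real" shows "n >= 1 ==> integrable (measure_pmf (emp n t)) g"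
 by (rule integrable_measure_pmf_finite) (simp add: empirical_measure_def)

text \<open>Colour means are unbounded functionals and not weakly continuous. Outside an event of
  negligible probability, however, degrees above \<open>K\<close> contribute less than de / 4, and
  below \<open>K\<close> only finitely many atoms matter.\<close>

lemma colmean_concentration:
 fixes mu :: "('x::finite, 'y::finite) star pmf"
 assumes kp: "kp > 0" and mu: "mean_deg mu < \<infinity>" and de: "de > 0" shows "EX F ep. finite F & ep > 0 & (Ev n. prob (ER_law kp nu xi n)
  {t : seq_ball n F ep mu. EX k. de < \<bar>freq n t k - colmean mu k\<bar>} <= decay r n)"
proof -
 note int = integrable_star_deg[OF mu]
 have fin: "finite (set_pmf nu)" by simp
 obtain K1 where K1: "!!K. K >= K1 ==> Ev n. prob (ER_law kp nu xi n)
  {t. (de / 4) * real n <= (SUM v:{1..n}. big_deg K (t v))} <= decay r n" using big_deg_tail[OF fin kp, of "de / 4" xi r] de by auto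
 obtain K2 where K2: "!!K. K >= K2 ==> expect mu (big_deg K) < de / 4" using expectation_big_deg[OF int, of "de / 4"] de by auto
 define K where "K = max K1 K2"
 let ?F = "{ta :: ('x, 'y) star. deg ta <= K}"
 have F: "finite ?F" by (rule finite_stars)
 \<comment> \<open>A colour occurs at most \<open>K\<close> times in each of the
   \<open>card ?F\<close> stars, so the error on \<open>?F\<close> is at most de / 4; with the two
   tails the total stays below \<open>de\<close>.\<close>
 define ep where "ep = de / 4 / (real K + 1) / (real (card ?F) + 1)"
 have ep: "ep > 0" unfolding ep_def using de by simp
 have ep': "real (card ?F) * (real K * ep) <= de / 4"
 proof -
  have "real (card ?F) * (real K * ep) <= (real (card ?F) + 1) * ((real K + 1) * ep)" using ep by (intro mult_mono) auto
  also have "... = de / 4"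
  proof -
   have "a * (b * (de / 4 / b / a)) = de / 4" if "a > 0" "b > 0" for a b :: real using that by simp
   from this[of "real (card ?F) + 1" "real K + 1"] show ?thesis unfolding ep_def by simp
  qed
  finally show ?thesis .
 qed
 show ?thesis
 proof (intro exI conjI)
  have "Ev n. prob (ER_law kp nu xi n)
  {t. (de / 4) * real n <= (SUM v:{1..n}. big_deg K (t v))} <= decay r n" by (rule K1) (simp add: K_def)
  thus "Ev n. prob (ER_law kp nu xi n)
  {t : seq_ball n ?F ep mu. EX k. de < \<bar>freq n t k - colmean mu k\<bar>} <= decay r n" using eventually_ge_at_top[of 1]
  proof eventually_elim
   case (elim n)
   have "(de / 4) * real n <= (SUM v:{1..n}. big_deg K (t v))"
    if t: "t : seq_ball n ?F ep mu" and k: "de < \<bar>freq n t k - colmean mu k\<bar>" for t k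
   proof (rule ccontr)
    assume neg: "~ ?thesis"
    let ?L = "emp n t" and ?g = "%ta :: ('x, 'y) star. real (count (cols ta) k)"
    have 1: "\<bar>colmean ?L k - (SUM ta:?F. ?g ta * pmf ?L ta)\<bar> < de / 4" using neg elim(2) expectation_truncate[of ?L ?g K] integrable_empirical[OF elim(2)] count_cols_le[of _ k] unfolding colmean_def by (force simp: expectation_empirical field_simps)
    have "expect mu (big_deg K) < de / 4" by (rule K2) (simp add: K_def)
    hence 2: "\<bar>colmean mu k - (SUM ta:?F. ?g ta * pmf mu ta)\<bar> < de / 4" using expectation_truncate[OF int, of ?g K] count_cols_le[of _ k]
     unfolding colmean_def by fastforce
    have "\<bar>(SUM ta:?F. ?g ta * pmf ?L ta) - (SUM ta:?F. ?g ta * pmf mu ta)\<bar> <= (SUM ta:?F. \<bar>?g ta * (pmf ?L ta - pmf mu ta)\<bar>)" unfolding sum_subtractf[symmetric] right_diff_distrib[symmetric] by simp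
    also have "... <= real (card ?F) * (real K * ep)"
    proof (rule sum_bounded_above)
     fix ta :: "('x, 'y) star" assume ta: "ta : ?F"
     have "count (cols ta) k <= K" using ta count_cols_le[of ta k] by simp
     moreover have "\<bar>pmf ?L ta - pmf mu ta\<bar> <= ep" using t ta unfolding seq_ball_def by (blast intro: less_imp_le)
     ultimately show "\<bar>?g ta * (pmf ?L ta - pmf mu ta)\<bar> <= real K * ep" unfolding abs_mult by (intro mult_mono) auto
    qed
    finally have "\<bar>colmean ?L k - colmean mu k\<bar> < de" using 1 2 ep' by linarith
    thus False using k by (simp add: colmean_empirical[OF elim(2)])
   qed
   thus ?case by (intro order_trans[OF measure_pmf.finite_measure_mono elim(1)], simp_all, blast)
  qed
 qed (use F ep in auto)
qed

text \<open>Sanov's bound near \<open>mu\<close>: exponential Markov inequality with the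
  log-likelihood ratio on the finite set \<open>F\<close> as test function f. Where
  \<open>mu\<close> has mass, f mu - (exp f - 1) et equals \<open>kl_term\<close>, so the exponent
  is essentially the partial entropy. At atoms of \<open>F\<close> without mass the ratio would be
  minus infinity and is replaced by - C.\<close>

lemma iid_local_upper:
 fixes mu et :: "'a pmf" assumes F: "finite F" and r: "r < (SUM a:F. kl_term mu et a)" and sub: "set_pmf mu <= set_pmf et"
 shows "EX ep>0. ALL n>=1. prob (Pi_pmf {1..n} d (%_. et)) (seq_ball n F ep mu) <= decay r n"
proof -
 define s where "s = (SUM a:F. kl_term mu et a)"
 \<comment> \<open>Large enough that the atoms where the test function is - C lose at most (s - r) /
   2 altogether.\<close>
 define C where "C = ln (2 * (real (card F) + 1) / (s - r))"
 have sr: "s - r > 0" using r by (simp add: s_def)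
 have expC: "real (card F) * exp (- C) <= (s - r) / 2" using sr by (simp add: C_def exp_minus field_simps)
 define f where "f a = (if a : F then if pmf mu a > 0 then ln (pmf mu a / pmf et a) else - C else 0)" for a
 define A where "A = (SUM a:F. \<bar>f a\<bar>)"
 have A: "A >= 0" by (auto simp: A_def intro: sum_nonneg)
 define ep where "ep = (s - r) / 2 / (A + 1)"
 have ep: "ep > 0" using sr A by (simp add: ep_def)
 have epA: "ep * A <= (s - r) / 2"
 proof -
  have "ep * A <= ep * (A + 1)" using ep by simp
  also have "... = (s - r) / 2"
  proof -
   have "x / y * y = x" if "y ~= 0" for x y :: real using that by simp
   from this[of "A + 1" "(s - r) / 2"] show ?thesis using A unfolding ep_def by simp
  qed
  finally show ?thesis .
 qed
 have "exp (f a) : insert 1 ((%a. exp (f a)) ` F)" for a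
 proof (cases "a : F")
  case False
  thus ?thesis by (simp add: f_def)
 qed blast
 hence "range (%a. exp (f a)) <= insert 1 ((%a. exp (f a)) ` F)" by blast
 hence bdd: "bounded (range (%a. exp (f a)))" using F by (meson bounded_subset finite_imageI finite_imp_bounded finite_insert)
 then obtain b where b: "!!a. \<bar>exp (f a)\<bar> <= b" unfolding bounded_real by auto
 have int: "integrable et (%a. exp (f a))" by (rule measure_pmf.integrable_const_bound[where B = b]) (use b in auto)
 have Eexp: "expect et (%a. exp (f a)) = 1 + (SUM a:F. (exp (f a) - 1) * pmf et a)"
 proof -
  have "expect et (%a. exp (f a)) - 1 = expect et (%a. exp (f a) - 1)" using int by simp
  also have "... = (SUM a:F. (exp (f a) - 1) * pmf et a)" by (rule expectation_finite_support[OF F]) (simp add: f_def)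
  finally show ?thesis by simp
 qed
 have tm: "kl_term mu et a - exp (- C) <= f a * pmf mu a - (exp (f a) - 1) * pmf et a" if a: "a : F" for a
 proof (cases "pmf mu a > 0")
  case True
  hence "pmf et a > 0" using sub by (auto simp: set_pmf_iff less_le)
  hence "f a * pmf mu a - (exp (f a) - 1) * pmf et a = kl_term mu et a" using True a by (simp add: kl_term_def f_def algebra_simps)
  thus ?thesis by simp
 next
  case False
  hence "pmf mu a = 0" by (simp add: less_le)
  moreover have "exp (- C) * pmf et a <= exp (- C) * 1" by (intro mult_left_mono pmf_le_1) auto
  ultimately show ?thesis using a by (simp add: kl_term_def f_def algebra_simps)
 qed
 have gap: "r + ep * A <= (SUM a:F. f a * pmf mu a) - (SUM a:F. (exp (f a) - 1) * pmf et a)"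
 proof -
  have "(SUM a:F. kl_term mu et a - exp (- C)) <= (SUM a:F. f a * pmf mu a - (exp (f a) - 1) * pmf et a)" by (rule sum_mono) (rule tm)
  hence "s - real (card F) * exp (- C) <= (SUM a:F. f a * pmf mu a) - (SUM a:F. (exp (f a) - 1) * pmf et a)" by (simp add: s_def sum_subtractf)
  thus ?thesis using expC epA by simp
 qed
 show ?thesis
 proof (intro exI conjI allI impI)
  fix n :: nat assume n: "n >= 1"
  let ?m = "(SUM a:F. f a * pmf mu a) - ep * A"
  have "prob (Pi_pmf {1..n} d (%_. et)) (seq_ball n F ep mu) <= prob (Pi_pmf {1..n} d (%_. et)) {t. real n * ?m <= (SUM v:{1..n}. f (t v))}"
  proof (rule measure_pmf.finite_measure_mono)
   show "seq_ball n F ep mu <= {t. real n * ?m <= (SUM v:{1..n}. f (t v))}"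
   proof
    fix t assume t: "t : seq_ball n F ep mu"
    let ?L = "emp n t"
    have eq: "(SUM v:{1..n}. f (t v)) = real n * (SUM a:F. f a * pmf ?L a)" using n by (simp add: sum_pmf_empirical[OF n F], intro sum.cong, auto simp: f_def)
    have "(SUM a:F. f a * pmf mu a) - (SUM a:F. f a * pmf ?L a) <= (SUM a:F. \<bar>f a\<bar> * ep)"
     unfolding sum_subtractf[symmetric] right_diff_distrib[symmetric]
    proof (rule sum_mono)
     fix a assume "a : F"
     hence "\<bar>f a\<bar> * \<bar>pmf mu a - pmf ?L a\<bar> <= \<bar>f a\<bar> * ep" using t by (intro mult_left_mono, auto, auto simp: seq_ball_def less_imp_le)
     thus "f a * (pmf mu a - pmf ?L a) <= \<bar>f a\<bar> * ep" by (simp add: abs_mult[symmetric])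
    qed
    also have "... = ep * A" by (simp add: A_def sum_distrib_left mult.commute)
    finally have "?m <= (SUM a:F. f a * pmf ?L a)" by simp
    thus "t : {t. real n * ?m <= (SUM v:{1..n}. f (t v))}" unfolding mem_Collect_eq eq by (rule mult_left_mono) simp
   qed
  qed simp
  also have "... <= exp (- (real n * ?m)) * (expect et (%a. exp (f a))) ^ card {1..n}" by (rule chernoff_Pi_pmf[OF _ int]) simp
  also have "... <= exp (- (real n * ?m)) * exp (SUM a:F. (exp (f a) - 1) * pmf et a) ^ card {1..n}"
   by (intro mult_left_mono power_mono Bochner_Integration.integral_nonneg) (auto simp: Eexp intro: exp_ge_add_one_self)
  also have "... = exp (- (real n * (?m - (SUM a:F. (exp (f a) - 1) * pmf et a))))"
   by (simp add: exp_of_nat_mult[symmetric] exp_add[symmetric] algebra_simps)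
  also have "... <= decay r n"
  proof -
   have "real n * r <= real n * (?m - (SUM a:F. (exp (f a) - 1) * pmf et a))" using gap by (intro mult_left_mono) auto
   thus ?thesis by (simp add: mult.commute)
  qed
  finally show "prob (Pi_pmf {1..n} d (%_. et)) (seq_ball n F ep mu) <= decay r n" .
 qed (rule ep)
qed

text \<open>The rate as the counting yields it, relative to the Poisson law of fixed mean
  \<open>kp\<close>; \<open>rate_ER_eq\<close> identifies it with \<open>rate_ER\<close>.\<close>

definition ER_rate :: "real => 'x pmf => ('y * 'y) pmf => ('x, 'y) star pmf => ereal" where "ER_rate kp nu xi mu =
  (if mean_deg mu < \<infinity> & (ALL k. colmean mu (rev_col k) = colmean mu k) & kl_finite mu (poi_law kp nu xi)
   then ereal (kl_real mu (poi_law kp nu xi) - col_div kp nu xi (colmean mu) / 2) else \<infinity>)"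

lemma seq_ball_mono: "F <= F' ==> ep' <= ep ==> seq_ball n F' ep' mu <= seq_ball n F ep mu" by (force simp: seq_ball_def)

lemma prob_mono_AE_pmf: "(!!t. t : set_pmf P ==> t : A ==> t : B) ==> prob P A <= prob P B"
 by (rule measure_pmf.finite_measure_mono_AE) (auto simp: AE_measure_pmf_iff)

text \<open>Lower semicontinuity of the mean degree: a partial sum over finitely many stars already
  exceeds \<open>B\<close>, and still does so on a neighbourhood.\<close>

lemma mean_deg_infinite_ball:
 fixes mu :: "('x::finite, 'y::finite) star pmf" assumes B: "ennreal B < mean_deg mu" "B >= 0"
 shows "EX F ep. finite F & ep > 0 & (ALL n>=1. ALL t:seq_ball n F ep mu. B * real n < real (size (seq_cols n t)))"
proof -
 have "ennreal B < (SUP j. ennreal (SUM a:{a. deg a <= j}. real (deg a) * pmf mu a))"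
  using B(1) unfolding mean_deg_def nn_integral_moment_SUP[OF finite_stars] .
 then obtain j where "ennreal B < ennreal (SUM a:{a. deg a <= j}. real (deg a) * pmf mu a)" by (auto simp: less_SUP_iff)
 hence j: "B < (SUM a:{a. deg a <= j}. real (deg a) * pmf mu a)" using B(2) by (simp add: ennreal_less_iff)
 let ?F = "{a :: ('x, 'y) star. deg a <= j}"
 define s where "s = (SUM a:?F. real (deg a) * pmf mu a) - B"
 define A where "A = (SUM a:?F. real (deg a))"
 have s: "s > 0" using j by (simp add: s_def)
 have A: "A >= 0" by (auto simp: A_def intro: sum_nonneg)
 define ep where "ep = s / (A + 1)"
 have ep: "ep > 0" using s A by (simp add: ep_def)
 have epA: "ep * A < s" using s A by (simp add: ep_def field_simps)
 show ?thesis
 proof (intro exI conjI allI impI ballI)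
  fix n :: nat and t assume n: "n >= 1" and t: "t : seq_ball n ?F ep mu"
  let ?L = "emp n t"
  have "(SUM a:?F. real (deg a) * pmf mu a) - (SUM a:?F. real (deg a) * pmf ?L a) <= (SUM a:?F. real (deg a) * ep)"
   unfolding sum_subtractf[symmetric] right_diff_distrib[symmetric]
  proof (intro sum_mono mult_left_mono)
   fix a assume "a : ?F"
   hence "\<bar>pmf ?L a - pmf mu a\<bar> < ep" using t unfolding seq_ball_def by blast
   thus "pmf mu a - pmf ?L a <= ep" by simp
  qed simp
  also have "... = ep * A" by (simp add: A_def sum_distrib_left mult.commute)
  finally have "B < (SUM a:?F. real (deg a) * pmf ?L a)" using epA by (simp add: s_def)
  also have "... = (SUM v:{1..n}. if t v : ?F then real (deg (t v)) else 0) / real n" by (rule sum_pmf_empirical[OF n finite_stars])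
  also have "... <= (SUM v:{1..n}. real (deg (t v))) / real n" by (intro divide_right_mono sum_mono) auto
  finally show "B * real n < real (size (seq_cols n t))" unfolding seq_cols_total size_total_cols using n by (simp add: star_deg_def field_simps)
 qed (use finite_stars ep in auto)
qed

text \<open>An infinite mean degree requires too many edges, asymmetric colour means contradict the
  symmetry of a graph, and a star of probability 0 never occurs. In the main case the i.i.d. bound
  is multiplied by the colour factor, which is under control as long as the colour means are close
  to those of \<open>mu\<close>.\<close>

lemma ER_local_upper:
 fixes mu :: "('x::finite, 'y::finite) star pmf"
 assumes kp: "kp > 0" and r: "ereal r < ER_rate kp nu xi mu" shows "EX F ep. finite F & ep > 0 & (Ev n.
  prob (ER_law kp nu xi n) (seq_ball n F ep mu) <= decay r n)"
proof -
 let ?P = "%n. ER_law kp nu xi n" and ?et = "poi_law kp nu xi"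
 obtain n0 :: nat where n0: "real n0 >= 2 * kp + 1" using real_arch_simple by blast
 have big: "kp < real n" "n >= 1" if "n >= n0" for n using that n0 kp by linarith+
 consider (inf) "mean_deg mu = \<infinity>" | (asym) "mean_deg mu < \<infinity>" "~ (ALL k. colmean mu (rev_col k) = colmean mu k)"
  | (sing) "~ set_pmf mu <= set_pmf ?et"
  | (main) "mean_deg mu < \<infinity>" "ALL k. colmean mu (rev_col k) = colmean mu k" "set_pmf mu <= set_pmf ?et"
 proof -
  show thesis using that by (metis infinity_ennreal_def less_top)
 qed
 thus ?thesis
 proof cases
  case inf
  obtain B where B: "B >= 1" "Ev n. prob (?P n) {t. B * real n < real (size (seq_cols n t))} <= decay r n" using total_degree_tail[OF kp] by blast
  obtain F ep where F: "finite F" "ep > 0" "ALL n>=1. ALL t:seq_ball n F ep mu. B * real n < real (size (seq_cols n t))"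
   using mean_deg_infinite_ball[of B mu] inf B(1) by auto
  have "Ev n. prob (?P n) (seq_ball n F ep mu) <= decay r n" using B(2) eventually_ge_at_top[of 1]
  proof eventually_elim
   case (elim n)
   have "prob (?P n) (seq_ball n F ep mu) <= prob (?P n) {t. B * real n < real (size (seq_cols n t))}"
    using F(3) elim(2) by (intro measure_pmf.finite_measure_mono) auto
   thus ?case using elim(1) by simp
  qed
  thus ?thesis using F by blast
 next
  case asym
  then obtain k where k: "colmean mu (rev_col k) ~= colmean mu k" by blast
  \<comment> \<open>The counts of a colour and its reversal agree in a graph, so they cannot be
    within \<open>de\<close> of both means, which lie \<open>3 * de\<close> apart.\<close>
  define de where "de = \<bar>colmean mu (rev_col k) - colmean mu k\<bar> / 3"
  have de: "de > 0" using k by (simp add: de_def)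
  obtain F ep where F: "finite F" "ep > 0" and ev: "Ev n. prob (?P n)
  {t : seq_ball n F ep mu. EX k. de < \<bar>freq n t k - colmean mu k\<bar>} <= decay r n" using colmean_concentration[OF kp asym(1) de] by blast
  have "Ev n. prob (?P n) (seq_ball n F ep mu) <= decay r n" using ev eventually_ge_at_top[of n0]
  proof eventually_elim
   case (elim n)
   have "prob (?P n) (seq_ball n F ep mu) <= prob (?P n)
    {t : seq_ball n F ep mu. EX k. de < \<bar>freq n t k - colmean mu k\<bar>}"
   proof (rule prob_mono_AE_pmf)
    fix t assume t: "t : set_pmf (?P n)" "t : seq_ball n F ep mu"
    have "count (seq_cols n t) (rev_col k) = count (rev_cols (seq_cols n t)) (rev_col k)" by (insert star_seq_upper(2)[OF kp big(1)[OF elim(2)] t(1)], simp)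
    also have "... = count (seq_cols n t) k" by (rule count_image_mset_inj) (metis injI rev_col_rev_col)
    finally have "count (seq_cols n t) (rev_col k) = count (seq_cols n t) k" .
    hence "de < \<bar>freq n t k - colmean mu k\<bar>
      | de < \<bar>real (count (seq_cols n t) (rev_col k)) / real n - colmean mu (rev_col k)\<bar>"
    proof -
     assume "count (seq_cols n t) (rev_col k) = count (seq_cols n t) k"
     hence eqr: "real (count (seq_cols n t) (rev_col k)) / real n = freq n t k" by simp
     have "\<bar>colmean mu (rev_col k) - colmean mu k\<bar> = 3 * de" by (simp add: de_def)
     thus ?thesis using de unfolding eqr by argo
    qed
    thus "t : {t : seq_ball n F ep mu. EX k. de < \<bar>freq n t k - colmean mu k\<bar>}" using t(2) by blast
   qed
   thus ?case using elim(1) by simp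
  qed
  thus ?thesis using F by blast
 next
  case sing
  then obtain a where a: "a : set_pmf mu" "a ~: set_pmf ?et" by blast
  have ap: "pmf mu a > 0" using a by (simp add: pmf_positive)
  have "Ev n. prob (?P n) (seq_ball n {a} (pmf mu a) mu) <= decay r n" using eventually_ge_at_top[of n0]
  proof eventually_elim
   case (elim n)
   have "prob (?P n) (seq_ball n {a} (pmf mu a) mu) <= prob (?P n) {}"
   proof (rule prob_mono_AE_pmf)
    fix t assume t: "t : set_pmf (?P n)" "t : seq_ball n {a} (pmf mu a) mu"
    hence "pmf (emp n t) a > 0" by (auto simp: seq_ball_def)
    hence "a : set_pmf (emp n t)" by (simp add: pmf_positive_iff)
    then obtain v where "v : {1..n}" "a = t v" using big(2)[OF elim] by (auto simp: empirical_measure_def set_pmf_of_set)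
    thus "t : {}" using star_seq_upper(3)[OF kp big(1)[OF elim] t(1)] a(2) by (force simp: set_pmf_iff)
   qed
   hence "prob (?P n) (seq_ball n {a} (pmf mu a) mu) <= 0" by simp
   also have "0 <= decay r n" by simp
   finally show ?case .
  qed
  thus ?thesis using ap by blast
 next
  case main
  define G where "G = col_div kp nu xi (colmean mu) / 2"
  have "ereal (r + G) < rel_entropy mu (measure_pmf ?et)" using r main by (auto simp: ER_rate_def rel_entropy_pmf G_def split: if_splits)
  then obtain q where q: "ereal (r + G) < ereal q" "ereal q < rel_entropy mu (measure_pmf ?et)" using ereal_dense2 by blast
  \<comment> \<open>Half of the gap is spent on the colour factor, the other half is kept for the
    union with the bad event: q - (G + ep1) = r + ep1.\<close>
  define ep1 where "ep1 = (q - (r + G)) / 2"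
  have ep1: "ep1 > 0" using q(1) by (simp add: ep1_def)
  obtain K where K: "q < (SUM a:{a. deg a <= K}. kl_term mu ?et a)" using rel_entropy_greater[OF finite_stars main(3) q(2)] by blast
  obtain ep2 where ep2: "ep2 > 0" "ALL n>=1. prob (Pi_pmf {1..n} undefined (%_. ?et)) (seq_ball n {a. deg a <= K} ep2 mu) <= decay q n"
   using iid_local_upper[OF finite_stars K main(3)] by blast
  have fin: "finite (set_pmf nu)" by simp
  obtain de n1 where de: "de > 0" and n1: "!!n T. n >= n1 ==> set_mset T <= pcols nu xi ==>
   (ALL k:pcols nu xi. \<bar>real (count T k) / real n - colmean mu k\<bar> <= de) ==>
   col_factor kp nu xi n T <= exp (real n * (col_div kp nu xi (colmean mu) / 2 + ep1))"
   using col_factor_uniform_upper[OF fin kp ep1, of xi "colmean mu"] by blast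
  obtain F3 ep3 where F3: "finite F3" "ep3 > 0" and ev3: "Ev n. prob (?P n)
  {t : seq_ball n F3 ep3 mu. EX k. de < \<bar>freq n t k - colmean mu k\<bar>} <= decay (r + ep1) n"
   using colmean_concentration[OF kp main(1) de] by blast
  define F where "F = F3 \<union> {a. deg a <= K}"
  define ep where "ep = min ep2 ep3"
  let ?bad = "%n. {t : seq_ball n F3 ep3 mu. EX k. de < \<bar>freq n t k - colmean mu k\<bar>}"
  let ?good = "%n. {t : seq_ball n {a. deg a <= K} ep2 mu. ALL k. \<bar>freq n t k - colmean mu k\<bar> <= de}"
  have ev_good: "Ev n. prob (?P n) (?good n) <= decay (r + ep1) n" using eventually_ge_at_top[of "max n0 n1"]
  proof eventually_elim
   case (elim n)
   hence n: "n >= n0" "n >= n1" by auto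
   have "prob (?P n) (?good n) <= exp (real n * (G + ep1)) * prob (Pi_pmf {1..n} undefined (%_. ?et)) (?good n)"
   proof (rule star_seq_ER_dominated[OF kp big(1)[OF n(1)]])
    fix t assume t: "t : ?good n" "set_mset (seq_cols n t) <= pcols nu xi"
    have "ALL k:pcols nu xi. \<bar>freq n t k - colmean mu k\<bar> <= de" using t(1) by blast
    thus "col_factor kp nu xi n (seq_cols n t) <= exp (real n * (G + ep1))" unfolding G_def by (rule n1[OF n(2) t(2)])
   qed simp
   also have "... <= exp (real n * (G + ep1)) * prob (Pi_pmf {1..n} undefined (%_. ?et)) (seq_ball n {a. deg a <= K} ep2 mu)"
    by (intro mult_left_mono measure_pmf.finite_measure_mono) auto
   also have "... <= exp (real n * (G + ep1)) * decay q n" using ep2(2) big(2)[OF n(1)] by simp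
   also have "... = decay (r + ep1) n" by (simp add: exp_add[symmetric] ep1_def field_simps)
   finally show ?case .
  qed
  have "Ev n. prob (?P n) (seq_ball n F ep mu) <= decay r n"
  proof (rule eventually_exp_union[OF _ ev3 ev_good])
   show "r < r + ep1" using ep1 by simp
   show "seq_ball n F ep mu <= ?bad n \<union> ?good n" for n
   proof
    fix t assume t: "t : seq_ball n F ep mu"
    have "t : seq_ball n F3 ep3 mu" "t : seq_ball n {a. deg a <= K} ep2 mu"
     using seq_ball_mono[of F3 F ep ep3 n mu] seq_ball_mono[of "{a. deg a <= K}" F ep ep2 n mu] t by (auto simp: F_def ep_def)
    thus "t : ?bad n \<union> ?good n" by (auto simp: not_less)
   qed
  qed
  moreover have "finite F" "ep > 0" using F3 ep2(1) finite_stars by (auto simp: F_def ep_def)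
  ultimately show ?thesis by blast
 qed
qed

lemma mean_deg_empirical: assumes "n >= 1" shows "mean_deg (emp n t) = ennreal (real (size (seq_cols n t)) / real n)"
proof -
 have "mean_deg (emp n t) = (\<integral>\<^sup>+ta. ennreal (real (deg ta)) \<partial>(emp n t))"
  by (simp add: mean_deg_def ennreal_of_nat_eq_real_of_nat)
 also have "... = ennreal (expect (emp n t) (%ta. real (deg ta)))" by (rule nn_integral_eq_integral) (use integrable_empirical[OF assms] in auto)
 also have "expect (emp n t) (%ta. real (deg ta)) = (SUM v:{1..n}. real (deg (t v))) / real n" by (rule expectation_empirical[OF assms])
 finally show ?thesis unfolding seq_cols_total size_total_cols by (simp add: star_deg_def)
qed

lemma ER_tight:
 fixes nu :: "'x::finite pmf" and xi :: "('y::finite * 'y) pmf" assumes kp: "kp > 0" shows "EX B>=0. Ev n. prob (ER_law kp nu xi n)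
  {t. ~ mean_deg (emp n t) <= ennreal B} <= decay r n"
proof -
 obtain B where B: "B >= 1" "Ev n.
  prob (ER_law kp nu xi n) {t. B * real n < real (size (seq_cols n t))} <= decay r n" using total_degree_tail[OF kp] by blast
 have "Ev n. prob (ER_law kp nu xi n)
  {t. ~ mean_deg (emp n t) <= ennreal B} <= decay r n" using B(2) eventually_ge_at_top[of 1]
 proof eventually_elim
  case (elim n)
  show ?case using elim(2) B(1) elim(1) by (auto simp: mean_deg_empirical not_le ennreal_less_iff field_simps)
 qed
 thus ?thesis using B(1) by (intro exI[of _ B]) auto
qed

lemmas compactin_mean_deg = compactin_weak_moment[OF finite_stars, folded mean_deg_def]
lemmas closedin_mean_deg = closedin_weak_moment[OF finite_stars, folded mean_deg_def]

section \<open>Realising stars with distinct classes\<close>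



definition mcols :: "('x, 'y) star multiset => ('x * 'x * 'y * 'y) multiset" where "mcols S = (SUM z:#S. cols z)"

lemma mcols_simps [simp]: "mcols {#} = {#}" "mcols (add_mset z S) = cols z + mcols S" "mcols (S + S') = mcols S + mcols S'" by (auto simp: mcols_def)

definition deg_count :: "nat => ('x, 'y) star multiset => nat" where "deg_count d S = size {#z :# S. deg z = d#}"

lemma deg_count_simps [simp]: "deg_count d {#} = 0" "deg_count d (add_mset z S) = (if deg z = d then 1 else 0) + deg_count d S"
 "deg_count d (S + S') = deg_count d S + deg_count d S'" by (auto simp: deg_count_def)

lemma deg_count_const: "(!!z. z :# S ==> deg z = d) ==> deg_count i S = (if i = d then size S else 0)" by (induction S) auto

lemma size_mcols: "(!!z. z :# S ==> deg z <= M) ==> size (mcols S) = (SUM d<=M. d * deg_count d S)"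
proof (induction S)
 case (add z S)
 have "(SUM d<=M. d * deg_count d (add_mset z S)) = (SUM d<=M. (if d = deg z then d else 0) + d * deg_count d S)" by (intro sum.cong) auto
 thus ?case using add.prems[of z] add by (simp add: sum.distrib)
qed simp

text \<open>Admissible stars: they have positive probability, and the classes of the root and of the
 children are distinct, so that no colour equals its own reversal.\<close>

definition adm :: "('x => 'c) => 'x pmf => ('y * 'y) pmf => ('x, 'y) star => bool" where
 "adm cl nu xi z <-> good_star cl z & pmf nu (fst z) > 0 & (\<forall>c\<in>#snd z. child_wt nu xi c > 0)"

definition good_col :: "('x => 'c) => 'x pmf => ('y * 'y) pmf => 'x * 'x * 'y * 'y => bool" where
 "good_col cl nu xi k <-> edge_wt nu xi k > 0 & cl (fst k) ~= cl (fst (snd k))"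

lemma good_col_rev [simp]: "good_col cl nu xi (rev_col k) <-> good_col cl nu xi k" unfolding good_col_def edge_wt_rev by (cases k) auto

lemma good_col_neq: "good_col cl nu xi k ==> rev_col k ~= k" by (cases k) (auto simp: good_col_def)

lemma adm_cols: "adm cl nu xi z ==> k :# cols z ==> good_col cl nu xi k" using good_starD(1)[of cl "fst z" "snd z"]
 by (cases z) (force simp: adm_def good_col_def cols_def edge_wt_def)

lemma adm_mcols: "(!!z. z :# S ==> adm cl nu xi z) ==> k :# mcols S ==> good_col cl nu xi k" by (auto simp: mcols_def dest: adm_cols)

lemma admI: assumes "distinct (cl x # map (%c. cl (fst c)) cs)" "pmf nu x > 0" "!!c. c : set cs ==> child_wt nu xi c > 0"
 shows "adm cl nu xi (x, mset cs)"
proof -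
 have "count (mset (cl x # map (%c. cl (fst c)) cs)) k <= 1" for k using assms(1) unfolding distinct_count_atmost_1 by simp
 thus ?thesis using assms by (simp add: adm_def good_star_def)
qed

lemma sum_mset_image_swap: "(SUM a:#A. image_mset (f a) B) = (SUM b:#B. image_mset (%a. f a b) A)"
proof (induction A)
 case (add a A)
 have "(SUM b:#B. add_mset (f a b) (image_mset (%a. f a b) A)) = image_mset (f a) B + (SUM b:#B. image_mset (%a. f a b) A)" by (induction B) auto
 thus ?case using add by simp
qed simp

text \<open>A half-edge and its reversal have different colours and can be removed as a
  pair.\<close>

lemma even_size_balanced: assumes "rev_cols C = C" "!!k. k :# C ==> rev_col k ~= k" shows "even (size C)" using assms
proof (induction "size C" arbitrary: C rule: less_induct)
 case less
 show ?case
 proof (cases "C = {#}")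
  case False
  then obtain k where k: "k :# C" by blast
  have "rev_col k :# rev_cols C" using k by simp
  hence "rev_col k :# C" using less.prems(1) by simp
  then obtain D where D: "C = add_mset k (add_mset (rev_col k) D)" using k less.prems(2)[OF k] by (metis insert_noteq_member mset_add)
  show ?thesis using less.prems(1) unfolding D using less.hyps[of D] less.prems(2) D by simp
 qed simp
qed

abbreviation class_law :: "'x pmf => nat => ('x * nat) pmf" where "class_law nu q \<equiv> pair_pmf nu (pmf_of_set {..<q})"

lemma pmf_class_law: "q > 0 ==> pmf (class_law nu q) z = (if snd z < q then pmf nu (fst z) / real q else 0)"
 by (cases z) (simp add: pmf_pair pmf_of_set lessThan_empty_iff)

text \<open>The complete bipartite graph $K_{d,d}$ minus an edge, whose two free half-edges absorb the
 unmatched half-edges $k_1$ and $k_2$.\<close>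

lemma gadget:
 fixes nu :: "'x pmf" and xi :: "('y * 'y) pmf" assumes d: "d >= 1" and q: "q >= 2 * d + 4"
  and k1: "good_col snd (class_law nu q) xi k1" and k2: "good_col snd (class_law nu q) xi k2"
 shows "EX G. size G = 2 * d & (\<forall>z\<in>#G. adm snd (class_law nu q) xi z & deg z = d) &
  rev_cols (mcols G) + {#rev_col k1, rev_col k2#} = mcols G + {#k1, k2#}"
proof -
 let ?nu = "class_law nu q"
 obtain u p m m' where k1e: "k1 = (u, p, m, m')" by (cases k1)
 obtain w r l l' where k2e: "k2 = (w, r, l, l')" by (cases k2)
 obtain x0 where x0: "x0 : set_pmf nu" using set_pmf_not_empty[of nu] by blast
 obtain y0 y1 where y: "(y0, y1) : set_pmf (sym_law xi)" using set_pmf_not_empty[of "sym_law xi"] by (metis equals0I surj_pair)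
 have y01: "pmf (sym_law xi) (y0, y1) > 0" "pmf (sym_law xi) (y1, y0) > 0" using pmf_positive[OF y] sym_law_swap[of xi y0 y1] by simp_all
 have k1p: "pmf ?nu p > 0" "child_wt ?nu xi (u, m', m) > 0" "snd u ~= snd p"
  and k2p: "pmf ?nu r > 0" "child_wt ?nu xi (w, l', l) > 0" "snd w ~= snd r" using k1 k2 sym_law_swap[of xi m m'] sym_law_swap[of xi l l']
  by (auto simp: k1e k2e good_col_def edge_wt_def child_wt_def less_le)
 \<comment> \<open>At most four classes are taken by the ends of \<open>k1\<close> and
   \<open>k2\<close>; the bound on \<open>q\<close> leaves fresh distinct ones for the other 2 (d -
   1) vertices.\<close>
 define W where "W = {..<q} - {snd u, snd p, snd w, snd r}"
 have "2 * (d - 1) <= card W" using card_length[of "[snd u, snd p, snd w, snd r]"] q diff_card_le_card_Diff[of "{snd u, snd p, snd w, snd r}" "{..<q}"] by (simp add: W_def)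
 then obtain V where V: "V <= W" "card V = 2 * (d - 1)" "finite V"
  by (metis obtain_subset_with_card_n finite_lessThan finite_subset W_def Diff_subset)
 obtain cs where cs: "set cs = V" "distinct cs" using finite_distinct_list[OF V(3)] by blast
 have lcs: "length cs = 2 * (d - 1)" using cs V(2) distinct_card by fastforce
 define as where "as = map (Pair x0) (take (d - 1) cs)"
 define bs where "bs = map (Pair x0) (drop (d - 1) cs)"
 have las: "length as = d - 1" "length bs = d - 1" using lcs by (auto simp: as_def bs_def)
 have sas: "map snd as = take (d - 1) cs" "map snd bs = drop (d - 1) cs" by (simp_all add: as_def bs_def comp_def)
 have dist: "distinct (map snd as)" "distinct (map snd bs)" "set (map snd as) \<inter> set (map snd bs) = {}"
  using cs(2) unfolding sas by (auto simp: set_take_disj_set_drop_if_distinct)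
 have fresh: "snd a ~: {snd u, snd p, snd w, snd r}" "pmf ?nu a > 0" if "a : set as \<union> set bs" for a
 proof -
  have "snd a : V" "fst a = x0" using that cs(1) by (auto simp: as_def bs_def dest: in_set_takeD in_set_dropD)
  thus "snd a ~: {snd u, snd p, snd w, snd r}" "pmf ?nu a > 0" using q V(1) x0 by (auto simp: W_def pmf_class_law pmf_positive_iff)
 qed
 define ca where "ca = (%b. (b, y1, y0) :: ('x * nat) * 'y * 'y)"
 define cb where "cb = (%a. (a, y0, y1) :: ('x * nat) * 'y * 'y)"
 \<comment> \<open>One side of the bipartite graph is \<open>as\<close> with \<open>p\<close>, the
   other is \<open>bs\<close> with \<open>r\<close>, and the missing edge joins \<open>p\<close> and
   \<open>r\<close>. In its place \<open>P\<close> carries the half-edge opposite to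
   \<open>k1\<close> and \<open>R\<close> the one opposite to \<open>k2\<close>.\<close>
 define SA where "SA = (%a :: 'x * nat. (a, mset (map ca (r # bs))))"
 define SB where "SB = (%b :: 'x * nat. (b, mset (map cb (p # as))))"
 define P where "P = (p, mset ((u, m', m) # map ca bs))"
 define R where "R = (r, mset ((w, l', l) # map cb as))"
 define G where "G = image_mset SA (mset as) + image_mset SB (mset bs) + {#P, R#}"
 have wt: "child_wt ?nu xi (ca v) > 0" "child_wt ?nu xi (cb v) > 0" if "pmf ?nu v > 0" for v
  using that y01 by (simp_all add: ca_def cb_def child_wt_def)
 have fst_c: "(%c. snd (fst c)) \<circ> ca = snd" "(%c. snd (fst c)) \<circ> cb = snd" by (auto simp: ca_def cb_def)
 have fst_c': "snd (fst (ca v)) = snd v" "snd (fst (cb v)) = snd v" for v by (auto simp: ca_def cb_def)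
 have admA: "adm snd ?nu xi (SA a)" if "a : set as" for a unfolding SA_def
 proof (rule admI)
  have "snd a ~: set (map snd bs)" using dist(3) that by auto
  moreover have "snd r ~: set (map snd bs)" using fresh(1) by force
  ultimately show "distinct (snd a # map (%c. snd (fst c)) (map ca (r # bs)))" using fresh(1)[of a] that dist(2) by (simp add: fst_c fst_c')
  show "child_wt ?nu xi c > 0" if "c : set (map ca (r # bs))" for c using that wt(1)[OF k2p(1)] wt(1)[OF fresh(2)] unfolding set_map by auto
 qed (use that fresh(2) in blast)
 have admB: "adm snd ?nu xi (SB b)" if "b : set bs" for b unfolding SB_def
 proof (rule admI)
  have "snd b ~: set (map snd as)" using dist(3) that by auto
  moreover have "snd p ~: set (map snd as)" using fresh(1) by force
  ultimately show "distinct (snd b # map (%c. snd (fst c)) (map cb (p # as)))" using fresh(1)[of b] that dist(1) by (simp add: fst_c fst_c')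
  show "child_wt ?nu xi c > 0" if "c : set (map cb (p # as))" for c using that wt(2)[OF k1p(1)] wt(2)[OF fresh(2)] unfolding set_map by auto
 qed (use that fresh(2) in blast)
 have admP: "adm snd ?nu xi P" unfolding P_def
 proof (rule admI)
  have "snd p ~: set (map snd bs)" "snd u ~: set (map snd bs)" using fresh(1) by force+
  thus "distinct (snd p # map (%c. snd (fst c)) ((u, m', m) # map ca bs))" using k1p(3) dist(2) by (simp add: fst_c)
  show "child_wt ?nu xi c > 0" if "c : set ((u, m', m) # map ca bs)" for c using that k1p(2) wt(1)[OF fresh(2)] by auto
 qed (rule k1p)
 have admR: "adm snd ?nu xi R" unfolding R_def
 proof (rule admI)
  have "snd r ~: set (map snd as)" "snd w ~: set (map snd as)" using fresh(1) by force+
  thus "distinct (snd r # map (%c. snd (fst c)) ((w, l', l) # map cb as))" using k2p(3) dist(1) by (simp add: fst_c)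
  show "child_wt ?nu xi c > 0" if "c : set ((w, l', l) # map cb as)" for c using that k2p(2) wt(2)[OF fresh(2)] by auto
 qed (rule k2p)
 have "size G = 2 * d" using d las by (simp add: G_def)
 moreover have "\<forall>z\<in>#G. adm snd ?nu xi z & deg z = d"
  using admA admB admP admR d las by (auto simp: G_def star_deg_def SA_def SB_def P_def R_def)
 moreover have "rev_cols (mcols G) + {#rev_col k1, rev_col k2#} = mcols G + {#k1, k2#}"
 proof -
  let ?f = "%a b. (a, b, y1, y0)" and ?g = "%b a. (b, a, y0, y1)"
  have cSA: "cols (SA a) = image_mset (?f a) (mset bs) + {#?f a r#}" for a
   by (simp add: SA_def cols_def ca_def image_mset.compositionality comp_def flip: mset_map)
  have cSB: "cols (SB b) = image_mset (?g b) (mset as) + {#?g b p#}" for b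
   by (simp add: SB_def cols_def cb_def image_mset.compositionality comp_def flip: mset_map)
  have sng: "(SUM a:#A. add_mset (f a) (g a)) = image_mset f A + (SUM a:#A. g a)" for A :: "'t multiset" and f :: "'t => 's" and g
   by (induction A) auto
  have cR: "cols R = add_mset (rev_col k2) (image_mset (?g r) (mset as))"
   by (simp add: R_def cols_def cb_def image_mset.compositionality comp_def k2e flip: mset_map)
  \<comment> \<open>\<open>X\<close> lists the edges of the gadget as seen from the side of
    \<open>p\<close>; the other side sees \<open>rev_cols X\<close>.\<close>
  define X where "X = (SUM a:#mset as. image_mset (?f a) (mset bs)) + image_mset (%a. ?f a r) (mset as) + image_mset (?f p) (mset bs)"
  have rX: "rev_cols X = (SUM b:#mset bs. image_mset (?g b) (mset as)) + image_mset (%a. ?g r a) (mset as) + image_mset (%b. ?g b p) (mset bs)"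
  proof -
   have "rev_cols (SUM a:#mset as. image_mset (?f a) (mset bs)) = (SUM a:#mset as. image_mset (%b. ?g b a) (mset bs))"
    by (induction as) (auto simp: image_mset.compositionality comp_def)
   thus ?thesis using sum_mset_image_swap[of "%a b. ?g b a" "mset bs" "mset as"] by (simp add: X_def image_mset.compositionality comp_def)
  qed
  have "mcols G = X + rev_cols X + {#rev_col k1, rev_col k2#}" unfolding rX by (simp add: G_def mcols_def image_mset.compositionality comp_def cSA cSB cR X_def sng, simp add: P_def cols_def ca_def image_mset.compositionality comp_def k1e flip: mset_map)
  moreover have "rev_cols (rev_cols X) = X" by (simp add: image_mset.compositionality comp_def)
  ultimately show ?thesis by simp
 qed
 ultimately show ?thesis by blast
qed

text \<open>Unmatched half-edges are disposed of two at a time, each pair by one gadget of 2 d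
  stars.\<close>

lemma absorb:
 fixes nu :: "'x pmf" and xi :: "('y * 'y) pmf" assumes d: "d >= 1" and q: "q >= 2 * d + 4"
  and "even (size E)" "!!k. k :# E ==> good_col snd (class_law nu q) xi k"
 shows "EX A. size A = d * size E & (\<forall>z\<in>#A. adm snd (class_law nu q) xi z & deg z = d) &
  rev_cols (mcols A) + rev_cols E = mcols A + E" using assms(3,4)
proof (induction "size E" arbitrary: E rule: less_induct)
 case less
 show ?case
 proof (cases "E = {#}")
  case True
  thus ?thesis by simp
 next
  case False
  then obtain k1 E1 where E1: "E = add_mset k1 E1" by (metis multiset_cases)
  hence "E1 ~= {#}" using less.prems(1) by auto
  then obtain k2 E2 where "E1 = add_mset k2 E2" by (metis multiset_cases)
  hence E: "E = add_mset k1 (add_mset k2 E2)" using E1 by simp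
  obtain A where A: "size A = d * size E2" "\<forall>z\<in>#A. adm snd (class_law nu q) xi z & deg z = d"
   "rev_cols (mcols A) + rev_cols E2 = mcols A + E2" using less.hyps[of E2] less.prems by (auto simp: E)
  obtain G where G: "size G = 2 * d" "\<forall>z\<in>#G. adm snd (class_law nu q) xi z & deg z = d"
   "rev_cols (mcols G) + {#rev_col k1, rev_col k2#} = mcols G + {#k1, k2#}" using gadget[OF d q, of nu xi k1 k2] less.prems(2) by (auto simp: E)
  have "rev_cols (mcols (A + G)) + rev_cols E = mcols (A + G) + E"
  proof -
   have "rev_cols (mcols (A + G)) + rev_cols E = (rev_cols (mcols A) + rev_cols E2) + (rev_cols (mcols G) + {#rev_col k1, rev_col k2#})" by (simp add: E)
   thus ?thesis unfolding A(3) G(3) by (simp add: E)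
  qed
  thus ?thesis using A(1,2) G(1,2) by (intro exI[of _ "A + G"]) (auto simp: E)
 qed
qed

text \<open>Absorbing j copies of a colour and j of its reversal, which are symmetric already,
  leaves gadget stars that are symmetric by themselves. They adjust the number of stars of degree
  \<open>d\<close> in blocks of 2 d without disturbing the balance.\<close>

lemma neutral_stars:
 fixes nu :: "'x pmf" and xi :: "('y * 'y) pmf" assumes d: "d >= 1" and q: "q >= 2 * d + 4"
 shows "EX A. size A = 2 * d * j & (\<forall>z\<in>#A. adm snd (class_law nu q) xi z & deg z = d) &
  rev_cols (mcols A) = mcols A"
proof -
 obtain x0 where x0: "x0 : set_pmf nu" using set_pmf_not_empty[of nu] by blast
 obtain y0 y1 where y: "(y0, y1) : set_pmf (sym_law xi)" using set_pmf_not_empty[of "sym_law xi"] by (metis equals0I surj_pair)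
 define k where "k = ((x0, 0 :: nat), (x0, 1 :: nat), y0, y1)"
 have k: "good_col snd (class_law nu q) xi k" using x0 y q by (simp add: k_def good_col_def edge_wt_def child_wt_def pmf_class_law pmf_positive_iff)
 define E where "E = replicate_mset j k + replicate_mset j (rev_col k)"
 obtain A where A: "size A = d * size E" "\<forall>z\<in>#A. adm snd (class_law nu q) xi z & deg z = d"
   "rev_cols (mcols A) + rev_cols E = mcols A + E"
 proof -
  have "even (size E)" by (simp add: E_def)
  moreover have "good_col snd (class_law nu q) xi e" if "e :# E" for e
  proof -
   show ?thesis using that k by (auto simp: E_def split: if_splits)
  qed
  ultimately show thesis using absorb[OF d q, of E nu xi] that by blast
 qed
 show ?thesis using A by (intro exI[of _ A], auto simp: E_def)
qed

lemma filler_star: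
 fixes nu :: "'x pmf" and xi :: "('y * 'y) pmf" assumes "q > d" shows "EX z. adm snd (class_law nu q) xi z & deg z = d"
proof -
 obtain x0 where x0: "x0 : set_pmf nu" using set_pmf_not_empty[of nu] by blast
 obtain y0 y1 where y: "(y0, y1) : set_pmf (sym_law xi)" using set_pmf_not_empty[of "sym_law xi"] by (metis equals0I surj_pair)
 let ?cs = "map (%i. ((x0, i), y0, y1)) [1..<Suc d]"
 have "adm snd (class_law nu q) xi ((x0, 0), mset ?cs)"
 proof (rule admI)
  show "distinct (snd (x0, 0) # map (%c. snd (fst c)) ?cs)" by (simp add: comp_def)
 qed (use x0 y assms in \<open>auto simp: pmf_class_law pmf_positive_iff child_wt_def\<close>)
 thus ?thesis by (intro exI conjI) (auto simp: star_deg_def)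
qed

lemma excess_add: "size ((X + Y) - image_mset f (X + Y)) <= size (X - image_mset f X) + size Y"
proof -
 have "(X + Y) - image_mset f (X + Y) <=# (X - image_mset f X) + Y" by (rule mset_subset_eqI) simp
 thus ?thesis by (metis size_mset_mono size_union)
qed

text \<open>The excess of colours over their reversals is absorbed by gadgets. The colours without
  this excess are symmetric and contain no self-reverse colour, so their number is even, and hence
  so is the excess.\<close>

lemma balanced_completion:
 fixes nu :: "'x pmf" and xi :: "('y * 'y) pmf" assumes d: "d >= 1" and q: "q >= 2 * d + 4"
  and S: "!!z. z :# S ==> adm snd (class_law nu q) xi z" and ev: "even (size (mcols S))"
 shows "EX A. size A = d * size (mcols S - rev_cols (mcols S)) & even (size (mcols S - rev_cols (mcols S))) &
  (\<forall>z\<in>#A. adm snd (class_law nu q) xi z & deg z = d) &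
  rev_cols (mcols (S + A)) = mcols (S + A)"
proof -
 let ?T = "mcols S"
 define E where "E = ?T - rev_cols ?T"
 have cnt: "count (rev_cols T) k = count T (rev_col k)" for T k using count_image_mset_inj[of rev_col T "rev_col k"] by (metis injI rev_col_rev_col)
 have good: "good_col snd (class_law nu q) xi k" if "k :# ?T" for k using that by (rule adm_mcols[rotated]) (rule S)
 have rE: "rev_cols (?T - E) = ?T - E" by (rule multiset_eqI) (auto simp: cnt E_def)
 have "even (size (?T - E))" by (rule even_size_balanced[OF rE]) (meson good good_col_neq in_diffD)
 moreover have "size ?T = size (?T - E) + size E" by (metis E_def diff_subset_eq_self size_Diff_submset size_mset_mono le_add_diff_inverse2)
 ultimately have "even (size E)" using ev by simp
 moreover have "good_col snd (class_law nu q) xi k" if "k :# E" for k using that by (auto simp: E_def dest!: in_diffD intro: good)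
 ultimately obtain A where A: "size A = d * size E" "\<forall>z\<in>#A. adm snd (class_law nu q) xi z & deg z = d"
   "rev_cols (mcols A) + rev_cols E = mcols A + E" using absorb[OF d q, of E nu xi] by blast
 have "rev_cols (mcols (S + A)) = mcols (S + A)"
 proof (rule multiset_eqI)
  fix k
  have "count (rev_cols (mcols A) + rev_cols E) k = count (mcols A + E) k" by (simp add: A(3))
  thus "count (rev_cols (mcols (S + A))) k = count (mcols (S + A)) k" by (simp add: cnt E_def del: image_mset_union)
 qed
 thus ?thesis using A(1,2) \<open>even (size E)\<close> unfolding E_def by blast
qed

text \<open>Three repairs: filler stars make the missing numbers divisible by the block size 2 d,
  gadgets of the single degree \<open>i0\<close> restore the symmetry of the colours, and neutral
  blocks supply what is still missing. The room at \<open>i0\<close> pays for its remainder and for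
  the gadgets, whose number is bounded by the old excess plus the half-edges of the fillers.\<close>

lemma degree_completion:
 fixes nu :: "'x pmf" and xi :: "('y * 'y) pmf" assumes i0: "1 <= i0" "i0 <= M" and q: "q >= 2 * M + 4"
  and S: "!!z. z :# S ==> adm snd (class_law nu q) xi z & deg z <= M" and c: "!!d. d <= M ==> deg_count d S <= c d" and ev: "even (SUM d<=M. d * c d)"
  and room: "deg_count i0 S + 2 * i0 + i0 * (size (mcols S - rev_cols (mcols S)) + (SUM d<=M. d * (2 * d))) <= c i0"
 shows "EX S'. S <=# S' & (\<forall>z\<in>#S'. adm snd (class_law nu q) xi z & deg z <= M) & (ALL d<=M. deg_count d S' = c d)
  & rev_cols (mcols S') = mcols S'"
proof -
 let ?ok = "%z. adm snd (class_law nu q) xi z"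
 define L where "L d = c d - deg_count d S" for d
 \<comment> \<open>Stars of degree 0 have no half-edges, so all of them are supplied at
   once.\<close>
 define r where "r d = (if d = 0 then L d else L d mod (2 * d))" for d
 have "EX z. ?ok z & deg z = d" if "d <= M" for d using filler_star[of d q nu xi] q that by simp
 then obtain f where f: "!!d. d <= M ==> ?ok (f d) & deg (f d) = d" by metis
 define R where "R = (SUM d<=M. replicate_mset (r d) (f d))"
 have R_in: "?ok z & deg z <= M" if "z :# R" for z using that f by (auto simp: R_def set_mset_sum split: if_splits)
 have dc_sum: "deg_count d (SUM i:I. g i) = (SUM i:I. deg_count d (g i))" if "finite I" for I :: "nat set" and g :: "nat => ('x * nat, 'y) star multiset" and d
  using that by (induction I) auto
 have dR: "deg_count d R = r d" if "d <= M" for d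
 proof -
  have "deg_count d (replicate_mset (r i) (f i)) = (if d = i then r i else 0)" if "i <= M" for i
   using f[OF that] by (subst deg_count_const[of _ i]) (auto split: if_splits)
  thus ?thesis using that by (simp add: R_def dc_sum)
 qed
 have sR: "size (mcols R) <= (SUM d<=M. d * (2 * d))"
 proof -
  have "size (mcols R) = (SUM d<=M. d * deg_count d R)" by (rule size_mcols) (use R_in in blast)
  also have "... <= (SUM d<=M. d * (2 * d))"
  proof (intro sum_mono)
   fix d assume "d : {..M}"
   thus "d * deg_count d R <= d * (2 * d)" by (cases "d = 0") (auto simp: dR r_def intro: less_imp_le mod_less_divisor)
  qed
  finally show ?thesis .
 qed
 define S1 where "S1 = S + R"
 have S1: "?ok z & deg z <= M" if "z :# S1" for z using that S R_in unfolding S1_def union_iff by blast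
 have dS1: "deg_count d S1 = deg_count d S + r d" if "d <= M" for d using dR[OF that] by (simp add: S1_def)
 have rem: "EX j. c d = deg_count d S1 + 2 * d * j" if "d <= M" for d
 proof (cases "d = 0")
  case False
  have "c d = deg_count d S + L d" using c[OF that] by (simp add: L_def)
  also have "L d = r d + 2 * d * (L d div (2 * d))" by (simp add: r_def)
  finally show ?thesis using dS1[OF that] by auto
 next
  case True
  thus ?thesis using dS1[OF that] c[OF that] by (simp add: r_def L_def)
 qed
 then obtain j where j: "!!d. d <= M ==> c d = deg_count d S1 + 2 * d * j d" by metis
 have "size (mcols S1) = (SUM d<=M. d * deg_count d S1)" by (rule size_mcols) (use S1 in blast)
 moreover have "(SUM d<=M. d * c d) = (SUM d<=M. d * deg_count d S1 + 2 * (d * d * j d))" by (intro sum.cong) (simp_all add: j algebra_simps)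
 ultimately have ev1: "even (size (mcols S1))" using ev by (simp add: sum.distrib sum_distrib_left[symmetric])
 define E where "E = mcols S1 - rev_cols (mcols S1)"
 have q0: "q >= 2 * i0 + 4" using q i0 by simp
 obtain A where A: "size A = i0 * size E" "even (size E)" "\<forall>z\<in>#A. ?ok z & deg z = i0" "rev_cols (mcols (S1 + A)) = mcols (S1 + A)"
  using balanced_completion[OF i0(1) q0, of S1 nu xi] S1 ev1 unfolding E_def by blast
 obtain e where e: "size E = 2 * e" using A(2) by blast
 have "i0 * size E <= i0 * (size (mcols S - rev_cols (mcols S)) + (SUM d<=M. d * (2 * d)))" using excess_add[of "mcols S" "mcols R" rev_col] sR by (simp add: E_def S1_def)
 hence "deg_count i0 S + 2 * i0 + i0 * size E <= c i0" using room by linarith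
 moreover have "r i0 <= 2 * i0" using i0(1) by (auto simp: r_def intro: less_imp_le mod_less_divisor)
 ultimately have "deg_count i0 S1 + 2 * i0 * e <= c i0" using dS1[OF i0(2)] e by simp
 hence je: "e <= j i0" using j[OF i0(2)] i0(1) by simp
 \<comment> \<open>The gadgets consist of \<open>2 * i0 * e\<close> stars and so take the place of
   \<open>e\<close> blocks of degree \<open>i0\<close>.\<close>
 define j' where "j' d = (if d = i0 then j d - e else j d)" for d
 have "EX N. size N = 2 * d * j' d & (\<forall>z\<in>#N. ?ok z & deg z = d) & rev_cols (mcols N) = mcols N" if "d <= M" for d
 proof (cases "d = 0")
  case False
  thus ?thesis using neutral_stars[of d q "j' d" nu xi] q that by simp
 qed (auto intro: exI[of _ "{#}"])
 then obtain N where N: "!!d. d <= M ==> size (N d) = 2 * d * j' d & (\<forall>z\<in>#N d. ?ok z & deg z = d) & rev_cols (mcols (N d)) = mcols (N d)"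
  by metis
 define NN where "NN = (SUM d<=M. N d)"
 have mc_sum: "mcols (SUM i:I. g i) = (SUM i:I. mcols (g i))" if "finite I" for I :: "nat set" and g :: "nat => ('x * nat, 'y) star multiset"
  using that by (induction I) auto
 have im_sum: "rev_cols (SUM i:I. g i) = (SUM i:I. rev_cols (g i))" if "finite I" for I :: "nat set" and g :: "nat => (('x * nat) \<times> ('x * nat) * 'y * 'y) multiset"
  using that by (induction I) auto
 have dN: "deg_count d NN = 2 * d * j' d" if "d <= M" for d
 proof -
  have "deg_count d (N i) = (if d = i then 2 * i * j' i else 0)" if "i <= M" for i using N[OF that] by (subst deg_count_const[of _ i]) auto
  thus ?thesis using that by (simp add: NN_def dc_sum)
 qed
 have dA: "deg_count d A = (if d = i0 then 2 * i0 * e else 0)" for d using A(1,3) e by (subst deg_count_const[of _ i0]) auto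
 show ?thesis
 proof (intro exI[of _ "S1 + A + NN"] conjI allI impI ballI)
  show "S <=# S1 + A + NN" by (simp add: S1_def)
  show "rev_cols (mcols (S1 + A + NN)) = mcols (S1 + A + NN)" using N A(4) by (simp add: NN_def mc_sum im_sum)
 next
  fix z assume "z :# S1 + A + NN"
  then consider "z :# S1" | "z :# A" | d where "d <= M" "z :# N d" by (auto simp: NN_def set_mset_sum)
  hence "?ok z & deg z <= M"
  proof cases
   case 2 thus ?thesis using A(3) i0(2) by auto
  next
   case 3 thus ?thesis using N[OF 3(1)] by auto
  qed (use S1 in blast)
  thus "?ok z" "deg z <= M" by auto
 next
  fix d assume d: "d <= M"
  show "deg_count d (S1 + A + NN) = c d"
  proof (cases "d = i0")
   case True
   show ?thesis using je True d by (simp add: dA dN j j'_def, simp flip: distrib_left)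
  qed (use d in \<open>simp add: dA dN j j'_def\<close>)
 qed
qed

text \<open>With classes the mark type is infinite; finiteness comes from the positive weights of
  admissible stars.\<close>

lemma finite_supported_stars:
 fixes nu :: "'x pmf" and xi :: "('y::finite * 'y) pmf" assumes "finite (set_pmf nu)" shows "finite {z. adm cl nu xi z & deg z <= M}"
proof (rule finite_subset)
 let ?C = "set_pmf nu \<times> (UNIV :: ('y * 'y) set)"
 show "{z. adm cl nu xi z & deg z <= M} <= set_pmf nu \<times> mset ` {xs. set xs <= ?C & length xs <= M}"
 proof
  fix z assume z: "z : {z. adm cl nu xi z & deg z <= M}"
  obtain xs where xs: "mset xs = snd z" using ex_mset by blast
  have "set xs <= ?C"
  proof
   fix c assume "c : set xs"
   hence "child_wt nu xi c > 0" using z by (auto simp: adm_def, metis xs set_mset_mset)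
   thus "c : ?C" by (cases c) (auto simp: child_wt_def zero_less_mult_iff pmf_positive_iff)
  qed
  moreover have "length xs <= M" using z xs by (metis (mono_tags, lifting) mem_Collect_eq size_mset star_deg_def)
  moreover have "fst z : set_pmf nu" using z by (auto simp: adm_def pmf_positive_iff)
  ultimately show "z : set_pmf nu \<times> mset ` {xs. set xs <= ?C & length xs <= M}" using xs by (cases z) force
 qed
 show "finite (set_pmf nu \<times> mset ` {xs. set xs <= ?C & length xs <= M})"
  using assms by (intro finite_cartesian_product finite_imageI finite_lists_length_le) auto
qed

section \<open>The probability of a multiset of admissible stars and its limit\<close>

lemma size_deg_count: "(!!z. z :# S ==> deg z <= M) ==> size S = (SUM d<=M. deg_count d S)"
proof (induction S)
 case (add z S)
 show ?case using add.prems[of z] add by (simp add: sum.distrib)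
qed simp

lemma adm_true_law: assumes "kp > 0" "adm cl nu xi z" shows "pmf (poi_law kp nu xi) z > 0"
proof -
 have "(PROD c:#m. kp * child_wt nu xi c) > 0" if "\<forall>c\<in>#m. child_wt nu xi c > 0" for m using that assms(1) by (induction m) auto
 thus ?thesis using assms by (simp add: pmf_true_law_Poi adm_def divide_pos_pos)
qed

text \<open>Each of the n! / \<open>mfact S\<close> orderings of \<open>S\<close> is a star sequence
  to which \<open>star_seq_lower\<close> applies.\<close>

lemma multiset_prob_lower:
 fixes nu :: "'x pmf" and xi :: "('y::finite * 'y) pmf" and S :: "('x, 'y) star multiset" assumes kp: "0 < kp" "kp < real n" and n: "size S = n"
  and bal: "rev_cols (mcols S) = mcols S" and S: "!!z. z :# S ==> adm cl nu xi z"
 shows "fact n / mfact S * (PROD z:#S. pmf (poi_law kp nu xi) z) * col_factor kp nu xi n (mcols S)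
  <= prob (ER_law kp nu xi n) {t. image_mset t (mset_set {1..n}) = S}"
proof -
 let ?et = "poi_law kp nu xi" and ?P = "ER_law kp nu xi n"
 define c where "c = (PROD z:#S. pmf ?et z) * col_factor kp nu xi n (mcols S)"
 define seq where "seq xs v = (if v : {1..n} then xs ! (v - 1) else undefined)" for xs :: "('x, 'y) star list" and v
 have im: "image_mset (seq xs) (mset_set {1..n}) = S" if "xs : permutations_of_multiset S" for xs
 proof -
  have xs: "mset xs = S" "length xs = n" using that n by (auto simp: permutations_of_multiset_def simp flip: size_mset)
  have "mset_set {1..n} = image_mset Suc (mset_set {0..<n})" by (simp add: image_mset_mset_set atLeastLessThanSuc_atLeastAtMost)
  hence "image_mset (seq xs) (mset_set {1..n}) = image_mset (%i. seq xs (Suc i)) (mset_set {0..<n})"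
   by (simp add: image_mset.compositionality comp_def)
  also have "... = mset (map ((!) xs) [0..<length xs])" using xs(2) by (simp only: mset_map mset_upt, intro image_mset_cong, simp add: seq_def)
  finally show ?thesis by (simp only: map_nth xs(1))
 qed
 have low: "c <= pmf ?P (seq xs)" if xs: "xs : permutations_of_multiset S" for xs
 proof -
  have cols: "seq_cols n (seq xs) = mcols S"
   by (simp add: seq_cols_def mcols_def flip: im[OF xs]) (simp add: sum_unfold_sum_mset image_mset.compositionality comp_def)
  have prod: "(PROD v:{1..n}. pmf ?et (seq xs v)) = (PROD z:#S. pmf ?et z)"
   by (simp add: prod_unfold_prod_mset image_mset.compositionality comp_def flip: im[OF xs])
  have mem: "adm cl nu xi (seq xs v)" if "v : {1..n}" for v
  proof (rule S)
   have "seq xs v :# image_mset (seq xs) (mset_set {1..n})" using that by simp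
   thus "seq xs v :# S" unfolding im[OF xs] .
  qed
  have "(PROD v:{1..n}. pmf ?et (seq xs v)) * col_factor kp nu xi n (seq_cols n (seq xs)) <= pmf ?P (seq xs)"
  proof (rule star_seq_lower(1)[OF kp])
   show "seq xs v = undefined" if "v ~: {1..n}" for v using that unfolding seq_def by auto
   show "rev_cols (seq_cols n (seq xs)) = seq_cols n (seq xs)" by (simp add: cols bal)
   show "good_star cl (seq xs v)" if "v : {1..n}" for v using mem[OF that] by (simp add: adm_def)
   show "pmf ?et (seq xs v) > 0" if "v : {1..n}" for v using adm_true_law[OF kp(1) mem[OF that]] .
  qed
  thus ?thesis unfolding c_def cols prod .
 qed
 have inj: "inj_on seq (permutations_of_multiset S)"
 proof (rule inj_onI)
  fix xs ys assume xy: "xs : permutations_of_multiset S" "ys : permutations_of_multiset S" "seq xs = seq ys"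
  hence len: "length xs = n" "length ys = n" using n by (auto simp: permutations_of_multiset_def simp flip: size_mset)
  show "xs = ys"
  proof (rule nth_equalityI)
   fix i assume "i < length xs"
   thus "xs ! i = ys ! i" using fun_cong[OF xy(3), of "Suc i"] len by (simp add: seq_def)
  qed (simp add: len)
 qed
 have "fact n / mfact S * c = (SUM xs:permutations_of_multiset S. c)" by (simp add: card_permutations_mfact n)
 also have "... <= (SUM xs:permutations_of_multiset S. pmf ?P (seq xs))" by (rule sum_mono) (rule low)
 also have "... = (SUM t:seq ` permutations_of_multiset S. pmf ?P t)" using inj by (simp add: sum.reindex)
 also have "... = prob ?P (seq ` permutations_of_multiset S)" by (simp add: prob_finite_sum)
 also have "... <= prob ?P {t. image_mset t (mset_set {1..n}) = S}" by (rule measure_pmf.finite_measure_mono) (use im in auto)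
 finally show ?thesis by (simp add: c_def)
qed

lemma sum_mset_count:
 fixes f :: "'a => real" assumes "finite A" "set_mset S <= A" shows "(SUM z:#S. f z) = (SUM z:A. real (count S z) * f z)" using assms(2)
proof (induction S)
 case (add x S)
 have "(SUM z:A. real (count (add_mset x S) z) * f z) = (SUM z:A. (if z = x then f x else 0) + real (count S z) * f z)"
  by (intro sum.cong) (auto simp: algebra_simps)
 thus ?case using add assms(1) by (simp add: sum.distrib)
qed simp

text \<open>By Stirling's formula the multinomial coefficient and the star probabilities give minus
  the relative entropy; \<open>tendsto_col_factor\<close> adds half the divergence.\<close>

lemma tendsto_multiset_prob:
 fixes nu :: "'x pmf" and xi :: "('y::finite * 'y) pmf" and S :: "nat => ('x, 'y) star multiset" assumes fin: "finite (set_pmf nu)" and kp: "0 < kp"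
  and S: "Ev n. size (S n) = n & (\<forall>z\<in>#S n. adm cl nu xi z & deg z <= M)" and mu: "!!z. z : set_pmf mu ==> adm cl nu xi z & deg z <= M"
  and lim: "!!z. (%n. real (count (S n) z) / real n) ----> pmf mu z"
 shows "(%n. ln (fact n / mfact (S n) * (PROD z:#S n. pmf (poi_law kp nu xi) z) * col_factor kp nu xi n (mcols (S n))) / real n)
  ----> - kl_real mu (poi_law kp nu xi) + col_div kp nu xi (colmean mu) / 2"
proof -
 let ?et = "poi_law kp nu xi"
 define Z where "Z = {z. adm cl nu xi z & deg z <= M}"
 have Z: "finite Z" unfolding Z_def by (rule finite_supported_stars[OF fin])
 have muZ: "set_pmf mu <= Z" using mu by (auto simp: Z_def)
 have SZ: "Ev n. size (S n) = n & set_mset (S n) <= Z & kp < real n & n >= 1"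
 proof -
  obtain n0 :: nat where "real n0 > kp" using reals_Archimedean2 by blast
  hence n0: "kp < real n" if "n >= max 1 n0" for n using that by linarith
  show ?thesis using S eventually_ge_at_top[of "max 1 n0"]
  proof eventually_elim
   case (elim n)
   thus ?case using n0[OF elim(2)] by (auto simp: Z_def)
  qed
 qed
 have et: "pmf ?et z > 0" if "z : Z" for z using that adm_true_law[OF kp] unfolding Z_def by blast
 have Emu: "expect mu f = (SUM z:Z. f z * pmf mu z)" for f :: "_ => real" by (rule integral_measure_pmf_real[OF Z]) (use muZ in auto)
 have colT: "Ev n. set_mset (mcols (S n)) <= pcols nu xi" using SZ
 proof eventually_elim
  case (elim n)
  thus ?case using adm_mcols[of "S n" cl nu xi] by (force simp: Z_def pcols_def good_col_def)
 qed
 have cmcols: "real (count (mcols (S n)) k) = (SUM z:Z. real (count (S n) z) * real (count (cols z) k))" if "set_mset (S n) <= Z" for n k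
 proof -
  have "real (count (mcols T) k) = (SUM z:#T. real (count (cols z) k))" for T by (induction T) auto
  thus ?thesis using sum_mset_count[OF Z that] by simp
 qed
 have colcnt: "(%n. real (count (mcols (S n)) k) / real n) ----> colmean mu k" for k
 proof -
  have "(%n. SUM z:Z. real (count (S n) z) / real n * real (count (cols z) k)) ----> (SUM z:Z. pmf mu z * real (count (cols z) k))"
   by (intro tendsto_sum tendsto_mult tendsto_const lim)
  also have "(SUM z:Z. pmf mu z * real (count (cols z) k)) = colmean mu k" by (simp add: colmean_def Emu mult.commute)
  finally show ?thesis
  proof (rule Lim_transform_eventually)
   show "Ev n. (SUM z:Z. real (count (S n) z) / real n * real (count (cols z) k)) = real (count (mcols (S n)) k) / real n"
    using SZ by eventually_elim (simp add: cmcols sum_divide_distrib)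
  qed
 qed
 have id: "filterlim (%n::nat. n) at_top sequentially" by (rule filterlim_ident)
 have one: "(%n. real n / real n) ----> 1"
  by (rule Lim_transform_eventually[OF tendsto_const]) (use eventually_ge_at_top[of "1::nat"] in eventually_elim, simp)
 have "(%n. (ln (fact n) - real n * ln (real n)) / real n - (SUM z:Z. (ln (fact (count (S n) z)) - real (count (S n) z) * ln (real n)) / real n)
   + (SUM z:Z. real (count (S n) z) / real n * ln (pmf ?et z)) + ln (col_factor kp nu xi n (mcols (S n))) / real n)
  ----> (1 * ln 1 - 1) - (SUM z:Z. pmf mu z * ln (pmf mu z) - pmf mu z) + (SUM z:Z. pmf mu z * ln (pmf ?et z)) + col_div kp nu xi (colmean mu) / 2"
  by (intro tendsto_add tendsto_diff tendsto_sum tendsto_mult tendsto_const lim tendsto_ln_fact[OF id] one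
   tendsto_col_factor[OF fin kp id colT] colcnt)
 also have "(1 * ln 1 - 1) - (SUM z:Z. pmf mu z * ln (pmf mu z) - pmf mu z) + (SUM z:Z. pmf mu z * ln (pmf ?et z)) = - kl_real mu ?et"
 proof -
  have "pmf mu z * ln (pmf mu z) - pmf mu z * ln (pmf ?et z) = ln (pmf mu z / pmf ?et z) * pmf mu z" if "z : Z" for z
  proof (cases "pmf mu z = 0")
   case False
   thus ?thesis using et[OF that] by (simp add: ln_div algebra_simps)
  qed simp
  hence "kl_real mu ?et = (SUM z:Z. pmf mu z * ln (pmf mu z) - pmf mu z * ln (pmf ?et z))" by (simp add: kl_real_def Emu)
  thus ?thesis using sum_pmf_eq_1[OF Z muZ] by (simp add: sum_subtractf)
 qed
 finally show ?thesis
 proof (rule Lim_transform_eventually)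
  show "Ev n. (ln (fact n) - real n * ln (real n)) / real n - (SUM z:Z. (ln (fact (count (S n) z)) - real (count (S n) z) * ln (real n)) / real n)
   + (SUM z:Z. real (count (S n) z) / real n * ln (pmf ?et z)) + ln (col_factor kp nu xi n (mcols (S n))) / real n
   = ln (fact n / mfact (S n) * (PROD z:#S n. pmf ?et z) * col_factor kp nu xi n (mcols (S n))) / real n" using SZ colT
  proof eventually_elim
   case (elim n)
   hence e: "size (S n) = n" "set_mset (S n) <= Z" "kp < real n" "n >= 1" by auto
   note cf = ln_col_factor(1)[OF fin kp e(3) elim(2)]
   have m: "ln (mfact (S n)) = (SUM z:Z. ln (fact (count (S n) z)))" unfolding mfact_superset[OF Z e(2)] by (rule ln_prod) (use Z in auto)
   have p: "(PROD z:#S n. pmf ?et z) = (PROD z:Z. pmf ?et z ^ count (S n) z)" by (rule prod_mset_count[OF Z e(2)])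
   have ppos: "(PROD z:Z. pmf ?et z ^ count (S n) z) > 0" by (rule prod_pos) (use et in auto)
   have lp: "ln (PROD z:Z. pmf ?et z ^ count (S n) z) = (SUM z:Z. real (count (S n) z) * ln (pmf ?et z))"
   proof -
    have "ln (PROD z:Z. pmf ?et z ^ count (S n) z) = (SUM z:Z. ln (pmf ?et z ^ count (S n) z))" by (rule ln_prod) (use Z et in force)+
    also have "... = (SUM z:Z. real (count (S n) z) * ln (pmf ?et z))" by (intro sum.cong) (use et in \<open>auto simp: ln_realpow\<close>)
    finally show ?thesis .
   qed
   have sz: "(SUM z:Z. real (count (S n) z)) = real n" using sum_mset_count[OF Z e(2), of "%_. 1"] e(1) by simp
   show ?case using cf ppos by (simp add: p ln_mult ln_div mfact_nonzero m lp sum_subtractf sum_divide_distrib[symmetric] sum_distrib_right[symmetric] sz diff_divide_distrib add_divide_distrib)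
  qed
 qed
qed

lemma tendsto_floor_share: assumes s: "s ----> (0 :: real)" and p: "p >= 0" shows "(%n. real (nat \<lfloor>real n * (1 - s n) * p\<rfloor>) / real n) ----> p"
proof (rule tendsto_sandwich)
 let ?l = "%n. (1 - s n) * p"
 have l: "?l ----> p" using tendsto_mult[OF tendsto_diff[OF tendsto_const s] tendsto_const, of 1 p] by simp
 show "Ev n. ?l n - 1 / real n <= real (nat \<lfloor>real n * (1 - s n) * p\<rfloor>) / real n" using eventually_ge_at_top[of "1::nat"]
 proof eventually_elim
  case (elim n)
  have "real n * (1 - s n) * p - 1 <= real (nat \<lfloor>real n * (1 - s n) * p\<rfloor>)" by linarith
  from divide_right_mono[OF this, of "real n"] show ?case using elim by (simp add: diff_divide_distrib)
 qed
 show "Ev n. real (nat \<lfloor>real n * (1 - s n) * p\<rfloor>) / real n <= ?l n"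
  using order_tendstoD(2)[OF s zero_less_one] eventually_ge_at_top[of "1::nat"]
 proof eventually_elim
  case (elim n)
  hence "real (nat \<lfloor>real n * (1 - s n) * p\<rfloor>) <= real n * (1 - s n) * p" using p by simp
  thus ?case using elim by (simp add: divide_le_eq mult.commute mult.left_commute)
 qed
 show "(%n. ?l n - 1 / real n) ----> p" using tendsto_diff[OF l lim_1_over_n] by simp
 show "?l ----> p" by (rule l)
qed

text \<open>The masses of \<open>mu\<close> are shrunk by 1 - s n before they are rounded down. This
  keeps the counts below the prescribed \<open>c n d\<close> with room of order sqrt n, while the
  rounded colours are asymmetric only by a bounded amount. So \<open>degree_completion\<close>
  applies for large n and changes a vanishing proportion of the stars.\<close>

lemma rounding:
 fixes nu :: "'x pmf" and xi :: "('y::finite * 'y) pmf" and mu :: "('x * nat, 'y) star pmf" and c :: "nat => nat => nat"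
 assumes fin: "finite (set_pmf nu)" and i0: "1 <= i0" "i0 <= M" "pmf (map_pmf deg mu) i0 > 0" and q: "q >= 2 * M + 4"
  and mu: "!!z. z : set_pmf mu ==> adm snd (class_law nu q) xi z & deg z <= M" and sym: "!!k. colmean mu (rev_col k) = colmean mu k"
  and c: "Ev n. (SUM d<=M. c n d) = n & even (SUM d<=M. d * c n d)"
  and clim: "!!d. d <= M ==> (%n. real (c n d) / real n) ----> pmf (map_pmf deg mu) d"
 shows "EX S. (Ev n. size (S n) = n & (\<forall>z\<in>#S n. adm snd (class_law nu q) xi z & deg z <= M)
   & (ALL d<=M. deg_count d (S n) = c n d) & rev_cols (mcols (S n)) = mcols (S n))
  & (ALL z. (%n. real (count (S n) z) / real n) ----> pmf mu z)"
proof -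
 let ?ok = "%z. adm snd (class_law nu q) xi z & deg z <= M"
 define Z where "Z = set_pmf mu"
 have finc: "finite (set_pmf (class_law nu q))" using q fin by (simp add: lessThan_empty_iff)
 have Z: "finite Z" unfolding Z_def by (rule finite_subset[OF _ finite_supported_stars[OF finc]]) (use mu in blast)
 have Emu: "expect mu f = (SUM z:Z. f z * pmf mu z)" for f :: "_ => real" by (rule integral_measure_pmf_real[OF Z]) (auto simp: Z_def)
 have sum1: "(SUM z:Z. pmf mu z) = 1" using sum_pmf_eq_1[OF Z] by (simp add: Z_def)
 define al where "al d = pmf (map_pmf deg mu) d" for d
 have alZ: "al d = (SUM z:{z:Z. deg z = d}. pmf mu z)" for d
 proof -
  have "al d = prob mu (deg -` {d} \<inter> set_pmf mu)" by (simp add: al_def pmf_map measure_Int_set_pmf)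
  also have "deg -` {d} \<inter> set_pmf mu = {z:Z. deg z = d}" by (auto simp: Z_def)
  finally show ?thesis using Z by (simp add: prob_finite_sum)
 qed
 have al0: "al d >= 0" for d by (simp add: al_def)
 \<comment> \<open>The first term creates room of order sqrt n at every degree that occurs; the
   others compensate the relative errors of the prescribed degree counts.\<close>
 define s where "s n = 1 / sqrt (real n) + (SUM d<=M. if al d > 0 then \<bar>real (c n d) / real n - al d\<bar> / al d else 0)" for n
 have s0: "s ----> 0"
 proof -
  have "(%n. 1 / sqrt (real n)) ----> 0" using tendsto_real_sqrt[OF lim_1_over_n] by (simp add: real_sqrt_divide)
  moreover have "(%n. if al d > 0 then \<bar>real (c n d) / real n - al d\<bar> / al d else 0) ----> 0" if "d <= M" for d
  proof (cases "al d > 0")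
   case True
   have "(%n. \<bar>real (c n d) / real n - al d\<bar> / al d) ----> \<bar>al d - al d\<bar> / al d"
    using clim[OF that] True unfolding al_def[symmetric] by (intro tendsto_intros) auto
   thus ?thesis using True by simp
  qed simp
  hence "(%n. SUM d<=M. if al d > 0 then \<bar>real (c n d) / real n - al d\<bar> / al d else 0) ----> (SUM d<=M. 0)" by (intro tendsto_sum) auto
  ultimately show ?thesis unfolding s_def[abs_def] using tendsto_add by fastforce
 qed
 define N where "N n z = nat \<lfloor>real n * (1 - s n) * pmf mu z\<rfloor>" for n z
 define S0 where "S0 n = (SUM z:Z. replicate_mset (N n z) z)" for n
 have cnt0: "count (S0 n) z = (if z : Z then N n z else 0)" for n z
 proof -
  have "count (S0 n) z = (SUM w:Z. count (replicate_mset (N n w) w) z)" by (simp add: S0_def count_sum)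
  thus ?thesis using Z by simp
 qed
 have mem0: "z : Z" if "z :# S0 n" for z n
 proof -
  have "count (S0 n) z ~= 0" using that by simp
  thus ?thesis unfolding cnt0 by (meson)
 qed
 have S0Z: "?ok z" if "z :# S0 n" for z n using mem0[OF that] mu by (auto simp: Z_def)
 have size_filter: "size {#z :# S0 n. P z#} = (SUM z:{z:Z. P z}. N n z)" for n P
 proof -
  have "size {#z :# S0 n. P z#} = (SUM z:{z:Z. P z}. count {#z :# S0 n. P z#} z)"
   by (rule size_multiset_overloaded_eq[THEN trans], rule sum.mono_neutral_left) (use Z mem0 in \<open>auto simp: not_in_iff\<close>)
  also have "... = (SUM z:{z:Z. P z}. N n z)" by (intro sum.cong) (auto simp: cnt0)
  finally show ?thesis .
 qed
 have cc: "real (count (mcols (S0 n)) k) = (SUM z:Z. real (N n z) * real (count (cols z) k))" for n k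
 proof -
  have "real (count (mcols T) k) = (SUM z:#T. real (count (cols z) k))" for T :: "('x * nat, 'y) star multiset" by (induction T) auto
  moreover have "set_mset (S0 n) <= Z" using mem0 by blast
  ultimately show ?thesis using sum_mset_count[OF Z, of "S0 n"] by (simp add: cnt0)
 qed
 define C1 where "C1 = (SUM z:Z. deg z)"
 \<comment> \<open>The room asked for by \<open>degree_completion\<close>, with \<open>C1\<close>
   bounding the excess of colours; it does not depend on n.\<close>
 define room where "room = 2 * i0 + i0 * (C1 + (SUM d<=M. d * (2 * d)))"
 have ev: "Ev n. n >= 1 & s n < 1 & real room / al i0 <= sqrt (real n) & (SUM d<=M. c n d) = n & even (SUM d<=M. d * c n d)"
 proof -
  have "Ev n. real room / al i0 <= sqrt (real n)" by (insert filterlim_compose[OF sqrt_at_top filterlim_real_sequentially], simp add: filterlim_at_top)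
  moreover have "Ev n. s n < 1" using order_tendstoD(2)[OF s0, of 1] by simp
  ultimately show ?thesis using c eventually_ge_at_top[of 1] by eventually_elim simp
 qed
 have main: "EX S. S0 n <=# S & (\<forall>z\<in>#S. ?ok z) & (ALL d<=M. deg_count d S = c n d) & rev_cols (mcols S) = mcols S"
  if n: "n >= 1" "s n < 1" "real room / al i0 <= sqrt (real n)" "even (SUM d<=M. d * c n d)" for n
 proof (rule degree_completion[OF i0(1,2) q])
  let ?r = "real n * (1 - s n)"
  have N_up: "real (N n z) <= ?r * pmf mu z" for z using n(2) by (simp add: N_def)
  have N_lo: "?r * pmf mu z <= real (N n z) + 1" for z unfolding N_def by linarith
  have dc: "real (deg_count d (S0 n)) <= ?r * al d" for d
  proof -
   have "real (deg_count d (S0 n)) = (SUM z:{z:Z. deg z = d}. real (N n z))" unfolding deg_count_def size_filter by simp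
   also have "... <= (SUM z:{z:Z. deg z = d}. ?r * pmf mu z)" by (intro sum_mono N_up)
   also have "... = ?r * al d" by (simp only: alZ sum_distrib_left)
   finally show ?thesis .
  qed
  have gap: "?r * al d <= real (c n d) - sqrt (real n) * al d" if "d <= M" for d
  proof (cases "al d > 0")
   case True
   let ?g = "%d. if al d > 0 then \<bar>real (c n d) / real n - al d\<bar> / al d else 0"
   have "?g d <= (SUM d<=M. ?g d)" by (rule member_le_sum) (use that in auto)
   hence "1 / sqrt (real n) + \<bar>real (c n d) / real n - al d\<bar> / al d <= s n" using True by (simp add: s_def)
   hence "(1 / sqrt (real n) + \<bar>real (c n d) / real n - al d\<bar> / al d) * (real n * al d) <= s n * (real n * al d)"
    by (rule mult_right_mono) (use al0 in simp)
   moreover have "(1 / sqrt (real n) + \<bar>real (c n d) / real n - al d\<bar> / al d) * (real n * al d)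
     = (1 / sqrt (real n) * real n) * al d + \<bar>real (c n d) / real n - al d\<bar> * real n" using True by (simp add: field_simps)
   moreover have "(1 / sqrt (real n) * real n) * al d = sqrt (real n) * al d" using n(1) by (simp add: real_div_sqrt)
   moreover have "\<bar>real (c n d) / real n - al d\<bar> * real n >= real n * al d - real (c n d)"
   proof -
    have "(al d - real (c n d) / real n) * real n <= \<bar>real (c n d) / real n - al d\<bar> * real n" by (rule mult_right_mono) auto
    thus ?thesis using n(1) by (simp add: field_simps)
   qed
   ultimately have "sqrt (real n) * al d + (real n * al d - real (c n d)) <= s n * (real n * al d)" by linarith
   thus ?thesis by (simp add: algebra_simps)
  next
   case False
   hence "al d = 0" using al0[of d] by simp
   thus ?thesis by simp
  qed
  show "?ok z" if "z :# S0 n" for z using S0Z[OF that] .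
  show "deg_count d (S0 n) <= c n d" if "d <= M" for d
  proof -
   have "0 <= sqrt (real n) * al d" using al0 by simp
   hence "real (deg_count d (S0 n)) <= real (c n d)" using dc[of d] gap[OF that] by linarith
   thus ?thesis by simp
  qed
  show "even (SUM d<=M. d * c n d)" by (rule n(4))
  \<comment> \<open>Each star loses at most one copy by rounding down, and the colour means are
    symmetric. So the excess is at most one copy of the colours of every star in the support,
    whatever n is.\<close>
  have ex: "mcols (S0 n) - rev_cols (mcols (S0 n)) <=# rev_cols (SUM z:Z. cols z)"
  proof (rule mset_subset_eqI)
   fix k
   have cnt: "count (rev_cols T) k = count T (rev_col k)" for T :: "(('x * nat) \<times> ('x * nat) * 'y * 'y) multiset"
    using count_image_mset_inj[of rev_col T "rev_col k"] by (metis injI rev_col_rev_col)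
   have cm: "colmean mu k = (SUM z:Z. real (count (cols z) k) * pmf mu z)" for k by (simp add: colmean_def Emu)
   have "real (count (mcols (S0 n)) k) <= (SUM z:Z. ?r * pmf mu z * real (count (cols z) k))"
    unfolding cc by (intro sum_mono mult_right_mono N_up) simp
   also have "... = ?r * colmean mu k" by (simp only: cm sum_distrib_left ac_simps)
   also have "... = ?r * colmean mu (rev_col k)" by (simp only: sym)
   also have "... = (SUM z:Z. ?r * pmf mu z * real (count (cols z) (rev_col k)))" by (simp only: cm sum_distrib_left ac_simps)
   also have "... <= (SUM z:Z. (real (N n z) + 1) * real (count (cols z) (rev_col k)))" by (intro sum_mono mult_right_mono N_lo) simp
   also have "... = real (count (mcols (S0 n)) (rev_col k) + count (SUM z:Z. cols z) (rev_col k))"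
    by (simp add: cc count_sum algebra_simps sum.distrib)
   finally have "count (mcols (S0 n)) k <= count (mcols (S0 n)) (rev_col k) + count (SUM z:Z. cols z) (rev_col k)" by simp
   thus "count (mcols (S0 n) - rev_cols (mcols (S0 n))) k <= count (rev_cols (SUM z:Z. cols z)) k" unfolding count_diff cnt by simp
  qed
  have szC: "size (SUM z:Z. cols z) = C1" by (simp add: C1_def)
  have "size (mcols (S0 n) - rev_cols (mcols (S0 n))) <= C1" using size_mset_mono[OF ex] unfolding size_image_mset szC .
  hence "2 * i0 + i0 * (size (mcols (S0 n) - rev_cols (mcols (S0 n))) + (SUM d<=M. d * (2 * d))) <= room" unfolding room_def by simp
  moreover have "deg_count i0 (S0 n) + room <= c n i0"
  proof -
   have "real room <= sqrt (real n) * al i0" using n(3) i0(3) by (simp add: al_def divide_le_eq)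
   hence "real (deg_count i0 (S0 n)) + real room <= real (c n i0)" using dc[of i0] gap[OF i0(2)] by linarith
   thus ?thesis by simp
  qed
  ultimately show "deg_count i0 (S0 n) + 2 * i0 + i0 * (size (mcols (S0 n) - rev_cols (mcols (S0 n))) + (SUM d<=M. d * (2 * d))) <= c n i0"
   by linarith
 qed
 define good where "good n S <-> S0 n <=# S & (\<forall>z\<in>#S. ?ok z) & (ALL d<=M. deg_count d S = c n d) & rev_cols (mcols S) = mcols S" for n S
 define S where "S n = (SOME S. good n S)" for n
 have S: "Ev n. n >= 1 & s n < 1 & good n (S n) & size (S n) = n" using ev
 proof eventually_elim
  case (elim n)
  hence "EX S. good n S" using main[of n] by (simp add: good_def)
  hence g: "good n (S n)" unfolding S_def by (rule someI_ex)
  moreover have "size (S n) = (SUM d<=M. deg_count d (S n))" by (rule size_deg_count) (use g in \<open>simp add: good_def\<close>)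
  moreover have "(SUM d<=M. deg_count d (S n)) = (SUM d<=M. c n d)" by (intro sum.cong) (use g in \<open>auto simp: good_def\<close>)
  ultimately show ?case using elim by simp
 qed
 have Nlim: "(%n. real (N n z) / real n) ----> pmf mu z" for z unfolding N_def by (rule tendsto_floor_share[OF s0]) simp
 have Slim: "(%n. real (count (S n) z) / real n) ----> pmf mu z" for z
 proof (rule tendsto_sandwich)
  define m where "m n = (if z : Z then real (N n z) / real n else 0)" for n
  have m: "m ----> pmf mu z"
  proof (cases "z : Z")
   case True
   thus ?thesis using Nlim by (simp add: m_def[abs_def])
  next
   case False
   hence "pmf mu z = 0" by (simp add: Z_def set_pmf_iff)
   thus ?thesis using False by (simp add: m_def[abs_def])
  qed
  show "Ev n. m n <= real (count (S n) z) / real n" using S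
  proof eventually_elim
   case (elim n)
   hence "count (S0 n) z <= count (S n) z" by (auto simp: good_def intro: mset_subset_eq_count)
   thus ?case by (auto simp: m_def cnt0 intro!: divide_right_mono)
  qed
  \<comment> \<open>A star gains at most the share of all added stars, which tends to 0 since the
    rounded masses add up to 1 in the limit.\<close>
  show "Ev n. real (count (S n) z) / real n <= m n + (1 - (SUM w:Z. real (N n w) / real n))" using S
  proof eventually_elim
   case (elim n)
   hence sub: "S0 n <=# S n" and sz: "size (S n) = n" and n: "n >= 1" by (auto simp: good_def)
   have s0: "size (S0 n) = (SUM w:Z. N n w)" using size_filter[of "%_. True" n] by simp
   have "count (S n) z = count (S0 n) z + count (S n - S0 n) z" using mset_subset_eq_count[OF sub, of z] by simp
   also have "count (S n - S0 n) z <= size (S n - S0 n)" by (rule count_le_size)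
   also have "size (S n - S0 n) = n - size (S0 n)" using sub sz by (simp add: size_Diff_submset)
   finally have "real (count (S n) z) <= real (count (S0 n) z) + (real n - real (size (S0 n)))" using size_mset_mono[OF sub] sz by linarith
   hence "real (count (S n) z) / real n <= (real (count (S0 n) z) + (real n - real (size (S0 n)))) / real n" by (rule divide_right_mono) simp
   also have "... = m n + (1 - (SUM w:Z. real (N n w) / real n))"
    using n by (simp add: m_def cnt0 s0 add_divide_distrib diff_divide_distrib sum_divide_distrib)
   finally show ?case .
  qed
  show "m ----> pmf mu z" by (rule m)
  have "(%n. m n + (1 - (SUM w:Z. real (N n w) / real n))) ----> pmf mu z + (1 - (SUM w:Z. pmf mu w))" by (intro tendsto_intros m Nlim)
  thus "(%n. m n + (1 - (SUM w:Z. real (N n w) / real n))) ----> pmf mu z" by (simp add: sum1)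
 qed
 show ?thesis
 proof (intro exI conjI allI)
  show "Ev n. size (S n) = n & (\<forall>z\<in>#S n. ?ok z) & (ALL d<=M. deg_count d (S n) = c n d) & rev_cols (mcols (S n)) = mcols (S n)"
   using S by eventually_elim (simp add: good_def)
 qed (rule Slim)
qed

section \<open>Splitting the vertex marks into classes\<close>



definition strip :: "('x * nat) * 'y * 'y => 'x * 'y * 'y" where "strip c = (fst (fst c), snd c)"

definition proj :: "('x * nat, 'y) star => ('x, 'y) star" where "proj z = (fst (fst z), image_mset strip (snd z))"

lemma star_deg_proj [simp]: "deg (proj z) = deg z" by (simp add: proj_def star_deg_def)

lemma proj_label_stars: assumes "v : {1..n}" shows "proj (label_stars n x l v) = label_stars n (%v. if v : {1..n} then fst (x v) else undefined) l v"
proof -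
 have "image_mset strip (halves {1..n} x l v) = halves {1..n} (%v. if v : {1..n} then fst (x v) else undefined) l v"
  unfolding halves_def image_mset.compositionality comp_def
 proof (rule image_mset_cong)
  fix u assume "u :# mset_set (lnbrs {1..n} l v)"
  thus "strip (half x l v u) = half (%v. if v : {1..n} then fst (x v) else undefined) l v u" by (simp add: lnbrs_def strip_def half_def)
 qed
 thus ?thesis using assms by (simp add: label_stars_def proj_def)
qed

text \<open>Forgetting independent classes gives back the original model, so lower bounds proved
  with classes carry over.\<close>

lemma star_seq_law_proj: assumes "q > 0"
 shows "map_pmf (%t v. if v : {1..n} then proj (t v) else undefined) (star_seq_law n (ER_graph kp n) (class_law nu q) xi) = ER_law kp nu xi n"
proof -
 let ?r = "%x v. if v : {1..n} then fst (x v) else undefined"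
 have marks: "map_pmf ?r (Pi_pmf {1..n} undefined (%_. class_law nu q)) = Pi_pmf {1..n} undefined (%_. nu)"
 proof -
  have h: "Pi_pmf {1..n} (fst (undefined :: 'a * nat)) (%_. map_pmf fst (class_law nu q)) = map_pmf (%h. fst \<circ> h) (Pi_pmf {1..n} undefined (%_. class_law nu q))"
   by (rule Pi_pmf_map) auto
  have "map_pmf (%f v. if v : {1..n} then f v else undefined) (map_pmf (%h. fst \<circ> h) (Pi_pmf {1..n} undefined (%_. class_law nu q)))
    = Pi_pmf {1..n} undefined (%_. nu)" unfolding h[symmetric] map_fst_pair_pmf by (rule Pi_pmf_default_swap) simp
  thus ?thesis by (simp add: map_pmf_comp comp_def)
 qed
 have key: "(%v. if v : {1..n} then proj (label_stars n x l v) else undefined) = label_stars n (?r x) l" for x and l :: "nat set => ('b * 'b) option"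
 proof
  fix v show "(if v : {1..n} then proj (label_stars n x l v) else undefined) = label_stars n (?r x) l v"
  proof (cases "v : {1..n}")
   case True
   thus ?thesis using proj_label_stars[of v n x l] by simp
  next
   case False
   thus ?thesis unfolding label_stars_def using False by auto
  qed
 qed
 show ?thesis unfolding star_seq_law_ER marks[symmetric] map_bind_pmf bind_map_pmf map_pmf_comp by (simp only: key)
qed

text \<open>Choices of distinct classes for \<open>m\<close> vertices; in \<open>attach\<close>
  entry 0 belongs to the root and entry l + 1 to child l.\<close>

definition inj_lists :: "nat => nat => nat list set" where "inj_lists q m = {cl. length cl = m & distinct cl & set cl <= {..<q}}"

lemma finite_inj_lists [simp]: "finite (inj_lists q m)" by (rule finite_subset[OF _ finite_lists_length_eq[of "{..<q}" m]]) (auto simp: inj_lists_def)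

lemma inj_lists_nth: assumes "cl : inj_lists q m" "l < m" shows "cl ! l < q" and "l' < m ==> l ~= l' ==> cl ! l ~= cl ! l'"
proof -
 have cl: "length cl = m" "distinct cl" "set cl <= {..<q}" using assms(1) by (auto simp: inj_lists_def)
 thus "cl ! l < q" using assms(2) nth_mem[of l cl] by blast
 show "l' < m ==> l ~= l' ==> cl ! l ~= cl ! l'" using cl assms(2) by (simp add: nth_eq_iff_index_eq)
qed

lemma inj_lists_nonempty: "m <= q ==> inj_lists q m ~= {}"
proof -
 assume "m <= q"
 hence "[0..<m] : inj_lists q m" by (auto simp: inj_lists_def)
 thus ?thesis by blast
qed

lemma card_inj_lists_ge: assumes "m <= q" shows "real (card (inj_lists q (Suc m))) >= (real q - real m) ^ Suc m"
proof (cases "m = q")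
 case False
 hence m: "Suc m <= card {..<q}" using assms by simp
 have "real (card (inj_lists q (Suc m))) = (PROD i:{q - m .. q}. real i)" unfolding inj_lists_def using card_lists_distinct_length_eq[OF _ m] m by (simp add: Suc_diff_Suc)
 moreover have "(PROD i:{q - m .. q}. real (q - m)) <= (PROD i:{q - m .. q}. real i)" by (rule prod_mono) auto
 moreover have "card {q - m .. q} = Suc m" using m by simp
 ultimately show ?thesis by simp
qed simp

text \<open>Permutations of the classes act on the lists, so all q (q - 1) ordered pairs of distinct
  classes occur equally often at the positions 0 and l.\<close>

lemma inj_lists_pair_count: assumes l: "1 <= l" "l < m" and ij: "i < q" "j < q" "i ~= j"
 shows "real (card {cl:inj_lists q m. cl ! 0 = i & cl ! l = j}) * (real q * (real q - 1)) = real (card (inj_lists q m))"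
proof -
 let ?A = "%i j. {cl:inj_lists q m. cl ! 0 = i & cl ! l = j}"
 let ?P = "SIGMA i:{..<q}. {..<q} - {i}"
 have le: "card (?A i j) <= card (?A i' j')" if ij: "i < q" "j < q" "i ~= j" and ij': "i' < q" "j' < q" "i' ~= j'" for i j i' j'
 proof -
  \<comment> \<open>The transposition of \<open>i\<close> and \<open>i'\<close> sends
    \<open>i\<close> to \<open>i'\<close> and \<open>j\<close> to \<open>j1\<close>; a second one
    then moves \<open>j1\<close> to \<open>j'\<close> and fixes \<open>i'\<close>.\<close>
  define j1 where "j1 = Transposition.transpose i i' j"
  define sg where "sg = Transposition.transpose j1 j' \<circ> Transposition.transpose i i'"
  have j1q: "j1 < q" using ij ij' by (auto simp: j1_def Transposition.transpose_def)
  have perm: "sg permutes {..<q}" unfolding sg_def by (intro permutes_compose permutes_swap_id) (use ij ij' j1q in auto)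
  have sg: "sg i = i'" "sg j = j'" using ij ij' by (simp_all add: sg_def j1_def[symmetric] transpose_apply_other, auto simp: j1_def Transposition.transpose_def)
  show ?thesis
  proof (rule card_inj_on_le[of "map sg"])
   have inj: "inj sg" using perm by (rule permutes_inj)
   show "inj_on (map sg) (?A i j)" using inj by (auto intro: inj_onI dest: map_injective)
   show "map sg ` ?A i j <= ?A i' j'"
   proof (rule image_subsetI)
    fix cl assume cl: "cl : ?A i j"
    hence c: "length cl = m" "distinct cl" "set cl <= {..<q}" "cl ! 0 = i" "cl ! l = j" by (auto simp: inj_lists_def)
    have "sg ` set cl <= {..<q}" using c(3) permutes_image[OF perm] by blast
    moreover have "distinct (map sg cl)" using c(2) inj by (simp add: distinct_map inj_on_subset[OF inj])
    ultimately show "map sg cl : ?A i' j'" using c(1) c l sg by (simp add: inj_lists_def)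
   qed
  qed simp
 qed
 have eq: "card (?A i' j') = card (?A i j)" if "(i', j') : ?P" for i' j' using that ij by (intro antisym le) auto
 have "(SUM p:?P. card {cl:inj_lists q m. cl ! 0 = fst p & cl ! l = snd p}) = (SUM cl:inj_lists q m. card {p:?P. cl ! 0 = fst p & cl ! l = snd p})"
  by (rule sum_card_swap) auto
 also have "... = (SUM cl:inj_lists q m. 1)"
 proof (rule sum.cong)
  fix cl assume cl: "cl : inj_lists q m"
  hence "cl ! 0 ~= cl ! l" "cl ! 0 < q" "cl ! l < q"
   using l inj_lists_nth(2)[OF cl, of 0 l] inj_lists_nth(1)[OF cl, of 0] inj_lists_nth(1)[OF cl, of l] by auto
  hence "{p:?P. cl ! 0 = fst p & cl ! l = snd p} = {(cl ! 0, cl ! l)}" by auto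
  thus "card {p:?P. cl ! 0 = fst p & cl ! l = snd p} = 1" by simp
 qed simp
 finally have s1: "(SUM p:?P. card {cl:inj_lists q m. cl ! 0 = fst p & cl ! l = snd p}) = card (inj_lists q m)" by simp
 have s2: "(SUM p:?P. card {cl:inj_lists q m. cl ! 0 = fst p & cl ! l = snd p}) = (SUM p:?P. card (?A i j))"
  by (intro sum.cong refl) (use eq in force)
 have "(SUM p:?P. card (?A i j)) = card ?P * card (?A i j)" by simp
 moreover have "card ?P = q * (q - 1)" by simp
 ultimately have "card (inj_lists q m) = q * (q - 1) * card (?A i j)" using s1 s2 by simp
 thus ?thesis using ij by simp
qed

text \<open>An arbitrary order on the children, along which the classes are handed out.\<close>

definition children :: "('x, 'y) star => ('x * 'y * 'y) list" where "children ta = (SOME cs. mset cs = snd ta)"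

lemma mset_children [simp]: "mset (children ta) = snd ta" unfolding children_def using ex_mset[of "snd ta"] by (rule someI_ex)

lemma length_children [simp]: "length (children ta) = deg ta" unfolding star_deg_def by (metis mset_children size_mset)

definition attach :: "('x, 'y) star => nat list => ('x * nat, 'y) star" where
 "attach ta cl = ((fst ta, cl ! 0), mset (map (%l. ((fst (children ta ! l), cl ! Suc l), snd (children ta ! l))) [0..<deg ta]))"

lemma star_deg_attach [simp]: "deg (attach ta cl) = deg ta" by (simp add: attach_def) (simp add: star_deg_def)

lemma proj_attach [simp]: "proj (attach ta cl) = ta"
proof -
 have "map strip (map (%l. ((fst (children ta ! l), cl ! Suc l), snd (children ta ! l))) [0..<deg ta]) = children ta"
  by (rule nth_equalityI) (auto simp: strip_def)
 hence "image_mset strip (snd (attach ta cl)) = snd ta" by (simp only: attach_def snd_conv flip: mset_map) simp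
 thus ?thesis by (cases ta) (simp add: proj_def attach_def)
qed

lemma adm_attach: assumes cl: "cl : inj_lists q (Suc (deg ta))" and ta: "pmf nu (fst ta) > 0" "!!c. c :# snd ta ==> child_wt nu xi c > 0"
 shows "adm snd (class_law nu q) xi (attach ta cl)" unfolding attach_def
proof (rule admI)
 have len: "length cl = Suc (deg ta)" and dist: "distinct cl" using cl by (auto simp: inj_lists_def)
 note lt = inj_lists_nth(1)[OF cl]
 have q: "q > 0" using lt[of 0] by simp
 have eq: "snd (fst ta, cl ! 0) # map (%c. snd (fst c)) (map (%l. ((fst (children ta ! l), cl ! Suc l), snd (children ta ! l))) [0..<deg ta]) = cl"
  by (rule nth_equalityI) (auto simp: len nth_Cons split: nat.split)
 show "distinct (snd (fst ta, cl ! 0) # map (%c. snd (fst c)) (map (%l. ((fst (children ta ! l), cl ! Suc l), snd (children ta ! l))) [0..<deg ta]))"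
  unfolding eq by (rule dist)
 show "pmf (class_law nu q) (fst ta, cl ! 0) > 0" using ta(1) q lt[of 0] len by (simp add: pmf_class_law)
 show "child_wt (class_law nu q) xi c > 0" if c: "c : set (map (%l. ((fst (children ta ! l), cl ! Suc l), snd (children ta ! l))) [0..<deg ta])" for c
 proof -
  obtain l where l: "l < deg ta" "c = ((fst (children ta ! l), cl ! Suc l), snd (children ta ! l))" using c by auto
  have "children ta ! l :# mset (children ta)" using l(1) by (simp del: mset_children)
  thus ?thesis using ta(2) q lt[of "Suc l"] l len by (simp add: child_wt_def pmf_class_law)
 qed
qed

lemma strip_attach [simp]: "image_mset strip (snd (attach ta cl)) = snd ta" using proj_attach[of ta cl] unfolding proj_def by (metis snd_conv)

text \<open>The stars of \<open>mu\<close> with uniformly random distinct classes. For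
  \<open>q\<close> above the degrees and \<open>mu\<close> dominated by the Poisson star law, the
  lift lives on admissible stars; its rate is compared with that of \<open>mu\<close> in
  \<open>kl_lift\<close> and \<open>col_div_lift\<close>.\<close>

definition lift :: "nat => ('x, 'y) star pmf => ('x * nat, 'y) star pmf" where
 "lift q mu = bind_pmf mu (%ta. map_pmf (attach ta) (pmf_of_set (inj_lists q (Suc (deg ta)))))"

lemma map_proj_lift: "map_pmf proj (lift q mu) = mu" by (simp add: lift_def map_bind_pmf map_pmf_comp bind_return_pmf')

lemma set_lift: assumes M: "!!ta. ta : set_pmf mu ==> deg ta <= M" "M < q" and z: "z : set_pmf (lift q mu)"
 shows "EX ta:set_pmf mu. EX cl:inj_lists q (Suc (deg ta)). z = attach ta cl"
proof -
 obtain ta where ta: "ta : set_pmf mu" "z : attach ta ` set_pmf (pmf_of_set (inj_lists q (Suc (deg ta))))" using z by (auto simp: lift_def)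
 have "inj_lists q (Suc (deg ta)) ~= {}" using M(1)[OF ta(1)] M(2) by (intro inj_lists_nonempty) simp
 thus ?thesis using ta by auto
qed

lemma expectation_lift:
 fixes h :: "_ => real" assumes fin: "finite (set_pmf mu)" and M: "!!ta. ta : set_pmf mu ==> deg ta <= M" "M < q" shows "expect (lift q mu) h
  = (SUM ta:set_pmf mu. pmf mu ta * ((SUM cl:inj_lists q (Suc (deg ta)). h (attach ta cl)) / real (card (inj_lists q (Suc (deg ta))))))"
proof -
 have ne: "inj_lists q (Suc (deg ta)) ~= {}" if "ta : set_pmf mu" for ta using M(1)[OF that] M(2) by (intro inj_lists_nonempty) simp
 have "expect (lift q mu) h = (SUM ta:set_pmf mu. pmf mu ta *\<^sub>R
  expect (map_pmf (attach ta) (pmf_of_set (inj_lists q (Suc (deg ta))))) h)"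
  unfolding lift_def using ne by (intro pmf_expectation_bind fin) (auto simp: set_pmf_of_set)
 also have "... = (SUM ta:set_pmf mu. pmf mu ta * ((SUM cl:inj_lists q (Suc (deg ta)). h (attach ta cl)) / real (card (inj_lists q (Suc (deg ta))))))"
  using ne by (intro sum.cong refl) (simp add: integral_pmf_of_set)
 finally show ?thesis .
qed

lemma count_mset_map_upt: "real (count (mset (map f [0..<d])) c) = (\<Sum>l<d. if f l = c then 1 else 0)" by (induction d) auto

text \<open>By \<open>inj_lists_pair_count\<close> the mean of a colour spreads evenly over the
  ordered pairs of distinct classes; in particular the lift inherits symmetry.\<close>

lemma colmean_lift: assumes fin: "finite (set_pmf mu)" and M: "!!ta. ta : set_pmf mu ==> deg ta <= M" "M < q"
 shows "colmean (lift q mu) ((x, i), (x', j), y) = (if i < q & j < q & i ~= j then colmean mu (x, x', y) / (real q * (real q - 1)) else 0)"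
proof -
 let ?I = "%ta. inj_lists q (Suc (deg ta))" and ?k = "((x, i), (x', j), y)"
 have cnt: "real (count (cols (attach ta cl)) ?k)
   = (\<Sum>l<deg ta. if fst ta = x & children ta ! l = (x', y) & cl ! 0 = i & cl ! Suc l = j then 1 else 0)" for ta cl
 proof -
  have eq: "cols (attach ta cl) = mset (map (%l. ((fst ta, cl ! 0), (fst (children ta ! l), cl ! Suc l), snd (children ta ! l))) [0..<deg ta])"
   unfolding cols_def attach_def fst_conv snd_conv mset_map[symmetric] by (simp add: comp_def)
  show ?thesis unfolding eq count_mset_map_upt by (auto intro!: sum.cong simp: prod_eq_iff)
 qed
 have cnt0: "real (count (cols ta) (x, x', y)) = (\<Sum>l<deg ta. if fst ta = x & children ta ! l = (x', y) then 1 else 0)" for ta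
 proof -
  have "map ((!) (children ta)) [0..<deg ta] = children ta" by (metis length_children map_nth)
  hence "snd ta = mset (map ((!) (children ta)) [0..<deg ta])" by simp
  hence eq: "cols ta = mset (map (%l. (fst ta, children ta ! l)) [0..<deg ta])"
   unfolding cols_def by (simp only: mset_map[symmetric] map_map comp_def)
  show ?thesis unfolding eq count_mset_map_upt by auto
 qed
 have inner: "(SUM cl:?I ta. real (count (cols (attach ta cl)) ?k)) / real (card (?I ta))
   = (if i < q & j < q & i ~= j then real (count (cols ta) (x, x', y)) / (real q * (real q - 1)) else 0)" if ta: "ta : set_pmf mu" for ta
 proof -
  have ne: "?I ta ~= {}" using M(1)[OF ta] M(2) by (intro inj_lists_nonempty) simp
  hence I0: "real (card (?I ta)) > 0" by auto
  have "(SUM cl:?I ta. real (count (cols (attach ta cl)) ?k))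
   = (\<Sum>l<deg ta. SUM cl:?I ta. if fst ta = x & children ta ! l = (x', y) & cl ! 0 = i & cl ! Suc l = j then 1 else 0)"
   unfolding cnt by (rule sum.swap)
  also have "... = (\<Sum>l<deg ta. if fst ta = x & children ta ! l = (x', y) then
    (if i < q & j < q & i ~= j then real (card (?I ta)) / (real q * (real q - 1)) else 0) else 0)"
  proof (rule sum.cong)
   fix l assume l: "l : {..<deg ta}"
   have "(SUM cl:?I ta. if cl ! 0 = i & cl ! Suc l = j then 1 else 0) = real (card {cl:?I ta. cl ! 0 = i & cl ! Suc l = j})"
    by (simp add: sum.If_cases Int_def)
   also have "... = (if i < q & j < q & i ~= j then real (card (?I ta)) / (real q * (real q - 1)) else 0)"
   proof (cases "i < q & j < q & i ~= j")
    case True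
    hence "real q * (real q - 1) > 0" by auto
    thus ?thesis using inj_lists_pair_count[of "Suc l" "Suc (deg ta)" i q j] True l by (simp add: field_simps)
   next
    case False
    have "{cl:?I ta. cl ! 0 = i & cl ! Suc l = j} = {}"
    proof -
     have "i < q & j < q & i ~= j" if cl: "cl : ?I ta" "cl ! 0 = i" "cl ! Suc l = j" for cl
     proof -
      have "cl ! 0 < q" "cl ! Suc l < q" "cl ! 0 ~= cl ! Suc l"
       using l inj_lists_nth(2)[OF cl(1), of 0 "Suc l"] inj_lists_nth(1)[OF cl(1), of 0] inj_lists_nth(1)[OF cl(1), of "Suc l"] by auto
      thus ?thesis using cl by simp
     qed
     thus ?thesis using False by blast
    qed
    thus ?thesis using False by auto
   qed
   finally show "(SUM cl:?I ta. if fst ta = x & children ta ! l = (x', y) & cl ! 0 = i & cl ! Suc l = j then 1 else 0) = (if fst ta = x & children ta ! l = (x', y) then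
    (if i < q & j < q & i ~= j then real (card (?I ta)) / (real q * (real q - 1)) else 0) else 0)" by auto
  qed simp
  also have "... = (if i < q & j < q & i ~= j then real (card (?I ta)) / (real q * (real q - 1)) else 0) * real (count (cols ta) (x, x', y))"
   unfolding cnt0 sum_distrib_left by (intro sum.cong) auto
  finally show ?thesis using I0 ne by simp
 qed
 have "colmean (lift q mu) ?k = (SUM ta:set_pmf mu. pmf mu ta * (if i < q & j < q & i ~= j then real (count (cols ta) (x, x', y)) / (real q * (real q - 1)) else 0))"
 proof -
  have "expect (lift q mu) (%z. real (count (cols z) ?k))
    = (SUM ta:set_pmf mu. pmf mu ta * ((SUM cl:?I ta. real (count (cols (attach ta cl)) ?k)) / real (card (?I ta))))"
   by (rule expectation_lift[OF fin M])
  thus ?thesis unfolding colmean_def by (simp only: inner cong: sum.cong)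
 qed
 moreover have "colmean mu (x, x', y) = (SUM ta:set_pmf mu. real (count (cols ta) (x, x', y)) * pmf mu ta)"
  unfolding colmean_def by (rule integral_measure_pmf_real[OF fin]) auto
 ultimately show ?thesis by (auto simp: sum_divide_distrib mult.commute)
qed

text \<open>Filling the list from left to right, an entry over \<open>a\<close> has at most as many
  choices as \<open>a\<close> still has preimages in \<open>S\<close>, counted with
  multiplicity.\<close>

lemma card_lists_map_mset: "finite {l. map f l = xs & mset l = S} & real (card {l. map f l = xs & mset l = S}) <= mfact (image_mset f S)"
proof (induction xs arbitrary: S)
 case Nil
 show ?case
 proof (cases "S = {#}")
  case True
  thus ?thesis using True by simp
 next
  case False
  hence e: "{l. map f l = [] & mset l = S} = {}" by auto
  show ?thesis unfolding e by simp
 qed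
next
 case (Cons a xs)
 let ?B = "%S. {l. map f l = xs & mset l = S}" and ?A = "{s : set_mset S. f s = a}"
 have eq: "{l. map f l = a # xs & mset l = S} = (\<Union>s\<in>?A. (#) s ` ?B (S - {#s#}))"
 proof (intro equalityI subsetI)
  fix l assume "l : {l. map f l = a # xs & mset l = S}"
  then obtain s l' where "l = s # l'" "f s = a" "map f l' = xs" "add_mset s (mset l') = S" by (cases l) auto
  thus "l : (\<Union>s\<in>?A. (#) s ` ?B (S - {#s#}))" by auto
 next
  fix l assume "l : (\<Union>s\<in>?A. (#) s ` ?B (S - {#s#}))"
  thus "l : {l. map f l = a # xs & mset l = S}" by auto
 qed
 have fin: "finite (?B (S - {#s#}))" for s using Cons.IH[of "S - {#s#}"] by simp
 have "real (card {l. map f l = a # xs & mset l = S}) <= (SUM s:?A. real (card ((#) s ` ?B (S - {#s#}))))"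
  unfolding eq of_nat_sum[symmetric] of_nat_le_iff by (rule card_UN_le) simp
 also have "... <= (SUM s:?A. mfact (image_mset f S - {#a#}))"
 proof (rule sum_mono)
  fix s assume s: "s : ?A"
  have "card ((#) s ` ?B (S - {#s#})) = card (?B (S - {#s#}))" by (rule card_image) simp
  thus "real (card ((#) s ` ?B (S - {#s#}))) <= mfact (image_mset f S - {#a#})" using Cons.IH[of "S - {#s#}"] s by (simp add: image_mset_Diff)
 qed
 also have "... <= mfact (image_mset f S)"
 proof (cases "?A = {}")
  case False
  hence a: "a :# image_mset f S" by auto
  have "card ?A = (SUM s:?A. 1)" by simp
  also have "... <= (SUM s:?A. count S s)" by (rule sum_mono) (simp add: Suc_le_eq)
  finally have "real (card ?A) * mfact (image_mset f S - {#a#}) <= real (count (image_mset f S) a) * mfact (image_mset f S - {#a#})" by (intro mult_right_mono, auto, simp add: count_image_mset' eq_commute)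
  thus ?thesis using mfact_remove[OF a] by simp
 qed (simp only: sum.empty mfact_nonneg)
 finally show ?case using fin unfolding eq by auto
qed

text \<open>Class lists that give the same star differ by exchanges among children with equal marks,
  of which there are at most \<open>mfact (snd ta)\<close>.\<close>

lemma card_attach_le: "real (card {cl : inj_lists q (Suc (deg ta)). attach ta cl = z}) <= mfact (snd ta)"
proof (cases "{cl : inj_lists q (Suc (deg ta)). attach ta cl = z} = {}")
 case True
 thus ?thesis by (simp only: card.empty of_nat_0 mfact_nonneg)
next
 case False
 let ?A = "{cl : inj_lists q (Suc (deg ta)). attach ta cl = z}" and ?B = "{l. map strip l = children ta & mset l = snd z}"
 let ?f = "%cl. map (%l. ((fst (children ta ! l), cl ! Suc l), snd (children ta ! l))) [0..<deg ta]"
 have z: "image_mset strip (snd z) = snd ta" using False by auto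
 have "card ?A <= card ?B"
 proof (rule card_inj_on_le[of ?f])
  show "inj_on ?f ?A"
  proof (rule inj_onI)
   fix cl cl' assume c: "cl : ?A" "cl' : ?A" "?f cl = ?f cl'"
   have len: "length cl = Suc (deg ta)" "length cl' = Suc (deg ta)" using c by (auto simp: inj_lists_def)
   have "cl ! 0 = cl' ! 0" using c(1,2) by (auto simp: attach_def)
   moreover have "cl ! Suc l = cl' ! Suc l" if "l < deg ta" for l using arg_cong[OF c(3), of "%xs. xs ! l"] that by simp
   ultimately show "cl = cl'" by (intro nth_equalityI) (auto simp: len less_Suc_eq_0_disj)
  qed
  show "?f ` ?A <= ?B"
  proof (rule image_subsetI)
   fix cl assume "cl : ?A"
   hence "mset (?f cl) = snd z" by (metis (mono_tags, lifting) attach_def mem_Collect_eq snd_conv)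
   moreover have "map strip (?f cl) = children ta" by (rule nth_equalityI) (auto simp: strip_def)
   ultimately show "?f cl : ?B" by blast
  qed
  show "finite ?B" using card_lists_map_mset[of strip "children ta" "snd z"] by blast
 qed
 hence "real (card ?A) <= real (card ?B)" by simp
 thus ?thesis using card_lists_map_mset[of strip "children ta" "snd z"] by (simp add: z)
qed

lemma finite_lift: assumes "finite (set_pmf mu)" "!!ta. ta : set_pmf mu ==> deg ta <= M" "M < q" shows "finite (set_pmf (lift q mu))"
proof (rule finite_subset)
 show "set_pmf (lift q mu) <= (\<Union>ta\<in>set_pmf mu. attach ta ` inj_lists q (Suc (deg ta)))"
 proof
  fix z assume z: "z : set_pmf (lift q mu)"
  have "EX ta:set_pmf mu. EX cl:inj_lists q (Suc (deg ta)). z = attach ta cl" by (rule set_lift[OF assms(2,3) z])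
  thus "z : (\<Union>ta\<in>set_pmf mu. attach ta ` inj_lists q (Suc (deg ta)))" by blast
 qed
qed (use assms(1) in simp)

lemma pmf_lift_le: assumes fin: "finite (set_pmf mu)" and M: "!!ta. ta : set_pmf mu ==> deg ta <= M" "M < q"
  and ta: "ta : set_pmf mu" and z: "z = attach ta cl"
 shows "pmf (lift q mu) z <= pmf mu ta * mfact (snd ta) / real (card (inj_lists q (Suc (deg ta))))"
proof -
 let ?I = "%ta. inj_lists q (Suc (deg ta))"
 have "pmf (lift q mu) z = expect (lift q mu) (indicator {z})" by (simp add: measure_pmf_single)
 also have "... = (SUM ta':set_pmf mu. pmf mu ta' * ((SUM cl:?I ta'. indicator {z} (attach ta' cl)) / real (card (?I ta'))))"
  by (rule expectation_lift[OF fin M])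
 also have "... = (SUM ta':{ta}. pmf mu ta' * ((SUM cl:?I ta'. indicator {z} (attach ta' cl)) / real (card (?I ta'))))"
 proof (rule sum.mono_neutral_right[OF fin])
  show "ALL i:set_pmf mu - {ta}. pmf mu i * ((SUM cl:?I i. indicator {z} (attach i cl)) / real (card (?I i))) = 0"
  proof
   fix i assume i: "i : set_pmf mu - {ta}"
   have "attach i cl' ~= z" for cl' using i by (metis DiffE proj_attach singletonI z)
   thus "pmf mu i * ((SUM cl:?I i. indicator {z} (attach i cl)) / real (card (?I i))) = 0" by simp
  qed
 qed (use ta in auto)
 also have "... = pmf mu ta * (real (card {cl : ?I ta. attach ta cl = z}) / real (card (?I ta)))" by (simp add: indicator_def Int_def)
 finally show ?thesis by (simp, intro mult_left_mono divide_right_mono card_attach_le, auto)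
qed

text \<open>With distinct classes all children of the lifted star differ, so its own
  \<open>mfact\<close> is 1, and every vertex costs a factor 1 / q. The surviving
  \<open>mfact (snd ta)\<close> cancels against the one in \<open>pmf_lift_le\<close>.\<close>

lemma pmf_true_law_attach: assumes kp: "kp > 0" and cl: "cl : inj_lists q (Suc (deg ta))" and ta: "pmf (poi_law kp nu xi) ta > 0"
 shows "adm snd (class_law nu q) xi (attach ta cl)"
  and "pmf (true_law (Poi kp) (class_law nu q) xi) (attach ta cl) = pmf (poi_law kp nu xi) ta * mfact (snd ta) / real q ^ Suc (deg ta)"
proof -
 have q: "q > 0" using inj_lists_nth(1)[OF cl, of 0] by simp
 have "pmf nu (fst ta) ~= 0" "(PROD c:#snd ta. kp * child_wt nu xi c) ~= 0"
  using ta unfolding pmf_true_law_Poi[OF less_imp_le[OF kp]] by (metis mult_zero_right mult_zero_left div_0 less_irrefl)+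
 hence pos: "pmf nu (fst ta) > 0" "!!c. c :# snd ta ==> child_wt nu xi c > 0"
 proof -
  have "child_wt nu xi c ~= 0" if "(PROD c:#m. kp * child_wt nu xi c) ~= 0" "c :# m" for m c using that by auto
  thus "pmf nu (fst ta) > 0" "!!c. c :# snd ta ==> child_wt nu xi c > 0"
   using \<open>pmf nu (fst ta) \<noteq> 0\<close> \<open>(PROD c:#snd ta. kp * child_wt nu xi c) \<noteq> 0\<close> by (simp_all add: less_le)
 qed
 show adm: "adm snd (class_law nu q) xi (attach ta cl)" by (rule adm_attach[OF cl pos])
 let ?z = "attach ta cl"
 have "mfact (snd ?z) = 1"
 proof (rule mfact_1)
  have "good_star snd (fst ?z, snd ?z)" using adm by (simp add: adm_def)
  thus "count (snd ?z) c <= 1" for c by (rule good_starD(3))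
 qed
 moreover have "pmf (class_law nu q) (fst ?z) = pmf nu (fst ta) / real q"
  using q inj_lists_nth(1)[OF cl, of 0] by (simp add: attach_def pmf_class_law)
 moreover have "(PROD c:#m. kp * child_wt (class_law nu q) xi c) = (PROD c:#image_mset strip m. kp * child_wt nu xi c) / real q ^ size m"
  if "\<forall>c\<in>#m. child_wt (class_law nu q) xi c > 0" for m using that
 proof (induction m)
  case (add c m)
  show ?case using add.prems q add by (cases "snd (fst c) < q", auto simp: child_wt_def pmf_class_law strip_def)
 qed simp
 hence "(PROD c:#snd ?z. kp * child_wt (class_law nu q) xi c) = (PROD c:#snd ta. kp * child_wt nu xi c) / real q ^ deg ta"
 proof -
  have "image_mset strip (snd ?z) = snd ta" by simp
  moreover have "size (snd ?z) = deg ta" using star_deg_attach[of ta cl] by (simp add: star_deg_def)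
  moreover have "\<forall>c\<in>#snd ?z. child_wt (class_law nu q) xi c > 0" using adm by (simp add: adm_def)
  ultimately show ?thesis using \<open>\<And>m. \<forall>c\<in>#m. child_wt (class_law nu q) xi c > 0 \<Longrightarrow> _ m\<close>[of "snd ?z"] by simp
 qed
 ultimately show "pmf (true_law (Poi kp) (class_law nu q) xi) ?z = pmf (poi_law kp nu xi) ta * mfact (snd ta) / real q ^ Suc (deg ta)" using kp by (simp add: pmf_true_law_Poi)
qed

text \<open>For a star of degree d, replacing independent uniform classes by distinct ones costs the
  logarithm of q^(d + 1) over the number of injective lists. For bounded degree this vanishes as q
  grows.\<close>

lemma kl_lift: assumes kp: "kp > 0" and fin: "finite (set_pmf mu)" and M: "!!ta. ta : set_pmf mu ==> deg ta <= M" "M < q"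
  and sub: "set_pmf mu <= set_pmf (poi_law kp nu xi)" shows "kl_real (lift q mu) (true_law (Poi kp) (class_law nu q) xi)
  <= kl_real mu (poi_law kp nu xi) + real (Suc M) * ln (real q / (real q - real M))"
proof -
 let ?et = "poi_law kp nu xi" and ?et' = "true_law (Poi kp) (class_law nu q) xi"
 let ?c = "real (Suc M) * ln (real q / (real q - real M))"
 have finl: "finite (set_pmf (lift q mu))" by (rule finite_lift[OF fin M])
 have "kl_real (lift q mu) ?et' <= expect (lift q mu) (%z. ln (pmf mu (proj z) / pmf ?et (proj z)) + ?c)" unfolding kl_real_def
 proof (rule integral_mono_AE)
  show "AE z in (lift q mu). ln (pmf (lift q mu) z / pmf ?et' z) <= ln (pmf mu (proj z) / pmf ?et (proj z)) + ?c" unfolding AE_measure_pmf_iff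
  proof
   fix z assume z: "z : set_pmf (lift q mu)"
   obtain ta cl where t: "ta : set_pmf mu" "cl : inj_lists q (Suc (deg ta))" "z = attach ta cl"
   proof -
    have "EX ta:set_pmf mu. EX cl:inj_lists q (Suc (deg ta)). z = attach ta cl" by (rule set_lift[OF M z])
    thus thesis using that by blast
   qed
   let ?d = "deg ta" and ?I = "real (card (inj_lists q (Suc (deg ta))))"
   have mup: "pmf mu ta > 0" using t(1) by (rule pmf_positive)
   have etp: "pmf ?et ta > 0" using t(1) sub by (auto intro: pmf_positive)
   have e: "pmf ?et' z = pmf ?et ta * mfact (snd ta) / real q ^ Suc ?d" unfolding t(3) by (rule pmf_true_law_attach(2)[OF kp t(2) etp])
   have dM: "?d <= M" by (rule M(1)[OF t(1)])
   have qd: "real q - real ?d > 0" "real q - real M > 0" using dM M(2) by auto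
   have Ige: "(real q - real ?d) ^ Suc ?d <= ?I" by (rule card_inj_lists_ge) (use dM M(2) in simp)
   have I0: "?I > 0" using Ige zero_less_power[OF qd(1), of "Suc ?d"] by linarith
   have up: "pmf (lift q mu) z <= pmf mu ta * mfact (snd ta) / ?I" by (rule pmf_lift_le[OF fin M t(1) t(3)])
   have e0: "pmf ?et' z > 0" unfolding e using etp M(2) by simp
   have "pmf (lift q mu) z / pmf ?et' z <= (pmf mu ta * mfact (snd ta) / ?I) / pmf ?et' z" using up e0 by (intro divide_right_mono) auto
   also have "... = pmf mu ta / pmf ?et ta * (real q ^ Suc ?d / ?I)" unfolding e using mfact_nonzero[of "snd ta"] by simp
   also have "... <= pmf mu ta / pmf ?et ta * (real q / (real q - real M)) ^ Suc M"
   proof (intro mult_left_mono)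
    have "real q ^ Suc ?d / ?I <= (real q / (real q - real ?d)) ^ Suc ?d" using Ige I0 qd by (simp only: power_divide, intro divide_left_mono mult_pos_pos zero_less_power, auto)
    also have "... <= (real q / (real q - real M)) ^ Suc ?d" using qd dM by (intro power_mono divide_left_mono) auto
    also have "... <= (real q / (real q - real M)) ^ Suc M" using qd dM by (intro power_increasing) auto
    finally show "real q ^ Suc ?d / ?I <= (real q / (real q - real M)) ^ Suc M" .
   qed (use mup etp in simp)
   finally have le: "pmf (lift q mu) z / pmf ?et' z <= pmf mu ta / pmf ?et ta * (real q / (real q - real M)) ^ Suc M" .
   have "pmf (lift q mu) z / pmf ?et' z > 0" using pmf_positive[OF z] e0 by simp
   hence "ln (pmf (lift q mu) z / pmf ?et' z) <= ln (pmf mu ta / pmf ?et ta * (real q / (real q - real M)) ^ Suc M)" using le by simp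
   also have "... = ln (pmf mu ta / pmf ?et ta) + ln ((real q / (real q - real M)) ^ Suc M)"
    using mup etp qd M(2) by (intro ln_mult_pos divide_pos_pos zero_less_power) auto
   also have "ln ((real q / (real q - real M)) ^ Suc M) = ?c" by (simp add: ln_realpow del: power_Suc of_nat_Suc)
   finally show "ln (pmf (lift q mu) z / pmf ?et' z) <= ln (pmf mu (proj z) / pmf ?et (proj z)) + ?c" by (simp add: t(3))
  qed
 qed (rule integrable_measure_pmf_finite[OF finl])+
 also have "... = expect (map_pmf proj (lift q mu)) (%ta. ln (pmf mu ta / pmf ?et ta) + ?c)" by simp
 also have "... = kl_real mu ?et + ?c" unfolding map_proj_lift kl_real_def using integrable_measure_pmf_finite[OF fin]
  by (subst Bochner_Integration.integral_add) (auto simp: measure_pmf.prob_space)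
 finally show ?thesis .
qed

text \<open>The weight of a colour is spread over q^2 pairs of classes, its mean only over q (q -
  1), which can only raise the divergence. As the divergence enters the rate with a minus sign, this
  is the favourable direction.\<close>

lemma col_div_lift:
 fixes nu :: "'x pmf" and xi :: "('y::finite * 'y) pmf" assumes kp: "kp > 0" and finnu: "finite (set_pmf nu)" and fin: "finite (set_pmf mu)"
  and M: "!!ta. ta : set_pmf mu ==> deg ta <= M" "M < q" and q: "q >= 2"
 shows "col_div kp nu xi (colmean mu) <= col_div kp (class_law nu q) xi (colmean (lift q mu))"
proof -
 let ?pc = "colmean mu" and ?pc' = "colmean (lift q mu)" and ?nu' = "class_law nu q"
 define e where "e = (%((x, x', y), (i, j)). ((x, i), (x', j), y) :: ('x * nat) \<times> ('x * nat) * 'y * 'y)"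
 have e: "inj e" by (auto simp: e_def inj_def)
 have wt: "edge_wt ?nu' xi (e (k, ij)) = (if fst ij < q & snd ij < q then edge_wt nu xi k / (real q)\<^sup>2 else 0)" for k ij
  using q by (auto simp: e_def edge_wt_def child_wt_def pmf_class_law power2_eq_square split: prod.splits)
 have pc: "pcols ?nu' xi = e ` (pcols nu xi \<times> ({..<q} \<times> {..<q}))"
 proof (intro equalityI subsetI)
  fix k' assume k': "k' : pcols ?nu' xi"
  obtain x i x' j y where "k' = ((x, i), (x', j), y)" by (metis surj_pair)
  hence eq: "k' = e ((x, x', y), (i, j))" by (simp add: e_def)
  thus "k' : e ` (pcols nu xi \<times> ({..<q} \<times> {..<q}))" using k' wt[of "(x, x', y)" "(i, j)"] unfolding eq using q by (intro imageI, auto simp: pcols_def zero_less_divide_iff split: if_splits)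
 next
  fix k' assume "k' : e ` (pcols nu xi \<times> ({..<q} \<times> {..<q}))"
  thus "k' : pcols ?nu' xi" using wt q by (auto simp: pcols_def)
 qed
 have fp: "finite (pcols nu xi)" by (rule finite_pcols[OF finnu])
 have pi: "?pc' (e (k, (i, j))) = (if i < q & j < q & i ~= j then ?pc k / (real q * (real q - 1)) else 0)" for k i j
  using colmean_lift[OF fin M] by (cases k) (simp add: e_def)
 have pc0: "?pc k >= 0" for k by (simp add: colmean_def)
 have "(SUM k:pcols ?nu' xi. ?pc' k * ln (?pc' k / (kp * edge_wt ?nu' xi k)) - ?pc' k)
  = (SUM k:pcols nu xi. SUM ij:{..<q} \<times> {..<q}. ?pc' (e (k, ij)) * ln (?pc' (e (k, ij)) / (kp * edge_wt ?nu' xi (e (k, ij)))) - ?pc' (e (k, ij)))" unfolding pc by (subst sum.cartesian_product, simp add: case_prod_unfold, subst sum.reindex, auto intro: inj_on_subset[OF e])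
 also have "... >= (SUM k:pcols nu xi. ?pc k * ln (?pc k / (kp * edge_wt nu xi k)) - ?pc k)"
 proof (rule sum_mono)
  fix k assume k: "k : pcols nu xi"
  hence w: "edge_wt nu xi k > 0" by (simp add: pcols_def)
  define Q where "Q = real q * (real q - 1)"
  have Q: "Q > 0" using q by (simp add: Q_def)
  define D where "D = (SIGMA i:{..<q}. {..<q} - {i})"
  have cD: "real (card D) = Q" unfolding D_def using q by (simp add: Q_def)
  let ?t = "?pc k / Q * ln (?pc k / Q / (kp * (edge_wt nu xi k / (real q)\<^sup>2))) - ?pc k / Q"
  have "(SUM ij:{..<q} \<times> {..<q}. ?pc' (e (k, ij)) * ln (?pc' (e (k, ij)) / (kp * edge_wt ?nu' xi (e (k, ij)))) - ?pc' (e (k, ij)))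
   = (SUM ij:D. ?pc' (e (k, ij)) * ln (?pc' (e (k, ij)) / (kp * edge_wt ?nu' xi (e (k, ij)))) - ?pc' (e (k, ij)))"
   by (rule sum.mono_neutral_right) (auto simp: D_def pi)
  also have "... = (SUM ij:D. ?t)" by (intro sum.cong refl) (auto simp: D_def pi wt Q_def)
  finally have eq: "(SUM ij:{..<q} \<times> {..<q}. ?pc' (e (k, ij)) * ln (?pc' (e (k, ij)) / (kp * edge_wt ?nu' xi (e (k, ij)))) - ?pc' (e (k, ij)))
   = ?pc k * ln (?pc k / Q / (kp * (edge_wt nu xi k / (real q)\<^sup>2))) - ?pc k" using Q by (simp add: cD right_diff_distrib)
  show "?pc k * ln (?pc k / (kp * edge_wt nu xi k)) - ?pc k <= (SUM ij:{..<q} \<times> {..<q}. ?pc' (e (k, ij)) * ln (?pc' (e (k, ij)) / (kp * edge_wt ?nu' xi (e (k, ij)))) - ?pc' (e (k, ij)))"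
   unfolding eq
  proof (cases "?pc k = 0")
   case False
   hence p: "?pc k > 0" using pc0[of k] by simp
   have "?pc k / Q / (kp * (edge_wt nu xi k / (real q)\<^sup>2)) = ?pc k / (kp * edge_wt nu xi k) * ((real q)\<^sup>2 / Q)" by simp
   moreover have "(real q)\<^sup>2 / Q >= 1" using q Q by (simp add: Q_def power2_eq_square)
   moreover have "?pc k / (kp * edge_wt nu xi k) > 0" using p kp w by simp
   ultimately have "ln (?pc k / (kp * edge_wt nu xi k)) <= ln (?pc k / Q / (kp * (edge_wt nu xi k / (real q)\<^sup>2)))"
    by (metis ln_mono mult.right_neutral mult_left_mono less_imp_le)
   thus "?pc k * ln (?pc k / (kp * edge_wt nu xi k)) - ?pc k <= ?pc k * ln (?pc k / Q / (kp * (edge_wt nu xi k / (real q)\<^sup>2))) - ?pc k"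
    using pc0[of k] by (intro diff_right_mono mult_left_mono) auto
  qed simp
 qed
 finally show ?thesis unfolding col_div_def by linarith
qed

section \<open>The lower bound for laws of bounded degree\<close>

lemma pmf_empirical: assumes "n >= 1" shows "pmf (emp n t) a = real (card {v : {1..n}. t v = a}) / real n"
 using sum_pmf_empirical[OF assms, of "{a}" "%_. 1" t] by (simp add: sum.If_cases Int_def)

lemma size_filter_image_mset: "finite A ==> size {#z :# image_mset t (mset_set A). P z#} = card {v : A. P (t v)}"
proof (induction A rule: finite_induct)
 case (insert a A)
 have "{v : insert a A. P (t v)} = (if P (t a) then insert a {v : A. P (t v)} else {v : A. P (t v)})" by auto
 thus ?case using insert by simp
qed simp

text \<open>The number of vertices of each degree is prescribed exactly. The two conditioned models
  are obtained by choosing \<open>c\<close>: the given degree counts, or any counts with the right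
  number of half-edges.\<close>

lemma ER_lower_bounded_degree:
 fixes mu :: "('x::finite, 'y::finite) star pmf" and c :: "nat => nat => nat"
 assumes kp: "kp > 0" and M: "!!ta. ta : set_pmf mu ==> deg ta <= M" and i0: "1 <= i0" "pmf (map_pmf deg mu) i0 > 0"
  and sym: "!!k. colmean mu (rev_col k) = colmean mu k" and sub: "set_pmf mu <= set_pmf (poi_law kp nu xi)"
  and c: "Ev n. (SUM d<=M. c n d) = n & even (SUM d<=M. d * c n d)"
  and clim: "!!d. d <= M ==> (%n. real (c n d) / real n) ----> pmf (map_pmf deg mu) d"
  and F: "finite F" "ep > 0" and r: "kl_real mu (poi_law kp nu xi) - col_div kp nu xi (colmean mu) / 2 < r"
 shows "Ev n. decay r n <= prob (ER_law kp nu xi n)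
  {t : seq_ball n F ep mu. ALL d<=M. card {v : {1..n}. deg (t v) = d} = c n d}"
proof -
 let ?et = "poi_law kp nu xi"
 define de where "de = r - (kl_real mu ?et - col_div kp nu xi (colmean mu) / 2)"
 have de: "de > 0" using r by (simp add: de_def)
 have fin: "finite (set_pmf mu)" by (rule finite_subset[OF _ finite_stars[of M]]) (use M in blast)
 \<comment> \<open>Enough classes for the gadgets, and so many that the splitting costs an entropy
   below de / 2.\<close>
 obtain q where q: "q >= 2 * M + 4" "real (Suc M) * ln (real q / (real q - real M)) < de / 2"
 proof -
  have lim: "(%q. real (Suc M) * ln (1 / (1 - real M / real q))) ----> real (Suc M) * ln (1 / (1 - 0))" by (intro tendsto_intros, auto)
  have "\<forall>\<^sub>F q in sequentially. real (Suc M) * ln (1 / (1 - real M / real q)) < de / 2"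
   by (rule order_tendstoD(2)[OF lim]) (use de in simp)
  then obtain N where "ALL q>=N. real (Suc M) * ln (1 / (1 - real M / real q)) < de / 2" unfolding eventually_sequentially by blast
  then obtain q where q: "q >= 2 * M + 4" "real (Suc M) * ln (1 / (1 - real M / real q)) < de / 2" by (metis max.cobounded1 max.cobounded2)
  moreover have "1 / (1 - real M / real q) = real q / (real q - real M)" using q(1) by (simp add: field_simps)
  ultimately show thesis using that by metis
 qed
 have qM: "M < q" "q >= 2" "q > 0" using q(1) by auto
 define mu' where "mu' = lift q mu"
 let ?nu' = "class_law nu q" and ?P = "%n. ER_law kp nu xi n" and ?P' = "%n. star_seq_law n (ER_graph kp n) (class_law nu q) xi"
 have finnu: "finite (set_pmf nu)" by simp
 have finnu': "finite (set_pmf ?nu')" using qM by (simp add: lessThan_empty_iff)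
 have i0M: "i0 <= M"
 proof -
  show ?thesis using i0(2) M by (auto simp: pmf_positive_iff)
 qed
 have adm': "adm snd ?nu' xi z & deg z <= M" if z0: "z : set_pmf mu'" for z
 proof -
  have z: "z : set_pmf (lift q mu)" using z0 by (simp add: mu'_def)
  obtain ta cl where t: "ta : set_pmf mu" "cl : inj_lists q (Suc (deg ta))" "z = attach ta cl"
  proof -
   have "EX ta:set_pmf mu. EX cl:inj_lists q (Suc (deg ta)). z = attach ta cl" by (rule set_lift[OF M qM(1) z])
   thus thesis using that by blast
  qed
  show ?thesis using t(1) sub pmf_true_law_attach(1)[OF kp t(2)] M[OF t(1)] by (simp add: t(3), auto intro: pmf_positive)
 qed
 have deg': "map_pmf deg mu' = map_pmf deg mu"
 proof -
  have "map_pmf deg mu' = map_pmf deg (map_pmf proj mu')" by (simp add: map_pmf_comp)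
  thus ?thesis by (simp add: mu'_def map_proj_lift)
 qed
 have sym': "colmean mu' (rev_col k) = colmean mu' k" for k
 proof -
  obtain x i x' j y y' where k: "k = ((x, i), (x', j), y, y')" by (metis surj_pair)
  have cl: "colmean mu' ((x, i), (x', j), y) = (if i < q & j < q & i ~= j then colmean mu (x, x', y) / (real q * (real q - 1)) else 0)" for x i x' j y
   unfolding mu'_def by (rule colmean_lift[OF fin M qM(1)])
  show ?thesis using sym[of "(x, x', y, y')"] by (auto simp: k cl)
 qed
 obtain S where S: "Ev n. size (S n) = n & (\<forall>z\<in>#S n. adm snd ?nu' xi z & deg z <= M)
   & (ALL d<=M. deg_count d (S n) = c n d) & rev_cols (mcols (S n)) = mcols (S n)"
  and Slim: "!!z. (%n. real (count (S n) z) / real n) ----> pmf mu' z"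
  using rounding[OF finnu i0(1) i0M _ q(1) adm' sym' c] i0(2) clim unfolding deg' by blast
 define A where "A n = fact n / mfact (S n) * (PROD z:#S n. pmf (true_law (Poi kp) ?nu' xi) z) * col_factor kp ?nu' xi n (mcols (S n))" for n
 have "(%n. ln (A n) / real n) ----> - kl_real mu' (true_law (Poi kp) ?nu' xi) + col_div kp ?nu' xi (colmean mu') / 2" unfolding A_def
 proof (rule tendsto_multiset_prob[OF finnu' kp _ adm' Slim])
  show "Ev n. size (S n) = n & (\<forall>z\<in>#S n. adm snd ?nu' xi z & deg z <= M)" using S by eventually_elim blast
 qed
 moreover have "- r < - kl_real mu' (true_law (Poi kp) ?nu' xi) + col_div kp ?nu' xi (colmean mu') / 2"
 proof -
  have "kl_real mu' (true_law (Poi kp) ?nu' xi) <= kl_real mu ?et + real (Suc M) * ln (real q / (real q - real M))"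
   unfolding mu'_def by (rule kl_lift[OF kp fin M qM(1) sub])
  moreover have "col_div kp nu xi (colmean mu) <= col_div kp ?nu' xi (colmean mu')"
   unfolding mu'_def by (rule col_div_lift[OF kp finnu fin M qM(1,2)])
  ultimately show ?thesis using q(2) de by (simp add: de_def)
 qed
 ultimately have evA: "Ev n. - r < ln (A n) / real n" by (rule order_tendstoD(1))
 have ball: "Ev n. ALL a:F. \<bar>real (size {#z :# S n. proj z = a#}) / real n - pmf mu a\<bar> < ep"
 proof (rule eventually_ball_finite[OF F(1)], rule)
  fix a
  define Z where "Z = {z. adm snd ?nu' xi z & deg z <= M}"
  have Z: "finite Z" unfolding Z_def by (rule finite_supported_stars[OF finnu'])
  have "(%n. SUM z:{z:Z. proj z = a}. real (count (S n) z) / real n) ----> (SUM z:{z:Z. proj z = a}. pmf mu' z)" by (intro tendsto_sum Slim)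
  also have "(SUM z:{z:Z. proj z = a}. pmf mu' z) = pmf mu a"
  proof -
   have "pmf mu a = prob mu' (proj -` {a})" by (subst map_proj_lift[of q mu, symmetric]) (simp add: pmf_map mu'_def)
   also have "... = prob mu' {z:Z. proj z = a}"
    by (rule measure_pmf.finite_measure_eq_AE) (use adm' in \<open>auto simp: AE_measure_pmf_iff Z_def\<close>)
   finally show ?thesis using Z by (simp add: prob_finite_sum)
  qed
  finally have "Ev n. \<bar>(SUM z:{z:Z. proj z = a}. real (count (S n) z) / real n) - pmf mu a\<bar> < ep"
   using F(2) by (simp add: tendsto_iff dist_real_def)
  thus "Ev n. \<bar>real (size {#z :# S n. proj z = a#}) / real n - pmf mu a\<bar> < ep" using S
  proof eventually_elim
   case (elim n)
   have sub: "set_mset {#z :# S n. proj z = a#} <= {z:Z. proj z = a}" using elim(2) by (auto simp: Z_def)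
   have "real (size {#z :# S n. proj z = a#}) = (SUM z:{z:Z. proj z = a}. real (count {#z :# S n. proj z = a#} z))"
    using sum_mset_count[OF _ sub, of "%_. 1"] Z by simp
   also have "... = (SUM z:{z:Z. proj z = a}. real (count (S n) z))" by simp
   finally show ?case using elim(1) by (simp add: sum_divide_distrib)
  qed
 qed
 obtain n0 :: nat where n0: "real n0 > kp" using reals_Archimedean2 by blast
 show ?thesis using evA ball S eventually_ge_at_top[of "max 1 n0"]
 proof eventually_elim
  case (elim n)
  have n: "n >= 1" "kp < real n" using elim(4) n0 by linarith+
  have sz: "size (S n) = n" and adm: "!!z. z :# S n ==> adm snd ?nu' xi z" and dc: "ALL d<=M. deg_count d (S n) = c n d"
   and bal: "rev_cols (mcols (S n)) = mcols (S n)" using elim(3) by blast+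
  have pc: "set_mset (mcols (S n)) <= pcols ?nu' xi" using adm_mcols[OF adm] by (auto simp: pcols_def good_col_def)
  have "(PROD z:#S n. pmf (true_law (Poi kp) ?nu' xi) z) > 0"
  proof -
   have "(PROD z:#T. pmf (true_law (Poi kp) ?nu' xi) z) > 0" if "\<forall>z\<in>#T. pmf (true_law (Poi kp) ?nu' xi) z > 0" for T
    using that by (induction T) auto
   thus ?thesis using adm_true_law[OF kp adm] by blast
  qed
  hence A0: "A n > 0" unfolding A_def using ln_col_factor(1)[OF finnu' kp n(2) pc] by simp
  have "- r * real n < ln (A n)" using elim(1) n(1) by (simp add: field_simps)
  hence "decay r n < exp (ln (A n))" by simp
  also have "... = A n" using A0 by simp
  also have "... <= prob (?P' n) {t. image_mset t (mset_set {1..n}) = S n}" unfolding A_def by (rule multiset_prob_lower[OF kp n(2) sz bal adm])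
  also have "... <= prob (?P' n) ((%t v. if v : {1..n} then proj (t v) else undefined) -`
    {t : seq_ball n F ep mu. ALL d<=M. card {v : {1..n}. deg (t v) = d} = c n d})"
  proof (rule measure_pmf.finite_measure_mono)
   show "{t. image_mset t (mset_set {1..n}) = S n} <= (%t v. if v : {1..n} then proj (t v) else undefined) -`
    {t : seq_ball n F ep mu. ALL d<=M. card {v : {1..n}. deg (t v) = d} = c n d}"
   proof
    fix t assume "t : {t. image_mset t (mset_set {1..n}) = S n}"
    hence t: "S n = image_mset t (mset_set {1..n})" by simp
    let ?t = "%v. if v : {1..n} then proj (t v) else undefined"
    have "pmf (emp n ?t) a = real (size {#z :# S n. proj z = a#}) / real n" for a
    proof -
     have "{v : {1..n}. ?t v = a} = {v : {1..n}. proj (t v) = a}" by auto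
     thus ?thesis unfolding pmf_empirical[OF n(1)] t size_filter_image_mset[OF finite_atLeastAtMost] by simp
    qed
    hence "?t : seq_ball n F ep mu" using elim(2) unfolding seq_ball_def by simp
    moreover have "card {v : {1..n}. deg (?t v) = d} = c n d" if "d <= M" for d
    proof -
     have "{v : {1..n}. deg (?t v) = d} = {v : {1..n}. deg (t v) = d}" by auto
     moreover have "card {v : {1..n}. deg (t v) = d} = deg_count d (S n)" unfolding deg_count_def t size_filter_image_mset[OF finite_atLeastAtMost] ..
     ultimately show ?thesis using dc that by simp
    qed
    ultimately show "t : (%t v. if v : {1..n} then proj (t v) else undefined) -`
      {t : seq_ball n F ep mu. ALL d<=M. card {v : {1..n}. deg (t v) = d} = c n d}" by blast
   qed
  qed simp
  also have "... = prob (?P n) {t : seq_ball n F ep mu. ALL d<=M. card {v : {1..n}. deg (t v) = d} = c n d}" using arg_cong[OF star_seq_law_proj[OF qM(3), of n kp nu xi], of "%p. prob p {t : seq_ball n F ep mu. ALL d<=M. card {v : {1..n}. deg (t v) = d} = c n d}"] by simp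
  finally show ?case by simp
 qed
qed

section \<open>Truncation of the degrees\<close>



lemma finite_pmf_exists:
 fixes w :: "'a => real" assumes "finite F" "!!a. w a >= 0" "!!a. a ~: F ==> w a = 0" "sum w F = 1" shows "EX p. pmf p = w"
proof -
 have "(\<integral>\<^sup>+a. ennreal (w a) \<partial>count_space UNIV) = (SUM a:F. ennreal (w a))"
  by (rule nn_integral_count_space') (use assms in auto)
 hence "pmf (embed_pmf w) a = w a" for a using assms assms(2) by (intro pmf_embed_pmf, auto)
 thus ?thesis by blast
qed

lemma set_true_law_Poi: assumes "kp > 0" shows "a : set_pmf (poi_law kp nu xi) <-> pmf nu (fst a) > 0 & (\<forall>c\<in>#snd a. child_wt nu xi c > 0)"
proof -
 have "(PROD c:#m. kp * child_wt nu xi c) ~= 0 <-> (\<forall>c\<in>#m. child_wt nu xi c ~= 0)" for m using assms by auto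
 thus ?thesis using assms by (auto simp: set_pmf_iff pmf_true_law_Poi less_le mfact_nonzero)
qed

lemma count_cols_supported: assumes "kp > 0" "a : set_pmf (poi_law kp nu xi)" "k ~: pcols nu xi" shows "count (cols a) k = 0"
 using assms set_true_law_Poi[OF assms(1), of a nu xi] by (force simp: pcols_def edge_wt_def cols_def count_eq_zero_iff)

lemma colmean_supported: assumes "kp > 0" "set_pmf mu <= set_pmf (poi_law kp nu xi)" "k ~: pcols nu xi" shows "colmean mu k = 0"
proof -
 have "colmean mu k = expect mu (%_. 0)" unfolding colmean_def using count_cols_supported[OF assms(1) _ assms(3)] assms(2)
  by (intro integral_cong_AE) (auto simp: AE_measure_pmf_iff)
 thus ?thesis by simp
qed

lemma colmean_nonneg [simp]: "colmean mu k >= 0" by (simp add: colmean_def Bochner_Integration.integral_nonneg)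

lemma integrable_count_cols: "mean_deg mu < \<infinity> ==> integrable (measure_pmf mu) (%ta. real (count (cols ta) k))"
 by (rule integrable_le_star_deg[OF integrable_star_deg]) (auto simp: count_cols_le)

lemma expectation_sum_cols:
 fixes mu :: "('x::finite, 'y::finite) star pmf" and h :: "_ => real" assumes "mean_deg mu < \<infinity>"
 shows "integrable (measure_pmf mu) (%ta. SUM k:#cols ta. h k)" and "expect mu (%ta. SUM k:#cols ta. h k) = (SUM k:UNIV. colmean mu k * h k)"
proof -
 have "(SUM k:#cols ta. h k) = (SUM k:UNIV. real (count (cols ta) k) * h k)" for ta :: "('x, 'y) star" by (rule sum_mset_count) auto
 thus "integrable mu (%ta. SUM k:#cols ta. h k)" "expect mu (%ta. SUM k:#cols ta. h k) = (SUM k:UNIV. colmean mu k * h k)"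
  using integrable_count_cols[OF assms] by (simp_all add: colmean_def)
qed

lemma mean_deg_colmean:
 fixes mu :: "('x::finite, 'y::finite) star pmf" assumes "mean_deg mu < \<infinity>" shows "mean_deg mu = ennreal (SUM k:UNIV. colmean mu k)"
proof -
 show ?thesis using mean_deg_expectation[OF assms] expectation_sum_cols(2)[OF assms, of "%_. 1"] by simp
qed

lemma mean_deg_bounded: assumes "!!ta. ta : set_pmf mu ==> deg ta <= M" shows "mean_deg mu < \<infinity>"
proof -
 have "mean_deg mu <= (\<integral>\<^sup>+ta. of_nat M \<partial>mu)"
  unfolding mean_deg_def by (rule nn_integral_mono_AE) (use assms in \<open>auto simp: AE_measure_pmf_iff\<close>)
 also have "... < \<infinity>" by (simp add: of_nat_less_top)
 finally show ?thesis .
qed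

text \<open>On the finite set \<open>A\<close> the entropy terms converge by continuity of x ln x.
  Off \<open>A\<close> the law \<open>m j\<close> is 1 - t j times \<open>mu\<close> cut at degree
  j, so the logarithm splits and dominated convergence applies.\<close>

lemma kl_perturbation:
 fixes mu et :: "('x::finite, 'y::finite) star pmf" assumes A: "finite A" "A <= set_pmf et" "!!a. a : A ==> deg a <= J" and kl: "kl_finite mu et"
  and t: "t ----> 0" and e: "!!a. (%j. e j a) ----> 0" "!!j a. a ~: A ==> e j a = 0"
  and m: "\<forall>\<^sub>F j in sequentially. t j < 1 & (ALL a. pmf (m j) a = (1 - t j) * (if deg a <= j then pmf mu a else 0) + e j a)"
 shows "(%j. pmf (m j) a) ----> pmf mu a" and "(%j. kl_real (m j) et) ----> kl_real mu et"
proof -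
 define f where "f a = ln (pmf mu a / pmf et a)" for a
 have sub: "set_pmf mu <= set_pmf et" and int: "integrable mu f" using kl by (auto simp: kl_finite_def f_def[abs_def])
 show plim: "(%j. pmf (m j) a) ----> pmf mu a" for a
 proof (rule Lim_transform_eventually)
  have "(%j. (1 - t j) * pmf mu a + e j a) ----> (1 - 0) * pmf mu a + 0" by (intro tendsto_intros t e)
  thus "(%j. (1 - t j) * pmf mu a + e j a) ----> pmf mu a" by simp
  show "\<forall>\<^sub>F j in sequentially. (1 - t j) * pmf mu a + e j a = pmf (m j) a" using m eventually_ge_at_top[of "deg a"]
  proof eventually_elim
   case (elim j)
   hence "pmf (m j) a = (1 - t j) * (if deg a <= j then pmf mu a else 0) + e j a" by blast
   thus ?case using elim(2) by simp
  qed
 qed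
 have dom: "(%j. expect mu (%a. if a ~: A & deg a <= j then g a else 0)) ----> expect mu (%a. if a ~: A then g a else 0)"
  if g: "integrable (measure_pmf mu) g" for g :: "_ => real"
 proof (rule integral_dominated_convergence[where w = "%a. \<bar>g a\<bar>"])
  show "AE a in mu. (%j. if a ~: A & deg a <= j then g a else 0) ----> (if a ~: A then g a else 0)"
  proof (rule AE_I2)
   fix a
   have "\<forall>\<^sub>F j in sequentially. (if a ~: A then g a else 0) = (if a ~: A & deg a <= j then g a else 0)"
    using eventually_ge_at_top[of "deg a"] by eventually_elim simp
   thus "(%j. if a ~: A & deg a <= j then g a else 0) ----> (if a ~: A then g a else 0)" by (rule Lim_transform_eventually[OF tendsto_const])
  qed
 qed (use g in auto)
 let ?g = "%j. expect mu (%a. if a ~: A & deg a <= j then f a else 0)"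
 let ?p = "%j. expect mu (%a. if a ~: A & deg a <= j then 1 else 0 :: real)"
 have "(%j. (SUM a:A. pmf (m j) a * ln (pmf (m j) a) - pmf (m j) a * ln (pmf et a)) + (1 - t j) * ?g j + (1 - t j) * ln (1 - t j) * ?p j)
  ----> (SUM a:A. pmf mu a * ln (pmf mu a) - pmf mu a * ln (pmf et a)) + (1 - 0) * expect mu (%a. if a ~: A then f a else 0)
   + (1 - 0) * ln (1 - 0) * expect mu (%a. if a ~: A then 1 else 0)" by (intro tendsto_intros tendsto_xlnx plim dom int t) auto
 also have "(SUM a:A. pmf mu a * ln (pmf mu a) - pmf mu a * ln (pmf et a)) + (1 - 0) * expect mu (%a. if a ~: A then f a else 0)
   + (1 - 0) * ln (1 - 0) * expect mu (%a. if a ~: A then 1 else 0) = kl_real mu et"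
 proof -
  have "(SUM a:A. pmf mu a * ln (pmf mu a) - pmf mu a * ln (pmf et a)) = (SUM a:A. (if a : A then f a else 0) * pmf mu a)"
  proof (rule sum.cong)
   fix a assume a: "a : A"
   hence "pmf et a > 0" using A(2) by (auto intro: pmf_positive)
   thus "pmf mu a * ln (pmf mu a) - pmf mu a * ln (pmf et a) = (if a : A then f a else 0) * pmf mu a"
    using a by (cases "pmf mu a = 0") (auto simp: f_def ln_div algebra_simps)
  qed simp
  also have "... = expect mu (%a. if a : A then f a else 0)" by (rule expectation_finite_support[OF A(1), symmetric]) simp
  finally have eq: "(SUM a:A. pmf mu a * ln (pmf mu a) - pmf mu a * ln (pmf et a)) = expect mu (%a. if a : A then f a else 0)" .
  have ints: "integrable mu (%a. if a : A then f a else 0)" "integrable mu (%a. if a ~: A then f a else 0)"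
   by (auto intro: Bochner_Integration.integrable_bound[OF int])
  have "kl_real mu et = expect mu (%a. (if a : A then f a else 0) + (if a ~: A then f a else 0))"
   unfolding kl_real_def f_def by (intro Bochner_Integration.integral_cong) auto
  thus ?thesis unfolding eq using ints by simp
 qed
 finally show "(%j. kl_real (m j) et) ----> kl_real mu et"
 proof (rule Lim_transform_eventually)
  show "\<forall>\<^sub>F j in sequentially. (SUM a:A. pmf (m j) a * ln (pmf (m j) a) - pmf (m j) a * ln (pmf et a)) + (1 - t j) * ?g j + (1 - t j) * ln (1 - t j) * ?p j
    = kl_real (m j) et" using m
  proof eventually_elim
   case (elim j)
   define L where "L = {a :: ('x, 'y) star. deg a <= max j J}"
   have L: "finite L" "A <= L" using finite_stars A(3) by (auto simp: L_def le_max_iff_disj)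
   have mj: "pmf (m j) a = (1 - t j) * (if deg a <= j then pmf mu a else 0) + e j a" for a using elim by blast
   have "kl_real (m j) et = (SUM a:L. ln (pmf (m j) a / pmf et a) * pmf (m j) a)" unfolding kl_real_def
   proof (rule integral_measure_pmf_real[OF L(1)])
    fix a assume "a : set_pmf (m j)"
    hence "pmf (m j) a ~= 0" by (simp add: set_pmf_iff)
    thus "a : L" using e(2)[of a j] L(2) unfolding mj by (auto simp: L_def split: if_splits)
   qed
   also have "... = (SUM a:A. ln (pmf (m j) a / pmf et a) * pmf (m j) a) + (SUM a:L - A. ln (pmf (m j) a / pmf et a) * pmf (m j) a)" using L by (simp add: sum.subset_diff[of A L])
   also have "(SUM a:A. ln (pmf (m j) a / pmf et a) * pmf (m j) a) = (SUM a:A. pmf (m j) a * ln (pmf (m j) a) - pmf (m j) a * ln (pmf et a))"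
   proof (rule sum.cong)
    fix a assume "a : A"
    hence "pmf et a > 0" using A(2) by (auto intro: pmf_positive)
    thus "ln (pmf (m j) a / pmf et a) * pmf (m j) a = pmf (m j) a * ln (pmf (m j) a) - pmf (m j) a * ln (pmf et a)"
     by (cases "pmf (m j) a = 0") (auto simp: ln_div algebra_simps)
   qed simp
   also have "(SUM a:L - A. ln (pmf (m j) a / pmf et a) * pmf (m j) a)
     = (SUM a:L. (1 - t j) * ((if a ~: A & deg a <= j then f a else 0) * pmf mu a) + (1 - t j) * ln (1 - t j) * ((if a ~: A & deg a <= j then 1 else 0) * pmf mu a))"
   proof (rule sum.mono_neutral_cong_left)
    fix a assume a: "a : L - A"
    have "pmf (m j) a = (if deg a <= j then (1 - t j) * pmf mu a else 0)" using a by (simp add: mj e(2))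
    moreover have "ln ((1 - t j) * pmf mu a / pmf et a) = ln (1 - t j) + f a" if "pmf mu a ~= 0"
    proof -
     have "pmf mu a > 0" "pmf et a > 0" using that sub by (auto simp: less_le set_pmf_iff)
     thus ?thesis using elim unfolding f_def times_divide_eq_right[symmetric] by (intro ln_mult_pos, auto)
    qed
    ultimately show "ln (pmf (m j) a / pmf et a) * pmf (m j) a
     = (1 - t j) * ((if a ~: A & deg a <= j then f a else 0) * pmf mu a) + (1 - t j) * ln (1 - t j) * ((if a ~: A & deg a <= j then 1 else 0) * pmf mu a)"
     using a by (cases "pmf mu a = 0") (auto simp: algebra_simps)
   qed (use L in auto)
   also have "... = (1 - t j) * ?g j + (1 - t j) * ln (1 - t j) * ?p j"
   proof -
    have E: "expect mu (%a. if a ~: A & deg a <= j then h a else 0) = (SUM a:L. (if a ~: A & deg a <= j then h a else 0) * pmf mu a)" for h :: "_ => real"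
     by (rule expectation_finite_support[OF L(1)]) (auto simp: L_def)
    show ?thesis unfolding E sum.distrib sum_distrib_left ..
   qed
   finally show ?case by simp
  qed
 qed
qed

definition mono_star :: "nat => 'x * 'x * 'y * 'y => ('x, 'y) star" where "mono_star d k = (fst k, replicate_mset d (snd k))"

lemma star_deg_mono_star [simp]: "deg (mono_star d k) = d" by (simp add: mono_star_def star_deg_def)

lemma count_cols_mono_star: "count (cols (mono_star d k)) k' = (if k' = k then d else 0)"
 by (cases k; cases k') (auto simp: mono_star_def cols_def image_replicate_mset)

lemma set_true_law_mono_star: assumes "kp > 0" "k : pcols nu xi" shows "mono_star d k : set_pmf (poi_law kp nu xi)"
 using assms by (auto simp: set_true_law_Poi mono_star_def pcols_def edge_wt_def zero_less_mult_iff not_less[symmetric])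

text \<open>Cutting off the stars of degree above $j$ destroys the symmetry of the edge statistics. It is
 restored exactly by small masses on stars all of whose edges have the same colour.\<close>

lemma degree_truncation:
 fixes mu :: "('x::finite, 'y::finite) star pmf"
 assumes kp: "kp > 0" and mean: "mean_deg mu < \<infinity>" "mean_deg mu ~= 0" and kl: "kl_finite mu (poi_law kp nu xi)"
 shows "EX m J. (\<forall>\<^sub>F j in sequentially. (ALL ta:set_pmf (m j). deg ta <= max j J) & colmean (m j) = colmean mu
   & set_pmf (m j) <= set_pmf (poi_law kp nu xi))
  & (ALL a. (%j. pmf (m j) a) ----> pmf mu a)
  & (%j. kl_real (m j) (poi_law kp nu xi)) ----> kl_real mu (poi_law kp nu xi)"
proof -
 let ?et = "poi_law kp nu xi"
 define C where "C = pcols nu xi"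
 define pc where "pc = colmean mu"
 define be where "be = (SUM k:UNIV. pc k)"
 \<comment> \<open>A degree above the mean \<open>be\<close>, so that the measure on stars of degree
   \<open>J\<close> with the colour means of \<open>mu\<close> has mass be / J below 1.\<close>
 define J where "J = Suc (nat \<lceil>be\<rceil>)"
 define D where "D j = {a :: ('x, 'y) star. deg a <= j}" for j
 define w where "w j k = pc k - (SUM a:D j. real (count (cols a) k) * pmf mu a)" for j k
 define Pr where "Pr j = (SUM a:D j. pmf mu a)" for j
 define B where "B j = expect mu (big_deg j)" for j
 \<comment> \<open>Putting the lost half-edges \<open>w\<close> back on stars of degree 1 restores
   the colour means but gives a total mass \<open>Z j\<close> of at least 1. Mixing in, with weight
   \<open>t j\<close>, the measure of mass be / J on stars of degree \<open>J\<close> keeps the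
   colour means and brings the mass to exactly 1.\<close>
 define Z where "Z j = Pr j + B j" for j
 define t where "t j = (Z j - 1) / (Z j - be / real J)" for j
 define e where "e j a = (SUM k:C. (1 - t j) * w j k * of_bool (a = mono_star 1 k) + t j * pc k / real J * of_bool (a = mono_star J k))" for j a
 define v where "v j a = (1 - t j) * (if deg a <= j then pmf mu a else 0) + e j a" for j a
 have sub: "set_pmf mu <= set_pmf ?et" using kl by (simp add: kl_finite_def)
 note ideg = integrable_star_deg[OF mean(1)]
 have D: "finite (D j)" for j unfolding D_def by (rule finite_stars)
 have C: "finite C" by simp
 have pcC: "pc k = 0" if "k ~: C" for k using colmean_supported[OF kp sub] that by (simp add: pc_def C_def)
 have pc0: "pc k >= 0" for k by (simp add: pc_def)
 have be: "be > 0"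
 proof -
  show ?thesis using mean mean_deg_colmean[OF mean(1)] pc0 by (simp add: be_def pc_def less_le sum_nonneg)
 qed
 have beC: "(SUM k:C. pc k) = be" unfolding be_def by (rule sum.mono_neutral_left) (use pcC in auto)
 have J: "be < real J" unfolding J_def by linarith
 hence J0: "real J > 0" using be by linarith
 have beJ: "be / real J < 1" "0 <= be / real J" using J J0 be by auto
 have Blim: "B ----> 0"
 proof (rule LIMSEQ_I)
  fix de :: real assume "de > 0"
  then obtain K0 where "ALL K>=K0. B K < de" using expectation_big_deg[OF ideg] unfolding B_def by blast
  moreover have "B K >= 0" for K by (auto simp: B_def big_deg_le intro: Bochner_Integration.integral_nonneg)
  ultimately show "EX K0. ALL K>=K0. norm (B K - 0) < de" by auto
 qed
 have ibig: "integrable (measure_pmf mu) (big_deg j)" for j by (rule integrable_le_star_deg[OF ideg]) (simp add: big_deg_def)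
 have cut: "expect mu (%a. if deg a <= j then g a else 0) = (SUM a:D j. g a * pmf mu a)" for j and g :: "_ => real"
  using expectation_finite_support[OF D[of j], of "%a. if deg a <= j then g a else 0" mu] by (simp add: D_def)
 have w0: "w j k >= 0" for j k
 proof -
  have "(SUM a:D j. real (count (cols a) k) * pmf mu a) <= pc k" unfolding cut[symmetric] pc_def colmean_def
   by (intro integral_mono integrable_count_cols[OF mean(1)] Bochner_Integration.integrable_bound[OF integrable_count_cols[OF mean(1)]]) auto
  thus ?thesis by (simp add: w_def)
 qed
 have wlim: "(%j. w j k) ----> 0" for k
 proof (rule Lim_null_comparison[OF _ Blim])
  have "norm (w j k) <= B j" for j using expectation_truncate[OF ideg, of "%ta. real (count (cols ta) k)" j]
   by (simp add: w_def pc_def colmean_def B_def D_def count_cols_le)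
  thus "\<forall>\<^sub>F j in sequentially. norm (w j k) <= B j" by simp
 qed
 have W: "(SUM k:C. w j k) = B j" for j
 proof -
  have cnt: "(SUM k:UNIV. real (count (cols a) k)) = real (deg a)" for a :: "('x, 'y) star" using sum_mset_count[of UNIV "cols a" "%_. 1"] by simp
  have "w j k = 0" if "k ~: C" for k
  proof -
   have "0 <= (SUM a:D j. real (count (cols a) k) * pmf mu a)" by (intro sum_nonneg) simp
   thus ?thesis using w0[of j k] pcC[OF that] by (simp add: w_def)
  qed
  hence "(SUM k:C. w j k) = (SUM k:UNIV. w j k)" by (intro sum.mono_neutral_left) auto
  also have "... = be - (SUM a:D j. real (deg a) * pmf mu a)" unfolding w_def sum_subtractf be_def by (simp add: sum.swap[of _ "D j"] sum_distrib_right[symmetric] cnt)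
  also have "be = expect mu (%a. real (deg a))" using expectation_sum_cols(2)[OF mean(1), of "%_. 1"] by (simp add: be_def pc_def)
  also have "... = B j + (SUM a:D j. real (deg a) * pmf mu a)"
  proof -
   have "expect mu (%a. real (deg a)) = expect mu (%a. big_deg j a + (if deg a <= j then real (deg a) else 0))"
    by (intro Bochner_Integration.integral_cong) (auto simp: big_deg_def)
   also have "... = B j + expect mu (%a. if deg a <= j then real (deg a) else 0)"
    unfolding B_def by (intro Bochner_Integration.integral_add ibig integrable_le_star_deg[OF ideg]) auto
   finally show ?thesis by (simp only: cut)
  qed
  finally show ?thesis by simp
 qed
 have Z1: "1 <= Z j" "Z j <= 1 + B j" for j
 proof -
  have P: "Pr j = expect mu (%a. if deg a <= j then 1 else 0)" by (simp add: cut Pr_def)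
  have i1: "integrable mu (%a. if deg a <= j then 1 else 0 :: real)" by (rule measure_pmf.integrable_const_bound[where B = 1]) auto
  have "Z j = expect mu (%a. (if deg a <= j then 1 else 0) + big_deg j a)"
   unfolding Z_def P B_def by (rule Bochner_Integration.integral_add[symmetric, OF i1 ibig])
  also have "... >= expect mu (%_. 1)" by (intro integral_mono Bochner_Integration.integrable_add i1 ibig) (auto simp: big_deg_def)
  finally show "1 <= Z j" by simp
  have "Pr j <= 1" unfolding Pr_def prob_finite_sum[OF D, symmetric] by simp
  thus "Z j <= 1 + B j" by (simp add: Z_def)
 qed
 have Zlim: "Z ----> 1"
 proof (rule tendsto_sandwich[of "%_. 1"])
  show "(%j. 1 + B j) ----> 1" using tendsto_add[OF tendsto_const Blim, of 1] by simp
 qed (use Z1 in auto)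
 have tlim: "t ----> 0"
 proof -
  have "(%j. (Z j - 1) / (Z j - be / real J)) ----> (1 - 1) / (1 - be / real J)" using beJ by (intro tendsto_intros Zlim) auto
  thus ?thesis by (simp add: t_def[abs_def])
 qed
 have den: "Z j - be / real J > 0" for j using Z1(1)[of j] beJ by linarith
 have t01: "0 <= t j" "t j < 1" for j using den[of j] Z1(1)[of j] beJ by (auto simp: t_def)
 have v0: "v j a >= 0" for j a using t01[of j] w0 pc0 by (auto simp: v_def e_def intro!: add_nonneg_nonneg sum_nonneg mult_nonneg_nonneg)
 define A where "A = mono_star 1 ` C \<union> mono_star J ` C"
 have A: "finite A" "A <= set_pmf ?et" "!!a. a : A ==> deg a <= J" using C set_true_law_mono_star[OF kp] by (auto simp: A_def C_def J_def)
 have eA: "e j a = 0" if "a ~: A" for j a using that by (auto simp: e_def A_def intro!: sum.neutral)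
 have elim: "(%j. e j a) ----> 0" for a
 proof -
  have "(%j. e j a) ----> (SUM k:C. (1 - 0) * 0 * of_bool (a = mono_star 1 k) + 0 * pc k / real J * of_bool (a = mono_star J k))"
   unfolding e_def by (intro tendsto_intros tlim wlim) (use J0 in auto)
  thus ?thesis by simp
 qed
 define L where "L j = D (max j J)" for j
 have AL: "A <= L j" for j using A(3) by (auto simp: L_def D_def le_max_iff_disj)
 have eS: "(SUM a:L j. g a * e j a) = (SUM k:C. (1 - t j) * w j k * g (mono_star 1 k) + t j * pc k / real J * g (mono_star J k))" for j and g :: "_ => real"
 proof -
  have pick: "(SUM a:L j. g a * (c * of_bool (a = b))) = c * g b" if "b : L j" for b c
  proof -
   have "(SUM a:L j. g a * (c * of_bool (a = b))) = (SUM a:L j. if a = b then c * g b else 0)" by (intro sum.cong) auto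
   thus ?thesis using that D by (simp add: L_def)
  qed
  have "(SUM a:L j. g a * e j a) = (SUM k:C. (SUM a:L j. g a * ((1 - t j) * w j k * of_bool (a = mono_star 1 k))) + (SUM a:L j. g a * (t j * pc k / real J * of_bool (a = mono_star J k))))"
   unfolding e_def sum_distrib_left distrib_left sum.distrib by (simp add: sum.swap[of _ "L j"])
  also have "... = (SUM k:C. (1 - t j) * w j k * g (mono_star 1 k) + t j * pc k / real J * g (mono_star J k))"
   using AL[of j] by (intro sum.cong refl arg_cong2[where f = "(+)"] pick) (auto simp: A_def)
  finally show ?thesis .
 qed
 have vS: "(SUM a:L j. g a * v j a) = (1 - t j) * (SUM a:D j. g a * pmf mu a)
   + (SUM k:C. (1 - t j) * w j k * g (mono_star 1 k) + t j * pc k / real J * g (mono_star J k))" for j and g :: "_ => real"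
 proof -
  have h: "(SUM a:L j. g a * (if deg a <= j then pmf mu a else 0)) = (SUM a:D j. g a * pmf mu a)"
   by (rule sum.mono_neutral_cong_right) (use D in \<open>auto simp: L_def D_def\<close>)
  show ?thesis unfolding h[symmetric] sum_distrib_left eS[symmetric] by (simp add: mult.left_commute v_def distrib_left sum.distrib)
 qed
 have vL: "v j a = 0" if "a ~: L j" for j a using that AL[of j] eA[of a j] by (auto simp: v_def L_def D_def)
 have "EX p. pmf p = v j" for j
 proof (rule finite_pmf_exists[of "L j"])
  have "(SUM a:L j. v j a) = (1 - t j) * Z j + t j * (be / real J)" using vS[of "%_. 1" j] by (simp add: Pr_def sum.distrib sum_distrib_left[symmetric] sum_divide_distrib[symmetric] W beC Z_def distrib_left)
  also have "... = Z j - t j * (Z j - be / real J)" by (simp add: algebra_simps)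
  also have "... = 1" using den[of j] by (simp add: t_def)
  finally show "sum (v j) (L j) = 1" .
 qed (use v0 vL D in \<open>auto simp: L_def\<close>)
 then obtain m where m: "!!j. pmf (m j) = v j" by metis
 have mL: "set_pmf (m j) <= L j" for j unfolding set_pmf_eq m using vL by blast
 have met: "set_pmf (m j) <= set_pmf ?et" for j
 proof
  fix a assume "a : set_pmf (m j)"
  hence "v j a ~= 0" by (simp add: set_pmf_iff m)
  hence "a : set_pmf mu | a : A" by (cases "a : A") (auto simp: v_def eA set_pmf_iff split: if_splits)
  thus "a : set_pmf ?et" using sub A(2) by blast
 qed
 have cm: "colmean (m j) = colmean mu" for j
 proof
  fix k
  show "colmean (m j) k = colmean mu k"
  proof (cases "k : C")
   case True
   have "colmean (m j) k = (SUM a:L j. real (count (cols a) k) * v j a)"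
    unfolding colmean_def m[symmetric] by (rule integral_measure_pmf_real) (use D mL in \<open>auto simp: L_def\<close>)
   also have "... = (1 - t j) * (SUM a:D j. real (count (cols a) k) * pmf mu a) + (SUM k':C. if k = k' then (1 - t j) * w j k + t j * pc k else 0)"
    unfolding vS using J0 by (intro arg_cong2[where f = "(+)"] sum.cong) (auto simp: count_cols_mono_star)
   also have "... = pc k" using True C by (simp add: w_def algebra_simps)
   finally show ?thesis by (simp add: pc_def)
  next
   case False
   thus ?thesis using colmean_supported[OF kp met, of k j] pcC[OF False] by (simp add: C_def pc_def)
  qed
 qed
 have ev: "\<forall>\<^sub>F j in sequentially. t j < 1 & (ALL a. pmf (m j) a = (1 - t j) * (if deg a <= j then pmf mu a else 0) + e j a)" unfolding m v_def using t01(2) by simp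
 have lims: "(%j. pmf (m j) a) ----> pmf mu a" "(%j. kl_real (m j) ?et) ----> kl_real mu ?et" for a
  by (rule kl_perturbation[OF A kl tlim elim eA ev], assumption+)+
 show ?thesis
 proof (intro exI conjI allI)
  show "\<forall>\<^sub>F j in sequentially. (ALL ta:set_pmf (m j). deg ta <= max j J) & colmean (m j) = colmean mu & set_pmf (m j) <= set_pmf ?et"
   using mL cm met by (intro always_eventually) (auto simp: L_def D_def)
 qed (fact lims)+
qed

lemma tendsto_col_div:
 fixes nu :: "'x::finite pmf" and xi :: "('y::finite * 'y) pmf"
 assumes kp: "kp > 0" and lim: "!!k. (%j. p j k) ----> pc k" and p0: "!!j k. p j k >= 0" "!!k. pc k >= 0"
 shows "(%j. col_div kp nu xi (p j)) ----> col_div kp nu xi pc"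
proof -
 have eq: "x * ln (x / (kp * edge_wt nu xi k)) = x * ln x - x * ln (kp * edge_wt nu xi k)" if "x >= 0" "k : pcols nu xi" for x k
  using that kp by (cases "x = 0") (auto simp: ln_div pcols_def algebra_simps)
 have "col_div kp nu xi q = (SUM k:pcols nu xi. q k * ln (q k) - q k * ln (kp * edge_wt nu xi k) - q k) + kp" if "!!k. q k >= 0" for q unfolding col_div_def using eq that by simp
 thus ?thesis using p0 by (simp only:) (intro tendsto_intros tendsto_xlnx lim always_eventually allI p0)
qed

lemma pcols_nonempty: "EX k. k : pcols nu xi"
proof -
 obtain x y y' where "x : set_pmf nu" "(y, y') : set_pmf (sym_law xi)"
  using set_pmf_not_empty[of nu] set_pmf_not_empty[of "sym_law xi"] by (metis equals0I surj_pair)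
 hence "(x, x, y, y') : pcols nu xi" by (simp add: pcols_def edge_wt_def child_wt_def pmf_positive_iff)
 thus ?thesis by blast
qed

lemma mean_deg_zero: "mean_deg mu = 0 <-> (ALL ta:set_pmf mu. deg ta = 0)" by (simp add: mean_deg_def nn_integral_0_iff_AE AE_measure_pmf_iff)

text \<open>The lower bound repairs colours with stars of a positive degree \<open>i0\<close> and so
  does not reach laws without edges. A small mass on two stars of degree 1 with opposite colours
  makes the mean degree positive and keeps the symmetry.\<close>

lemma zero_degree_approx:
 fixes mu :: "('x::finite, 'y::finite) star pmf"
 assumes kp: "kp > 0" and mean: "mean_deg mu = 0" and kl: "kl_finite mu (poi_law kp nu xi)"
 shows "EX m. (ALL j. (ALL ta:set_pmf (m j). deg ta <= 1) & mean_deg (m j) ~= 0 & (ALL k. colmean (m j) (rev_col k) = colmean (m j) k)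
   & set_pmf (m j) <= set_pmf (poi_law kp nu xi))
  & (ALL a. (%j. pmf (m j) a) ----> pmf mu a)
  & (%j. kl_real (m j) (poi_law kp nu xi)) ----> kl_real mu (poi_law kp nu xi)
  & (%j. col_div kp nu xi (colmean (m j))) ----> col_div kp nu xi (colmean mu)"
proof -
 let ?et = "poi_law kp nu xi"
 have deg0: "deg ta = 0" if "ta : set_pmf mu" for ta using mean that by (simp add: mean_deg_zero)
 have c0: "count (cols ta) k = 0" if "ta : set_pmf mu" for ta k using deg0[OF that] count_cols_le[of ta k] by simp
 obtain k0 where k0: "k0 : pcols nu xi" using pcols_nonempty by blast
 hence k1: "rev_col k0 : pcols nu xi" by (simp add: pcols_def)
 define t where "t j = 1 / real (Suc (Suc j))" for j
 define L where "L = {a :: ('x, 'y) star. deg a <= 1}"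
 define A where "A = {mono_star 1 k0, mono_star 1 (rev_col k0)}"
 define e where "e j a = t j / 2 * (of_bool (a = mono_star 1 k0) + of_bool (a = mono_star 1 (rev_col k0)))" for j a
 define v where "v j a = (1 - t j) * (if deg a <= j then pmf mu a else 0) + e j a" for j a
 have L: "finite L" unfolding L_def by (rule finite_stars)
 have t01: "0 < t j" "t j < 1" for j by (auto simp: t_def)
 have tlim: "t ----> 0" unfolding t_def using LIMSEQ_Suc[OF LIMSEQ_inverse_real_of_nat] by (simp add: inverse_eq_divide)
 have A: "finite A" "A <= set_pmf ?et" "!!a. a : A ==> deg a <= 1" "A <= L"
  using set_true_law_mono_star[OF kp k0, of 1] set_true_law_mono_star[OF kp k1, of 1] by (auto simp: A_def L_def)
 have eA: "e j a = 0" if "a ~: A" for j a using that by (auto simp: e_def A_def)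
 have elim: "(%j. e j a) ----> 0" for a
 proof -
  have "(%j. e j a) ----> 0 / 2 * (of_bool (a = mono_star 1 k0) + of_bool (a = mono_star 1 (rev_col k0)))"
   unfolding e_def by (intro tendsto_intros tlim) auto
  thus ?thesis by simp
 qed
 have muL: "set_pmf mu <= L" using deg0 by (auto simp: L_def)
 have v: "v j a = (1 - t j) * pmf mu a + e j a" for j a using deg0[of a] by (cases "pmf mu a = 0") (auto simp: v_def set_pmf_iff)
 have vS: "(SUM a:L. g a * v j a) = (1 - t j) * (SUM a:L. g a * pmf mu a) + t j / 2 * (g (mono_star 1 k0) + g (mono_star 1 (rev_col k0)))" for j and g :: "_ => real"
 proof -
  have pick: "(SUM a:L. g a * of_bool (a = b)) = g b" if "b : L" for b
  proof -
   show ?thesis using that L by simp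
  qed
  have "(SUM a:L. g a * v j a) = (SUM a:L. (1 - t j) * (g a * pmf mu a) + t j / 2 * (g a * of_bool (a = mono_star 1 k0) + g a * of_bool (a = mono_star 1 (rev_col k0))))"
   by (intro sum.cong refl) (simp add: v e_def algebra_simps)
  also have "... = (1 - t j) * (SUM a:L. g a * pmf mu a) + t j / 2 * ((SUM a:L. g a * of_bool (a = mono_star 1 k0)) + (SUM a:L. g a * of_bool (a = mono_star 1 (rev_col k0))))"
   by (simp only: sum.distrib sum_distrib_left[symmetric])
  finally show ?thesis using A(4) by (simp add: pick A_def)
 qed
 have "EX p. pmf p = v j" for j
 proof (rule finite_pmf_exists[OF L])
  show "sum (v j) L = 1" using vS[of "%_. 1" j] by (insert sum_pmf_eq_1[OF L muL], simp)
  show "v j a = 0" if "a ~: L" for a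
  proof -
   have "a ~: A" "a ~: set_pmf mu" using that A(4) muL by blast+
   thus ?thesis by (simp add: v eA set_pmf_iff)
  qed
 qed (use t01[of j] in \<open>auto simp: v e_def less_imp_le\<close>)
 then obtain m where m: "!!j. pmf (m j) = v j" by metis
 have mL: "set_pmf (m j) <= muset" if "muset = set_pmf mu \<union> A" for j muset
 proof
  fix a assume "a : set_pmf (m j)"
  hence "v j a ~= 0" by (simp add: set_pmf_iff m)
  thus "a : muset" using that by (cases "a : A") (auto simp: v eA set_pmf_iff)
 qed
 have mL': "set_pmf (m j) <= L" for j using mL[OF refl, of j] A(4) muL by blast
 have cm: "colmean (m j) k = t j / 2 * (of_bool (k = k0) + of_bool (k = rev_col k0))" for j k
 proof -
  have "colmean (m j) k = (SUM a:L. real (count (cols a) k) * v j a)"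
   unfolding colmean_def m[symmetric] by (rule integral_measure_pmf_real[OF L]) (use mL' in blast)
  moreover have "(SUM a:L. real (count (cols a) k) * pmf mu a) = 0"
   using c0[of _ k] by (intro sum.neutral ballI) (metis mult_eq_0_iff of_nat_0 set_pmf_iff)
  ultimately show ?thesis by (simp only: vS count_cols_mono_star) auto
 qed
 have cmmu: "colmean mu k = 0" for k
 proof -
  have "colmean mu k = expect mu (%_. 0)" unfolding colmean_def using c0 by (intro integral_cong_AE) (auto simp: AE_measure_pmf_iff)
  thus ?thesis by simp
 qed
 have ev: "\<forall>\<^sub>F j in sequentially. t j < 1 & (ALL a. pmf (m j) a = (1 - t j) * (if deg a <= j then pmf mu a else 0) + e j a)" unfolding m v_def using t01(2) by simp
 have lims: "(%j. pmf (m j) a) ----> pmf mu a" "(%j. kl_real (m j) ?et) ----> kl_real mu ?et" for a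
  by (rule kl_perturbation[OF A(1-3) kl tlim elim eA ev], assumption+)+
 show ?thesis
 proof (intro exI conjI allI ballI)
  fix j ta assume "ta : set_pmf (m j)"
  thus "deg ta <= 1" using mL'[of j] by (auto simp: L_def)
 next
  fix j
  have "mono_star 1 k0 : set_pmf (m j)" using t01[of j] by (auto simp: set_pmf_iff m v e_def add_nonneg_eq_0_iff)
  thus "mean_deg (m j) ~= 0" by (force simp: mean_deg_zero)
  show "set_pmf (m j) <= set_pmf ?et" using kl mL[OF refl, of j] A(2) by (auto simp: kl_finite_def)
 next
  fix j k
  have "rev_col k = k0 <-> k = rev_col k0" by auto
  moreover have "rev_col k = rev_col k0 <-> k = k0" by (metis rev_col_rev_col)
  ultimately show "colmean (m j) (rev_col k) = colmean (m j) k" unfolding cm by auto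
 next
  show "(%j. col_div kp nu xi (colmean (m j))) ----> col_div kp nu xi (colmean mu)"
  proof (rule tendsto_col_div[OF kp])
   fix k
   have "(%j. t j / 2 * (of_bool (k = k0) + of_bool (k = rev_col k0))) ----> 0 / 2 * (of_bool (k = k0) + of_bool (k = rev_col k0))"
    by (intro tendsto_intros tlim) auto
   thus "(%j. colmean (m j) k) ----> colmean mu k" by (simp add: cm cmmu)
  qed auto
 qed (fact lims)+
qed

text \<open>A positive mean degree is preserved exactly, because the number of edges may be fixed
  afterwards.\<close>

lemma ER_bounded_approx:
 fixes mu :: "('x::finite, 'y::finite) star pmf"
 assumes kp: "kp > 0" and r: "ER_rate kp nu xi mu < ereal r" and F: "finite F" "ep > 0"
 shows "EX mu' M. (ALL ta:set_pmf mu'. deg ta <= M) & mean_deg mu' ~= 0 & (ALL k. colmean mu' (rev_col k) = colmean mu' k)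
  & set_pmf mu' <= set_pmf (poi_law kp nu xi) & (ALL a:F. \<bar>pmf mu' a - pmf mu a\<bar> < ep)
  & kl_real mu' (poi_law kp nu xi) - col_div kp nu xi (colmean mu') / 2 < r
  & (mean_deg mu ~= 0 --> mean_deg mu' = mean_deg mu)"
proof -
 let ?et = "poi_law kp nu xi"
 have fin: "mean_deg mu < \<infinity>" and sym: "!!k. colmean mu (rev_col k) = colmean mu k" and kl: "kl_finite mu ?et"
  and rr: "kl_real mu ?et - col_div kp nu xi (colmean mu) / 2 < r" using r by (auto simp: ER_rate_def split: if_splits)
 have close: "\<forall>\<^sub>F j in sequentially. (ALL a:F. \<bar>pmf (m j) a - pmf mu a\<bar> < ep) & kl_real (m j) ?et - col_div kp nu xi (c j) / 2 < r"
  if m: "!!a. (%j. pmf (m j) a) ----> pmf mu a" "(%j. kl_real (m j) ?et) ----> kl_real mu ?et" "(%j. col_div kp nu xi (c j)) ----> col_div kp nu xi (colmean mu)"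
  for m :: "nat => ('x, 'y) star pmf" and c
 proof (rule eventually_conj)
  show "\<forall>\<^sub>F j in sequentially. ALL a:F. \<bar>pmf (m j) a - pmf mu a\<bar> < ep"
   by (rule eventually_ball_finite[OF F(1)]) (use m(1) F(2) in \<open>auto simp: tendsto_iff dist_real_def\<close>)
  have "(%j. kl_real (m j) ?et - col_div kp nu xi (c j) / 2) ----> kl_real mu ?et - col_div kp nu xi (colmean mu) / 2"
   by (intro tendsto_intros m) auto
  thus "\<forall>\<^sub>F j in sequentially. kl_real (m j) ?et - col_div kp nu xi (c j) / 2 < r" by (rule order_tendstoD(2)) (rule rr)
 qed
 show ?thesis
 proof (cases "mean_deg mu = 0")
  case True
  obtain m where m1: "ALL j. (ALL ta:set_pmf (m j). deg ta <= 1) & mean_deg (m j) ~= 0 & (ALL k. colmean (m j) (rev_col k) = colmean (m j) k)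
   & set_pmf (m j) <= set_pmf ?et" and m2: "ALL a. (%j. pmf (m j) a) ----> pmf mu a"
   and m3: "(%j. kl_real (m j) ?et) ----> kl_real mu ?et" "(%j. col_div kp nu xi (colmean (m j))) ----> col_div kp nu xi (colmean mu)"
   using zero_degree_approx[OF kp True kl] by blast
  have "EX j. (ALL a:F. \<bar>pmf (m j) a - pmf mu a\<bar> < ep) & kl_real (m j) ?et - col_div kp nu xi (colmean (m j)) / 2 < r"
   using eventually_happens'[OF _ close[OF spec[OF m2] m3]] by simp
  thus ?thesis using m1 True by blast
 next
  case False
  obtain m J where m1: "\<forall>\<^sub>F j in sequentially. (ALL ta:set_pmf (m j). deg ta <= max j J) & colmean (m j) = colmean mu & set_pmf (m j) <= set_pmf ?et"
   and m2: "ALL a. (%j. pmf (m j) a) ----> pmf mu a" and m3: "(%j. kl_real (m j) ?et) ----> kl_real mu ?et"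
   using degree_truncation[OF kp fin False kl] by blast
  obtain j where j: "ALL ta:set_pmf (m j). deg ta <= max j J" "colmean (m j) = colmean mu" "set_pmf (m j) <= set_pmf ?et"
   "ALL a:F. \<bar>pmf (m j) a - pmf mu a\<bar> < ep" "kl_real (m j) ?et - col_div kp nu xi (colmean mu) / 2 < r"
   using eventually_happens'[OF _ eventually_conj[OF m1 close[OF spec[OF m2] m3 tendsto_const]]] by auto
  show ?thesis using mean_deg_colmean[OF mean_deg_bounded[of "m j" "max j J"]] mean_deg_colmean[OF fin] j(1,2) j sym False by (intro exI[of _ "m j"] exI[of _ "max j J"], simp)
 qed
qed

section \<open>Conditioning on the edges and on the degrees\<close>



lemma prob_bind_finite: assumes "finite I" "set_pmf g <= I" shows "prob (bind_pmf g K) S = (SUM E:I. prob (K E) S * pmf g E)"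
proof -
 have int: "(\<integral>\<^sup>+E. ennreal (prob (K E) S) \<partial>g) = ennreal (expect g (%E. prob (K E) S))" using assms finite_subset by (intro nn_integral_eq_integral integrable_measure_pmf_finite, auto)
 have "emeasure (bind_pmf g K) S = (\<integral>\<^sup>+E. emeasure (K E) S \<partial>g)" by simp
 also have "... = ennreal (expect g (%E. prob (K E) S))" unfolding measure_pmf.emeasure_eq_measure by (rule int)
 also have "expect g (%E. prob (K E) S) = (SUM E:I. prob (K E) S * pmf g E)" by (rule integral_measure_pmf_real) (use assms in auto)
 finally show ?thesis by (simp add: measure_pmf.emeasure_eq_measure sum_nonneg)
qed

lemma star_seq_law_bind: "star_seq_law n g nu xi = bind_pmf g (%E. star_seq_law n (return_pmf E) nu xi)"
 by (simp add: star_seq_law_def bind_return_pmf)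

lemma finite_vertex_pairs [simp]: "finite (vertex_pairs n)" by (simp add: vertex_pairs_eq)

lemma set_ER_graph: "set_pmf (ER_graph kp n) <= Pow (vertex_pairs n)" by (auto simp: ER_graph_def)

lemma pmf_ER_graph: assumes E: "E <= vertex_pairs n" shows "pmf (ER_graph kp n) E = pmf (bernoulli_pmf (kp / real n)) True ^ card E
  * pmf (bernoulli_pmf (kp / real n)) False ^ (card (vertex_pairs n) - card E)"
proof -
 let ?b = "bernoulli_pmf (kp / real n)" and ?V = "vertex_pairs n"
 let ?P = "Pi_pmf ?V False (%_. ?b)"
 have "pmf (ER_graph kp n) E = prob ?P ((%present. {e : ?V. present e}) -` {E})" by (simp add: ER_graph_def pmf_map)
 also have "... = prob ?P {%e. e : E}"
 proof (rule measure_pmf.finite_measure_eq_AE)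
  show "AE f in ?P. (f : (%present. {e : ?V. present e}) -` {E}) = (f : {%e. e : E})" unfolding AE_measure_pmf_iff
  proof
   fix f assume "f : set_pmf ?P"
   thus "(f : (%present. {e : ?V. present e}) -` {E}) = (f : {%e. e : E})" using set_Pi_pmf_subset[of ?V False] E by auto
  qed
 qed auto
 also have "... = (PROD e:?V. pmf ?b (e : E))" using E by (auto simp: measure_pmf_single intro!: pmf_Pi')
 also have "... = (PROD e:E. pmf ?b True) * (PROD e:?V - E. pmf ?b False)"
 proof -
  have "(PROD e:?V. pmf ?b (e : E)) = (PROD e:?V - E. pmf ?b (e : E)) * (PROD e:E. pmf ?b (e : E))" by (rule prod.subset_diff[OF E]) simp
  thus ?thesis by simp
 qed
 also have "... = pmf ?b True ^ card E * pmf ?b False ^ (card ?V - card E)" using E by (simp add: card_Diff_subset finite_subset)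
 finally show ?thesis .
qed

text \<open>\<open>D\<close> is an event about the graph alone: given the edge set it is certain or
  impossible.\<close>

lemma prob_graph_event: assumes "set_pmf g <= Pow (vertex_pairs n)"
  and D: "!!E t. E <= vertex_pairs n ==> t : set_pmf (star_seq_law n (return_pmf E) nu xi) ==> t : D <-> E : A"
 shows "prob (star_seq_law n g nu xi) (S \<inter> D)
  = (SUM E:Pow (vertex_pairs n) \<inter> A. prob (star_seq_law n (return_pmf E) nu xi) S * pmf g E)"
proof -
 let ?K = "%E. star_seq_law n (return_pmf E) nu xi"
 have K: "prob (?K E) (S \<inter> D) = (if E : A then prob (?K E) S else 0)" if "E <= vertex_pairs n" for E
 proof -
  have "prob (?K E) (S \<inter> D) = prob (?K E) (if E : A then S else {})"
   by (rule measure_pmf.finite_measure_eq_AE) (use D[OF that] in \<open>auto simp: AE_measure_pmf_iff\<close>)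
  thus ?thesis by simp
 qed
 have "prob (star_seq_law n g nu xi) (S \<inter> D) = (SUM E:Pow (vertex_pairs n). prob (?K E) (S \<inter> D) * pmf g E)"
  by (subst star_seq_law_bind) (rule prob_bind_finite, use assms(1) in auto)
 also have "... = (SUM E:Pow (vertex_pairs n). if E : A then prob (?K E) S * pmf g E else 0)" by (intro sum.cong) (auto simp: K)
 also have "... = (SUM E:Pow (vertex_pairs n) \<inter> A. prob (?K E) S * pmf g E)" by (rule sum.inter_restrict[symmetric]) simp
 finally show ?thesis .
qed

text \<open>The uniform models are the graph of the model ER conditioned on a set of equally
 likely graphs.\<close>

lemma conditioned_ER: assumes A: "A <= Pow (vertex_pairs n)" "!!E. E : A ==> card E = m"
  and D: "!!E t. E <= vertex_pairs n ==> t : set_pmf (star_seq_law n (return_pmf E) nu xi) ==> t : D <-> E : A"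
  and pos: "prob (ER_law kp nu xi n) D > 0" shows "prob (star_seq_law n (pmf_of_set A) nu xi) S
  = prob (ER_law kp nu xi n) (S \<inter> D) / prob (ER_law kp nu xi n) D"
proof -
 let ?K = "%E. star_seq_law n (return_pmf E) nu xi" and ?P = "ER_law kp nu xi n"
 define c where "c = pmf (bernoulli_pmf (kp / real n)) True ^ m * pmf (bernoulli_pmf (kp / real n)) False ^ (card (vertex_pairs n) - m)"
 have c: "pmf (ER_graph kp n) E = c" if "E : A" for E using that A pmf_ER_graph[of E n kp] by (auto simp: c_def)
 have fin: "finite A" using finite_subset[OF A(1)] by simp
 have PA: "Pow (vertex_pairs n) \<inter> A = A" using A(1) by blast
 have ev: "prob ?P (S \<inter> D) = c * (SUM E:A. prob (?K E) S)" for S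
 proof -
  have "prob ?P (S \<inter> D) = (SUM E:Pow (vertex_pairs n) \<inter> A. prob (?K E) S * pmf (ER_graph kp n) E)"
   by (rule prob_graph_event[OF set_ER_graph]) (rule D)
  also have "... = (SUM E:A. prob (?K E) S * pmf (ER_graph kp n) E)" by (simp only: PA)
  finally show ?thesis by (simp add: c sum_distrib_left mult.commute)
 qed
 have D': "prob ?P D = c * real (card A)" using ev[of UNIV] by simp
 have ne: "A ~= {}" "c ~= 0" using pos unfolding D' by auto
 have "prob (star_seq_law n (pmf_of_set A) nu xi) S = (SUM E:A. prob (?K E) S * pmf (pmf_of_set A) E)"
  by (subst star_seq_law_bind) (rule prob_bind_finite, use ne fin in auto)
 also have "... = (SUM E:A. prob (?K E) S) / real (card A)" using ne fin by (simp add: sum_divide_distrib)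
 finally show ?thesis unfolding D' ev using ne by simp
qed

lemma star_seq_degree: assumes t: "t : set_pmf (star_seq_law n (return_pmf E) nu xi)" and v: "v : {1..n}" shows "deg (t v) = card (nbrs E v)"
proof -
 obtain G where G: "G : set_pmf (marked_graph n E nu xi)" "t = (%v. if v : {1..n} then star_class G v else undefined)"
  using t by (auto simp: star_seq_law_def bind_return_pmf)
 thus ?thesis using v by (auto simp: marked_graph_def G(2) star_class_def star_deg_def)
qed

text \<open>The handshake identity, read off from the half-edge count of
  \<open>size_total_cols_labelling\<close> with trivial marks.\<close>

lemma sum_degrees: assumes E: "E <= vertex_pairs n" shows "(SUM v:{1..n}. card (nbrs E v)) = 2 * card E"
proof -
 define l where "l e = (if e : E then Some ((), ()) else None)" for e
 have E': "E <= all_pairs {1..n}" using E by (simp add: vertex_pairs_eq)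
 have "lnbrs {1..n} l v = nbrs E v" if "v : {1..n}" for v
 proof -
  have "u : {1..n}" if "{u, v} : E" for u using subsetD[OF E' that] by simp
  thus ?thesis by (auto simp: lnbrs_def nbrs_def l_def)
 qed
 hence "(SUM v:{1..n}. card (nbrs E v)) = size (total_cols {1..n} (%_. ()) (halves {1..n} (%_. ()) l))"
  unfolding size_total_cols by (intro sum.cong) (simp_all add: halves_def)
 also have "... = 2 * card {e : all_pairs {1..n}. l e ~= None}"
  by (rule size_total_cols_labelling) (use E' in \<open>auto simp: labellings_def l_def\<close>)
 also have "{e : all_pairs {1..n}. l e ~= None} = E" using E' by (auto simp: l_def)
 finally show ?thesis .
qed

lemma size_seq_cols: "size (seq_cols n t) = (SUM v:{1..n}. deg (t v))" unfolding seq_cols_total size_total_cols by (simp add: star_deg_def)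

section \<open>Lower bounds with a prescribed number of edges\<close>

lemma sum_card_levels:
 fixes f :: "'a => nat" assumes V: "finite V" and s: "(\<Sum>d\<le>N. card {v : V. f v = d}) = card V"
 shows "!!v. v : V ==> f v <= N" and "(SUM v:V. f v) = (\<Sum>d\<le>N. d * card {v : V. f v = d})"
proof -
 have "(\<Union>d\<in>{..N}. {v : V. f v = d}) = V" using V s by (intro card_subset_eq[OF V], auto, subst card_UN_disjoint, auto)
 thus le: "f v <= N" if "v : V" for v using that by blast
 have "(SUM v:V. f v) = (\<Sum>d\<le>N. SUM v:{v : V. f v = d}. f v)" by (rule sum.group[symmetric]) (use V le in auto)
 thus "(SUM v:V. f v) = (\<Sum>d\<le>N. d * card {v : V. f v = d})" by (simp add: mult.commute)
qed

text \<open>Rounded shares of (1 - s n) \<open>al\<close> leave \<open>R n\<close> vertices and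
  \<open>T n\<close> half-edges, which are distributed as evenly as possible over two neighbouring
  degrees. The reserve is large enough that \<open>T n\<close> is not negative in truth and the
  average T n / R n is at most M + 1.\<close>

lemma degree_counts:
 fixes al :: "nat pmf" and m :: "nat => nat" assumes M: "!!d. d : set_pmf al ==> d <= M" and be: "be = expect al real" "be > 0"
  and lim: "(%n. real (2 * m n) / real n) ----> be" shows "EX c. (Ev n. (\<Sum>d\<le>Suc M. c n d) = n & (\<Sum>d\<le>Suc M. d * c n d) = 2 * m n)
  & (ALL d<=Suc M. (%n. real (c n d) / real n) ----> pmf al d)"
proof -
 have sum1: "(SUM d<=M. pmf al d) = 1" using sum_pmf_eq_1[of "{..M}" al] M by auto
 have bes: "be = (SUM d<=M. real d * pmf al d)" unfolding be(1) by (rule integral_measure_pmf_real) (use M in auto)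
 have beM: "be <= real M"
 proof -
  have "be <= (SUM d<=M. real M * pmf al d)" unfolding bes by (intro sum_mono mult_right_mono) auto
  thus ?thesis by (simp add: sum_distrib_left[symmetric] sum1)
 qed
 define de where "de n = \<bar>real (2 * m n) / real n - be\<bar>" for n
 \<comment> \<open>The square root makes \<open>s\<close> much larger than the error
   \<open>de\<close>, so the vertices set aside can absorb the discrepancy in the number of
   half-edges; 1 / sqrt n dominates the rounding errors.\<close>
 define s where "s n = 1 / sqrt (real n) + sqrt (de n)" for n
 have de0: "de n >= 0" for n by (simp add: de_def)
 have sq: "(%n. sqrt (de n)) ----> 0"
 proof -
  have "(%n. sqrt (de n)) ----> sqrt \<bar>be - be\<bar>" unfolding de_def by (intro tendsto_intros lim)
  thus ?thesis by simp
 qed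
 have slim: "s ----> 0"
 proof -
  show ?thesis using tendsto_real_sqrt[OF lim_1_over_n] unfolding s_def[abs_def] using tendsto_add[OF _ sq] by (simp add: real_sqrt_divide)
 qed
 define b where "b n d = nat \<lfloor>real n * (1 - s n) * pmf al d\<rfloor>" for n d
 define R where "R n = n - (SUM d<=M. b n d)" for n
 define T where "T n = 2 * m n - (SUM d<=M. d * b n d)" for n
 define c where "c n d = (if d <= M then b n d else 0) + (if d = T n div R n then R n - T n mod R n else 0)
  + (if d = Suc (T n div R n) then T n mod R n else 0)" for n d
 define C where "C = (SUM d<=M. d)"
 have ev: "Ev n. n >= 1 & s n < 1 & sqrt (de n) <= 1 / 2 & sqrt (de n) <= be & 2 * real C <= sqrt (real n)"
 proof -
  have "Ev n. 2 * real C <= sqrt (real n)" by (insert filterlim_compose[OF sqrt_at_top filterlim_real_sequentially], simp add: filterlim_at_top)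
  moreover have "Ev n. s n < 1" by (rule order_tendstoD(2)[OF slim]) simp
  moreover have "Ev n. sqrt (de n) < 1 / 2" by (rule order_tendstoD(2)[OF sq]) simp
  moreover have "Ev n. sqrt (de n) < be" by (rule order_tendstoD(2)[OF sq]) (rule be(2))
  ultimately show ?thesis using eventually_ge_at_top[of 1] by eventually_elim simp
 qed
 have facts: "(\<Sum>d\<le>Suc M. c n d) = n & (\<Sum>d\<le>Suc M. d * c n d) = 2 * m n & (SUM d<=M. b n d) <= n & 0 < R n"
  if n: "n >= 1" "s n < 1" "sqrt (de n) <= 1 / 2" "sqrt (de n) <= be" "2 * real C <= sqrt (real n)" for n
 proof -
  let ?r = "real n * (1 - s n)"
  have s0: "s n > 0" using n(1) de0[of n] by (auto simp: s_def intro: add_pos_nonneg)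
  have b_up: "real (b n d) <= ?r * pmf al d" for d using n(2) by (simp add: b_def)
  have b_lo: "?r * pmf al d - 1 <= real (b n d)" for d unfolding b_def by linarith
  have sb: "real (SUM d<=M. b n d) <= ?r"
  proof -
   have "real (SUM d<=M. b n d) <= (SUM d<=M. ?r * pmf al d)" unfolding of_nat_sum by (intro sum_mono b_up)
   thus ?thesis by (simp add: sum_distrib_left[symmetric] sum1)
  qed
  have sdb: "real (SUM d<=M. d * b n d) <= ?r * be" "?r * be - real C <= real (SUM d<=M. d * b n d)"
  proof -
   have "real (SUM d<=M. d * b n d) <= ?r * be" unfolding of_nat_sum of_nat_mult bes by (simp only: sum_distrib_left mult.left_commute, intro sum_mono mult_left_mono b_up, auto)
   thus "real (SUM d<=M. d * b n d) <= ?r * be" .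
   have "?r * be - real C = (SUM d<=M. real d * (?r * pmf al d - 1))"
    unfolding bes C_def of_nat_sum sum_distrib_left sum_subtractf[symmetric] by (intro sum.cong) (auto simp: algebra_simps)
   also have "... <= real (SUM d<=M. d * b n d)" unfolding of_nat_sum of_nat_mult by (intro sum_mono mult_left_mono b_lo) auto
   finally show "?r * be - real C <= real (SUM d<=M. d * b n d)" .
  qed
  have sbn: "(SUM d<=M. b n d) <= n"
  proof -
   have "?r <= real n * 1" using s0 by (intro mult_left_mono) auto
   hence "real (SUM d<=M. b n d) <= real n" using sb by linarith
   thus ?thesis by (simp only: of_nat_le_iff)
  qed
  have Rn: "real (R n) = real n - real (SUM d<=M. b n d)" using sbn by (simp add: R_def)
  hence Rge: "real (R n) >= real n * s n" using sb by (simp add: algebra_simps)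
  have ns: "real n * s n > 0" using s0 n(1) by simp
  hence R0: "R n > 0" using Rge by simp
  have mb: "real n * (be - de n) <= real (2 * m n)" "real (2 * m n) <= real n * (be + de n)"
  proof -
   have "be - de n <= real (2 * m n) / real n" "real (2 * m n) / real n <= be + de n" unfolding de_def by linarith+
   thus "real n * (be - de n) <= real (2 * m n)" "real (2 * m n) <= real n * (be + de n)" using n(1) by (simp_all add: field_simps)
  qed
  have d1: "de n = sqrt (de n) * sqrt (de n)" using de0 by simp
  have ssq: "sqrt (de n) <= s n" by (simp add: s_def)
  have ns2: "real n * s n >= 2 * real C"
  proof -
   have "real n * (1 / sqrt (real n)) = sqrt (real n)" using n(1) by (simp add: real_div_sqrt)
   moreover have "real n * (1 / sqrt (real n)) <= real n * s n" by (intro mult_left_mono) (use de0 in \<open>auto simp: s_def\<close>)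
   ultimately show ?thesis using n(5) by linarith
  qed
  have "real (SUM d<=M. d * b n d) <= real (2 * m n)"
  proof -
   have "real n * de n <= real n * (s n * be)" by (subst d1, intro mult_mono ssq n(4), use de0 s0 in auto)
   thus ?thesis using sdb(1) mb(1) by (simp add: algebra_simps)
  qed
  hence le2m: "(SUM d<=M. d * b n d) <= 2 * m n" by (simp only: of_nat_le_iff)
  have "real (T n) <= real (Suc M) * real (R n)"
  proof -
   have "real (T n) <= real n * de n + real n * s n * be + real C" unfolding T_def using le2m mb(2) sdb(2) by (simp add: algebra_simps)
   also have "real n * de n <= real n * (s n * (1 / 2))" by (subst d1, intro mult_mono ssq n(3), use de0 s0 in auto)
   also have "real n * s n * be <= real n * s n * real M" using beM ns by (intro mult_left_mono) auto
   finally have "real (T n) <= real n * s n * (real M + 1)" using ns2 by (simp add: algebra_simps)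
   also have "... <= real (R n) * (real M + 1)" using Rge by simp
   finally show ?thesis by (simp add: algebra_simps)
  qed
  hence TR: "T n <= Suc M * R n" by (simp only: of_nat_mult[symmetric] of_nat_le_iff)
  have div: "T n div R n <= Suc M" using div_le_mono[OF TR, of "R n"] R0 by simp
  \<comment> \<open>If the quotient is already M + 1 the remainder is 0, so degree M + 2 does not
    occur.\<close>
  have md: "T n mod R n = 0 | Suc (T n div R n) <= Suc M"
  proof (cases "T n div R n = Suc M")
   case True
   show ?thesis using div_mult_mod_eq[of "T n" "R n"] True TR by simp
  qed (use div in simp)
  let ?e = "%d. (if d = T n div R n then R n - T n mod R n else 0) + (if d = Suc (T n div R n) then T n mod R n else 0)"
  have pick: "(\<Sum>d\<le>Suc M. g d * ?e d) = g (T n div R n) * (R n - T n mod R n) + g (Suc (T n div R n)) * (T n mod R n)" for g :: "nat => nat"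
  proof -
   have "(\<Sum>d\<le>Suc M. g d * ?e d) = (SUM d:{..Suc M}. if d = T n div R n then g d * (R n - T n mod R n) else 0) + (SUM d:{..Suc M}. if d = Suc (T n div R n) then g d * (T n mod R n) else 0)"
    unfolding sum.distrib[symmetric] by (intro sum.cong) auto
   thus ?thesis using div md by (auto simp: sum.delta simp del: sum.atMost_Suc)
  qed
  have cb: "(\<Sum>d\<le>Suc M. g d * c n d) = (SUM d<=M. g d * b n d) + (\<Sum>d\<le>Suc M. g d * ?e d)" for g :: "nat => nat"
  proof -
   show ?thesis by (simp add: sum.distrib[symmetric] c_def distrib_left add.assoc)
  qed
  have mR: "T n mod R n <= R n" using R0 by simp
  have "(\<Sum>d\<le>Suc M. c n d) = n" using cb[of "%_. 1"] pick[of "%_. 1"] mR sbn by (simp add: R_def del: sum.atMost_Suc)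
  moreover have "(\<Sum>d\<le>Suc M. d * c n d) = 2 * m n"
  proof -
   have "T n div R n * (R n - T n mod R n) + Suc (T n div R n) * (T n mod R n) = T n div R n * ((R n - T n mod R n) + T n mod R n) + T n mod R n"
   proof -
    have "a * x + Suc a * y = a * (x + y) + y" for a x y :: nat by (simp add: algebra_simps)
    thus ?thesis .
   qed
   also have "... = T n" using mR by simp
   finally show ?thesis using cb[of "%d. d"] pick[of "%d. d"] le2m by (simp add: T_def del: sum.atMost_Suc)
  qed
  ultimately show ?thesis using sbn R0 by blast
 qed
 have blim: "(%n. real (b n d) / real n) ----> pmf al d" for d unfolding b_def by (rule tendsto_floor_share[OF slim]) simp
 have clim: "(%n. real (c n d) / real n) ----> pmf al d" if d: "d <= Suc M" for d
 proof (rule tendsto_sandwich)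
  let ?b = "%n. if d <= M then real (b n d) / real n else 0"
  have b': "?b ----> pmf al d"
  proof (cases "d <= M")
   case False
   thus ?thesis using M[of d] False by (force simp: set_pmf_iff)
  qed (use blim in simp)
  have "(%n. ?b n + (1 - (SUM d<=M. real (b n d) / real n))) ----> pmf al d + (1 - (SUM d<=M. pmf al d))"
   by (intro tendsto_add tendsto_diff tendsto_sum tendsto_const b' blim)
  hence up: "(%n. ?b n + (1 - (SUM d<=M. real (b n d) / real n))) ----> pmf al d" by (simp add: sum1)
  show "Ev n. ?b n <= real (c n d) / real n" by (intro always_eventually) (auto simp: c_def intro!: divide_right_mono)
  show "Ev n. real (c n d) / real n <= ?b n + (1 - (SUM d<=M. real (b n d) / real n))" using ev
  proof eventually_elim
   case (elim n)
   have sbn: "(SUM d<=M. b n d) <= n" and R0: "0 < R n" using facts elim by blast+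
   have "c n d <= (if d <= M then b n d else 0) + R n" using R0 by (auto simp: c_def less_imp_le mod_less_divisor)
   hence "real (c n d) <= (if d <= M then real (b n d) else 0) + real (R n)" by auto
   hence "real (c n d) / real n <= ((if d <= M then real (b n d) else 0) + real (R n)) / real n" by (rule divide_right_mono) simp
   thus ?case using elim sbn by (auto simp: R_def of_nat_diff add_divide_distrib diff_divide_distrib sum_divide_distrib)
  qed
  show "?b ----> pmf al d" by (rule b')
  show "(%n. ?b n + (1 - (SUM d<=M. real (b n d) / real n))) ----> pmf al d" by (rule up)
 qed
 show ?thesis
 proof (intro exI conjI allI impI)
  show "Ev n. (\<Sum>d\<le>Suc M. c n d) = n & (\<Sum>d\<le>Suc M. d * c n d) = 2 * m n" using ev by eventually_elim (use facts in blast)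
 qed (rule clim)
qed

lemma bounded_lower_edges:
 fixes mu :: "('x::finite, 'y::finite) star pmf"
 assumes kp: "kp > 0" and M: "!!ta. ta : set_pmf mu ==> deg ta <= M" and mean: "mean_deg mu ~= 0"
  and sym: "!!k. colmean mu (rev_col k) = colmean mu k" and sub: "set_pmf mu <= set_pmf (poi_law kp nu xi)"
  and F: "finite F" "ep > 0" and r: "kl_real mu (poi_law kp nu xi) - col_div kp nu xi (colmean mu) / 2 < r"
  and lim: "(%n. real (2 * m n) / real n) ----> enn2real (mean_deg mu)" shows "Ev n. decay r n <= prob (ER_law kp nu xi n)
  (seq_ball n F ep mu \<inter> {t. size (seq_cols n t) = 2 * m n})"
proof -
 define al where "al = map_pmf deg mu"
 have fin: "mean_deg mu < \<infinity>" by (rule mean_deg_bounded[OF M])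
 have be: "enn2real (mean_deg mu) = expect al real" unfolding al_def integral_map_pmf mean_deg_expectation[OF fin] by simp
 have be0: "enn2real (mean_deg mu) > 0" using mean fin by (simp add: enn2real_positive_iff zero_less_iff_neq_zero)
 obtain c where c: "Ev n. (\<Sum>d\<le>Suc M. c n d) = n & (\<Sum>d\<le>Suc M. d * c n d) = 2 * m n"
  and clim: "ALL d<=Suc M. (%n. real (c n d) / real n) ----> pmf al d"
 proof -
  have "!!d. d : set_pmf al ==> d <= M" using M by (auto simp: al_def)
  thus thesis using degree_counts[OF _ be be0 lim] that by blast
 qed
 obtain ta0 where "ta0 : set_pmf mu" "deg ta0 ~= 0" using mean by (auto simp: mean_deg_zero)
 hence i0: "1 <= deg ta0" "pmf (map_pmf deg mu) (deg ta0) > 0" by (auto intro: pmf_positive)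
 have M': "deg ta <= Suc M" if "ta : set_pmf mu" for ta using M[OF that] by simp
 have c': "Ev n. (\<Sum>d\<le>Suc M. c n d) = n & even (\<Sum>d\<le>Suc M. d * c n d)" using c by eventually_elim (simp del: sum.atMost_Suc)
 have "Ev n. decay r n <= prob (ER_law kp nu xi n)
  {t : seq_ball n F ep mu. ALL d<=Suc M. card {v : {1..n}. deg (t v) = d} = c n d}"
  by (rule ER_lower_bounded_degree[OF kp M' i0 sym sub c' _ F r]) (use clim in \<open>auto simp: al_def\<close>)
 thus ?thesis using c
 proof eventually_elim
  case (elim n)
  have "{t : seq_ball n F ep mu. ALL d<=Suc M. card {v : {1..n}. deg (t v) = d} = c n d} <= seq_ball n F ep mu \<inter> {t. size (seq_cols n t) = 2 * m n}"
  proof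
   fix t assume "t : {t : seq_ball n F ep mu. ALL d<=Suc M. card {v : {1..n}. deg (t v) = d} = c n d}"
   hence t: "t : seq_ball n F ep mu" and tc: "!!d. d <= Suc M ==> card {v : {1..n}. deg (t v) = d} = c n d" by auto
   have "(\<Sum>d\<le>Suc M. card {v : {1..n}. deg (t v) = d}) = card {1..n}" using elim(2) tc by simp
   from sum_card_levels(2)[OF _ this] have "size (seq_cols n t) = 2 * m n" using elim(2) tc by (simp add: size_seq_cols del: sum.atMost_Suc)
   thus "t : seq_ball n F ep mu \<inter> {t. size (seq_cols n t) = 2 * m n}" using t by simp
  qed
  thus ?case by (intro order_trans[OF elim(1)] measure_pmf.finite_measure_mono) auto
 qed
qed

lemma tendsto_nat_floor: assumes "c >= 0" shows "(%n. real (nat \<lfloor>real n * c\<rfloor>) / real n) ----> c"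
proof (rule tendsto_sandwich)
 show "Ev n. c - 1 / real n <= real (nat \<lfloor>real n * c\<rfloor>) / real n" using eventually_ge_at_top[of "1::nat"]
 proof eventually_elim
  case (elim n)
  have "real n * c - 1 <= real (nat \<lfloor>real n * c\<rfloor>)" by linarith
  hence "(real n * c - 1) / real n <= real (nat \<lfloor>real n * c\<rfloor>) / real n" by (rule divide_right_mono) simp
  thus ?case using elim by (simp add: diff_divide_distrib)
 qed
 show "Ev n. real (nat \<lfloor>real n * c\<rfloor>) / real n <= c" using eventually_ge_at_top[of "1::nat"]
 proof eventually_elim
  case (elim n)
  show ?case using assms elim by (simp add: divide_le_eq mult.commute)
 qed
 show "(%n. c - 1 / real n) ----> c" using tendsto_diff[OF tendsto_const lim_1_over_n, of c] by simp
qed simp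

lemma seq_ball_shift: assumes "!!a. a : F ==> \<bar>pmf mu' a - pmf mu a\<bar> < ep / 2" shows "seq_ball n F (ep / 2) mu' <= seq_ball n F ep mu"
proof
 fix t assume t: "t : seq_ball n F (ep / 2) mu'"
 have "\<bar>pmf (emp n t) a - pmf mu a\<bar> < ep" if "a : F" for a
 proof -
  have "\<bar>pmf (emp n t) a - pmf mu' a\<bar> < ep / 2" using t that unfolding seq_ball_def by blast
  thus ?thesis using assms[OF that] by linarith
 qed
 thus "t : seq_ball n F ep mu" unfolding seq_ball_def by blast
qed

lemma ER_lower_edges:
 fixes mu :: "('x::finite, 'y::finite) star pmf"
 assumes kp: "kp > 0" and r: "ER_rate kp nu xi mu < ereal r" and F: "finite F" "ep > 0"
 shows "Ev n. decay r n <= prob (ER_law kp nu xi n) (seq_ball n F ep mu)"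
  and "mean_deg mu = ennreal be ==> be > 0 ==> (%n. real (2 * m n) / real n) ----> be ==>
   Ev n. decay r n <= prob (ER_law kp nu xi n) (seq_ball n F ep mu \<inter> {t. size (seq_cols n t) = 2 * m n})"
proof -
 have ep: "ep / 2 > 0" using F(2) by simp
 obtain mu' M where M: "ALL ta:set_pmf mu'. deg ta <= M" and mean: "mean_deg mu' ~= 0" and sym: "ALL k. colmean mu' (rev_col k) = colmean mu' k"
  and sub: "set_pmf mu' <= set_pmf (poi_law kp nu xi)" and close: "ALL a:F. \<bar>pmf mu' a - pmf mu a\<bar> < ep / 2"
  and r': "kl_real mu' (poi_law kp nu xi) - col_div kp nu xi (colmean mu') / 2 < r" and same: "mean_deg mu ~= 0 --> mean_deg mu' = mean_deg mu"
  using ER_bounded_approx[OF kp r F(1) ep] by blast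
 have ball: "seq_ball n F (ep / 2) mu' <= seq_ball n F ep mu" for n by (rule seq_ball_shift) (use close in blast)
 have main: "Ev n. decay r n <= prob (ER_law kp nu xi n) (seq_ball n F ep mu \<inter> {t. size (seq_cols n t) = 2 * m n})"
  if lim: "(%n. real (2 * m n) / real n) ----> enn2real (mean_deg mu')" for m
 proof -
  have "Ev n. decay r n <= prob (ER_law kp nu xi n) (seq_ball n F (ep / 2) mu' \<inter> {t. size (seq_cols n t) = 2 * m n})"
   by (rule bounded_lower_edges[OF kp bspec[OF M] mean spec[OF sym] sub F(1) ep r' lim])
  thus ?thesis
  proof eventually_elim
   case (elim n)
   thus ?case using ball[of n] by (elim order_trans) (intro measure_pmf.finite_measure_mono, auto)
  qed
 qed
 show "Ev n. decay r n <= prob (ER_law kp nu xi n) (seq_ball n F ep mu \<inter> {t. size (seq_cols n t) = 2 * m n})"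
  if "mean_deg mu = ennreal be" "be > 0" "(%n. real (2 * m n) / real n) ----> be" by (rule main) (use that same in simp)
 \<comment> \<open>When the number of edges is free, it is fixed at a value that fits the mean
   degree of the approximating law; dropping the condition afterwards only increases the
   probability.\<close>
 let ?m = "%n. nat \<lfloor>real n * (enn2real (mean_deg mu') / 2)\<rfloor>"
 have "(%n. 2 * (real (?m n) / real n)) ----> 2 * (enn2real (mean_deg mu') / 2)" by (intro tendsto_mult tendsto_const tendsto_nat_floor) simp
 hence "(%n. real (2 * ?m n) / real n) ----> enn2real (mean_deg mu')" by simp
 from main[OF this] show "Ev n. decay r n <= prob (ER_law kp nu xi n) (seq_ball n F ep mu)"
  by eventually_elim (erule order_trans, intro measure_pmf.finite_measure_mono, auto)
qed

section \<open>Colour means and rates of the true laws\<close>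

lemma nn_integral_count_replicate:
 "(\<integral>\<^sup>+cs. of_nat (count (mset cs) c) \<partial>measure_pmf (replicate_pmf d p)) = of_nat d * ennreal (pmf p c)"
proof (induction d)
 case (Suc d)
 have one: "(\<integral>\<^sup>+x. (if x = c then 1 else 0) \<partial>p) = ennreal (pmf p c)"
 proof -
  have "(%x. if x = c then 1 else 0) = (indicator {c} :: _ => ennreal)" by auto
  thus ?thesis by (simp add: emeasure_pmf_single)
 qed
 have "(\<integral>\<^sup>+cs. of_nat (count (mset cs) c) \<partial>(replicate_pmf (Suc d) p))
   = (\<integral>\<^sup>+x. \<integral>\<^sup>+xs. (if x = c then 1 else 0) + of_nat (count (mset xs) c) \<partial>(replicate_pmf d p) \<partial>p)"
  by (simp add: if_distrib[of of_nat] cong: if_cong) (intro nn_integral_cong, auto)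
 also have "... = (\<integral>\<^sup>+x. (if x = c then 1 else 0) + of_nat d * ennreal (pmf p c) \<partial>p)"
  by (intro nn_integral_cong) (simp add: nn_integral_add Suc measure_pmf.emeasure_space_1)
 also have "... = ennreal (pmf p c) + of_nat d * ennreal (pmf p c)" by (simp add: nn_integral_add one measure_pmf.emeasure_space_1)
 finally show ?case by (simp add: distrib_right)
qed simp

lemma mean_deg_true_law: "mean_deg (true_law q nu xi) = (\<integral>\<^sup>+d. of_nat d \<partial>measure_pmf q)"
proof -
 have "(\<integral>\<^sup>+d. of_nat d \<partial>(map_pmf deg (true_law q nu xi))) = mean_deg (true_law q nu xi)" by (simp add: mean_deg_def)
 thus ?thesis by (simp only: map_star_deg_true_law)
qed

lemma colmean_true_law: assumes be: "mean_deg (true_law q nu xi) = ennreal be" "be >= 0" shows "colmean (true_law q nu xi) k = be * edge_wt nu xi k"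
proof -
 obtain x c where k: "k = (x, c)" by (cases k)
 have cnt: "of_nat (count (cols (x', mset cs)) (x, c)) = (if x' = x then 1 else 0) * (of_nat (count (mset cs) c) :: ennreal)" for x' cs
 proof -
  have "count (cols (x', m)) (x, c) = (if x' = x then count m c else 0)" for m by (induction m) (auto simp: cols_def)
  thus ?thesis by simp
 qed
 have one: "(\<integral>\<^sup>+x'. (if x' = x then 1 else 0) * a \<partial>measure_pmf nu) = ennreal (pmf nu x) * a" for a :: ennreal
 proof -
  have "(\<integral>\<^sup>+x'. (if x' = x then 1 else 0) * a \<partial>nu) = (\<integral>\<^sup>+x'. indicator {x} x' * a \<partial>nu)"
   by (intro nn_integral_cong) (auto simp: indicator_def)
  thus ?thesis by (simp only: nn_integral_multc) (simp add: nn_integral_multc emeasure_pmf_single)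
 qed
 have "(\<integral>\<^sup>+ta. of_nat (count (cols ta) k) \<partial>(true_law q nu xi))
  = (\<integral>\<^sup>+d. \<integral>\<^sup>+x'. \<integral>\<^sup>+cs. (if x' = x then 1 else 0) * of_nat (count (mset cs) c) \<partial>(replicate_pmf d (pair_pmf nu (sym_law xi))) \<partial>nu \<partial>q)"
  by (simp add: true_law_def k cnt)
 also have "... = (\<integral>\<^sup>+d. of_nat d * ennreal (edge_wt nu xi k) \<partial>q)"
 proof (rule nn_integral_cong)
  fix d
  have "(\<integral>\<^sup>+x'. \<integral>\<^sup>+cs. (if x' = x then 1 else 0) * of_nat (count (mset cs) c) \<partial>(replicate_pmf d (pair_pmf nu (sym_law xi))) \<partial>nu)
   = (\<integral>\<^sup>+x'. (if x' = x then 1 else 0) * (of_nat d * ennreal (child_wt nu xi c)) \<partial>nu)"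
   by (intro nn_integral_cong) (simp add: nn_integral_cmult nn_integral_count_replicate pmf_pair_child)
  also have "... = ennreal (pmf nu x) * (of_nat d * ennreal (child_wt nu xi c))" by (rule one)
  finally show "(\<integral>\<^sup>+x'. \<integral>\<^sup>+cs. (if x' = x then 1 else 0) * of_nat (count (mset cs) c) \<partial>(replicate_pmf d (pair_pmf nu (sym_law xi))) \<partial>nu)
   = of_nat d * ennreal (edge_wt nu xi k)" by (simp add: edge_wt_def k ennreal_mult ac_simps)
 qed
 also have "... = ennreal be * ennreal (edge_wt nu xi k)" by (simp add: nn_integral_multc be(1)[unfolded mean_deg_true_law])
 finally have "(\<integral>\<^sup>+ta. of_nat (count (cols ta) k) \<partial>(true_law q nu xi)) = ennreal (be * edge_wt nu xi k)"
  using be(2) by (simp add: ennreal_mult)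
 hence nn: "(\<integral>\<^sup>+ta. ennreal (real (count (cols ta) k)) \<partial>(true_law q nu xi)) = ennreal (be * edge_wt nu xi k)"
  by (simp add: ennreal_of_nat_eq_real_of_nat)
 have "colmean (true_law q nu xi) k = enn2real (\<integral>\<^sup>+ta. ennreal (real (count (cols ta) k)) \<partial>(true_law q nu xi))"
  unfolding colmean_def by (rule integral_eq_nn_integral) auto
 thus ?thesis unfolding nn using be(2) by simp
qed

lemma sum_edge_wt:
 fixes nu :: "'x::finite pmf" and xi :: "('y::finite * 'y) pmf" shows "(SUM k:pcols nu xi. edge_wt nu xi k) = 1"
proof -
 have pm: "pmf (pair_pmf nu (pair_pmf nu (sym_law xi))) k = edge_wt nu xi k" for k by (cases k) (simp add: pmf_pair edge_wt_def child_wt_def)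
 have "(SUM k:pcols nu xi. pmf (pair_pmf nu (pair_pmf nu (sym_law xi))) k) = 1"
  by (rule sum_pmf_eq_1) (auto simp: pcols_def pm[symmetric] pmf_positive_iff)
 thus ?thesis by (simp only: pm)
qed

lemma col_div_true_law:
 fixes nu :: "'x::finite pmf" and xi :: "('y::finite * 'y) pmf" assumes "kp > 0" shows "col_div kp nu xi (%k. kp * edge_wt nu xi k) = 0"
proof -
 have "col_div kp nu xi (%k. kp * edge_wt nu xi k) = (SUM k:pcols nu xi. - (kp * edge_wt nu xi k)) + kp"
  unfolding col_div_def using assms by (intro arg_cong2[where f = "(+)"] sum.cong) (auto simp: pcols_def)
 thus ?thesis by (simp add: sum_negf sum_distrib_left[symmetric] sum_edge_wt)
qed

text \<open>The two star laws have the same conditional law given the degree, so their log-ratio is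
  a function of the degree.\<close>

lemma kl_true_law: assumes kl: "kl_finite q p"
 shows "kl_finite (true_law q nu xi) (true_law p nu xi)" and "kl_real (true_law q nu xi) (true_law p nu xi) = kl_real q p"
proof -
 have eq: "ln (pmf (true_law q nu xi) ta / pmf (true_law p nu xi) ta) = ln (pmf q (deg ta) / pmf p (deg ta)) & ta : set_pmf (true_law p nu xi)"
  if "ta : set_pmf (true_law q nu xi)" for ta
 proof -
  let ?w = "fact (deg ta) * pmf nu (fst ta) * (PROD c:#snd ta. child_wt nu xi c) / mfact (snd ta)"
  have w: "pmf (true_law q nu xi) ta = pmf q (deg ta) * ?w" "pmf (true_law p nu xi) ta = pmf p (deg ta) * ?w" by (simp_all add: pmf_true_law)
  have nz: "pmf q (deg ta) ~= 0" "?w ~= 0" using that unfolding set_pmf_iff w by auto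
  show ?thesis using nz(1) kl nz unfolding set_pmf_iff w by (auto simp: kl_finite_def set_pmf_iff)
 qed
 have int: "integrable (true_law q nu xi) (%ta. ln (pmf q (deg ta) / pmf p (deg ta)))"
  using kl integrable_map_pmf_eq[of deg "true_law q nu xi" "%d. ln (pmf q d / pmf p d)"] by (simp add: kl_finite_def map_star_deg_true_law)
 have "integrable (true_law q nu xi) (%ta. ln (pmf (true_law q nu xi) ta / pmf (true_law p nu xi) ta))"
  by (rule integrable_cong_AE_imp[OF int]) (use eq in \<open>auto simp: AE_measure_pmf_iff\<close>)
 thus "kl_finite (true_law q nu xi) (true_law p nu xi)" using eq unfolding kl_finite_def by blast
 have "kl_real (true_law q nu xi) (true_law p nu xi) = expect (map_pmf deg (true_law q nu xi)) (%d. ln (pmf q d / pmf p d))" unfolding kl_real_def by (simp only: integral_map_pmf, rule integral_cong_AE, (use eq in \<open>auto simp: AE_measure_pmf_iff\<close>))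
 thus "kl_real (true_law q nu xi) (true_law p nu xi) = kl_real q p" by (simp only: map_star_deg_true_law kl_real_def)
qed

text \<open>With mean \<open>kp\<close> the colour means are those of the Poisson star law, so the
  divergence vanishes and the entropy of the degrees remains. This gives the cost of the
  conditioning events: 0 for the number of edges, the entropy of \<open>al\<close> for the
  degrees.\<close>

lemma ER_rate_true_law:
 fixes nu :: "'x::finite pmf" and xi :: "('y::finite * 'y) pmf"
 assumes kp: "kp > 0" and mean: "(\<integral>\<^sup>+d. of_nat d \<partial>measure_pmf q) = ennreal kp" and kl: "kl_finite q (Poi kp)"
 shows "ER_rate kp nu xi (true_law q nu xi) = ereal (kl_real q (Poi kp))"
proof -
 have m: "mean_deg (true_law q nu xi) = ennreal kp" by (simp add: mean_deg_true_law mean)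
 have cm: "colmean (true_law q nu xi) = (%k. kp * edge_wt nu xi k)" using colmean_true_law[OF m] kp by auto
 show ?thesis using kp by (simp add: ER_rate_def m cm col_div_true_law kl_true_law[OF kl])
qed

lemma mean_Poi: assumes "kp > 0" shows "(\<integral>\<^sup>+d. of_nat d \<partial>measure_pmf (Poi kp)) = ennreal kp"
proof -
 have p: "pmf (Poi kp) (Suc d) * real (Suc d) = kp * pmf (Poi kp) d" for d using assms by (simp add: pmf_Poi del: of_nat_Suc)
 have "(\<integral>\<^sup>+d. of_nat d \<partial>(Poi kp)) = (\<integral>\<^sup>+d. ennreal (pmf (Poi kp) d) * of_nat d \<partial>count_space UNIV)"
  by (rule nn_integral_measure_pmf)
 also have "... = (\<Sum>d. ennreal (pmf (Poi kp) d * real d))" by (simp add: nn_integral_count_space_nat ennreal_mult ennreal_of_nat_eq_real_of_nat)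
 also have "... = (\<Sum>d. ennreal (pmf (Poi kp) (Suc d) * real (Suc d)))" by (subst suminf_offset[of _ 1]) (simp_all del: of_nat_Suc)
 finally show ?thesis unfolding p using assms nn_integral_pmf_eq_1[of "Poi kp"] by (simp add: ennreal_mult nn_integral_count_space_nat)
qed

lemma edges_event: assumes E: "E <= vertex_pairs n" and t: "t : set_pmf (star_seq_law n (return_pmf E) nu xi)"
 shows "t : {t. size (seq_cols n t) = 2 * m} <-> E : {E. E <= vertex_pairs n & card E = m}"
proof -
 have "size (seq_cols n t) = 2 * card E"
  unfolding size_seq_cols sum_degrees[OF E, symmetric] by (intro sum.cong) (simp_all add: star_seq_degree[OF t])
 thus ?thesis using E by simp
qed

lemma prob_FE: assumes "prob (ER_law kp nu xi n) {t. size (seq_cols n t) = 2 * m} > 0" shows "prob (star_seq_law n (FE_graph m n) nu xi) S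
  = prob (ER_law kp nu xi n) (S \<inter> {t. size (seq_cols n t) = 2 * m})
   / prob (ER_law kp nu xi n) {t. size (seq_cols n t) = 2 * m}" unfolding FE_graph_def by (rule conditioned_ER[OF _ _ edges_event assms]) auto

lemma ratio_ge_exp: assumes "exp (- (a * n)) <= (x :: real)" "y <= exp (- (b * n))" "y > 0" shows "exp (- ((a - b) * n)) <= x / y"
proof -
 have "exp (- ((a - b) * n)) * y <= exp (- ((a - b) * n)) * exp (- (b * n))" using assms(2) by simp
 thus ?thesis using assms by (simp add: exp_add[symmetric] algebra_simps pos_le_divide_eq)
qed

lemma ratio_le_exp: assumes "x <= exp (- (a * n))" "exp (- (b * n)) <= (y :: real)" shows "x / y <= exp (- ((a - b) * n))" and "y > 0"
proof -
 show y: "y > 0" using assms(2) by (meson exp_gt_zero less_le_trans)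
 have "x <= exp (- ((a - b) * n)) * exp (- (b * n))" using assms(1) by (simp add: exp_add[symmetric] algebra_simps)
 also have "... <= exp (- ((a - b) * n)) * y" using assms(2) by simp
 finally show "x / y <= exp (- ((a - b) * n))" using y by (simp add: pos_divide_le_eq)
qed

lemma kl_self: "kl_finite q q" "kl_real q q = 0"
proof -
 have ae: "AE a in q. ln (pmf q a / pmf q a) = 0" by simp
 show "kl_finite q q" by (simp add: kl_finite_def, rule integrable_cong_AE_imp[of _ "%_. 0"], (use ae in auto))
 have "kl_real q q = expect q (%_. 0)" unfolding kl_real_def by (rule integral_cong_AE) (use ae in auto)
 thus "kl_real q q = 0" by simp
qed

section \<open>The graph with a fixed number of edges\<close>

context
 fixes kp :: real and nu :: "'x::finite pmf" and xi :: "('y::finite * 'y) pmf" and m :: "nat => nat"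
 assumes kp: "kp > 0" and m: "(%n. real (m n) / real n) ----> kp / 2"
begin

private abbreviation "edges_eq n \<equiv> {t :: nat => ('x, 'y) star. size (seq_cols n t) = 2 * m n}"

lemma FE_lim: "(%n. real (2 * m n) / real n) ----> kp" using tendsto_mult[OF tendsto_const m, of 2] by simp

text \<open>The Poisson star law has rate 0 and mean degree \<open>kp\<close>, so fixing the number
  of edges is free on the exponential scale; with the empty set of atoms the ball is the whole
  space.\<close>

lemma FE_edges_lower: assumes "de > 0" shows "Ev n. decay de n <= prob (ER_law kp nu xi n) (edges_eq n)"
proof -
 have "ER_rate kp nu xi (poi_law kp nu xi) < ereal de" using ER_rate_true_law[OF kp mean_Poi[OF kp] kl_self(1), of nu xi] assms by (simp add: kl_self)
 from ER_lower_edges(2)[OF kp this finite.emptyI zero_less_one _ kp FE_lim]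
 show ?thesis by (simp add: mean_deg_true_law mean_Poi[OF kp] seq_ball_def)
qed

lemma FE_lower:
 fixes mu :: "('x, 'y) star pmf" assumes "mean_deg mu = ennreal kp" "ER_rate kp nu xi mu < ereal r" "finite F" "ep > 0"
 shows "Ev n. decay r n <= prob (star_seq_law n (FE_graph (m n) n) nu xi) (seq_ball n F ep mu)"
 using ER_lower_edges(2)[OF kp assms(2-4,1) kp FE_lim] FE_edges_lower[OF zero_less_one]
proof eventually_elim
 case (elim n)
 have pos: "prob (ER_law kp nu xi n) (edges_eq n) > 0" using elim(2) by (meson exp_gt_zero less_le_trans)
 have "decay (r - 0) n <= prob (ER_law kp nu xi n) (seq_ball n F ep mu \<inter> edges_eq n) / prob (ER_law kp nu xi n) (edges_eq n)"
  by (rule ratio_ge_exp[OF elim(1) _ pos]) simp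
 thus ?case by (simp add: prob_FE[OF pos])
qed

lemma FE_upper_ER: assumes "Ev n. prob (ER_law kp nu xi n) (S n \<inter> edges_eq n) <= decay r' n" "r < r'"
 shows "Ev n. prob (star_seq_law n (FE_graph (m n) n) nu xi) (S n) <= decay r n"
proof -
 have "r' - r > 0" using assms(2) by simp
 from assms(1) FE_edges_lower[OF this] show ?thesis
 proof eventually_elim
  case (elim n)
  show ?case using ratio_le_exp[OF elim] by (simp add: prob_FE)
 qed
qed

text \<open>The colour means sum to the mean degree. If that is finite and not \<open>kp\<close>,
  the prescribed number of edges forces some colour mean to deviate; if it is infinite, the ball
  contains no sequence with that number of edges.\<close>

lemma FE_upper:
 fixes mu :: "('x, 'y) star pmf" assumes r: "mean_deg mu = ennreal kp ==> ereal r < ER_rate kp nu xi mu" shows "EX F ep. finite F & ep > 0 & (Ev n.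
  prob (star_seq_law n (FE_graph (m n) n) nu xi) (seq_ball n F ep mu) <= decay r n)"
proof -
 have suff: ?thesis if F: "finite F" "ep > 0" and r': "r < r'" and ev: "Ev n. prob (ER_law kp nu xi n) (seq_ball n F ep mu \<inter> edges_eq n) <= decay r' n" for F ep r'
  using FE_upper_ER[OF ev r'] F by blast
 consider (eq) "mean_deg mu = ennreal kp" | (inf) "mean_deg mu = \<infinity>" | (neq) be where "mean_deg mu = ennreal be" "be >= 0" "be ~= kp"
 proof (cases "mean_deg mu")
  case (real be)
  thus thesis using that by auto
 qed (use that in simp)
 thus ?thesis
 proof cases
  case eq
  obtain r' where r': "ereal r < ereal r'" "ereal r' < ER_rate kp nu xi mu" using ereal_dense2[OF r[OF eq]] by blast
  obtain F ep where F: "finite F" "ep > 0" and ev: "Ev n. prob (ER_law kp nu xi n) (seq_ball n F ep mu) <= decay r' n"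
   using ER_local_upper[OF kp r'(2)] by blast
  have "Ev n. prob (ER_law kp nu xi n) (seq_ball n F ep mu \<inter> edges_eq n) <= decay r' n" using ev
  proof eventually_elim
   case (elim n)
   have "prob (ER_law kp nu xi n) (seq_ball n F ep mu \<inter> edges_eq n) <= prob (ER_law kp nu xi n) (seq_ball n F ep mu)"
    by (rule measure_pmf.finite_measure_mono) auto
   thus ?case using elim by simp
  qed
  thus ?thesis using suff[OF F] r'(1) by simp
 next
  case inf
  have "ennreal (kp + 1) < mean_deg mu" using inf by simp
  then obtain F ep where F: "finite F" "ep > 0" and ball: "ALL n>=1. ALL t:seq_ball n F ep mu. (kp + 1) * real n < real (size (seq_cols n t))"
   using mean_deg_infinite_ball[of "kp + 1" mu] kp by auto
  have "Ev n. real (2 * m n) / real n < kp + 1" by (rule order_tendstoD(2)[OF FE_lim]) simp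
  hence "Ev n. prob (ER_law kp nu xi n) (seq_ball n F ep mu \<inter> edges_eq n) <= decay (r + 1) n" using eventually_ge_at_top[of 1]
  proof eventually_elim
   case (elim n)
   have "seq_ball n F ep mu \<inter> edges_eq n = {}" using elim ball elim(2) by (force simp: field_simps)
   thus ?case by simp
  qed
  thus ?thesis using suff[OF F, of "r + 1"] by simp
 next
  case neq
  define N where "N = real (card (UNIV :: ('x * 'x * 'y * 'y) set)) + 1"
  have N: "N > 0" unfolding N_def by (rule add_nonneg_pos) (rule of_nat_0_le_iff, rule zero_less_one)
  \<comment> \<open>Deviations of at most \<open>de\<close> in all colours move the mean degree by
    at most |kp - be| / 2, too little to lead from \<open>be\<close> to the neighbourhood of
    \<open>kp\<close> where 2 m n / n lies.\<close>
  define de where "de = \<bar>kp - be\<bar> / (2 * N)"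
  have de: "de > 0" using neq(3) N by (simp add: de_def)
  have fin: "mean_deg mu < \<infinity>" using neq(1) by simp
  have be: "be = (SUM k:UNIV. colmean mu k)" using mean_deg_colmean[OF fin] neq(1,2) by (simp add: sum_nonneg)
  obtain F ep where F: "finite F" "ep > 0" and ev: "Ev n. prob (ER_law kp nu xi n)
   {t : seq_ball n F ep mu. EX k. de < \<bar>freq n t k - colmean mu k\<bar>} <= decay (r + 1) n" using colmean_concentration[OF kp fin de] by blast
  have "Ev n. \<bar>real (2 * m n) / real n - kp\<bar> < \<bar>kp - be\<bar> / 2"
   by (rule tendstoD[OF FE_lim, unfolded dist_real_def]) (use neq(3) in simp)
  hence "Ev n. prob (ER_law kp nu xi n) (seq_ball n F ep mu \<inter> edges_eq n) <= decay (r + 1) n" using ev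
  proof eventually_elim
   case (elim n)
   have "seq_ball n F ep mu \<inter> edges_eq n <= {t : seq_ball n F ep mu. EX k. de < \<bar>freq n t k - colmean mu k\<bar>}"
   proof (rule ccontr)
    assume "~ ?thesis"
    then obtain t where t: "t : edges_eq n" and nt: "~ (EX k. de < \<bar>freq n t k - colmean mu k\<bar>)" by blast
    have tk: "\<bar>freq n t k - colmean mu k\<bar> <= de" for k using nt not_less by blast
    have "real (2 * m n) / real n - be = (SUM k:UNIV. freq n t k - colmean mu k)" using sum_mset_count[of UNIV "seq_cols n t" "%_. 1"] t by (simp add: be sum_subtractf sum_divide_distrib)
    also have "\<bar>...\<bar> <= (SUM k:(UNIV :: ('x * 'x * 'y * 'y) set). de)" by (rule order_trans[OF sum_abs sum_mono]) (rule tk)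
    also have "... <= N * de" using de by (simp add: N_def)
    also have "... = \<bar>kp - be\<bar> / 2" using N by (simp add: de_def)
    finally show False using elim(1) by argo
   qed
   thus ?case by (intro order_trans[OF _ elim(2)] measure_pmf.finite_measure_mono) auto
  qed
  thus ?thesis using suff[OF F, of "r + 1"] by simp
 qed
qed

lemma FE_tight: "Ev n. prob (star_seq_law n (FE_graph (m n) n) nu xi) {t. ~ mean_deg (emp n t) <= ennreal (kp + 1)} <= decay r n"
proof -
 have "Ev n. real (2 * m n) / real n < kp + 1" by (rule order_tendstoD(2)[OF FE_lim]) simp
 thus ?thesis using eventually_ge_at_top[of 1] FE_edges_lower[OF zero_less_one]
 proof eventually_elim
  case (elim n)
  have pos: "prob (ER_law kp nu xi n) (edges_eq n) > 0" using elim(3) by (meson exp_gt_zero less_le_trans)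
  have "{t. ~ mean_deg (emp n t) <= ennreal (kp + 1)} \<inter> edges_eq n = {}"
  proof -
   have "mean_deg (emp n t) <= ennreal (kp + 1)" if "t : edges_eq n" for t
    unfolding mean_deg_empirical[OF elim(2)] by (rule ennreal_leI) (use that elim(1) in simp)
   thus ?thesis by blast
  qed
  thus ?case by (simp add: prob_FE[OF pos])
 qed
qed

end

text \<open>With trivial marks a star is its degree, so statements about degrees become statements
  about stars.\<close>

lemma unit_star_eq: "a = b <-> deg a = deg b" for a b :: "(unit, unit) star"
proof
 assume "deg a = deg b"
 moreover have "m = replicate_mset (size m) ((), (), ())" for m :: "(unit \<times> unit \<times> unit) multiset" by (induction m) auto
 ultimately show "a = b" unfolding star_deg_def by (simp add: prod_eq_iff, metis)
qed simp

section \<open>The configuration model\<close>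

context
 fixes kp :: real and M :: nat and al :: "nat pmf" and aln :: "nat => nat pmf" assumes kp: "kp > 0" and CM: "CM_degrees M kp al aln"
begin

text \<open>For n >= 1 and d up to \<open>M\<close> the mass is a multiple of 1 / n, so the floor is
  exact.\<close>

private definition "deg_cnt n d = nat \<lfloor>real n * pmf (aln n) d\<rfloor>"
private definition degrees_eq :: "nat => (nat => ('a, 'b) star) set" where
 "degrees_eq n = {t. ALL d<=M. card {v : {1..n}. deg (t v) = d} = deg_cnt n d}"
text \<open>The exponential cost of the degree event, as \<open>CM_degrees_lower\<close> and
  \<open>CM_degrees_upper\<close> show.\<close>

private abbreviation "entropy_cost \<equiv> kl_real al (Poi kp)"

lemma CM_counts: assumes n: "n >= 1" shows "!!d. d <= M ==> pmf (aln n) d = real (deg_cnt n d) / real n" and "!!d. d > M ==> pmf (aln n) d = 0"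
  and "(SUM d<=M. deg_cnt n d) = n" and "even (SUM d<=M. d * deg_cnt n d)"
proof -
 have set: "set_pmf (aln n) <= {0..M}" and q: "ALL i:{0..M}. EX k:{0..n}. pmf (aln n) i = real k / real n"
  and ev: "EX k::nat. real n * (\<Sum>i=0..M. real i * pmf (aln n) i) = real (2 * k)" using CM n unfolding CM_degrees_def by blast+
 show p: "pmf (aln n) d = real (deg_cnt n d) / real n" if d: "d <= M" for d
 proof -
  obtain k where k: "pmf (aln n) d = real k / real n" using bspec[OF q, of d] d by auto
  thus ?thesis using n k by (simp add: deg_cnt_def)
 qed
 show "pmf (aln n) d = 0" if "d > M" for d using set that by (force simp: set_pmf_iff)
 have "(SUM d<=M. pmf (aln n) d) = 1" by (rule sum_pmf_eq_1) (use set in auto)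
 hence "real (SUM d<=M. deg_cnt n d) = real n" using n p by (simp add: sum_divide_distrib[symmetric])
 thus "(SUM d<=M. deg_cnt n d) = n" by (simp only: of_nat_eq_iff)
 obtain k :: nat where k: "real n * (\<Sum>i=0..M. real i * pmf (aln n) i) = real (2 * k)" using ev by blast
 have "real (SUM d<=M. d * deg_cnt n d) = real n * (\<Sum>i=0..M. real i * pmf (aln n) i)" unfolding of_nat_sum sum_distrib_left atMost_atLeast0 using n p by simp
 hence "(SUM d<=M. d * deg_cnt n d) = 2 * k" unfolding k by (simp only: of_nat_eq_iff)
 thus "even (SUM d<=M. d * deg_cnt n d)" by simp
qed

lemma CM_clim: "(%n. real (deg_cnt n d) / real n) ----> pmf al d" if "d <= M"
proof (rule Lim_transform_eventually)
 show "(%n. pmf (aln n) d) ----> pmf al d" using CM unfolding CM_degrees_def by (intro limitin_weak_pmf) blast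
 show "Ev n. pmf (aln n) d = real (deg_cnt n d) / real n" using eventually_ge_at_top[of "1::nat"] by eventually_elim (rule CM_counts(1)[OF _ that])
qed

lemma CM_alpha: "d : set_pmf al ==> d <= M" using CM by (auto simp: CM_degrees_def)

lemma CM_mean: "(\<integral>\<^sup>+d. of_nat d \<partial>measure_pmf al) = ennreal kp"
proof -
 have "(\<integral>\<^sup>+d. ennreal (real d) \<partial>al) = ennreal (expect al real)" by (intro nn_integral_eq_integral integrable_measure_pmf_finite, auto, rule finite_subset[of _ "{..M}"], auto dest: CM_alpha)
 thus ?thesis using CM by (simp add: CM_degrees_def ennreal_of_nat_eq_real_of_nat)
qed

lemma CM_kl: "kl_finite al (Poi kp)"
proof -
 have "finite (set_pmf al)" by (rule finite_subset[of _ "{..M}"]) (auto dest: CM_alpha)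
 moreover have "d : set_pmf (Poi kp)" for d using kp by (simp add: set_pmf_iff pmf_Poi)
 ultimately show ?thesis by (auto simp: kl_finite_def intro: integrable_measure_pmf_finite)
qed

lemma CM_event: assumes n: "n >= 1" and E: "E <= vertex_pairs n" and t: "t : set_pmf (star_seq_law n (return_pmf E) nu xi)"
 shows "t : degrees_eq n <-> E : {E. E <= vertex_pairs n & emp n (%v. card (nbrs E v)) = aln n}"
proof -
 let ?e = "emp n (%v. card (nbrs E v))"
 have deg: "{v : {1..n}. deg (t v) = d} = {v : {1..n}. card (nbrs E v) = d}" for d using star_seq_degree[OF t] by auto
 have pe: "pmf ?e d = real (card {v : {1..n}. card (nbrs E v) = d}) / real n" for d by (rule pmf_empirical[OF n])
 show ?thesis
 proof
  assume "t : degrees_eq n"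
  hence cd: "!!d. d <= M ==> card {v : {1..n}. card (nbrs E v) = d} = deg_cnt n d" unfolding degrees_eq_def mem_Collect_eq deg by blast
  hence s: "(SUM d<=M. card {v : {1..n}. card (nbrs E v) = d}) = card {1..n}" using CM_counts(3)[OF n] by simp
  have "?e = aln n"
  proof (rule pmf_eqI)
   fix d
   show "pmf ?e d = pmf (aln n) d"
   proof (cases "d <= M")
    case False
    thus ?thesis using sum_card_levels(1)[OF _ s] unfolding pe using CM_counts(2)[OF n] False by force
   next
    case True
    show ?thesis unfolding pe cd[OF True] CM_counts(1)[OF n True] ..
   qed
  qed
  thus "E : {E. E <= vertex_pairs n & emp n (%v. card (nbrs E v)) = aln n}" using E by blast
 next
  assume "E : {E. E <= vertex_pairs n & emp n (%v. card (nbrs E v)) = aln n}"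
  hence e: "?e = aln n" by blast
  have "card {v : {1..n}. card (nbrs E v) = d} = deg_cnt n d" if "d <= M" for d using pe[of d] CM_counts(1)[OF n that] n unfolding e by simp
  thus "t : degrees_eq n" unfolding degrees_eq_def mem_Collect_eq deg by blast
 qed
qed

text \<open>The right side contains no marks: the degree event has the same probability for all mark
  spaces.\<close>

lemma prob_degrees_eq: assumes n: "n >= 1" shows "prob (ER_law kp nu xi n) (degrees_eq n)
  = (SUM E:Pow (vertex_pairs n) \<inter> {E. E <= vertex_pairs n & emp n (%v. card (nbrs E v)) = aln n}. pmf (ER_graph kp n) E)"
proof -
 have "prob (ER_law kp nu xi n) (UNIV \<inter> degrees_eq n)
  = (SUM E:Pow (vertex_pairs n) \<inter> {E. E <= vertex_pairs n & emp n (%v. card (nbrs E v)) = aln n}.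
    prob (star_seq_law n (return_pmf E) nu xi) UNIV * pmf (ER_graph kp n) E)" by (rule prob_graph_event[OF set_ER_graph CM_event[OF n]])
 thus ?thesis by simp
qed

lemma CM_total: assumes n: "n >= 1" and t: "t : degrees_eq n"
 shows "size (seq_cols n t) = (SUM d<=M. d * deg_cnt n d)" and "size (seq_cols n t) <= M * n" and "d > M ==> card {v : {1..n}. deg (t v) = d} = 0"
proof -
 have cd: "!!d. d <= M ==> card {v : {1..n}. deg (t v) = d} = deg_cnt n d" using t unfolding degrees_eq_def by blast
 hence s: "(SUM d<=M. card {v : {1..n}. deg (t v) = d}) = card {1..n}" using CM_counts(3)[OF n] by simp
 show e: "size (seq_cols n t) = (SUM d<=M. d * deg_cnt n d)" unfolding size_seq_cols using sum_card_levels(2)[OF _ s] cd by simp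
 also have "... <= (SUM d<=M. M * deg_cnt n d)" by (intro sum_mono mult_right_mono) auto
 also have "... = M * n" by (simp only: sum_distrib_left[symmetric] CM_counts(3)[OF n])
 finally show "size (seq_cols n t) <= M * n" .
 show "card {v : {1..n}. deg (t v) = d} = 0" if "d > M"
 proof -
  have "{v : {1..n}. deg (t v) = d} = {}" using sum_card_levels(1)[OF _ s] that by force
  thus ?thesis by simp
 qed
qed

text \<open>All graphs with the given degrees have the same number of edges, hence the same
  Erdos-Renyi probability.\<close>

lemma prob_CM: assumes n: "n >= 1" and pos: "prob (ER_law kp nu xi n) (degrees_eq n) > 0" shows "prob (star_seq_law n (CM_graph (aln n) n) nu xi) S
  = prob (ER_law kp nu xi n) (S \<inter> degrees_eq n)
   / prob (ER_law kp nu xi n) (degrees_eq n)" unfolding CM_graph_def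
proof (rule conditioned_ER[OF _ _ CM_event[OF n] pos])
 show "card E = (SUM d<=M. d * deg_cnt n d) div 2" if E: "E : {E. E <= vertex_pairs n & emp n (%v. card (nbrs E v)) = aln n}" for E
 proof -
  obtain t where t: "t : set_pmf (star_seq_law n (return_pmf E) nu xi)" using set_pmf_not_empty[of "star_seq_law n (return_pmf E) nu xi"] by blast
  have Ev: "E <= vertex_pairs n" using E by blast
  have "t : degrees_eq n" using CM_event[OF n Ev t] E by blast
  from CM_total(1)[OF n this] have "2 * card E = (SUM d<=M. d * deg_cnt n d)"
   unfolding size_seq_cols sum_degrees[OF Ev, symmetric] using star_seq_degree[OF t] by simp
  thus ?thesis by simp
 qed
qed auto

lemma CM_degrees_lower:
 fixes nu :: "'x::finite pmf" and xi :: "('y::finite * 'y) pmf" assumes "de > 0"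
 shows "Ev n. decay (entropy_cost + de) n <= prob (ER_law kp nu xi n) (degrees_eq n)"
proof -
 let ?mu = "true_law al nu xi"
 have m: "mean_deg ?mu = ennreal kp" by (simp add: mean_deg_true_law CM_mean)
 have cm: "colmean ?mu = (%k. kp * edge_wt nu xi k)" using colmean_true_law[OF m] kp by auto
 obtain ta where "ta : set_pmf ?mu" "deg ta ~= 0" using m kp mean_deg_zero[of ?mu] by (metis ennreal_eq_0_iff not_le)
 hence i0: "1 <= deg ta" "pmf (map_pmf deg ?mu) (deg ta) > 0" by (auto intro: pmf_positive)
 have "Ev n. decay (entropy_cost + de) n <= prob (ER_law kp nu xi n)
  {t : seq_ball n {} 1 ?mu. ALL d<=M. card {v : {1..n}. deg (t v) = d} = deg_cnt n d}"
 proof (rule ER_lower_bounded_degree[OF kp _ i0])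
  show "deg a <= M" if "a : set_pmf ?mu" for a
  proof (rule CM_alpha)
   have "deg a : set_pmf (map_pmf deg ?mu)" using that by simp
   thus "deg a : set_pmf al" by (simp only: map_star_deg_true_law)
  qed
  show "set_pmf ?mu <= set_pmf (poi_law kp nu xi)" using kl_true_law(1)[OF CM_kl, of nu xi] by (simp add: kl_finite_def)
  show "Ev n. (SUM d<=M. deg_cnt n d) = n & even (SUM d<=M. d * deg_cnt n d)"
   using eventually_ge_at_top[of "1::nat"] by eventually_elim (simp only: CM_counts(3,4))
  show "kl_real ?mu (poi_law kp nu xi) - col_div kp nu xi (colmean ?mu) / 2 < entropy_cost + de"
   using assms kp by (simp add: kl_true_law(2)[OF CM_kl] cm col_div_true_law)
 qed (simp_all add: cm map_star_deg_true_law CM_clim)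
 thus ?thesis by (simp add: seq_ball_def degrees_eq_def)
qed

text \<open>By \<open>prob_degrees_eq\<close> the marks may be taken trivial. The degree event then
  lies in a weak ball around the star law with degrees \<open>al\<close>, where the local upper
  bound applies.\<close>

lemma CM_degrees_upper:
 fixes nu :: "'x::finite pmf" and xi :: "('y::finite * 'y) pmf" assumes r: "r < entropy_cost"
 shows "Ev n. prob (ER_law kp nu xi n) (degrees_eq n) <= decay r n"
proof -
 let ?nu = "return_pmf ()" and ?xi = "return_pmf ((), ())"
 let ?mu = "true_law al ?nu ?xi"
 have "ereal r < ER_rate kp ?nu ?xi ?mu" unfolding ER_rate_true_law[OF kp CM_mean CM_kl] using r by simp
 then obtain F ep where F: "finite F" "ep > 0" and ev: "Ev n.
   prob (star_seq_law n (ER_graph kp n) ?nu ?xi) (seq_ball n F ep ?mu) <= decay r n" using ER_local_upper[OF kp] by blast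
 have pmu: "pmf ?mu a = pmf al (deg a)" for a
 proof -
  have "inj (deg :: (unit, unit) star => nat)" unfolding inj_def using unit_star_eq by blast
  hence "pmf (map_pmf deg ?mu) (deg a) = pmf ?mu a" by (rule pmf_map_inj')
  thus ?thesis by (simp only: map_star_deg_true_law)
 qed
 have "Ev n. ALL a:F. deg a <= M --> \<bar>real (deg_cnt n (deg a)) / real n - pmf al (deg a)\<bar> < ep"
  by (rule eventually_ball_finite[OF F(1)]) (use CM_clim F(2) in \<open>auto simp: tendsto_iff dist_real_def eventually_mono\<close>)
 thus ?thesis using ev eventually_ge_at_top[of 1]
 proof eventually_elim
  case (elim n)
  have ball: "degrees_eq n <= seq_ball n F ep ?mu"
  proof
   fix t :: "nat => (unit, unit) star" assume t: "t : degrees_eq n"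
   have "\<bar>pmf (emp n t) a - pmf ?mu a\<bar> < ep" if a: "a : F" for a
   proof -
    have e: "pmf (emp n t) a = real (card {v : {1..n}. deg (t v) = deg a}) / real n"
     unfolding pmf_empirical[OF elim(3)] by (simp only: unit_star_eq[of _ a])
    show ?thesis
    proof (cases "deg a <= M")
     case True
     thus ?thesis using t unfolding degrees_eq_def using elim(1) a True unfolding e pmu by simp
    next
     case False
     hence "pmf al (deg a) = 0" using CM_alpha by (auto simp: set_pmf_iff)
     moreover have "card {v : {1..n}. deg (t v) = deg a} = 0" by (rule CM_total(3)[OF elim(3) t]) (use False in simp)
     ultimately show ?thesis using F(2) unfolding e pmu by (simp only: of_nat_0 div_0 diff_self abs_zero)
    qed
   qed
   thus "t : seq_ball n F ep ?mu" unfolding seq_ball_def by blast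
  qed
  have "prob (ER_law kp nu xi n) (degrees_eq n) = prob (star_seq_law n (ER_graph kp n) ?nu ?xi) (degrees_eq n)"
   by (simp only: prob_degrees_eq[OF elim(3)])
  also have "... <= prob (star_seq_law n (ER_graph kp n) ?nu ?xi) (seq_ball n F ep ?mu)" by (rule measure_pmf.finite_measure_mono[OF ball]) simp
  finally show ?case using elim(2) by simp
 qed
qed

lemma CM_lower:
 fixes mu :: "('x::finite, 'y::finite) star pmf"
 assumes mu: "map_pmf deg mu = al" and r: "ER_rate kp nu xi mu < ereal (r + entropy_cost)" and F: "finite F" "ep > 0"
 shows "Ev n. decay r n <= prob (star_seq_law n (CM_graph (aln n) n) nu xi) (seq_ball n F ep mu)"
proof -
 have rr: "kl_real mu (poi_law kp nu xi) - col_div kp nu xi (colmean mu) / 2 < r + entropy_cost"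
  and sym: "!!k. colmean mu (rev_col k) = colmean mu k" and sub: "set_pmf mu <= set_pmf (poi_law kp nu xi)"
  using r by (auto simp: ER_rate_def kl_finite_def split: if_splits)
 then obtain de where de: "de > 0" "kl_real mu (poi_law kp nu xi) - col_div kp nu xi (colmean mu) / 2 < r + entropy_cost - de"
  using field_le_epsilon[of "r + entropy_cost" "kl_real mu (poi_law kp nu xi) - col_div kp nu xi (colmean mu) / 2"] by (metis less_diff_eq linorder_not_less add.commute)
 obtain i0 where "i0 : set_pmf al" "i0 ~= 0"
 proof -
  have "EX i:set_pmf al. i ~= 0"
  proof (rule ccontr)
   assume "~ ?thesis"
   hence "(\<integral>\<^sup>+d. of_nat d \<partial>al) = 0" by (simp add: nn_integral_0_iff_AE AE_measure_pmf_iff)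
   thus False using CM_mean kp by simp
  qed
  thus thesis using that by blast
 qed
 hence i0: "1 <= i0" "pmf (map_pmf deg mu) i0 > 0" by (auto simp: mu intro: pmf_positive)
 have M: "deg a <= M" if "a : set_pmf mu" for a using CM_alpha that by (metis mu image_eqI set_map_pmf)
 have cc: "Ev n. (SUM d<=M. deg_cnt n d) = n & even (SUM d<=M. d * deg_cnt n d)"
  using eventually_ge_at_top[of "1::nat"] by eventually_elim (simp only: CM_counts(3,4))
 have "Ev n. decay (r + entropy_cost - de) n <= prob (ER_law kp nu xi n)
  {t : seq_ball n F ep mu. ALL d<=M. card {v : {1..n}. deg (t v) = d} = deg_cnt n d}"
  by (rule ER_lower_bounded_degree[OF kp M i0 sym sub cc _ F de(2)]) (assumption, simp only: mu, rule CM_clim)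
 moreover have "entropy_cost - de < entropy_cost" using de(1) by simp
 note CM_degrees_upper[OF this, of nu xi]
 ultimately show ?thesis using eventually_ge_at_top[of 1]
 proof eventually_elim
  case (elim n)
  have eq: "{t : seq_ball n F ep mu. ALL d<=M. card {v : {1..n}. deg (t v) = d} = deg_cnt n d} = seq_ball n F ep mu \<inter> degrees_eq n"
   unfolding degrees_eq_def by blast
  have "0 < decay (r + entropy_cost - de) n" by simp
  also have "... <= prob (ER_law kp nu xi n) (degrees_eq n)"
   by (rule order_trans[OF elim(1)[unfolded eq]]) (rule measure_pmf.finite_measure_mono, auto)
  finally have pos: "prob (ER_law kp nu xi n) (degrees_eq n) > 0" .
  show ?case using ratio_ge_exp[OF elim(1)[unfolded eq] elim(2) pos] by (simp add: prob_CM[OF elim(3) pos])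
 qed
qed

lemma CM_upper:
 fixes mu :: "('x::finite, 'y::finite) star pmf"
 assumes r: "map_pmf deg mu = al ==> ereal (r + entropy_cost) < ER_rate kp nu xi mu" shows "EX F ep. finite F & ep > 0 & (Ev n.
  prob (star_seq_law n (CM_graph (aln n) n) nu xi) (seq_ball n F ep mu) <= decay r n)"
proof (cases "map_pmf deg mu = al")
 case True
 obtain r' where r': "ereal (r + entropy_cost) < ereal r'" "ereal r' < ER_rate kp nu xi mu" using ereal_dense2[OF r[OF True]] by blast
 obtain F ep where F: "finite F" "ep > 0" and ev: "Ev n. prob (ER_law kp nu xi n) (seq_ball n F ep mu) <= decay r' n"
  using ER_local_upper[OF kp r'(2)] by blast
 have "r' - (r + entropy_cost) > 0" using r'(1) by simp
 from ev CM_degrees_lower[OF this, of nu xi] eventually_ge_at_top[of 1]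
 have "Ev n. prob (star_seq_law n (CM_graph (aln n) n) nu xi) (seq_ball n F ep mu) <= decay r n"
 proof eventually_elim
  case (elim n)
  have "prob (ER_law kp nu xi n) (seq_ball n F ep mu \<inter> degrees_eq n) <= decay r' n"
   by (rule order_trans[OF _ elim(1)]) (rule measure_pmf.finite_measure_mono, auto)
  from ratio_le_exp[OF this elim(2)] show ?case by (simp add: prob_CM[OF elim(3)])
 qed
 thus ?thesis using F by blast
next
 case False
 \<comment> \<open>The finitely many stars of degree \<open>d\<close> determine the mass of that
   degree, so a small ball around \<open>mu\<close> misses the degree event for large n.\<close>
 then obtain d where d: "pmf (map_pmf deg mu) d ~= pmf al d" using pmf_eqI[of "map_pmf deg mu" al] by blast
 define F where "F = {a :: ('x, 'y) star. deg a = d}"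
 have F: "finite F" unfolding F_def by (rule finite_subset[OF _ finite_stars[of d]]) auto
 define g where "g = \<bar>pmf (map_pmf deg mu) d - pmf al d\<bar>"
 have g: "g > 0" using d by (simp add: g_def)
 define ep where "ep = g / 2 / (real (card F) + 1)"
 have ep: "ep > 0" using g by (simp add: ep_def)
 have mud: "pmf (map_pmf deg mu) d = (SUM a:F. pmf mu a)"
 proof -
  have "deg -` {d} = F" by (auto simp: F_def)
  thus ?thesis by (simp add: pmf_map prob_finite_sum[OF F])
 qed
 have "Ev n. \<bar>(if d <= M then real (deg_cnt n d) / real n else 0) - pmf al d\<bar> < g / 2"
 proof (cases "d <= M")
  case True
  have "Ev n. \<bar>real (deg_cnt n d) / real n - pmf al d\<bar> < g / 2"
   by (rule tendstoD[OF CM_clim[OF True], unfolded dist_real_def]) (use g in simp)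
  thus ?thesis using True by simp
 next
  case False
  thus ?thesis using CM_alpha False g by (force simp: set_pmf_iff)
 qed
 hence "Ev n. prob (star_seq_law n (CM_graph (aln n) n) nu xi) (seq_ball n F ep mu) <= decay r n"
  using CM_degrees_lower[OF zero_less_one, of nu xi] eventually_ge_at_top[of 1]
 proof eventually_elim
  case (elim n)
  have pos: "prob (ER_law kp nu xi n) (degrees_eq n) > 0" using elim(2) by (meson exp_gt_zero less_le_trans)
  have "seq_ball n F ep mu \<inter> degrees_eq n = {}"
  proof (rule ccontr)
   assume "~ ?thesis"
   then obtain t where t: "t : seq_ball n F ep mu" "t : degrees_eq n" by blast
   let ?L = "emp n t"
   have "(SUM a:F. pmf ?L a) = real (card {v : {1..n}. deg (t v) = d}) / real n"
    using sum_pmf_empirical[OF elim(3) F, of "%_. 1" t] by (simp add: F_def sum.If_cases Int_def)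
   also have "... = (if d <= M then real (deg_cnt n d) / real n else 0)"
   proof (cases "d <= M")
    case True
    thus ?thesis using t(2) unfolding degrees_eq_def using True by simp
   next
    case False
    thus ?thesis using CM_total(3)[OF elim(3) t(2), of d] by simp
   qed
   finally have L: "(SUM a:F. pmf ?L a) = (if d <= M then real (deg_cnt n d) / real n else 0)" .
   have "\<bar>(SUM a:F. pmf ?L a) - (SUM a:F. pmf mu a)\<bar> <= (SUM a:F. ep)" unfolding sum_subtractf[symmetric]
   proof (rule order_trans[OF sum_abs sum_mono])
    fix a assume "a : F"
    thus "\<bar>pmf ?L a - pmf mu a\<bar> <= ep" using t(1) unfolding seq_ball_def by auto
   qed
   also have "... <= (real (card F) + 1) * ep" using ep by simp
   also have "... = g / 2"
   proof -
    show ?thesis unfolding ep_def by (rule nonzero_mult_div_cancel_left[where b = "g / 2", folded times_divide_eq_right], linarith)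
   qed
   finally show False using elim(1) unfolding L g_def mud by argo
  qed
  thus ?case by (simp add: prob_CM[OF elim(3) pos])
 qed
 thus ?thesis using F ep by blast
qed

lemma CM_tight:
 fixes nu :: "'x::finite pmf" and xi :: "('y::finite * 'y) pmf"
 shows "Ev n. prob (star_seq_law n (CM_graph (aln n) n) nu xi) {t. ~ mean_deg (emp n t) <= ennreal (real M)} <= decay r n"
 using CM_degrees_lower[OF zero_less_one, of nu xi] eventually_ge_at_top[of 1]
proof eventually_elim
 case (elim n)
 have pos: "prob (ER_law kp nu xi n) (degrees_eq n) > 0" using elim(1) by (meson exp_gt_zero less_le_trans)
 have "mean_deg (emp n t) <= ennreal (real M)" if "t : degrees_eq n" for t :: "nat => ('x, 'y) star"
 proof -
  have "real (size (seq_cols n t)) <= real (M * n)" using CM_total(2)[OF elim(2) that] by (simp only: of_nat_le_iff)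
  thus ?thesis unfolding mean_deg_empirical[OF elim(2)] using elim(2) by (intro ennreal_leI) (simp add: divide_le_eq)
 qed
 hence "{t :: nat => ('x, 'y) star. ~ mean_deg (emp n t) <= ennreal (real M)} \<inter> degrees_eq n = {}" by blast
 thus ?case by (simp add: prob_CM[OF elim(2) pos])
qed

end

section \<open>The rate functionals\<close>



lemma satisfies_LDP_nbhd_law:
 fixes nu :: "'x::finite pmf" and xi :: "('y::finite * 'y) pmf" and I :: "('x, 'y) star pmf => ereal"
 assumes lower: "!!mu F ep r. I mu < ereal r ==> finite F ==> ep > 0 ==> Ev n.
   decay r n <= prob (star_seq_law n (g n) nu xi) (seq_ball n F ep mu)" and upper: "!!mu r. ereal r < I mu ==> EX F ep. finite F & ep > 0 & (Ev n.
   prob (star_seq_law n (g n) nu xi) (seq_ball n F ep mu) <= decay r n)" and tight: "!!r. EX B>=0. Ev n. prob (star_seq_law n (g n) nu xi)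
   {t. ~ mean_deg (emp n t) <= ennreal B} <= decay r n" shows "satisfies_LDP weak real (%n. nbhd_law n (g n) nu xi) I"
proof (rule satisfies_LDP_local)
 have prob: "Ev n. ALL S. prob (nbhd_law n (g n) nu xi) S = prob (star_seq_law n (g n) nu xi) {t. emp n t : S}" using eventually_ge_at_top[of 1]
  by eventually_elim (auto simp: nbhd_law_eq_star_seq vimage_def)
 show "Ev n. decay r n <= prob (nbhd_law n (g n) nu xi) U" if U: "openin weak U" "mu : U" and I: "I mu < ereal r" for mu U r
 proof -
  obtain F ep where F: "finite F" "ep > 0" "!!mu'. (!!a. a : F ==> \<bar>pmf mu' a - pmf mu a\<bar> < ep) ==> mu' : U" using weak_nbhd[OF U] by metis
  have "Ev n. decay r n <= prob (star_seq_law n (g n) nu xi) (seq_ball n F ep mu)" by (rule lower[OF I F(1,2)])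
  with prob show ?thesis
  proof eventually_elim
   case (elim n)
   have "seq_ball n F ep mu <= {t. emp n t : U}" unfolding seq_ball_def using F(3) by blast
   thus ?case using elim(2) measure_pmf.finite_measure_mono[of "seq_ball n F ep mu" "{t. emp n t : U}" "star_seq_law n (g n) nu xi"]
    by (auto simp: elim(1)[rule_format])
  qed
 qed
 show "EX U. openin weak U & mu : U & (Ev n. prob (nbhd_law n (g n) nu xi) U <= decay r n)" if I: "ereal r < I mu" for mu r
 proof -
  obtain F ep where F: "finite F" "ep > 0" and ev: "Ev n.
    prob (star_seq_law n (g n) nu xi) (seq_ball n F ep mu) <= decay r n" using upper[OF I] by blast
  let ?U = "{mu'. ALL a:F. \<bar>pmf mu' a - pmf mu a\<bar> < ep}"
  have "Ev n. prob (nbhd_law n (g n) nu xi) ?U <= decay r n" using prob ev by eventually_elim (simp add: seq_ball_def)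
  thus ?thesis using openin_weak_ball[OF F(1), of mu ep] F(2) by auto
 qed
 show "EX K. compactin weak K & closedin weak K & (Ev n. prob (nbhd_law n (g n) nu xi) (- K) <= decay r n)" for r
 proof -
  obtain B where B: "B >= 0" and ev: "Ev n. prob (star_seq_law n (g n) nu xi)
   {t. ~ mean_deg (emp n t) <= ennreal B} <= decay r n" using tight[of r] by blast
  let ?K = "{mu :: ('x, 'y) star pmf. mean_deg mu <= ennreal B}"
  have "Ev n. prob (nbhd_law n (g n) nu xi) (- ?K) <= decay r n" using prob ev by eventually_elim simp
  thus ?thesis using compactin_mean_deg[OF B] closedin_mean_deg[of B] by blast
 qed
qed

text \<open>Size-biasing weights a star by its degree and the uniform choice of a child divides by
  it, so the law of child and root is the normalized colour mean.\<close>

lemma pmf_child_root_law: assumes be: "mean_deg mu = ennreal be" "be > 0"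
 shows "pmf (child_root_law mu) ((x, y), (x', y')) = colmean mu (x', x, y, y') / be"
proof -
 let ?k = "(x', x, y, y')"
 have m: "0 < mean_deg mu" "mean_deg mu < \<infinity>" "enn2real (mean_deg mu) = be" using be by auto
 have inner: "pmf (pmf_of_multiset (snd ta) \<bind> (%(x, y, y'). return_pmf ((x, y), (fst ta, y')))) ((x, y), (x', y'))
   = real (count (cols ta) ?k) / real (deg ta)" if "deg ta > 0" for ta :: "('a, 'b) star"
 proof -
  have ne: "snd ta ~= {#}" using that by (auto simp: star_deg_def)
  let ?f = "%(x, y, y'). ((x, y), (fst ta, y'))"
  have inj: "inj ?f" by (auto simp: inj_on_def)
  have "pmf_of_multiset (snd ta) \<bind> (%(x, y, y'). return_pmf ((x, y), (fst ta, y'))) = map_pmf ?f (pmf_of_multiset (snd ta))"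
   by (simp add: map_pmf_def case_prod_unfold)
  also have "pmf ... ((x, y), (x', y')) = (if fst ta = x' then real (count (snd ta) (x, y, y')) / real (deg ta) else 0)"
  proof (cases "fst ta = x'")
   case True
   thus ?thesis using pmf_map_inj'[OF inj, of "pmf_of_multiset (snd ta)" "(x, y, y')"] ne by (simp add: star_deg_def)
  next
   case False
   hence "((x, y), (x', y')) ~: set_pmf (map_pmf ?f (pmf_of_multiset (snd ta)))" by auto
   thus ?thesis using False unfolding pmf_eq_0_set_pmf[symmetric] by simp
  qed
  also have "(if fst ta = x' then real (count (snd ta) (x, y, y')) / real (deg ta) else 0) = real (count (cols ta) ?k) / real (deg ta)"
  proof (cases "fst ta = x'")
   case True
   have "count (image_mset (Pair (fst ta)) (snd ta)) (Pair (fst ta) (x, y, y')) = count (snd ta) (x, y, y')"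
    by (rule count_image_mset_inj) (auto simp: inj_on_def)
   thus ?thesis using True by (simp add: cols_def)
  qed (auto simp: cols_def count_eq_zero_iff)
  finally show ?thesis .
 qed
 have "ennreal (pmf (child_root_law mu) ((x, y), (x', y')))
   = (\<integral>\<^sup>+ta. ennreal (pmf (pmf_of_multiset (snd ta) \<bind> (%(x, y, y'). return_pmf ((x, y), (fst ta, y')))) ((x, y), (x', y'))) \<partial>size_biased mu)"
  unfolding child_root_law_def by (rule ennreal_pmf_bind)
 also have "... = (\<integral>\<^sup>+ta. ennreal (pmf mu ta * (real (deg ta) / be))
   * ennreal (pmf (pmf_of_multiset (snd ta) \<bind> (%(x, y, y'). return_pmf ((x, y), (fst ta, y')))) ((x, y), (x', y'))) \<partial>count_space UNIV)"
  by (simp add: nn_integral_measure_pmf pmf_size_biased[OF m(1,2)] m(3))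
 also have "... = (\<integral>\<^sup>+ta. ennreal (pmf mu ta) * ennreal (real (count (cols ta) ?k) / be) \<partial>count_space UNIV)"
 proof (rule nn_integral_cong)
  fix ta :: "('a, 'b) star"
  show "ennreal (pmf mu ta * (real (deg ta) / be))
   * ennreal (pmf (pmf_of_multiset (snd ta) \<bind> (%(x, y, y'). return_pmf ((x, y), (fst ta, y')))) ((x, y), (x', y')))
   = ennreal (pmf mu ta) * ennreal (real (count (cols ta) ?k) / be)"
  proof (cases "deg ta = 0")
   case True
   thus ?thesis using count_cols_le[of ta ?k] by simp
  next
   case False
   thus ?thesis using be(2) by (simp add: inner ennreal_mult[symmetric])
  qed
 qed
 also have "... = (\<integral>\<^sup>+ta. ennreal (real (count (cols ta) ?k) / be) \<partial>mu)" by (simp add: nn_integral_measure_pmf)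
 also have "... = ennreal (expect mu (%ta. real (count (cols ta) ?k) / be))"
  by (rule nn_integral_eq_integral) (use integrable_count_cols[OF m(2)] be in auto)
 finally show ?thesis using be(2) by (simp add: colmean_def)
qed

lemma child_root_law_symmetric_iff: assumes be: "mean_deg mu = ennreal be" "be > 0"
 shows "map_pmf prod.swap (child_root_law mu) = child_root_law mu <-> (ALL k. colmean mu (rev_col k) = colmean mu k)"
proof -
 have swap: "pmf (map_pmf prod.swap (child_root_law mu)) (a, b) = pmf (child_root_law mu) (b, a)" for a b
  using pmf_map_inj'[OF inj_swap, of "child_root_law mu" "(b, a)"] by simp
 have "map_pmf prod.swap (child_root_law mu) = child_root_law mu
   <-> (ALL x y x' y'. pmf (child_root_law mu) ((x', y'), (x, y)) = pmf (child_root_law mu) ((x, y), (x', y')))"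
  unfolding pmf_eq_iff split_paired_All swap by simp
 thus ?thesis using be(2) unfolding split_paired_All rev_col.simps by (auto simp: pmf_child_root_law[OF be])
qed

text \<open>A density that is a product over the colours of a star has a logarithm whose integral is
  a sum against the colour means; both \<open>check_law\<close> and \<open>hat_law\<close> are of
  this kind.\<close>

lemma rel_entropy_density_cols:
 fixes mu :: "('x::finite, 'y::finite) star pmf" assumes fin: "mean_deg mu < \<infinity>" and sub: "set_pmf mu <= set_pmf et"
  and h: "!!ta k. ta : set_pmf mu ==> k :# cols ta ==> h k > 0"
 shows "rel_entropy (measure_pmf mu) (density (measure_pmf et) (%ta. ennreal (PROD k:#cols ta. h k)))
  = (if kl_finite mu et then ereal (kl_real mu et - (SUM k:UNIV. colmean mu k * ln (h k))) else \<infinity>)"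
proof -
 let ?f = "%ta. PROD k:#cols ta. h k" and ?s = "%ta. SUM k:#cols ta. ln (h k)"
 have pos: "(PROD k:#T. h k) > 0 & ln (PROD k:#T. h k) = (SUM k:#T. ln (h k))" if "!!k. k :# T ==> h k > 0" for T using that
 proof (induction T)
  case (add k T)
  have "h k > 0" by (rule add.prems) simp
  moreover have "(PROD k:#T. h k) > 0 & ln (PROD k:#T. h k) = (SUM k:#T. ln (h k))" by (rule add.IH, rule add.prems) simp
  ultimately show ?case unfolding image_mset_add_mset prod_mset.add_mset sum_mset.add_mset by (metis ln_mult_pos mult_pos_pos)
 qed simp
 have f: "?f ta > 0" "ln (?f ta) = ?s ta" if "ta : set_pmf mu" for ta using pos h[OF that] by blast+
 have split: "a > 0 ==> b > 0 ==> c > 0 ==> ln (a / (b * c)) = ln (a / b) - ln c" for a b c :: real by (simp add: ln_div ln_mult)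
 have eq: "AE ta in mu. ln (pmf mu ta / (pmf et ta * ?f ta)) = ln (pmf mu ta / pmf et ta) - ?s ta" unfolding AE_measure_pmf_iff
 proof
  fix ta assume ta: "ta : set_pmf mu"
  hence "pmf mu ta > 0" "pmf et ta > 0" using sub by (auto simp: pmf_positive)
  thus "ln (pmf mu ta / (pmf et ta * ?f ta)) = ln (pmf mu ta / pmf et ta) - ?s ta" unfolding f(2)[OF ta, symmetric] using f(1)[OF ta] by (rule split)
 qed
 note S = expectation_sum_cols[OF fin, of "%k. ln (h k)"]
 have int: "integrable mu (%ta. ln (pmf mu ta / (pmf et ta * ?f ta))) <-> kl_finite mu et"
 proof -
  have "integrable mu (%ta. ln (pmf mu ta / (pmf et ta * ?f ta))) <-> integrable mu (%ta. ln (pmf mu ta / pmf et ta) - ?s ta)"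
   by (rule integrable_cong_AE) (use eq in auto)
  thus ?thesis using S(1) Bochner_Integration.integrable_add[OF _ S(1), of "%ta. ln (pmf mu ta / pmf et ta) - ?s ta"] sub by (auto simp: kl_finite_def)
 qed
 have ex: "expect mu (%ta. ln (pmf mu ta / (pmf et ta * ?f ta))) = kl_real mu et - (SUM k:UNIV. colmean mu k * ln (h k))" if "kl_finite mu et"
 proof -
  have "expect mu (%ta. ln (pmf mu ta / (pmf et ta * ?f ta))) = expect mu (%ta. ln (pmf mu ta / pmf et ta) - ?s ta)"
   by (rule integral_cong_AE) (use eq in auto)
  thus ?thesis using that S(1) by (simp add: kl_finite_def kl_real_def S(2))
 qed
 show ?thesis using rel_entropy_density[of mu ?f et, OF f(1) sub] int ex by simp
qed

text \<open>By symmetry the law of the conditioning value, the second marginal, is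
  \<open>child_law mu\<close>.\<close>

lemma pmf_child_cond_law:
 fixes mu :: "('x::finite, 'y::finite) star pmf"
 assumes sym: "map_pmf prod.swap (child_root_law mu) = child_root_law mu" and pos: "pmf (child_root_law mu) (a, b) > 0"
 shows "pmf (child_cond_law mu b) a = pmf (child_root_law mu) (a, b) / pmf (child_law mu) b" and "b : snd ` set_pmf (child_root_law mu)"
  and "pmf (child_law mu) b > 0"
proof -
 let ?J = "child_root_law mu"
 have ab: "(a, b) : set_pmf ?J" using pos by (simp add: set_pmf_iff)
 show b: "b : snd ` set_pmf ?J" using ab by force
 have ne: "set_pmf ?J \<inter> {z. snd z = b} ~= {}" using ab by auto
 have snd: "prob ?J {z. snd z = b} = pmf (child_law mu) b"
 proof -
  have "map_pmf fst (map_pmf prod.swap ?J) = map_pmf snd ?J" by (simp add: pmf.map_comp o_def)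
  thus ?thesis unfolding child_law_def using sym by (simp add: pmf_map vimage_def)
 qed
 have "pmf (child_cond_law mu b) a = prob (cond_pmf ?J {z. snd z = b}) (fst -` {a})" by (simp add: child_cond_law_def pmf_map)
 also have "... = prob (cond_pmf ?J {z. snd z = b}) {(a, b)}"
  by (rule measure_pmf.finite_measure_eq_AE) (auto simp: AE_measure_pmf_iff set_cond_pmf[OF ne])
 also have "... = pmf ?J (a, b) / pmf (child_law mu) b" by (simp add: measure_pmf_single pmf_cond[OF ne] snd)
 finally show "pmf (child_cond_law mu b) a = pmf ?J (a, b) / pmf (child_law mu) b" .
 show "pmf (child_law mu) b > 0" unfolding snd[symmetric] using measure_pmf_posI[of b "map_pmf snd ?J" "{b}"] b by (auto simp: vimage_def)
qed

text \<open>In the sum of the two entropies the one-point marginals of the child-root law cancel by symmetry.\<close>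

lemma rate_functional_eq:
 fixes mu :: "('x::finite, 'y::finite) star pmf" assumes be: "mean_deg mu = ennreal be" "be > 0" and q: "mean_deg (true_law q nu xi) = ennreal be"
 shows "rate_functional nu be (true_law q nu xi) mu = (if (ALL k. colmean mu (rev_col k) = colmean mu k) & kl_finite mu (true_law q nu xi)
   then ereal (kl_real mu (true_law q nu xi) - (SUM k:UNIV. colmean mu k * ln (colmean mu k / (be * edge_wt nu xi k))) / 2) else \<infinity>)"
proof (cases "(ALL k. colmean mu (rev_col k) = colmean mu k) & set_pmf mu <= set_pmf (true_law q nu xi)")
 case False
 thus ?thesis using be by (auto simp: rate_functional_def child_root_law_symmetric_iff[OF be] absolutely_continuous_pmf_iff kl_finite_def)
next
 case True
 define et where "et = true_law q nu xi"
 have sym: "!!k. colmean mu (rev_col k) = colmean mu k" and sub: "set_pmf mu <= set_pmf et" using True by (auto simp: et_def)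
 note q = q[folded et_def]
 have fin: "mean_deg mu < \<infinity>" using be by simp
 have w: "colmean et k = be * edge_wt nu xi k" for k unfolding et_def by (rule colmean_true_law) (use q be in \<open>auto simp: et_def\<close>)
 have symJ: "map_pmf prod.swap (child_root_law mu) = child_root_law mu" using child_root_law_symmetric_iff[OF be] sym by blast
 have symJ': "map_pmf prod.swap (child_root_law et) = child_root_law et" using child_root_law_symmetric_iff[OF q be(2)] w by simp
 note J = pmf_child_root_law[OF be] and J' = pmf_child_root_law[OF q be(2)]
 define u where "u a = pmf (child_law mu) a / pmf (child_law et) a" for a
 define F where "F k = u (fst (snd k), fst (snd (snd k)))" for k :: "'x * 'x * 'y * 'y"
 define G where "G k = pmf (child_cond_version et mu (fst k, snd (snd (snd k)))) (fst (snd k), fst (snd (snd k)))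
   / pmf (child_cond_law et (fst k, snd (snd (snd k)))) (fst (snd k), fst (snd (snd k)))" for k :: "'x * 'x * 'y * 'y"
 have check: "check_law et mu = density et (%ta. ennreal (PROD k:#cols ta. F k))" unfolding check_law_def cols_def
  by (intro arg_cong[where f = "density _"] ext arg_cong[where f = ennreal] arg_cong[where f = prod_mset])
   (auto simp: F_def u_def case_prod_unfold image_mset.compositionality comp_def)
 have hat: "hat_law et mu = density et (%ta. ennreal (PROD k:#cols ta. G k))" unfolding hat_law_def cols_def
  by (intro arg_cong[where f = "density _"] ext arg_cong[where f = ennreal] arg_cong[where f = prod_mset])
   (auto simp: G_def case_prod_unfold image_mset.compositionality comp_def)
 have cpos: "colmean nu' k > 0" if ta: "ta : set_pmf nu'" "k :# cols ta" and "mean_deg nu' < \<infinity>" for ta k and nu' :: "('x, 'y) star pmf"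
 proof -
  have "colmean nu' k ~= 0"
  proof
   assume "colmean nu' k = 0"
   hence "AE ta in nu'. real (count (cols ta) k) = 0"
    unfolding colmean_def using integrable_count_cols[OF that(3)] by (subst (asm) integral_nonneg_eq_0_iff_AE) auto
   thus False using ta by (force simp: AE_measure_pmf_iff count_eq_zero_iff)
  qed
  thus ?thesis using colmean_nonneg[of nu' k] by linarith
 qed
 have supp: "colmean et k > 0" if "colmean mu k > 0" for k
 proof -
  have "EX ta:set_pmf mu. k :# cols ta"
  proof (rule ccontr)
   assume "~ (EX ta:set_pmf mu. k :# cols ta)"
   hence "colmean mu k = expect mu (%_. 0)" unfolding colmean_def by (intro integral_cong_AE) (auto simp: AE_measure_pmf_iff count_eq_zero_iff)
   thus False using that by simp
  qed
  thus ?thesis using cpos[of _ et k] sub q by auto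
 qed
 \<comment> \<open>\<open>u\<close> is the ratio of the child marginals. The conditional ratio is
   the joint one, a ratio of colour means, divided by the marginal ratio at the conditioning
   value.\<close>
 have main: "u (x', y') > 0 & u (x, y) > 0 & F (x, x', y', y) = u (x', y')
   & G (x, x', y', y) = colmean mu (x, x', y', y) / (be * edge_wt nu xi (x, x', y', y)) / u (x, y)"
  if k: "colmean mu (x, x', y', y) > 0" for x x' y' y
 proof -
  have c: "colmean mu (x', x, y, y') > 0" using k sym[of "(x, x', y', y)"] by simp
  have pos: "pmf (child_root_law mu) ((x', y'), (x, y)) > 0" "pmf (child_root_law mu) ((x, y), (x', y')) > 0"
   "pmf (child_root_law et) ((x', y'), (x, y)) > 0" "pmf (child_root_law et) ((x, y), (x', y')) > 0"
   using k c supp[OF k] supp[OF c] be(2) by (simp_all add: J J')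
  note M = pmf_child_cond_law[OF symJ pos(1)] pmf_child_cond_law[OF symJ pos(2)]
  note E = pmf_child_cond_law[OF symJ' pos(3)] pmf_child_cond_law[OF symJ' pos(4)]
  show ?thesis using M(2) be(2) M(3,6) E(3,6) by (simp add: G_def child_cond_version_def M(1) E(1) J J' u_def F_def w)
 qed
 have FG: "F k > 0" "G k > 0"
  "ln (F k) + ln (G k) = ln (u (fst (snd k), fst (snd (snd k)))) - ln (u (fst k, snd (snd (snd k)))) + ln (colmean mu k / (be * edge_wt nu xi k))"
  if k: "colmean mu k > 0" for k
 proof -
  obtain x x' y' y where kk: "k = (x, x', y', y)" by (cases k)
  have wk: "be * edge_wt nu xi k > 0" using supp[OF k] by (simp add: w)
  note m = main[of x x' y' y, folded kk, OF k]
  show "F k > 0" "G k > 0" using m k wk by simp_all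
  have "ln (G k) = ln (colmean mu k / (be * edge_wt nu xi k)) - ln (u (x, y))"
  proof -
   have "a > 0 ==> b > 0 ==> ln (a / b) = ln a - ln b" for a b :: real by (simp add: ln_div)
   from this[OF divide_pos_pos[OF k wk], of "u (x, y)"] show ?thesis using m by metis
  qed
  thus "ln (F k) + ln (G k) = ln (u (fst (snd k), fst (snd (snd k)))) - ln (u (fst k, snd (snd (snd k))))
   + ln (colmean mu k / (be * edge_wt nu xi k))" using m kk by simp
 qed
 have bij: "bij rev_col" by (rule o_bij[of rev_col]) (auto simp: fun_eq_iff)
 \<comment> \<open>Reversal exchanges the child end and the root end of a colour and preserves the
   colour means.\<close>
 have cancel: "(SUM k:UNIV. colmean mu k * ln (u (fst (snd k), fst (snd (snd k))))) = (SUM k:UNIV. colmean mu k * ln (u (fst k, snd (snd (snd k)))))"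
 proof -
  have "(SUM k:UNIV. colmean mu k * ln (u (fst (snd k), fst (snd (snd k)))))
    = (SUM k:UNIV. colmean mu (rev_col k) * ln (u (fst (snd (rev_col k)), fst (snd (snd (rev_col k))))))"
   using sum.reindex_bij_betw[OF bij, of "%k. colmean mu k * ln (u (fst (snd k), fst (snd (snd k))))"] by simp
  also have "... = (SUM k:UNIV. colmean mu k * ln (u (fst k, snd (snd (snd k)))))" by (rule sum.cong) (auto simp: sym simp del: rev_col.simps, auto)
  finally show ?thesis .
 qed
 have "(SUM k:UNIV. colmean mu k * ln (F k)) + (SUM k:UNIV. colmean mu k * ln (G k))
   = (SUM k:UNIV. colmean mu k * (ln (u (fst (snd k), fst (snd (snd k)))) - ln (u (fst k, snd (snd (snd k))))
   + ln (colmean mu k / (be * edge_wt nu xi k))))" unfolding sum.distrib[symmetric]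
 proof (rule sum.cong)
  fix k
  show "colmean mu k * ln (F k) + colmean mu k * ln (G k) = colmean mu k * (ln (u (fst (snd k), fst (snd (snd k)))) - ln (u (fst k, snd (snd (snd k))))
   + ln (colmean mu k / (be * edge_wt nu xi k)))"
   using FG(3)[of k] colmean_nonneg[of mu k] by (cases "colmean mu k = 0") (auto simp: distrib_left[symmetric])
 qed simp
 also have "... = (SUM k:UNIV. colmean mu k * ln (colmean mu k / (be * edge_wt nu xi k)))"
  using cancel by (simp add: distrib_left right_diff_distrib sum.distrib sum_subtractf)
 finally have sum: "(SUM k:UNIV. colmean mu k * ln (F k)) + (SUM k:UNIV. colmean mu k * ln (G k)) = ..." .
 have e: "rel_entropy mu (check_law et mu) = (if kl_finite mu et then ereal (kl_real mu et - (SUM k:UNIV. colmean mu k * ln (F k))) else \<infinity>)"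
  "rel_entropy mu (hat_law et mu) = (if kl_finite mu et then ereal (kl_real mu et - (SUM k:UNIV. colmean mu k * ln (G k))) else \<infinity>)"
  unfolding check hat
  by (rule rel_entropy_density_cols[OF fin sub FG(1)[OF cpos[OF _ _ fin]]] rel_entropy_density_cols[OF fin sub FG(2)[OF cpos[OF _ _ fin]]]; assumption)+
 have "rate_functional nu be et mu = (rel_entropy mu (check_law et mu) + rel_entropy mu (hat_law et mu)) / 2"
  using be symJ sub by (simp add: rate_functional_def absolutely_continuous_pmf_iff)
 also have "... = (if kl_finite mu et then ereal (kl_real mu et - (SUM k:UNIV. colmean mu k * ln (colmean mu k / (be * edge_wt nu xi k))) / 2) else \<infinity>)"
  unfolding e sum[symmetric] by (simp add: field_simps)
 finally show ?thesis using sym unfolding et_def by simp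
qed

text \<open>The reference laws differ only through the degree, so exchanging them adds the integral
  of the log-ratio of degree probabilities.\<close>

lemma kl_true_law_change: assumes pos: "!!ta. ta : set_pmf mu ==> pmf p (deg ta) > 0 & pmf q (deg ta) > 0"
  and int: "integrable (measure_pmf mu) (%ta. ln (pmf q (deg ta) / pmf p (deg ta)))"
 shows "kl_finite mu (true_law q nu xi) <-> kl_finite mu (true_law p nu xi)"
  and "kl_finite mu (true_law p nu xi) ==> kl_real mu (true_law p nu xi) = kl_real mu (true_law q nu xi)
   + expect mu (%ta. ln (pmf q (deg ta) / pmf p (deg ta)))"
proof -
 let ?q = "true_law q nu xi" and ?p = "true_law p nu xi"
 let ?g = "%ta. ln (pmf q (deg ta) / pmf p (deg ta))"
 have ratio: "pmf ?q ta = pmf ?p ta * (pmf q (deg ta) / pmf p (deg ta))" if "ta : set_pmf mu" for ta using pos[OF that] by (simp add: pmf_true_law)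
 have sub: "set_pmf mu <= set_pmf ?q <-> set_pmf mu <= set_pmf ?p"
 proof -
  have "ta : set_pmf ?q <-> ta : set_pmf ?p" if "ta : set_pmf mu" for ta unfolding set_pmf_iff ratio[OF that] using pos[OF that] by simp
  thus ?thesis by blast
 qed
 have eq: "AE ta in mu. ln (pmf mu ta / pmf ?p ta) = ln (pmf mu ta / pmf ?q ta) + ?g ta" if "set_pmf mu <= set_pmf ?p" unfolding AE_measure_pmf_iff
 proof
  fix ta assume ta: "ta : set_pmf mu"
  have split: "ln (a / b) = ln (a / (b * c)) + ln c" if "a > 0" "b > 0" "c > 0" for a b c :: real using that by (simp add: ln_div ln_mult)
  thus "ln (pmf mu ta / pmf ?p ta) = ln (pmf mu ta / pmf ?q ta) + ?g ta"
   unfolding ratio[OF ta] using ta that pos[OF ta] by (intro split) (auto simp: pmf_positive)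
 qed
 have fin: "integrable mu (%ta. ln (pmf mu ta / pmf ?p ta)) <-> integrable mu (%ta. ln (pmf mu ta / pmf ?q ta))" if "set_pmf mu <= set_pmf ?p"
 proof -
  have "integrable mu (%ta. ln (pmf mu ta / pmf ?p ta)) <-> integrable mu (%ta. ln (pmf mu ta / pmf ?q ta) + ?g ta)"
   by (rule integrable_cong_AE) (use eq[OF that] in auto)
  thus ?thesis using int Bochner_Integration.integrable_diff[OF _ int, of "%ta. ln (pmf mu ta / pmf ?q ta) + ?g ta"] by auto
 qed
 show iff: "kl_finite mu ?q <-> kl_finite mu ?p" using fin sub by (auto simp: kl_finite_def)
 assume kl: "kl_finite mu ?p"
 have "kl_real mu ?p = expect mu (%ta. ln (pmf mu ta / pmf ?q ta) + ?g ta)"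
  unfolding kl_real_def using eq kl by (intro integral_cong_AE) (auto simp: kl_finite_def)
 thus "kl_real mu ?p = kl_real mu ?q + expect mu ?g" using kl int iff by (simp add: kl_finite_def kl_real_def)
qed

section \<open>Identification of the three rates\<close>

lemma edge_cost_eq: "kp > 0 ==> 2 * edge_cost kp be = be * ln (be / kp) - be + kp" by (simp add: edge_cost_def field_simps)

text \<open>The divergence splits into that of the normalized colours and that of the total masses
  \<open>be\<close> and \<open>kp\<close>; the latter is twice the edge cost.\<close>

lemma col_div_eq:
 fixes mu :: "('x::finite, 'y::finite) star pmf"
 assumes kp: "kp > 0" and be: "mean_deg mu = ennreal be" "be > 0" and sub: "set_pmf mu <= set_pmf (poi_law kp nu xi)"
 shows "col_div kp nu xi (colmean mu) = (SUM k:UNIV. colmean mu k * ln (colmean mu k / (be * edge_wt nu xi k))) + 2 * edge_cost kp be"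
proof -
 have sum: "(SUM k:UNIV. colmean mu k) = be" using mean_deg_colmean[of mu] be by (simp add: sum_nonneg)
 have "col_div kp nu xi (colmean mu) = (SUM k:UNIV. colmean mu k * ln (colmean mu k / (kp * edge_wt nu xi k)) - colmean mu k) + kp"
  unfolding col_div_def by (intro arg_cong[where f = "%x. x + kp"] sum.mono_neutral_left) (auto simp: colmean_supported[OF kp sub])
 also have "(SUM k:UNIV. colmean mu k * ln (colmean mu k / (kp * edge_wt nu xi k)) - colmean mu k)
   = (SUM k:UNIV. colmean mu k * ln (colmean mu k / (be * edge_wt nu xi k)) + (ln (be / kp) - 1) * colmean mu k)"
 proof (rule sum.cong)
  fix k
  have "ln (colmean mu k / (kp * edge_wt nu xi k)) = ln (colmean mu k / (be * edge_wt nu xi k)) + ln (be / kp)" if "colmean mu k ~= 0"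
  proof -
   have "edge_wt nu xi k > 0" using colmean_supported[OF kp sub] that by (simp add: pcols_def, blast)
   moreover have "colmean mu k > 0" using that colmean_nonneg[of mu k] by linarith
   ultimately show ?thesis using kp be(2) by (simp add: ln_div ln_mult)
  qed
  thus "colmean mu k * ln (colmean mu k / (kp * edge_wt nu xi k)) - colmean mu k
    = colmean mu k * ln (colmean mu k / (be * edge_wt nu xi k)) + (ln (be / kp) - 1) * colmean mu k"
   by (cases "colmean mu k = 0") (auto simp: algebra_simps)
 qed simp
 also have "... = (SUM k:UNIV. colmean mu k * ln (colmean mu k / (be * edge_wt nu xi k))) + (ln (be / kp) - 1) * be"
  by (simp add: sum.distrib sum_distrib_left[symmetric] sum)
 finally show ?thesis using edge_cost_eq[OF kp, of be] by (simp add: algebra_simps)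
qed

text \<open>Passing from Poisson mean \<open>be\<close> to \<open>kp\<close> raises the entropy by
  twice the edge cost and half the divergence by once the edge cost, so a single edge cost is left.
  Laws without edges are treated apart: there an entropy term \<open>kp\<close> and half the
  divergence, kp / 2, leave the edge cost of 0.\<close>

lemma rate_ER_eq:
 fixes mu :: "('x::finite, 'y::finite) star pmf" assumes kp: "kp > 0" shows "rate_ER kp nu xi mu = ER_rate kp nu xi mu"
proof (cases "mean_deg mu < \<infinity>")
 case False
 thus ?thesis by (simp add: rate_ER_def ER_rate_def)
next
 case fin: True
 define be where "be = enn2real (mean_deg mu)"
 have be: "mean_deg mu = ennreal be" "be >= 0" using fin by (auto simp: be_def less_top)
 have rate: "rate_ER kp nu xi mu = ereal (edge_cost kp be) + rate_functional nu be (true_law (Poi be) nu xi) mu"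
  using fin by (simp add: rate_ER_def be_def Let_def)
 show ?thesis
 proof (cases "be = 0")
  case True
  define m where "m = map_pmf fst mu"
  have z: "ALL ta:set_pmf mu. snd ta = {#}" using mean_deg_zero[of mu] True be by (simp add: star_deg_def)
  have mu: "mu = map_pmf (%x. (x, {#})) m"
  proof -
   have "map_pmf (%ta. (fst ta, {#})) mu = map_pmf id mu" by (rule map_pmf_cong) (use z in \<open>auto simp: prod_eq_iff\<close>)
   thus ?thesis by (simp add: m_def pmf.map_comp o_def)
  qed
  have col0: "colmean mu k = 0" for k by (simp add: colmean_def mu cols_def)
  have inj: "inj (%x :: 'x. (x, {#} :: ('x * 'y * 'y) multiset))" by (simp add: inj_on_def)
  have p: "pmf mu (x, {#}) = pmf m x" for x unfolding mu by (rule pmf_map_inj'[OF inj])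
  have e: "pmf (poi_law kp nu xi) (x, {#}) = exp (- kp) * pmf nu x" for x using kp by (simp add: pmf_true_law_Poi)
  have klf: "kl_finite mu (poi_law kp nu xi) <-> kl_finite m nu"
  proof -
   have "integrable (measure_pmf m) f" for f :: "'x => real" by (rule integrable_measure_pmf_finite) simp
   moreover have "integrable (measure_pmf mu) f" for f :: "('x, 'y) star => real" by (rule integrable_measure_pmf_finite) (simp add: mu)
   ultimately show ?thesis unfolding mu by (auto simp: set_true_law_Poi[OF kp] pmf_positive_iff kl_finite_def)
  qed
  have kl: "kl_real mu (poi_law kp nu xi) = kl_real m nu + kp" if "kl_finite m nu"
  proof -
   have "kl_real mu (poi_law kp nu xi) = expect m (%x. ln (pmf mu (x, {#}) / pmf (poi_law kp nu xi) (x, {#})))"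
    unfolding kl_real_def by (subst mu) (simp only: integral_map_pmf)
   also have "... = expect m (%x. ln (pmf m x / pmf nu x) + kp)"
   proof (rule integral_cong_AE)
    have "ln (pmf m x / (exp (- kp) * pmf nu x)) = ln (pmf m x / pmf nu x) + kp" if "x : set_pmf m" for x
    proof -
     have "pmf m x > 0" "pmf nu x > 0" using that \<open>kl_finite m nu\<close> by (auto simp: kl_finite_def pmf_positive)
     thus ?thesis by (simp add: ln_div ln_mult)
    qed
    thus "AE x in m. ln (pmf mu (x, {#}) / pmf (poi_law kp nu xi) (x, {#})) = ln (pmf m x / pmf nu x) + kp" by (auto simp: AE_measure_pmf_iff p e)
   qed auto
   also have "... = kl_real m nu + kp" using that by (simp add: kl_real_def kl_finite_def)
   finally show ?thesis .
  qed
  show ?thesis unfolding rate using True be kl fin kp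
   by (simp add: rate_functional_def rel_entropy_pmf m_def[symmetric] ER_rate_def col0 klf col_div_def edge_cost_def)
 next
  case False
  hence be0: "be > 0" using be by simp
  let ?g = "%ta :: ('x, 'y) star. ln (pmf (Poi be) (deg ta) / pmf (Poi kp) (deg ta))"
  have g: "?g ta = real (deg ta) * ln (be / kp) + (kp - be)" for ta
  proof -
   have "pmf (Poi be) (deg ta) / pmf (Poi kp) (deg ta) = (be / kp) ^ deg ta * exp (kp - be)"
    using kp be0 by (simp add: pmf_Poi field_simps power_divide exp_diff exp_minus)
   thus ?thesis using kp be0 by (simp add: ln_mult ln_realpow)
  qed
  have int: "integrable mu ?g" unfolding g using integrable_star_deg[OF fin] by simp
  have ex: "expect mu ?g = 2 * edge_cost kp be"
  proof -
   show ?thesis using mean_deg_expectation[OF fin] be unfolding g using integrable_star_deg[OF fin] by (simp add: edge_cost_eq[OF kp])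
  qed
  have pos: "pmf (Poi kp) (deg ta) > 0 & pmf (Poi be) (deg ta) > 0" for ta :: "('x, 'y) star" using kp be0 by (simp add: pmf_Poi)
  note kl = kl_true_law_change[of mu "Poi kp" "Poi be", OF pos int, where nu = nu and xi = xi]
  have m: "mean_deg (true_law (Poi be) nu xi) = ennreal be" by (simp add: mean_deg_true_law mean_Poi[OF be0])
  show ?thesis
  proof (cases "(ALL k. colmean mu (rev_col k) = colmean mu k) & kl_finite mu (poi_law kp nu xi)")
   case True
   hence "set_pmf mu <= set_pmf (poi_law kp nu xi)" by (simp add: kl_finite_def)
   note cd = col_div_eq[OF kp be(1) be0 this]
   show ?thesis unfolding rate rate_functional_eq[OF be(1) be0 m] ER_rate_def cd using True fin kl ex by simp argo
  next
   case F: False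
   thus ?thesis unfolding rate rate_functional_eq[OF be(1) be0 m] ER_rate_def using kl(1) by auto
  qed
 qed
qed

lemma rate_FE_eq:
 fixes mu :: "('x::finite, 'y::finite) star pmf" assumes kp: "kp > 0"
 shows "rate_FE kp nu xi mu = (if mean_deg mu = ennreal kp then ER_rate kp nu xi mu else \<infinity>)"
proof (cases "mean_deg mu = ennreal kp")
 case True
 have "rate_ER kp nu xi mu = rate_FE kp nu xi mu" using True kp by (simp add: rate_ER_def rate_FE_def edge_cost_def zero_ereal_def[symmetric])
 thus ?thesis using True by (simp add: rate_ER_eq[OF kp])
next
 case False
 thus ?thesis using kp by (simp add: rate_FE_def rate_functional_def)
qed

text \<open>At mean \<open>kp\<close> the edge cost is 0, and taking \<open>al\<close> in place of
  the Poisson degrees lowers the entropy by the constant entropy of \<open>al\<close>, which is the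
  cost of the conditioning.\<close>

lemma rate_CM_eq:
 fixes mu :: "('x::finite, 'y::finite) star pmf" assumes kp: "kp > 0" and CM: "CM_degrees M kp al aln"
 shows "rate_CM kp al nu xi mu = (if map_pmf deg mu = al then ER_rate kp nu xi mu - ereal (kl_real al (Poi kp)) else \<infinity>)"
proof (cases "map_pmf deg mu = al")
 case True
 have mean: "mean_deg mu = ennreal kp" using CM_mean[OF kp CM] by (simp add: mean_deg_def True[symmetric])
 have m: "mean_deg (true_law al nu xi) = ennreal kp" by (simp add: mean_deg_true_law CM_mean[OF kp CM])
 let ?g = "%ta :: ('x, 'y) star. ln (pmf al (deg ta) / pmf (Poi kp) (deg ta))"
 have int: "integrable mu ?g" using CM_kl[OF kp CM] by (simp add: kl_finite_def True[symmetric])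
 have pos: "pmf (Poi kp) (deg ta) > 0 & pmf al (deg ta) > 0" if "ta : set_pmf mu" for ta
  using that kp True by (auto simp: pmf_Poi intro!: pmf_positive)
 note kl = kl_true_law_change[of mu "Poi kp" al, OF pos int, where nu = nu and xi = xi]
 have rate: "rate_CM kp al nu xi mu = rate_functional nu kp (true_law al nu xi) mu" using True by (simp add: rate_CM_def)
 show ?thesis
 proof (cases "(ALL k. colmean mu (rev_col k) = colmean mu k) & kl_finite mu (poi_law kp nu xi)")
  case T: True
  hence "set_pmf mu <= set_pmf (poi_law kp nu xi)" by (simp add: kl_finite_def)
  note cd = col_div_eq[OF kp mean kp this]
  show ?thesis unfolding rate rate_functional_eq[OF mean kp m] ER_rate_def cd using T mean kl  True kp by (force simp: kl_real_def True[symmetric] edge_cost_def)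
 next
  case F: False
  thus ?thesis unfolding rate rate_functional_eq[OF mean kp m] ER_rate_def using kl(1) True by auto
 qed
qed (simp add: rate_CM_def)

section \<open>The three large deviation principles\<close>

lemma CM_LDP: assumes kp: "kp > 0" and CM: "CM_degrees M kp al aln"
 shows "satisfies_LDP weak real (%n. nbhd_law n (CM_graph (aln n) n) nu (xi :: ('y::finite * 'y) pmf)) (rate_CM kp al (nu :: 'x::finite pmf) xi)"
proof (rule satisfies_LDP_nbhd_law)
 have sub1: "x - ereal h < ereal r ==> x < ereal (r + h)" and sub2: "ereal r < x - ereal h ==> ereal (r + h) < x" for x h r by (cases x; simp)+
 note R = rate_CM_eq[OF kp CM, of nu xi]
 fix mu :: "('x, 'y) star pmf" and r
 show "Ev n. decay r n <= prob (star_seq_law n (CM_graph (aln n) n) nu xi) (seq_ball n F ep mu)"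
  if r: "rate_CM kp al nu xi mu < ereal r" and F: "finite F" "ep > 0" for F ep
 proof -
  from r have al: "map_pmf deg mu = al" by (auto simp: rate_CM_def split: if_splits)
  have "ER_rate kp nu xi mu < ereal (r + kl_real al (Poi kp))" using r al unfolding R by (auto intro: sub1)
  thus ?thesis by (rule CM_lower[OF kp CM al _ F])
 qed
 show "EX F ep. finite F & ep > 0 & (Ev n. prob (star_seq_law n (CM_graph (aln n) n) nu xi) (seq_ball n F ep mu) <= decay r n)"
  if r: "ereal r < rate_CM kp al nu xi mu" by (rule CM_upper[OF kp CM]) (use r in \<open>auto simp: R intro: sub2\<close>)
 show "EX B>=0. Ev n. prob (star_seq_law n (CM_graph (aln n) n) nu xi) {t. ~ mean_deg (emp n t) <= ennreal B} <= decay r n"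
  using CM_tight[OF kp CM] by (intro exI[of _ "real M"] conjI) auto
qed

lemma FE_LDP: assumes kp: "kp > 0" and m: "(%n. real (m n) / real n) ----> kp / 2"
 shows "satisfies_LDP weak real (%n. nbhd_law n (FE_graph (m n) n) nu (xi :: ('y::finite * 'y) pmf)) (rate_FE kp (nu :: 'x::finite pmf) xi)"
proof (rule satisfies_LDP_nbhd_law)
 note R = rate_FE_eq[OF kp, of nu xi]
 fix mu :: "('x, 'y) star pmf" and r
 show "Ev n. decay r n <= prob (star_seq_law n (FE_graph (m n) n) nu xi) (seq_ball n F ep mu)"
  if "rate_FE kp nu xi mu < ereal r" and F: "finite F" "ep > 0" for F ep
  by (rule FE_lower[OF kp m _ _ F]) (use that in \<open>auto simp: R split: if_splits\<close>)
 show "EX F ep. finite F & ep > 0 & (Ev n. prob (star_seq_law n (FE_graph (m n) n) nu xi) (seq_ball n F ep mu) <= decay r n)"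
  if "ereal r < rate_FE kp nu xi mu" by (rule FE_upper[OF kp m]) (use that in \<open>simp add: R\<close>)
 show "EX B>=0. Ev n. prob (star_seq_law n (FE_graph (m n) n) nu xi) {t. ~ mean_deg (emp n t) <= ennreal B} <= decay r n"
  using FE_tight[OF kp m] kp by (intro exI[of _ "kp + 1"] conjI) auto
qed

lemma ER_LDP: assumes kp: "kp > 0"
 shows "satisfies_LDP weak real (%n. nbhd_law n (ER_graph kp n) nu (xi :: ('y::finite * 'y) pmf)) (rate_ER kp (nu :: 'x::finite pmf) xi)"
 by (rule satisfies_LDP_nbhd_law)
  (simp_all only: rate_ER_eq[OF kp] ER_lower_edges(1)[OF kp] ER_local_upper[OF kp] ER_tight[OF kp])

theorem theorem3p2:
  fixes \<kappa> :: real
    and \<nu> :: "'x::finite pmf"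
    and \<xi> :: "('y::finite \<times> 'y) pmf"
  assumes "\<kappa> > 0"
  shows "(\<forall>M \<alpha> \<alpha>n. CM_degrees M \<kappa> \<alpha> \<alpha>n \<longrightarrow>
            satisfies_LDP weak_topology real
              (\<lambda>n. nbhd_law n (CM_graph (\<alpha>n n) n) \<nu> \<xi>) (rate_CM \<kappa> \<alpha> \<nu> \<xi>)) \<and>
         (\<forall>m :: nat \<Rightarrow> nat. (\<lambda>n. real (m n) / real n) \<longlonglongrightarrow> \<kappa> / 2 \<longrightarrow>
            satisfies_LDP weak_topology real
              (\<lambda>n. nbhd_law n (FE_graph (m n) n) \<nu> \<xi>) (rate_FE \<kappa> \<nu> \<xi>)) \<and>
         satisfies_LDP weak_topology real
           (\<lambda>n. nbhd_law n (ER_graph \<kappa> n) \<nu> \<xi>) (rate_ER \<kappa> \<nu> \<xi>)"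
  using CM_LDP[OF assms] FE_LDP[OF assms] ER_LDP[OF assms] by blast

end
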